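(* Let $A$ be an abelian group, let $p$ be an oriented parity with coefficients in $A$ on the diagrams of an oriented virtual knot $\mathcal K$, and for every diagram $D$ of $\mathcal K$ let $\delta^p_D=\sum_{a\in\mathcal A(D)}\delta_a\cdot a\in C_1(D,A)$ be the parity cycle of $p$ (defined in the context). Then: (1) $\delta^p_D$ is a 1-cycle, i.e. $d\delta^p_D=0$; (2) the family $(\delta^p_D)_D$ is invariant; (3) $\delta^p_D$ is normalized, i.e. $D\cdot\delta^p_D=0$; (4) (intersection formula) for every classical crossing $v\in\mathcal V(D)$ one has $p_D(v)=D^l_v\cdot\delta^p_D$.
   Context: Diagrams. A virtual knot diagram $D$ is a generic oriented closed curve in the plane whose double points are marked classical (with over/under information) or virtual. A virtual knot $\mathcal K$ is a class of diagrams modulo isotopy, classical Reidemeister moves R1, R2, R3 and detour moves (replacing a path containing only virtual crossings by another path with the same ends containing only virtual crossings). $\mathcal V(D)$ is the set of classical crossings; $\mathcal A(D)$ is the set of arcs, i.e. pieces of $D$ between consecutive classical crossings (one closed arc if there are no classical crossings). A move $f\colon D\to D'$ induces a partial bijection $f_*\colon\mathcal V(D)\to\mathcal V(D')$ between surviving crossings. Arcs $a\in\mathcal A(D)$, $a'\in\mathcal A(D')$ are correspondent under a Reidemeister move if they share a point outside the region of the move; isotopies and detour moves induce a bijection of arcs. Local picture. Draw a classical crossing $v$ with both strands directed upward: the incoming arcs are SW, SE, the outgoing ones NW, NE, and the strands run SW$\to$NE and SE$\to$NW. The oriented smoothing at $v$ splits $D$ into the left half $D^l_v$ (leaving $v$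 along NW, returning along SW) and the right half $D^r_v$ (leaving along NE, returning along SE). Chains. $C_1(D,A)$ is the group of $A$-linear combinations of arcs, i.e. 1-chains of the graph $\tilde D$ with vertices $\mathcal V(D)$ and edges $\mathcal A(D)$ oriented along $D$; $H_1(D,A)$ is its subgroup of 1-cycles (at each crossing the sum of incoming values equals the sum of outgoing values). The graph $\tilde D$ is embedded in the closed oriented surface $AD(D)$ obtained by gluing discs to the boundary of the ribbon surface that is the (immersed) neighbourhood of $D$ (virtual crossings not being vertices). $C_1\cdot C_2$ denotes the intersection number in $AD(D)$, a transverse intersection counting $+1$ when (tangent of $C_1$, tangent of $C_2$) is positively oriented. $D$, $D^l_v$, $D^r_v$ are viewed as integral 1-cycles. Oriented parity. A family of maps $p_D\colon\mathcal V(D)\to A$ for all diagrams $D$ of $\mathcal K$ such that: (P0) $p_D(v)=p_{D'}(f_*(v))$ for every move $f\colon D\to D'$ and every $v$ for which $f_*(v)$ exists; (P1) $p_D(v)=0$ if $v$ disappears in a decreasing R1; (P2) $p_D(v_1)+p_D(v_2)=0$ if $v_1,v_2$ disappear in a decreasing R2; (P3+) $\sum_{i=1}^3\epsilon_\Delta(v_i)p_D(v_i)=0$ if $v_1,v_2,v_3$ are the vertices of the disappearing triangle $\Delta$ of an R3. Here $\epsilon_\Delta(v)=+1$ if $\Delta$ lies to the left or right of $v$ in the local picture (between SW and NW, or between SE and NE) and $-1$ if it lies above or below $v$. Parity cycle. For $a\in\mathcal A(D)$ take two disjoint subsegments of $a$, bring them by detour moves side by side, parallel and in the same direction, and apply an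 increasing R2 to them. Let $v$ be the new crossing at which both strands enter the new bigon. Then $\delta_a$ is the value of $p$ at $v$ (it does not depend on the choices), and $\delta^p_D=\sum_a\delta_a\cdot a$. A family $\gamma_D\in C_1(D,A)$ is invariant if $\gamma_D(a)=\gamma_{D'}(a')$ for every move $D\to D'$ and all correspondent arcs $a,a'$. *)

theory Defs
  imports Main
begin

section \<open>Virtual knot diagrams\<close>

text \<open>
  A generic oriented closed plane curve is recorded, up to isotopy of the plane, by the cyclic
  sequence of its passages through double points, together with a planarity condition and the
  choice of the unbounded face.  Virtual double points are passages like the classical ones.

  Every double point is drawn with both strands directed upward, so that one strand runs from SW
  to NE and the other from SE to NW.  A passage records the double point, which of the two strands
  is being followed, and the marking of the double point; \<open>Classical s\<close> means that the strand \<open>s\<close>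
  is the overpass.
\<close>

datatype strand = SWNE | SENW

fun opp :: "strand \<Rightarrow> strand" where
  "opp SWNE = SENW"
| "opp SENW = SWNE"

datatype mark = Virtual | Classical strand

datatype passage = Passage (crossing: nat) (strand: strand) (mark: mark)

definition over :: "passage \<Rightarrow> bool" where
  "over x \<longleftrightarrow> mark x = Classical (strand x)"

definition under :: "passage \<Rightarrow> bool" where
  "under x \<longleftrightarrow> mark x = Classical (opp (strand x))"

text \<open>
  The double points cut the curve into edges.  Edge \<open>i\<close> ends at the passage \<open>i\<close> and starts at the
  cyclically preceding one.  A curve without double points has the single edge \<open>0\<close>.
\<close>

definition edge :: "passage list \<Rightarrow> nat \<Rightarrow> nat" where
  "edge w i = (if w = [] then 0 else i mod length w)"

definition edges :: "passage list \<Rightarrow> nat set" where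
  "edges w = {..<max 1 (length w)}"

definition position :: "passage list \<Rightarrow> nat \<Rightarrow> strand \<Rightarrow> nat" where
  "position w c s = (THE i. i < length w \<and> crossing (w ! i) = c \<and> strand (w ! i) = s)"

definition sw :: "passage list \<Rightarrow> nat \<Rightarrow> nat" where
  "sw w c = edge w (position w c SWNE)"

definition ne :: "passage list \<Rightarrow> nat \<Rightarrow> nat" where
  "ne w c = edge w (Suc (position w c SWNE))"

definition se :: "passage list \<Rightarrow> nat \<Rightarrow> nat" where
  "se w c = edge w (position w c SENW)"

definition nw :: "passage list \<Rightarrow> nat \<Rightarrow> nat" where
  "nw w c = edge w (Suc (position w c SENW))"

text \<open>
  Faces of the complement of the curve are represented by the sets of edge sides on their boundary.
  At every double point each of the four corners (west, east, south, north) joins two edge sides.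
  The additional argument \<open>J\<close> is a set of edges that are erased, i.e. whose two sides are merged.
\<close>

datatype side = Left | Right

definition corners :: "passage list \<Rightarrow> ((nat \<times> side) \<times> (nat \<times> side)) set" where
  "corners w = (\<Union>c \<in> crossing ` set w.
     {((sw w c, Left), (nw w c, Left)),
      ((se w c, Right), (ne w c, Right)),
      ((sw w c, Right), (se w c, Left)),
      ((ne w c, Left), (nw w c, Right))})"

definition region :: "passage list \<Rightarrow> nat set \<Rightarrow> nat \<times> side \<Rightarrow> (nat \<times> side) set" where
  "region w J x =
     (let r = corners w \<union> {((e, Left), (e, Right)) | e. e \<in> J} in (r \<union> r\<inverse>)\<^sup>* `` {x})"

definition faces :: "passage list \<Rightarrow> (nat \<times> side) set set" where
  "faces w = region w {} ` (edges w \<times> UNIV)"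

text \<open>
  The curve is connected, with \<open>n\<close> double points and \<open>2 n\<close> edges, so it is planar iff it has
  \<open>n + 2\<close> faces (also for \<open>n = 0\<close>, where the curve is a circle).
\<close>

definition planar :: "passage list \<Rightarrow> bool" where
  "planar w \<longleftrightarrow> card (faces w) = card (crossing ` set w) + 2"

text \<open>The second component is an edge side on the boundary of the unbounded face.\<close>

datatype diagram = Diagram (curve: "passage list") (outer: "nat \<times> side")

definition diagram :: "diagram \<Rightarrow> bool" where
  "diagram D \<longleftrightarrow>
     distinct (map (\<lambda>x. (crossing x, strand x)) (curve D)) \<and>
     (\<forall>x \<in> set (curve D). Passage (crossing x) (opp (strand x)) (mark x) \<in> set (curve D)) \<and>
     planar (curve D) \<and>
     fst (outer D) \<in> edges (curve D)"

definition classical :: "diagram \<Rightarrow> nat set" where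
  "classical D = crossing ` {x \<in> set (curve D). mark x \<noteq> Virtual}"

text \<open>Arcs are maximal runs of edges that are joined at virtual crossings.\<close>

definition arc_of :: "diagram \<Rightarrow> nat \<Rightarrow> nat set" where
  "arc_of D e =
     (let w = curve D; r = {(i, edge w (Suc i)) | i. i < length w \<and> mark (w ! i) = Virtual}
      in (r \<union> r\<inverse>)\<^sup>* `` {e})"

definition arcs :: "diagram \<Rightarrow> nat set set" where
  "arcs D = arc_of D ` edges (curve D)"


section \<open>Moves\<close>

text \<open>
  Every move comes with a relation \<open>E\<close> between the edges of the two diagrams: edges are related if
  they share a piece that is not touched by the move.  Two arcs are correspondent if they contain
  related edges.
\<close>

definition correspondent ::
    "(nat \<times> nat) set \<Rightarrow> diagram \<Rightarrow> diagram \<Rightarrow> nat set \<Rightarrow> nat set \<Rightarrow> bool" where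
  "correspondent E D D' a a' \<longleftrightarrow>
     a \<in> arcs D \<and> a' \<in> arcs D' \<and> (\<exists>(e, e') \<in> E. e \<in> a \<and> e' \<in> a')"

text \<open>
  A move takes place in the plane, hence fixes the point at infinity: this point lies beside some
  untouched piece of the curve that borders the unbounded faces of both diagrams, once the pieces
  \<open>J\<close> and \<open>J'\<close> which are being replaced have been erased.
\<close>

definition same_outer ::
    "(nat \<times> nat) set \<Rightarrow> nat set \<Rightarrow> nat set \<Rightarrow> diagram \<Rightarrow> diagram \<Rightarrow> bool" where
  "same_outer E J J' D D' \<longleftrightarrow>
     (\<exists>(e, e') \<in> E. \<exists>s. (e, s) \<in> region (curve D) J (outer D) \<and>
                         (e', s) \<in> region (curve D') J' (outer D'))"

text \<open>
  Isotopic diagrams differ in the base point of the curve, the names of the double points, and the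
  edge side that represents the unbounded face.
\<close>

definition isotopy :: "(nat \<Rightarrow> nat) \<Rightarrow> diagram \<Rightarrow> diagram \<Rightarrow> (nat \<times> nat) set \<Rightarrow> bool" where
  "isotopy \<sigma> D D' E \<longleftrightarrow>
     diagram D \<and> diagram D' \<and> inj_on \<sigma> (crossing ` set (curve D)) \<and>
     (\<exists>k. curve D' = rotate k (map (\<lambda>x. Passage (\<sigma> (crossing x)) (strand x) (mark x)) (curve D)) \<and>
          E = {(edge (curve D) (i + k), i) | i. i \<in> edges (curve D')}) \<and>
     same_outer E {} {} D D'"

text \<open>
  In a detour move the path \<open>P\<close> is replaced by \<open>P'\<close>.  Erasing the path, also at the other passages
  through the virtual crossings on it, leaves the same open curve in both diagrams.  Two edges
  correspond if they lie on the same edge of that open curve.  The first and the last edge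
  counted in \<open>J\<close> are those containing the ends of the path; the loose ends that remain there
  have the same face on both sides.
\<close>

definition erase :: "passage list \<Rightarrow> passage list \<Rightarrow> passage list" where
  "erase P u = filter (\<lambda>x. crossing x \<notin> crossing ` set P) u"

definition detour :: "diagram \<Rightarrow> diagram \<Rightarrow> (nat \<times> nat) set \<Rightarrow> bool" where
  "detour D D' E \<longleftrightarrow>
     diagram D \<and> diagram D' \<and>
     (\<exists>u P v u' P' v'.
        curve D = u @ P @ v \<and> curve D' = u' @ P' @ v' \<and>
        (\<forall>x \<in> set P \<union> set P'. mark x = Virtual) \<and>
        erase P u = erase P' u' \<and> erase P v = erase P' v' \<and>
        E = {(edge (curve D) i, edge (curve D') i') | i i'.
               i \<le> length u \<and> i' \<le> length u' \<and>
               length (erase P (take i u)) = length (erase P' (take i' u'))} \<union>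
            {(edge (curve D) (length (u @ P) + i), edge (curve D') (length (u' @ P') + i')) | i i'.
               i \<le> length v \<and> i' \<le> length v' \<and>
               length (erase P (take i v)) = length (erase P' (take i' v'))} \<and>
        same_outer E {edge (curve D) (length u + i) | i. i \<le> length P}
                     {edge (curve D') (length u' + i) | i. i \<le> length P'} D D')"

text \<open>
  A Reidemeister move changes the curve inside a disc that meets it in short blocks of consecutive
  passages and leaves the intermediate words \<open>us\<close> unchanged.  The edges adjacent to a block have a
  piece outside the disc; the edges inside a block have not.
\<close>

fun weave :: "'b list list \<Rightarrow> 'b list list \<Rightarrow> 'b list" where
  "weave (u # us) (A # As) = u @ A @ weave us As"
| "weave us As = concat us"

definition local_move ::
    "passage list list \<Rightarrow> passage list list \<Rightarrow> passage list list \<Rightarrow>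
     diagram \<Rightarrow> diagram \<Rightarrow> (nat \<times> nat) set \<Rightarrow> bool" where
  "local_move us As Bs D D' E \<longleftrightarrow>
     diagram D \<and> diagram D' \<and>
     length us = Suc (length As) \<and> length Bs = length As \<and>
     curve D = weave us As \<and> curve D' = weave us Bs \<and>
     E = {(edge (curve D) (length (weave (take j us) (take j As)) + i),
           edge (curve D') (length (weave (take j us) (take j Bs)) + i)) | j i.
             j < length us \<and> i \<le> length (us ! j)} \<and>
     same_outer E {} {} D D'"

text \<open>
  The increasing first Reidemeister move, creating the crossing \<open>c\<close>.  That the loop bounds a face
  is automatic.
\<close>

definition R1 :: "nat \<Rightarrow> diagram \<Rightarrow> diagram \<Rightarrow> (nat \<times> nat) set \<Rightarrow> bool" where
  "R1 c D D' E \<longleftrightarrow>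
     (\<exists>u v s t. local_move [u, v] [[]]
        [[Passage c s (Classical t), Passage c (opp s) (Classical t)]] D D' E)"

text \<open>
  The increasing second Reidemeister move, creating the crossings \<open>k\<close> and \<open>l\<close> on segments of the
  edges \<open>e\<close> and \<open>f\<close>.  One segment crosses the other from one side to the other at \<open>k\<close> and back at
  \<open>l\<close>, and it lies above the other at both crossings or below it at both.  If \<open>parallel\<close> holds,
  both strands enter the bigon at \<open>k\<close>.  That the bigon is a face of the new diagram is automatic;
  that the two segments lie side by side before the move amounts to planarity of the new diagram.
\<close>

definition R2 ::
    "bool \<Rightarrow> nat \<Rightarrow> nat \<Rightarrow> nat \<Rightarrow> nat \<Rightarrow> diagram \<Rightarrow> diagram \<Rightarrow> (nat \<times> nat) set \<Rightarrow> bool" where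
  "R2 parallel k l e f D D' E \<longleftrightarrow>
     (\<exists>u v x s t.
        let A = [Passage k s (Classical t), Passage l (opp s) (Classical (opp t))];
            B = [Passage k (opp s) (Classical t), Passage l s (Classical (opp t))]
        in local_move [u, v, x] [[], []] [A, if parallel then B else rev B] D D' E \<and>
           e = edge (curve D) (length u) \<and> f = edge (curve D) (length (u @ v)))"

text \<open>
  The third Reidemeister move.  \<open>\<Delta>\<close> is the disappearing triangle: a face bounded by one side of
  each of the three edges between the passages \<open>a, b\<close>, between \<open>c, d\<close> and between \<open>x, y\<close>.  One
  strand runs above the other two and one runs below the other two.
\<close>

definition R3 :: "(nat \<times> side) set \<Rightarrow> nat set \<Rightarrow> diagram \<Rightarrow> diagram \<Rightarrow> (nat \<times> nat) set \<Rightarrow> bool" where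
  "R3 \<Delta> V D D' E \<longleftrightarrow>
     (\<exists>u0 u1 u2 u3 a b c d x y.
        local_move [u0, u1, u2, u3] [[a, b], [c, d], [x, y]] [[b, a], [d, c], [y, x]] D D' E \<and>
        V = crossing ` {a, b, c, d, x, y} \<and>
        (\<forall>z \<in> {a, b, c, d, x, y}. mark z \<noteq> Virtual) \<and>
        (\<exists>(z, z') \<in> {(a, b), (c, d), (x, y)}. over z \<and> over z') \<and>
        (\<exists>(z, z') \<in> {(a, b), (c, d), (x, y)}. under z \<and> under z') \<and>
        \<Delta> \<in> faces (curve D) \<and> card \<Delta> = 3 \<and>
        fst ` \<Delta> = {length u0 + 1, length u0 + length u1 + 3,
                   length u0 + length u1 + length u2 + 5})"

text \<open>
  \<open>move D D' F E\<close>: \<open>F\<close> is the graph of the partial bijection between the classical crossings, and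
  \<open>E\<close> is the relation between the edges.
\<close>

inductive move :: "diagram \<Rightarrow> diagram \<Rightarrow> (nat \<times> nat) set \<Rightarrow> (nat \<times> nat) set \<Rightarrow> bool" where
  isotopy: "isotopy \<sigma> D D' E \<Longrightarrow> move D D' {(c, \<sigma> c) | c. c \<in> classical D} E"
| detour: "detour D D' E \<Longrightarrow> move D D' (Id_on (classical D)) E"
| R1: "R1 c D D' E \<Longrightarrow> move D D' (Id_on (classical D)) E"
| R2: "R2 parallel k l e f D D' E \<Longrightarrow> move D D' (Id_on (classical D)) E"
| R3: "R3 \<Delta> V D D' E \<Longrightarrow> move D D' (Id_on (classical D)) E"
| inverse: "move D D' F E \<Longrightarrow> move D' D (F\<inverse>) (E\<inverse>)"

definition virtual_knot :: "diagram set \<Rightarrow> bool" where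
  "virtual_knot K \<longleftrightarrow>
     (\<exists>D. diagram D \<and> K = {D'. (\<lambda>D D'. \<exists>F E. move D D' F E)\<^sup>*\<^sup>* D D'})"


section \<open>Chains and intersection numbers\<close>

definition chains :: "diagram \<Rightarrow> (nat set \<Rightarrow> 'a::ab_group_add) set" where
  "chains D = {C. \<forall>a. a \<notin> arcs D \<longrightarrow> C a = 0}"

definition coeff_at :: "diagram \<Rightarrow> (nat set \<Rightarrow> 'a) \<Rightarrow> nat \<Rightarrow> 'a" where
  "coeff_at D C e = C (arc_of D e)"

definition boundary :: "diagram \<Rightarrow> (nat set \<Rightarrow> 'a::ab_group_add) \<Rightarrow> nat \<Rightarrow> 'a" where
  "boundary D C v = (let w = curve D; C' = coeff_at D C in
     (C' (sw w v) + C' (se w v)) - (C' (nw w v) + C' (ne w v)))"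

definition cycles :: "diagram \<Rightarrow> (nat set \<Rightarrow> 'a::ab_group_add) set" where
  "cycles D = {C \<in> chains D. \<forall>v \<in> classical D. boundary D C v = 0}"

definition zmult :: "int \<Rightarrow> 'a::ab_group_add \<Rightarrow> 'a" where
  "zmult k x = (if 0 \<le> k then (\<Sum>i<nat k. x) else - (\<Sum>i<nat (- k). x))"

text \<open>
  The intersection number \<open>C\<^sub>1 \<cdot> C\<^sub>2\<close> in the surface of the diagram, for an integral 1-cycle and a
  1-cycle with coefficients.  Push \<open>C\<^sub>1\<close> off the graph to its right; since \<open>C\<^sub>1\<close> is a cycle, near a
  classical crossing all its branches can be routed through the eastern corner.  The branches on
  SW, SE, NW, NE then lie in the southern, eastern, northern and eastern corner, respectively.  So
  the SW branch has to cross the SE arc (with sign +1) and the NW branch the NE arc (with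
  sign -1), and there are no other intersections.  Virtual crossings do not contribute, since
  they are not vertices and the bands of the ribbon surface pass through each other there.
\<close>

definition intersection ::
    "diagram \<Rightarrow> (nat set \<Rightarrow> int) \<Rightarrow> (nat set \<Rightarrow> 'a::ab_group_add) \<Rightarrow> 'a" where
  "intersection D C1 C2 =
     (\<Sum>v \<in> classical D. let w = curve D in
        zmult (coeff_at D C1 (sw w v)) (coeff_at D C2 (se w v)) -
        zmult (coeff_at D C1 (nw w v)) (coeff_at D C2 (ne w v)))"

definition whole_cycle :: "diagram \<Rightarrow> nat set \<Rightarrow> int" where
  "whole_cycle D a = (if a \<in> arcs D then 1 else 0)"

text \<open>The edges met when following the curve from the edge \<open>e\<close> until the edge \<open>f\<close> is reached.\<close>

definition path :: "passage list \<Rightarrow> nat \<Rightarrow> nat \<Rightarrow> nat set" where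
  "path w e f = {edge w (e + i) | i. \<forall>j<i. edge w (e + j) \<noteq> f}"

definition left_half :: "diagram \<Rightarrow> nat \<Rightarrow> nat set \<Rightarrow> int" where
  "left_half D v a =
     (if a \<in> arc_of D ` path (curve D) (nw (curve D) v) (sw (curve D) v) then 1 else 0)"


section \<open>Oriented parities and the parity cycle\<close>

text \<open>
  The incidence sign of a triangle at one of its vertices: +1 if the triangle occupies the western
  or the eastern corner, -1 if it occupies the southern or the northern one.
\<close>

definition incidence :: "passage list \<Rightarrow> (nat \<times> side) set \<Rightarrow> nat \<Rightarrow> int" where
  "incidence w \<Delta> v =
     (if {(sw w v, Left), (nw w v, Left)} \<subseteq> \<Delta> \<or> {(se w v, Right), (ne w v, Right)} \<subseteq> \<Delta>
      then 1 else - 1)"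

definition oriented_parity ::
    "diagram set \<Rightarrow> (diagram \<Rightarrow> nat \<Rightarrow> 'a::ab_group_add) \<Rightarrow> bool" where
  "oriented_parity K p \<longleftrightarrow>
     (\<forall>D\<in>K. \<forall>D'\<in>K. \<forall>F E. move D D' F E \<longrightarrow> (\<forall>(v, v') \<in> F. p D v = p D' v')) \<and>
     (\<forall>D\<in>K. \<forall>D'\<in>K. \<forall>c E. R1 c D' D E \<longrightarrow> p D c = 0) \<and>
     (\<forall>D\<in>K. \<forall>D'\<in>K. \<forall>parallel k l e f E. R2 parallel k l e f D' D E \<longrightarrow> p D k + p D l = 0) \<and>
     (\<forall>D\<in>K. \<forall>D'\<in>K. \<forall>\<Delta> V E. R3 \<Delta> V D D' E \<longrightarrow>
        (\<Sum>v\<in>V. zmult (incidence (curve D) \<Delta> v) (p D v)) = 0)"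

text \<open>
  \<open>delta_value p D a x\<close>: \<open>x\<close> is the parity of the new crossing \<open>k\<close> for some choice of the detour
  moves (tracking the arc \<open>a\<close>) and of the second Reidemeister move on two segments of that arc.
\<close>

definition detour_step :: "diagram \<times> nat set \<Rightarrow> diagram \<times> nat set \<Rightarrow> bool" where
  "detour_step = (\<lambda>(D, a) (D', a').
     \<exists>E. ((\<exists>\<sigma>. isotopy \<sigma> D D' E) \<or> detour D D' E) \<and> correspondent E D D' a a')"

definition delta_value ::
    "(diagram \<Rightarrow> nat \<Rightarrow> 'a) \<Rightarrow> diagram \<Rightarrow> nat set \<Rightarrow> 'a \<Rightarrow> bool" where
  "delta_value p D a x \<longleftrightarrow>
     (\<exists>D1 a1 D2 k l e f E. detour_step\<^sup>*\<^sup>* (D, a) (D1, a1) \<and>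
        R2 True k l e f D1 D2 E \<and> e \<in> a1 \<and> f \<in> a1 \<and> x = p D2 k)"

definition parity_cycle ::
    "(diagram \<Rightarrow> nat \<Rightarrow> 'a::ab_group_add) \<Rightarrow> diagram \<Rightarrow> nat set \<Rightarrow> 'a" where
  "parity_cycle p D a = (if a \<in> arcs D then THE x. delta_value p D a x else 0)"

definition invariant_family ::
    "diagram set \<Rightarrow> (diagram \<Rightarrow> nat set \<Rightarrow> 'a::ab_group_add) \<Rightarrow> bool" where
  "invariant_family K \<gamma> \<longleftrightarrow>
     (\<forall>D\<in>K. \<gamma> D \<in> chains D) \<and>
     (\<forall>D\<in>K. \<forall>D'\<in>K. \<forall>F E a a'. move D D' F E \<and> correspondent E D D' a a' \<longrightarrow>
        \<gamma> D a = \<gamma> D' a')"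

end

theory Submission
  imports Defs "HOL-Library.Multiset"
begin

text \<open>
  The parity is compared with its values on auxiliary crossings. Suppose that two strands \<open>z\<close> and
  \<open>x\<close> of a diagram lie on a common face and can be made parallel across it. An increasing second
  Reidemeister move on them creates a crossing at which both strands enter the new bigon; the
  parity of this crossing is the value of the \<^emph>\<open>tip\<close> at \<open>z\<close> and \<open>x\<close>. If \<open>z\<close> and \<open>x\<close> are
  segments of one arc, the part of the curve between them can be replaced by a virtual loop, and
  the tip value is the value \<open>\<delta>\<close> of this arc (\<open>self_bigon\<close>). If \<open>z\<close> and \<open>x\<close> are two edges
  that meet at a crossing \<open>w\<close>, the bigon cancels against \<open>w\<close>, and the tip value is the parity of
  \<open>w\<close> up to sign (\<open>tip_below\<close>, \<open>tip_above\<close>).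

  Now let \<open>x\<close> run along the knot and drag \<open>z\<close> along by detour moves. To pass a crossing \<open>w\<close>, \<open>x\<close>
  has to get from an incoming to an outgoing edge of \<open>w\<close>. Two third Reidemeister moves show that
  the tip value differs by the parity of \<open>w\<close> between an incoming and an outgoing edge that bound a
  common corner (\<open>corner_first\<close>, \<open>corner_second\<close>). Between two edges of a face that are both
  incoming or both outgoing it differs by an amount that does not depend on \<open>z\<close>
  (\<open>antiparallel_test\<close>); putting \<open>z\<close> next to one of them identifies this amount as a sum of the
  parity of \<open>w\<close> and a value of \<open>\<delta>\<close>, with certain signs (\<open>strand_change_first\<close>,
  \<open>strand_change_second\<close>). The parity of \<open>w\<close> cancels. What is left is the value of \<open>\<delta>\<close> on
  the edge SE if \<open>x\<close> passes \<open>w\<close> from SW to NE, and minus the value on NE if it passes from SE to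
  NW (for \<open>z\<close> on the suitable side). These are exactly the local terms of the intersection number.
  When \<open>x\<close> arrives at the arc of \<open>z\<close>, the tip value is the value of this arc; this is \<open>walk\<close>.

  All claims are instances of this. Walking once around the knot yields \<open>D \<cdot> \<delta> = 0\<close>
  (\<open>sum_shifts\<close>). Walking along the left half of \<open>v\<close>, from the edge NW to the edge NE on which \<open>z\<close>
  lies, yields the intersection formula (\<open>crossing_value\<close>). Walking from SW to NW along the right
  half and comparing with the corner relation at the western corner yields the cycle condition
  (\<open>conservation\<close>). That \<open>\<delta>\<close> does not depend on which strand is first and which is above
  follows from evaluating the same changes on both sides of a loop (\<open>arc_value_opp\<close>) and from
  \<open>D \<cdot> \<delta> = 0\<close> before and after a first Reidemeister move (\<open>arc_value_mark\<close>). It is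
  invariant, because the small tangle that measures it can be put outside of the disc in which a
  move takes place (\<open>edge_value_invariant\<close>), and this also shows that all choices in the
  definition of the parity cycle give the same value.

  Every auxiliary diagram has to be planar. Planarity is expressed by colourings of the faces with
  two colours, and two strands are on a common face iff they see the same colour in every
  colouring. The criterion \<open>planar_iff_colorable\<close> turns the count of faces into the existence of
  colourings, which can be checked block by block when words are cut and pasted.
\<close>

section \<open>Words and colourings of their faces\<close>

fun flip :: "side \<Rightarrow> side" where
  "flip Left = Right"
| "flip Right = Left"

fun sd :: "strand \<Rightarrow> side" where
  "sd SWNE = Left"
| "sd SENW = Right"

datatype corner = West | East | South | North

fun cin :: "strand \<Rightarrow> side \<Rightarrow> corner" where
  "cin SWNE Left = West"
| "cin SWNE Right = South"
| "cin SENW Left = South"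
| "cin SENW Right = East"

fun cout :: "strand \<Rightarrow> side \<Rightarrow> corner" where
  "cout SWNE Left = North"
| "cout SWNE Right = East"
| "cout SENW Left = West"
| "cout SENW Right = North"

text \<open>
  Two colours are assigned to the four corners at every double point. The relation \<open>flow\<close> below
  says that they agree along both sides of the curve, which makes them a colouring of the faces. A
  state is the pair of the colours on the left and on the right of an edge.
\<close>

type_synonym coloring = "nat \<Rightarrow> corner \<Rightarrow> bool"

definition before :: "coloring \<Rightarrow> passage \<Rightarrow> bool \<times> bool" where
  "before col x = (col (crossing x) (cin (strand x) Left), col (crossing x) (cin (strand x) Right))"

definition after :: "coloring \<Rightarrow> passage \<Rightarrow> bool \<times> bool" where
  "after col x = (col (crossing x) (cout (strand x) Left), col (crossing x) (cout (strand x) Right))"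

fun flow :: "coloring \<Rightarrow> bool \<times> bool \<Rightarrow> passage list \<Rightarrow> bool \<times> bool \<Rightarrow> bool" where
  "flow col st [] st' \<longleftrightarrow> st = st'"
| "flow col st (x # xs) st' \<longleftrightarrow> before col x = st \<and> flow col (after col x) xs st'"

text \<open>
  Crossing over a double point, a strand turns from having different colours at its sides to
  having the same colour, or vice versa. This happens to both strands or to none.
\<close>

definition turn :: "(corner \<Rightarrow> bool) \<Rightarrow> bool" where
  "turn f \<longleftrightarrow> (f West \<noteq> f South) \<noteq> (f North \<noteq> f East)"

abbreviation crossings :: "passage list \<Rightarrow> nat set" where
  "crossings w \<equiv> crossing ` set w"

text \<open>
  This is planarity, as \<open>planar_iff_colorable\<close> shows. Unlike the number of faces, it can be
  followed through cutting and pasting of words.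
\<close>

definition colorable :: "passage list \<Rightarrow> bool" where
  "colorable w \<longleftrightarrow> (\<forall>T b. \<exists>col st. flow col st w st \<and> (fst st \<noteq> snd st) = b \<and>
     (\<forall>c\<in>crossings w. turn (col c) = (c \<in> T)))"

lemma colorableE:
  assumes "colorable w"
  obtains col st where "flow col st w st" "(fst st \<noteq> snd st) = b"
    "\<forall>c\<in>crossings w. turn (col c) = (c \<in> T)"
proof -
  from assms have "\<exists>col st. flow col st w st \<and> (fst st \<noteq> snd st) = b \<and>
     (\<forall>c\<in>crossings w. turn (col c) = (c \<in> T))"
    unfolding colorable_def by (elim allE)
  then show ?thesis using that by (elim exE conjE)
qed

definition valid :: "passage list \<Rightarrow> bool" where
  "valid w \<longleftrightarrow> distinct (map (\<lambda>x. (crossing x, strand x)) w) \<and>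
     (\<forall>x \<in> set w. Passage (crossing x) (opp (strand x)) (mark x) \<in> set w)"

lemma opp_opp [simp]: "opp (opp s) = s" by (cases s) auto
lemma opp_neq [simp]: "opp s \<noteq> s" "s \<noteq> opp s" by (cases s; simp)+
lemma opp_eq_iff [simp]: "opp s = opp t \<longleftrightarrow> s = t" by (cases s; cases t) auto
lemma neq_opp: "s \<noteq> t \<longleftrightarrow> s = opp t" by (cases s; cases t) auto
lemma flip_flip [simp]: "flip (flip s) = s" by (cases s) auto
lemma sd_opp [simp]: "sd (opp s) = flip (sd s)" by (cases s) auto

lemma position_nth:
  assumes "valid w" "i < length w"
  shows "position w (crossing (w ! i)) (strand (w ! i)) = i"
  unfolding position_def
proof (rule the_equality)
  fix j assume j: "j < length w \<and> crossing (w ! j) = crossing (w ! i) \<and> strand (w ! j) = strand (w ! i)"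
  then have "map (\<lambda>x. (crossing x, strand x)) w ! j = map (\<lambda>x. (crossing x, strand x)) w ! i"
    using assms by simp
  then show "j = i" 
    using assms j nth_eq_iff_index_eq[of "map (\<lambda>x. (crossing x, strand x)) w" j i]
    unfolding valid_def by simp
qed (use assms in auto)

lemma position_props:
  assumes "valid w" "c \<in> crossings w"
  shows "position w c s < length w" "crossing (w ! position w c s) = c"
    "strand (w ! position w c s) = s"
proof -
  obtain x where x: "x \<in> set w" "crossing x = c" using assms by auto
  have "\<exists>y\<in>set w. crossing y = c \<and> strand y = s"
  proof (cases "strand x = s")
    case False
    then have "opp (strand x) = s" by (cases s; cases "strand x") auto
    moreover have "Passage (crossing x) (opp (strand x)) (mark x) \<in> set w"
      using assms(1) x unfolding valid_def by blast
    ultimately show ?thesis using x by (metis passage.sel(1,2))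
  qed (use x in auto)
  then obtain i where i: "i < length w" "crossing (w ! i) = c" "strand (w ! i) = s"
    by (metis in_set_conv_nth)
  then have "position w c s = i" using position_nth[OF assms(1), of i] by simp
  with i show "position w c s < length w" "crossing (w ! position w c s) = c"
    "strand (w ! position w c s) = s" by auto
qed

lemma position_iff:
  assumes "valid w" "i < length w"
  shows "crossing (w ! i) = c \<and> strand (w ! i) = s \<longleftrightarrow> c \<in> crossings w \<and> i = position w c s"
  using position_nth[OF assms] position_props[OF assms(1), of c s] assms(2) by force

definition pred :: "passage list \<Rightarrow> nat \<Rightarrow> nat" where
  "pred w i = (i + length w - 1) mod length w"

lemma pred_less: "i < length w \<Longrightarrow> pred w i < length w"
  unfolding pred_def by (rule mod_less_divisor) auto

lemma edge_Suc_pred: "i < length w \<Longrightarrow> edge w (Suc (pred w i)) = i"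
  by (cases i) (auto simp: pred_def edge_def mod_Suc)

lemma pred_edge_Suc: "q < length w \<Longrightarrow> pred w (edge w (Suc q)) = q"
proof -
  assume q: "q < length w"
  show ?thesis
  proof (cases "Suc q = length w")
    case True then show ?thesis using q by (auto simp: pred_def edge_def)
  next
    case False then show ?thesis using q by (auto simp: pred_def edge_def)
  qed
qed

lemma pred_iff:
  assumes "valid w" "i < length w"
  shows "crossing (w ! pred w i) = c \<and> strand (w ! pred w i) = s
    \<longleftrightarrow> c \<in> crossings w \<and> i = edge w (Suc (position w c s))"
  using position_iff[OF assms(1) pred_less[OF assms(2)], of c s] edge_Suc_pred[OF assms(2)]
    pred_edge_Suc[OF position_props(1)[OF assms(1)], of c s] by auto

definition sides :: "passage list \<Rightarrow> (nat \<times> side) set" where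
  "sides w = edges w \<times> UNIV"

lemma sides_iff: "w \<noteq> [] \<Longrightarrow> (i, \<sigma>) \<in> sides w \<longleftrightarrow> i < length w"
  by (cases w) (auto simp: sides_def edges_def max_def)

text \<open>
  Every edge side, traversed with the face on its left, runs from one corner to another.
\<close>

fun fore :: "passage list \<Rightarrow> nat \<times> side \<Rightarrow> nat \<times> corner" where
  "fore w (i, Left) = (crossing (w ! i), cin (strand (w ! i)) Left)"
| "fore w (i, Right) = (crossing (w ! pred w i), cout (strand (w ! pred w i)) Right)"

fun hind :: "passage list \<Rightarrow> nat \<times> side \<Rightarrow> nat \<times> corner" where
  "hind w (i, Left) = (crossing (w ! pred w i), cout (strand (w ! pred w i)) Left)"
| "hind w (i, Right) = (crossing (w ! i), cin (strand (w ! i)) Right)"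

lemma cin_Left_iff: "cin s Left = d \<longleftrightarrow> (s = SWNE \<and> d = West \<or> s = SENW \<and> d = South)"
  by (cases s) auto
lemma cin_Right_iff: "cin s Right = d \<longleftrightarrow> (s = SWNE \<and> d = South \<or> s = SENW \<and> d = East)"
  by (cases s) auto
lemma cout_Left_iff: "cout s Left = d \<longleftrightarrow> (s = SWNE \<and> d = North \<or> s = SENW \<and> d = West)"
  by (cases s) auto
lemma cout_Right_iff: "cout s Right = d \<longleftrightarrow> (s = SWNE \<and> d = East \<or> s = SENW \<and> d = North)"
  by (cases s) auto
lemmas c_iffs = cin_Left_iff cin_Right_iff cout_Left_iff cout_Right_iff

lemma in_edge_less:
  assumes "valid w" "c \<in> crossings w"
  shows "sw w c < length w" "se w c < length w" "ne w c < length w" "nw w c < length w"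
  using position_props(1)[OF assms] by (auto simp: sw_def se_def ne_def nw_def edge_def)

lemma sw_se_position: 
  assumes "valid w" "c \<in> crossings w"
  shows "sw w c = position w c SWNE" "se w c = position w c SENW"
  using position_props(1)[OF assms] assms by (auto simp: sw_def se_def edge_def)

lemma fore_iff:
  assumes "valid w" "x \<in> sides w" "w \<noteq> []"
  shows "fore w x = (c, d) \<longleftrightarrow> c \<in> crossings w \<and>
     x = (case d of West \<Rightarrow> (sw w c, Left) | South \<Rightarrow> (se w c, Left) | East \<Rightarrow> (ne w c, Right) | North \<Rightarrow> (nw w c, Right))"
proof -
  obtain i \<sigma> where x: "x = (i, \<sigma>)" by force
  then have i: "i < length w" using assms sides_iff by auto
  show ?thesis
    using position_iff[OF assms(1) i, of c] pred_iff[OF assms(1) i, of c] sw_se_position[OF assms(1), of c]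
    unfolding x
    by (cases \<sigma>; cases d) (auto simp: c_iffs ne_def nw_def)
qed

lemma hind_iff:
  assumes "valid w" "x \<in> sides w" "w \<noteq> []"
  shows "hind w x = (c, d) \<longleftrightarrow> c \<in> crossings w \<and>
     x = (case d of West \<Rightarrow> (nw w c, Left) | South \<Rightarrow> (sw w c, Right) | East \<Rightarrow> (se w c, Right) | North \<Rightarrow> (ne w c, Left))"
proof -
  obtain i \<sigma> where x: "x = (i, \<sigma>)" by force
  then have i: "i < length w" using assms sides_iff by auto
  show ?thesis
    using position_iff[OF assms(1) i, of c] pred_iff[OF assms(1) i, of c] sw_se_position[OF assms(1), of c]
    unfolding x
    by (cases \<sigma>; cases d) (auto simp: c_iffs ne_def nw_def)
qed

lemma fore_inj:
  assumes "valid w" "w \<noteq> []" "x \<in> sides w" "y \<in> sides w" "fore w x = fore w y" shows "x = y"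
  using fore_iff[OF assms(1,3,2)] fore_iff[OF assms(1,4,2)] assms(5) by (metis surj_pair)

lemma hind_inj:
  assumes "valid w" "w \<noteq> []" "x \<in> sides w" "y \<in> sides w" "hind w x = hind w y" shows "x = y"
  using hind_iff[OF assms(1,3,2)] hind_iff[OF assms(1,4,2)] assms(5) by (metis surj_pair)

lemma corner_sides:
  assumes "valid w" "c \<in> crossings w"
  shows "(sw w c, a) \<in> sides w" "(se w c, a) \<in> sides w" "(ne w c, a) \<in> sides w" "(nw w c, a) \<in> sides w"
  using in_edge_less[OF assms] by (auto simp: sides_def edges_def)

lemma corners_iff:
  assumes "valid w" "w \<noteq> []"
  shows "(x, y) \<in> corners w \<union> (corners w)\<inverse> \<longleftrightarrow>
    x \<in> sides w \<and> y \<in> sides w \<and> (fore w x = hind w y \<or> hind w x = fore w y)"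
proof
  assume "(x, y) \<in> corners w \<union> (corners w)\<inverse>"
  then obtain c where c: "c \<in> crossings w" and xy: 
    "(x, y) \<in> {((sw w c, Left), (nw w c, Left)), ((se w c, Right), (ne w c, Right)),
      ((sw w c, Right), (se w c, Left)), ((ne w c, Left), (nw w c, Right))} \<or>
     (y, x) \<in> {((sw w c, Left), (nw w c, Left)), ((se w c, Right), (ne w c, Right)),
      ((sw w c, Right), (se w c, Left)), ((ne w c, Left), (nw w c, Right))}"
    unfolding corners_def by auto
  note s = corner_sides[OF assms(1) c]
  have f: "fore w (sw w c, Left) = (c, West)" "fore w (se w c, Left) = (c, South)"
    "fore w (ne w c, Right) = (c, East)" "fore w (nw w c, Right) = (c, North)"
    "hind w (nw w c, Left) = (c, West)" "hind w (sw w c, Right) = (c, South)"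
    "hind w (se w c, Right) = (c, East)" "hind w (ne w c, Left) = (c, North)"
    using fore_iff[OF assms(1) s(1) assms(2), of Left c West] fore_iff[OF assms(1) s(2) assms(2), of Left c South]
      fore_iff[OF assms(1) s(3) assms(2), of Right c East] fore_iff[OF assms(1) s(4) assms(2), of Right c North]
      hind_iff[OF assms(1) s(4) assms(2), of Left c West] hind_iff[OF assms(1) s(1) assms(2), of Right c South]
      hind_iff[OF assms(1) s(2) assms(2), of Right c East] hind_iff[OF assms(1) s(3) assms(2), of Left c North]
      c by (simp_all del: fore.simps hind.simps)
  show "x \<in> sides w \<and> y \<in> sides w \<and> (fore w x = hind w y \<or> hind w x = fore w y)"
    using xy s f by (auto simp del: fore.simps hind.simps)
next
  have *: "(x, y) \<in> corners w \<union> (corners w)\<inverse>"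
    if s: "x \<in> sides w" "y \<in> sides w" and e: "fore w x = hind w y" for x y
  proof -
    obtain c d where cd: "fore w x = (c, d)" by force
    then have "hind w y = (c, d)" using e by simp
    with cd show ?thesis
      using fore_iff[OF assms(1) s(1) assms(2), of c d] hind_iff[OF assms(1) s(2) assms(2), of c d]
      unfolding corners_def by (cases d) auto
  qed
  assume "x \<in> sides w \<and> y \<in> sides w \<and> (fore w x = hind w y \<or> hind w x = fore w y)"
  then show "(x, y) \<in> corners w \<union> (corners w)\<inverse>"
    using *[of x y] *[of y x] by auto
qed

definition closed_under_corners :: "passage list \<Rightarrow> (nat \<times> side \<Rightarrow> bool) \<Rightarrow> bool" where
  "closed_under_corners w H \<longleftrightarrow> (\<forall>(x, y) \<in> corners w. H x = H y)"

lemma closedD: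
  assumes "closed_under_corners w H" "c \<in> crossings w"
  shows "H (sw w c, Left) = H (nw w c, Left)" "H (se w c, Right) = H (ne w c, Right)"
    "H (sw w c, Right) = H (se w c, Left)" "H (ne w c, Left) = H (nw w c, Right)"
  using assms unfolding closed_under_corners_def corners_def by auto

lemma flow_iff_seq:
  "flow col st w st' \<longleftrightarrow> (\<exists>g. g 0 = st \<and> g (length w) = st' \<and>
     (\<forall>i<length w. before col (w ! i) = g i \<and> after col (w ! i) = g (Suc i)))"
proof (induction w arbitrary: st)
  case Nil then show ?case by auto
next
  case (Cons x xs)
  show ?case
  proof
    assume "flow col st (x # xs) st'"
    then obtain g where g: "before col x = st" "g 0 = after col x" "g (length xs) = st'"
      "\<forall>i<length xs. before col (xs ! i) = g i \<and> after col (xs ! i) = g (Suc i)"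
      using Cons.IH by auto
    show "\<exists>g. g 0 = st \<and> g (length (x # xs)) = st' \<and>
     (\<forall>i<length (x # xs). before col ((x # xs) ! i) = g i \<and> after col ((x # xs) ! i) = g (Suc i))"
      by (rule exI[of _ "\<lambda>n. case n of 0 \<Rightarrow> st | Suc m \<Rightarrow> g m"])
        (use g in \<open>auto simp: nth_Cons split: nat.splits\<close>)
  next
    assume "\<exists>g. g 0 = st \<and> g (length (x # xs)) = st' \<and>
     (\<forall>i<length (x # xs). before col ((x # xs) ! i) = g i \<and> after col ((x # xs) ! i) = g (Suc i))"
    then obtain g where g: "g 0 = st" "g (length (x # xs)) = st'"
     "\<And>i. i<length (x # xs) \<Longrightarrow> before col ((x # xs) ! i) = g i \<and> after col ((x # xs) ! i) = g (Suc i)"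
      by blast
    have "flow col (after col x) xs st'"
      unfolding Cons.IH
      by (rule exI[of _ "\<lambda>n. g (Suc n)"]) (use g(1,2) g(3)[of 0] g(3)[of "Suc _"] in auto)
    then show "flow col st (x # xs) st'" using g(1) g(3)[of 0] by auto
  qed
qed

lemma closed_to_flow:
  assumes "valid w" "w \<noteq> []" "closed_under_corners w H"
  obtains col where "flow col (H (0, Left), H (0, Right)) w (H (0, Left), H (0, Right))"
    "\<And>i. i < length w \<Longrightarrow> before col (w ! i) = (H (i, Left), H (i, Right))"
    "\<And>i. i < length w \<Longrightarrow> after col (w ! i) = (H (edge w (Suc i), Left), H (edge w (Suc i), Right))"
    "\<And>c. c \<in> crossings w \<Longrightarrow> turn (col c) =
       ((H (sw w c, Left) \<noteq> H (sw w c, Right)) \<noteq> (H (ne w c, Left) \<noteq> H (ne w c, Right)))"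
proof -
  define col where "col c d = (case d of West \<Rightarrow> H (sw w c, Left) | South \<Rightarrow> H (sw w c, Right)
    | East \<Rightarrow> H (ne w c, Right) | North \<Rightarrow> H (ne w c, Left))" for c d
  have b: "before col (w ! i) = (H (i, Left), H (i, Right))"
   and a: "after col (w ! i) = (H (edge w (Suc i), Left), H (edge w (Suc i), Right))" if i: "i < length w" for i
  proof -
    define c where "c = crossing (w ! i)"
    have c: "c \<in> crossings w" using i by (auto simp: c_def)
    note cl = closedD[OF assms(3) c]
    have p: "i = position w c (strand (w ! i))" using position_nth[OF assms(1) i] by (simp add: c_def)
    have "strand (w ! i) = SWNE \<Longrightarrow> sw w c = i \<and> ne w c = edge w (Suc i)"
      "strand (w ! i) = SENW \<Longrightarrow> se w c = i \<and> nw w c = edge w (Suc i)"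
      using p sw_se_position[OF assms(1) c] by (auto simp: ne_def nw_def)
    then show "before col (w ! i) = (H (i, Left), H (i, Right))"
      "after col (w ! i) = (H (edge w (Suc i), Left), H (edge w (Suc i), Right))"
      using cl by (cases "strand (w ! i)"; auto simp: before_def after_def c_def[symmetric] col_def)+
  qed
  have "flow col (H (0, Left), H (0, Right)) w (H (0, Left), H (0, Right))"
    unfolding flow_iff_seq
  proof (rule exI[of _ "\<lambda>i. (H (edge w i, Left), H (edge w i, Right))"], intro conjI allI impI)
    fix i assume i: "i < length w"
    then have "edge w i = i" by (auto simp: edge_def)
    then show "before col (w ! i) = (H (edge w i, Left), H (edge w i, Right))"
      using b[OF i] by simp
    show "after col (w ! i) = (H (edge w (Suc i), Left), H (edge w (Suc i), Right))" by (rule a[OF i])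
  qed (simp_all add: edge_def)
  moreover have "turn (col c) =
       ((H (sw w c, Left) \<noteq> H (sw w c, Right)) \<noteq> (H (ne w c, Left) \<noteq> H (ne w c, Right)))" for c
    by (auto simp: turn_def col_def)
  ultimately show ?thesis using that a b by blast
qed

fun val :: "side \<Rightarrow> bool \<times> bool \<Rightarrow> bool" where
  "val Left st = fst st"
| "val Right st = snd st"

lemma flow_to_closed:
  assumes "valid w" "w \<noteq> []" "g 0 = g (length w)"
    and g: "\<And>i. i < length w \<Longrightarrow> before col (w ! i) = g i \<and> after col (w ! i) = g (Suc i)"
  shows "closed_under_corners w (\<lambda>(i, \<sigma>). val \<sigma> (g i))"
    and "c \<in> crossings w \<Longrightarrow> turn (col c) =
       ((fst (g (sw w c)) \<noteq> snd (g (sw w c))) \<noteq> (fst (g (ne w c)) \<noteq> snd (g (ne w c))))"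
proof -
  have e: "g (sw w c) = (col c West, col c South)" "g (se w c) = (col c South, col c East)"
    "g (ne w c) = (col c North, col c East)" "g (nw w c) = (col c West, col c North)"
    if c: "c \<in> crossings w" for c
  proof -
    note P = position_props[OF assms(1) c]
    have E: "g (edge w (Suc i)) = g (Suc i)" if i: "i < length w" for i
    proof (cases "Suc i = length w")
      case True
      then have "edge w (Suc i) = 0" by (simp add: edge_def)
      then show ?thesis using assms(3) True by metis
    qed (use i in \<open>auto simp: edge_def\<close>)
    show "g (sw w c) = (col c West, col c South)" "g (se w c) = (col c South, col c East)"
      using g[OF P(1), of SWNE] g[OF P(1), of SENW] sw_se_position[OF assms(1) c] P(2,3)
      by (simp_all add: before_def)
    show "g (ne w c) = (col c North, col c East)" "g (nw w c) = (col c West, col c North)"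
      using g[OF P(1), of SWNE] g[OF P(1), of SENW] E[OF P(1), of SWNE] E[OF P(1), of SENW] P(2,3)
      by (simp_all add: after_def ne_def nw_def)
  qed
  show "closed_under_corners w (\<lambda>(i, \<sigma>). val \<sigma> (g i))"
    unfolding closed_under_corners_def corners_def using e by auto
  show "c \<in> crossings w \<Longrightarrow> turn (col c) =
       ((fst (g (sw w c)) \<noteq> snd (g (sw w c))) \<noteq> (fst (g (ne w c)) \<noteq> snd (g (ne w c))))"
    using e[of c] by (auto simp: turn_def)
qed

section \<open>The colouring criterion for planarity\<close>

definition closed_sets :: "passage list \<Rightarrow> (nat \<times> side) set set" where
  "closed_sets w = {X. X \<subseteq> sides w \<and> closed_under_corners w (\<lambda>x. x \<in> X)}"

abbreviation connected_sides :: "passage list \<Rightarrow> ((nat \<times> side) \<times> (nat \<times> side)) set" where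
  "connected_sides w \<equiv> (corners w \<union> (corners w)\<inverse>)\<^sup>*"

lemma region_eq: "region w {} x = connected_sides w `` {x}"
  by (simp add: region_def Let_def)

lemma connected_sym: "(x, y) \<in> connected_sides w \<Longrightarrow> (y, x) \<in> connected_sides w"
  by (metis (no_types, lifting) converse_Un converse_converse rtrancl_converseI sup_commute)

lemma region_same: "y \<in> region w {} x \<Longrightarrow> region w {} y = region w {} x"
  unfolding region_eq by (auto intro: rtrancl_trans connected_sym)

lemma connected_closed:
  assumes "closed_under_corners w H" "(x, y) \<in> connected_sides w" shows "H x = H y"
  using assms(2)
proof (induction rule: rtrancl_induct)
  case (step y z) then show ?case using assms(1) unfolding closed_under_corners_def by auto
qed auto

lemma corners_sides: "valid w \<Longrightarrow> corners w \<subseteq> sides w \<times> sides w"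
  unfolding corners_def using corner_sides by auto

lemma connected_in_sides:
  assumes "valid w" "(x, y) \<in> connected_sides w" "x \<in> sides w" shows "y \<in> sides w"
  using assms(2,3) corners_sides[OF assms(1)] by (induction rule: rtrancl_induct) auto

lemma card_closed_sets:
  assumes "valid w" shows "finite (closed_sets w)" "card (closed_sets w) = 2 ^ card (faces w)"
proof -
  have "(UNIV :: side set) = {Left, Right}" by (auto intro: side.exhaust)
  then have "finite (UNIV :: side set)" by (metis finite.emptyI finite_insert)
  then have fin: "finite (sides w)" by (simp add: sides_def edges_def)
  then show "finite (closed_sets w)" unfolding closed_sets_def by (simp add: finite_subset)
  have faces: "faces w = region w {} ` sides w" by (simp add: faces_def sides_def)
  have "bij_betw \<Union> (Pow (faces w)) (closed_sets w)"
  proof (rule bij_betw_imageI)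
    show "inj_on \<Union> (Pow (faces w))"
    proof (rule inj_onI)
      have *: "A \<subseteq> B" if AB: "A \<subseteq> faces w" "B \<subseteq> faces w" "\<Union>A = \<Union>B" for A B
      proof
        fix a assume a: "a \<in> A"
        with AB(1) have "a \<in> region w {} ` sides w" unfolding faces by (rule subsetD)
        then obtain x where x: "a = region w {} x" by (rule imageE)
        have "x \<in> a" unfolding x region_eq by simp
        with a have "x \<in> \<Union>B" unfolding AB(3)[symmetric] by (rule UnionI)
        then obtain b where b: "b \<in> B" "x \<in> b" by (rule UnionE)
        with AB(2) have "b \<in> region w {} ` sides w" unfolding faces by auto
        then obtain y where y: "b = region w {} y" by (rule imageE)
        have "a = b" using region_same[of x w y] b(2) unfolding x y by simp
        then show "a \<in> B" using b(1) by simp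
      qed
      fix A B assume "A \<in> Pow (faces w)" "B \<in> Pow (faces w)" "\<Union>A = \<Union>B"
      then show "A = B" using *[of A B] *[of B A] by auto
    qed
    show "\<Union> ` Pow (faces w) = closed_sets w"
    proof
      show "\<Union> ` Pow (faces w) \<subseteq> closed_sets w"
      proof
        fix X assume "X \<in> \<Union> ` Pow (faces w)"
        then obtain A where A: "A \<subseteq> faces w" "X = \<Union>A" by auto
        have "X \<subseteq> sides w"
          using A faces connected_in_sides[OF assms] unfolding region_eq by auto
        moreover have "(x \<in> X) = (y \<in> X)" if "(x, y) \<in> corners w" for x y
        proof -
          have "(x, y) \<in> connected_sides w" "(y, x) \<in> connected_sides w" using that by auto
          then have "x \<in> region w {} z \<longleftrightarrow> y \<in> region w {} z" for z
            unfolding region_eq by (auto intro: rtrancl_trans)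
          then have "x \<in> a \<longleftrightarrow> y \<in> a" if "a \<in> A" for a
            using subsetD[OF A(1) that] unfolding faces by (elim imageE) simp
          then show ?thesis unfolding A(2) by blast
        qed
        ultimately show "X \<in> closed_sets w" by (auto simp: closed_sets_def closed_under_corners_def)
      qed
      show "closed_sets w \<subseteq> \<Union> ` Pow (faces w)"
      proof
        fix X assume X: "X \<in> closed_sets w"
        have "X = \<Union>(region w {} ` X)"
        proof
          show "X \<subseteq> \<Union> (region w {} ` X)" by (auto simp: region_eq)
          show "\<Union> (region w {} ` X) \<subseteq> X"
            using X connected_closed[of w "\<lambda>x. x \<in> X"] by (auto simp: region_eq closed_sets_def)
        qed
        moreover have "region w {} ` X \<subseteq> faces w" using X faces by (auto simp: closed_sets_def)
        ultimately show "X \<in> \<Union> ` Pow (faces w)" by (metis PowI image_eqI)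
      qed
    qed
  qed
  then have "card (Pow (faces w)) = card (closed_sets w)" by (rule bij_betw_same_card)
  moreover have "finite (faces w)" using fin faces by simp
  ultimately show "card (closed_sets w) = 2 ^ card (faces w)" by (simp add: card_Pow)
qed

text \<open>
  A set of faces, as a colouring, is described by the double points at which it turns and by
  whether its colours at edge \<open>0\<close> differ.
\<close>

definition jumps :: "passage list \<Rightarrow> (nat \<times> side) set \<Rightarrow> nat set \<times> bool" where
  "jumps w X = ({c \<in> crossings w. (((sw w c, Left) \<in> X) \<noteq> ((sw w c, Right) \<in> X)) \<noteq>
       (((ne w c, Left) \<in> X) \<noteq> ((ne w c, Right) \<in> X))},
     ((0, Left) \<in> X) \<noteq> ((0, Right) \<in> X))"

lemma edge_induct:
  assumes "w \<noteq> []" "i < length w" "P 0"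
    "\<And>i. i < length w \<Longrightarrow> P i \<Longrightarrow> P (edge w (Suc i))" 
  shows "P (i :: nat)"
  using assms(2)
proof (induction i)
  case (Suc i)
  then have "edge w (Suc i) = Suc i" by (auto simp: edge_def)
  then show ?case using Suc assms(4)[of i] by simp
qed (use assms in auto)

lemma nth_position_cases:
  assumes "valid w" "i < length w"
  obtains c where "c \<in> crossings w" "i = sw w c" "edge w (Suc i) = ne w c"
  | c where "c \<in> crossings w" "i = se w c" "edge w (Suc i) = nw w c"
proof -
  have c: "crossing (w ! i) \<in> crossings w" using assms by auto
  show ?thesis
    using that c sw_se_position[OF assms(1) c] position_nth[OF assms]
    by (cases "strand (w ! i)") (auto simp: ne_def nw_def)
qed

text \<open>
  Colours are transported along the curve: the colour on one side and the jump give the colour on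
  the other side, and the turns tell how the jump changes.
\<close>

lemma jumps_determine:
  assumes v: "valid w" "w \<noteq> []" and X: "X \<in> closed_sets w" and Y: "Y \<in> closed_sets w"
    and J: "jumps w X = jumps w Y" and z: "(0, Left) \<in> X \<longleftrightarrow> (0, Left) \<in> Y"
  shows "X = Y"
proof -
  note cX = closedD[of w "\<lambda>x. x \<in> X"] and cY = closedD[of w "\<lambda>x. x \<in> Y"]
  have cl: "closed_under_corners w (\<lambda>x. x \<in> X)" "closed_under_corners w (\<lambda>x. x \<in> Y)"
    using X Y by (auto simp: closed_sets_def)
  let ?j = "\<lambda>X i. ((i, Left) \<in> X) \<noteq> ((i, Right) \<in> X)"
  have T: "(?j X (sw w c) \<noteq> ?j X (ne w c)) = (?j Y (sw w c) \<noteq> ?j Y (ne w c))" if c: "c \<in> crossings w" for c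
  proof -
    have "c \<in> fst (jumps w X) \<longleftrightarrow> c \<in> fst (jumps w Y)" using J by simp
    then show ?thesis using c unfolding jumps_def by simp
  qed
  have j: "?j X i = ?j Y i" if "i < length w" for i
  proof (rule edge_induct[OF v(2) that])
    show "?j X 0 = ?j Y 0" using J by (auto simp: jumps_def)
  next
    fix i assume i: "i < length w" and IH: "?j X i = ?j Y i"
    show "?j X (edge w (Suc i)) = ?j Y (edge w (Suc i))"
      using v(1) i
    proof (cases rule: nth_position_cases)
      case (1 c) then show ?thesis using T[of c] IH by simp blast
    next
      case (2 c)
      then show ?thesis using T[of c] IH cX[OF cl(1), of c] cY[OF cl(2), of c] by simp blast
    qed
  qed
  have e: "((i, Left) \<in> X) = ((i, Left) \<in> Y)" if "i < length w" for i
  proof (rule edge_induct[OF v(2) that])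
    fix i assume i: "i < length w" and IH: "((i, Left) \<in> X) = ((i, Left) \<in> Y)"
    show "((edge w (Suc i), Left) \<in> X) = ((edge w (Suc i), Left) \<in> Y)"
      using v(1) i
    proof (cases rule: nth_position_cases)
      case (1 c) 
      then show ?thesis using IH cX[OF cl(1), of c] cY[OF cl(2), of c] in_edge_less[OF v(1), of c]
          j[of "sw w c"] j[of "se w c"] j[of "ne w c"] by simp blast
    next
      case (2 c)
      then show ?thesis using IH cX[OF cl(1), of c] cY[OF cl(2), of c] in_edge_less[OF v(1), of c]
          j[of "sw w c"] by simp blast
    qed
  qed (use z in auto)
  have "((i, \<sigma>) \<in> X) = ((i, \<sigma>) \<in> Y)" if "i < length w" for i \<sigma>
    using e[OF that] j[OF that] by (cases \<sigma>) auto
  moreover have "X \<subseteq> sides w" "Y \<subseteq> sides w" using X Y by (auto simp: closed_sets_def)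
  ultimately show ?thesis using sides_iff[OF v(2)] by (auto 4 3 simp: subset_iff)
qed

lemma card_jumps:
  assumes v: "valid w" "w \<noteq> []"
  shows "card (closed_sets w) = 2 * card (jumps w ` closed_sets w)"
proof -
  let ?h = "\<lambda>X. (jumps w X, (0, Left) \<in> X)"
  have "inj_on ?h (closed_sets w)"
    by (rule inj_onI) (use jumps_determine[OF v] in auto)
  moreover have "?h ` closed_sets w = (jumps w ` closed_sets w) \<times> UNIV"
  proof -
    have "(jumps w X, b) \<in> ?h ` closed_sets w" if X: "X \<in> closed_sets w" for X b
    proof (cases "b = ((0, Left) \<in> X)")
      case True then show ?thesis using X by auto
    next
      case False
      have z: "(0, \<sigma>) \<in> sides w" for \<sigma> using v sides_iff by auto
      have "sides w - X \<in> closed_sets w"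
        using X corners_sides[OF v(1)] by (auto simp: closed_sets_def closed_under_corners_def)
      moreover have "jumps w (sides w - X) = jumps w X"
        using z corner_sides[OF v(1)] unfolding jumps_def by simp blast
      moreover have "((0, Left) \<in> sides w - X) = b" using False z by auto
      ultimately show ?thesis by (intro image_eqI[of _ _ "sides w - X"]) auto
    qed
    then show ?thesis by auto
  qed
  ultimately have "card (closed_sets w) = card ((jumps w ` closed_sets w) \<times> (UNIV :: bool set))"
    using card_image[of ?h "closed_sets w"] by simp
  then show ?thesis by (simp add: card_cartesian_product)
qed

text \<open>
  The sets of faces are determined by their jumps up to complement, so \<open>2 ^ card (faces w)\<close> is
  twice the number of jump patterns that occur. With \<open>n\<close> double points there are \<open>2 ^ (n + 1)\<close>
  patterns, and all of them occur iff there are \<open>n + 2\<close> faces.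
\<close>

lemma planar_iff_colorable:
  assumes v: "valid w" shows "planar w \<longleftrightarrow> colorable w"
proof (cases "w = []")
  case True
  have "sides [] = {(0, Left), (0, Right)}"
    unfolding sides_def edges_def by (auto, metis side.exhaust)
  moreover have "region [] {} x = {x}" for x by (simp add: region_eq corners_def)
  ultimately have "planar []" by (simp add: planar_def faces_def sides_def[symmetric])
  moreover have "colorable []" unfolding colorable_def by (auto intro: exI[of _ "True"])
  ultimately show ?thesis using True by simp
next
  case False
  let ?n = "card (crossings w)"
  let ?all = "Pow (crossings w) \<times> (UNIV :: bool set)"
  have sub: "jumps w ` closed_sets w \<subseteq> ?all" by (auto simp: jumps_def)
  have finall: "finite ?all" by simp
  have card_all: "card ?all = 2 ^ (?n + 1)" by (simp add: card_cartesian_product card_Pow)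
  have eq: "(2::nat) ^ card (faces w) = 2 * card (jumps w ` closed_sets w)"
    using card_jumps[OF v False] card_closed_sets(2)[OF v] by simp
  have "card (faces w) = ?n + 2 \<longleftrightarrow> (2::nat) ^ card (faces w) = 2 ^ (?n + 2)"
    by (rule power_inject_exp[symmetric]) simp
  then have "planar w \<longleftrightarrow> card (jumps w ` closed_sets w) = card ?all"
    unfolding planar_def card_all eq by simp
  also have "\<dots> \<longleftrightarrow> jumps w ` closed_sets w = ?all"
    using card_subset_eq[OF finall sub] by auto
  also have "\<dots> \<longleftrightarrow> colorable w"
  proof
    assume all: "jumps w ` closed_sets w = ?all"
    show "colorable w" unfolding colorable_def
    proof (intro allI)
      fix T b
      have "(T \<inter> crossings w, b) \<in> jumps w ` closed_sets w" using all by auto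
      then obtain X where X: "X \<in> closed_sets w" "jumps w X = (T \<inter> crossings w, b)" by auto
      then have "closed_under_corners w (\<lambda>x. x \<in> X)" by (simp add: closed_sets_def)
      from closed_to_flow[OF v False this] obtain col where
        "flow col ((0, Left) \<in> X, (0, Right) \<in> X) w ((0, Left) \<in> X, (0, Right) \<in> X)"
        "\<And>c. c \<in> crossings w \<Longrightarrow> turn (col c) = ((((sw w c, Left) \<in> X) \<noteq> ((sw w c, Right) \<in> X)) \<noteq>
             (((ne w c, Left) \<in> X) \<noteq> ((ne w c, Right) \<in> X)))" by metis
      moreover have "(((0, Left) \<in> X) \<noteq> ((0, Right) \<in> X)) = b"
        using X(2) unfolding jumps_def by simp
      moreover have "((((sw w c, Left) \<in> X) \<noteq> ((sw w c, Right) \<in> X)) \<noteq>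
             (((ne w c, Left) \<in> X) \<noteq> ((ne w c, Right) \<in> X))) = (c \<in> T)" if "c \<in> crossings w" for c
      proof -
        have "c \<in> fst (jumps w X) \<longleftrightarrow> c \<in> T" using X(2) that by simp
        then show ?thesis using that unfolding jumps_def by simp
      qed
      ultimately have "flow col ((0, Left) \<in> X, (0, Right) \<in> X) w ((0, Left) \<in> X, (0, Right) \<in> X) \<and>
        (fst ((0, Left) \<in> X, (0, Right) \<in> X) \<noteq> snd ((0, Left) \<in> X, (0, Right) \<in> X)) = b \<and>
        (\<forall>c\<in>crossings w. turn (col c) = (c \<in> T))" by simp
      then show "\<exists>col st. flow col st w st \<and> (fst st \<noteq> snd st) = b \<and>
          (\<forall>c\<in>crossings w. turn (col c) = (c \<in> T))" by blast
    qed
  next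
    assume c: "colorable w"
    have "(T, b) \<in> jumps w ` closed_sets w" if T: "T \<subseteq> crossings w" for T b
    proof -
      obtain col st where f: "flow col st w st" "(fst st \<noteq> snd st) = b"
        "\<forall>c\<in>crossings w. turn (col c) = (c \<in> T)"
        using c by (rule colorableE)
      then obtain g where g: "g 0 = st" "g (length w) = st"
        "\<And>i. i < length w \<Longrightarrow> before col (w ! i) = g i \<and> after col (w ! i) = g (Suc i)"
        unfolding flow_iff_seq by (elim exE conjE) (rule that, auto)
      define H where "H = (\<lambda>(i, \<sigma>). val \<sigma> (g i))"

      have H: "closed_under_corners w H" unfolding H_def
        by (rule flow_to_closed(1)[OF v False, of g col]) (use g in auto)
      have t: "turn (col c) = ((H (sw w c, Left) \<noteq> H (sw w c, Right)) \<noteq> (H (ne w c, Left) \<noteq> H (ne w c, Right)))"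
        if "c \<in> crossings w" for c
        using flow_to_closed(2)[OF v False _ g(3) that] g by (auto simp: H_def)
      define X where "X = {x \<in> sides w. H x}"
      have "X \<in> closed_sets w"
        using H corners_sides[OF v] by (auto simp: X_def closed_sets_def closed_under_corners_def)
      moreover have "jumps w X = (T, b)"
      proof -
        have z: "(0, \<sigma>) \<in> sides w" for \<sigma> using False sides_iff by auto
        have "(((0, Left) \<in> X) \<noteq> ((0, Right) \<in> X)) = b"
          using z f(2) g(1) by (simp add: X_def H_def)
        moreover have "{c \<in> crossings w. (((sw w c, Left) \<in> X) \<noteq> ((sw w c, Right) \<in> X)) \<noteq>
            (((ne w c, Left) \<in> X) \<noteq> ((ne w c, Right) \<in> X))} = T"
          using T f(3) t corner_sides[OF v] unfolding X_def by auto
        ultimately show ?thesis unfolding jumps_def by simp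
      qed
      ultimately show ?thesis by force
    qed
    then show "jumps w ` closed_sets w = ?all" using sub by auto
  qed
  finally show ?thesis .
qed

section \<open>Cutting a face\<close>

text \<open>
  A chord between the sides \<open>x\<close> and \<open>y\<close> of a face divides the cyclic sequence of its corners into
  two parts; \<open>f\<close> is the indicator of one part. It is found by walking along the boundary from \<open>x\<close>
  to \<open>y\<close>.
\<close>

lemma cut_coloring:
  assumes v: "valid w" "w \<noteq> []" and x: "x \<in> sides w" and xy: "(x, y) \<in> connected_sides w"
  shows "x = y \<or> (\<exists>f :: nat \<times> corner \<Rightarrow> bool.
     (\<forall>z\<in>sides w. z \<noteq> x \<and> z \<noteq> y \<longrightarrow> f (fore w z) = f (hind w z)) \<and>
     f (fore w x) \<noteq> f (hind w x) \<and> f (fore w y) \<noteq> f (hind w y) \<and> f (fore w x) = f (hind w y))"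
  using xy
proof (induction rule: rtrancl_induct)
  case (step y z)
  have y: "y \<in> sides w" and z: "z \<in> sides w"
    and k: "fore w y = hind w z \<or> hind w y = fore w z"
    using corners_iff[OF v, of y z] step(2) by auto
  define \<kappa> where "\<kappa> = (if fore w y = hind w z then fore w y else hind w y)"
  define A where "A \<longleftrightarrow> fore w y = hind w z"
  have fu: "fore w u = \<kappa> \<longleftrightarrow> u = (if A then y else z)" if "u \<in> sides w" for u
    using fore_inj[OF v that y] fore_inj[OF v that z] k by (auto simp: \<kappa>_def A_def)
  have hu: "hind w u = \<kappa> \<longleftrightarrow> u = (if A then z else y)" if "u \<in> sides w" for u
    using hind_inj[OF v that y] hind_inj[OF v that z] k by (auto simp: \<kappa>_def A_def)
  show ?case
  proof (cases "z = x")
    case False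
    from step.IH show ?thesis
    proof
      assume xy: "x = y"
      show ?thesis
        by (intro disjI2 exI[of _ "\<lambda>c. c = \<kappa>"]) (use False xy x z fu hu in auto)
    next
      assume "\<exists>f :: nat \<times> corner \<Rightarrow> bool. (\<forall>z\<in>sides w. z \<noteq> x \<and> z \<noteq> y \<longrightarrow> f (fore w z) = f (hind w z)) \<and>
        f (fore w x) \<noteq> f (hind w x) \<and> f (fore w y) \<noteq> f (hind w y) \<and> f (fore w x) = f (hind w y)"
      then obtain f :: "nat \<times> corner \<Rightarrow> bool" where F: "(\<forall>u\<in>sides w. u \<noteq> x \<and> u \<noteq> y \<longrightarrow> f (fore w u) = f (hind w u)) \<and>
        f (fore w x) \<noteq> f (hind w x) \<and> f (fore w y) \<noteq> f (hind w y) \<and> f (fore w x) = f (hind w y)"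
        by (elim exE) (rule that)
      note f' = conjunct1[OF F] and f = conjunct2[OF F, THEN conjunct1]
        conjunct2[OF F, THEN conjunct2, THEN conjunct1] conjunct2[OF F, THEN conjunct2, THEN conjunct2]
      show ?thesis
      proof (cases "x = y")
        case True
        show ?thesis
          by (intro disjI2 exI[of _ "\<lambda>c. c = \<kappa>"]) (use False True x z fu hu in auto)
      next
        case xy: False
        have zy: "z \<noteq> y" using f(2) k by auto
        have ff: "f (fore w z) = f (hind w z)" using bspec[OF f' z] False zy by simp
        have kk: "f \<kappa> = (if A then f (fore w y) else f (hind w y))" by (simp add: \<kappa>_def A_def)
        have kz: "f \<kappa> = f (fore w z)" using k ff by (auto simp: \<kappa>_def)
        show ?thesis
        proof (intro disjI2 exI[of _ "\<lambda>c. f c \<noteq> (c = \<kappa>)"] conjI ballI impI)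
          fix u assume u: "u \<in> sides w" "u \<noteq> x \<and> u \<noteq> z"
          show "(f (fore w u) \<noteq> (fore w u = \<kappa>)) = (f (hind w u) \<noteq> (hind w u = \<kappa>))"
            using u fu[OF u(1)] hu[OF u(1)] bspec[OF f' u(1)] f(2) zy by (cases "u = y"; cases A; simp)
        qed (use fu hu x z y f ff kk kz xy zy False in \<open>cases A; simp\<close>)+
      qed
    qed
  qed simp
qed simp

definition xor_state :: "bool \<times> bool \<Rightarrow> bool \<times> bool \<Rightarrow> bool \<times> bool" where
  "xor_state p q = (fst p \<noteq> fst q, snd p \<noteq> snd q)"

lemma val_xor [simp]: "val \<sigma> (xor_state p q) = (val \<sigma> p \<noteq> val \<sigma> q)"
  by (cases \<sigma>) (auto simp: xor_state_def)

lemma flow_xor: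
  assumes "flow c1 p w p'" "flow c2 q w q'"
  shows "flow (\<lambda>c d. c1 c d \<noteq> c2 c d) (xor_state p q) w (xor_state p' q')"
  using assms
proof (induction w arbitrary: p q)
  case (Cons x xs)
  have a: "after (\<lambda>c d. c1 c d \<noteq> c2 c d) x = xor_state (after c1 x) (after c2 x)"
    by (simp add: after_def xor_state_def)
  have b: "before (\<lambda>c d. c1 c d \<noteq> c2 c d) x = xor_state (before c1 x) (before c2 x)"
    by (simp add: before_def xor_state_def)
  have "flow (\<lambda>c d. c1 c d \<noteq> c2 c d) (xor_state (after c1 x) (after c2 x)) xs (xor_state p' q')"
    using Cons.prems by (intro Cons.IH) auto
  then show ?case using Cons.prems a b by auto
qed auto

lemma turn_xor: "turn (\<lambda>d. f d \<noteq> g d) = (turn f \<noteq> turn g)"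
  unfolding turn_def by argo

lemma flow_append: "flow col a (xs @ ys) c \<longleftrightarrow> (\<exists>b. flow col a xs b \<and> flow col b ys c)"
  by (induction xs arbitrary: a) auto

lemma flow_cong:
  assumes "\<And>c. c \<in> crossings w \<Longrightarrow> col c = col' c"
  shows "flow col a w b = flow col' a w b"
  using assms by (induction w arbitrary: a) (auto simp: before_def after_def)

lemma flow_change:
  assumes "flow col a w b" "\<And>c. c \<in> crossings w \<Longrightarrow> col' c = col c" shows "flow col' a w b"
  using assms flow_cong[of w col' col a b] by blast

lemma state_eqI: "(\<And>\<sigma>. val \<sigma> p = val \<sigma> q) \<Longrightarrow> p = q"
  by (rule prod_eqI) (metis val.simps(1), metis val.simps(2))

text \<open>
  Gap \<open>0\<close> and gap \<open>length v\<close> of the cyclic word \<open>v @ y\<close> border a common face, on the sides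
  \<open>\<sigma>\<close> and \<open>\<tau>\<close>: no colouring tells them apart.
\<close>

definition adj :: "passage list \<Rightarrow> passage list \<Rightarrow> side \<Rightarrow> side \<Rightarrow> bool" where
  "adj v y \<sigma> \<tau> \<longleftrightarrow> (\<forall>col a b. flow col a v b \<longrightarrow> flow col b y a \<longrightarrow> val \<sigma> a = val \<tau> b)"

lemma adjD: "adj v y \<sigma> \<tau> \<Longrightarrow> flow col a v b \<Longrightarrow> flow col b y a \<Longrightarrow> val \<sigma> a = val \<tau> b"
  unfolding adj_def by blast

text \<open>
  Otherwise the face at gap \<open>0\<close> could be coloured differently from all the others.
\<close>

lemma adj_connected:
  assumes v: "valid (v @ y)" "v \<noteq> []" "y \<noteq> []" and adj: "adj v y \<sigma> \<tau>"
  shows "((0, \<sigma>), (length v, \<tau>)) \<in> connected_sides (v @ y)"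
proof -
  let ?w = "v @ y"
  define H where "H z \<longleftrightarrow> ((0, \<sigma>), z) \<in> connected_sides ?w" for z
  have ne: "?w \<noteq> []" using v by simp
  have "closed_under_corners ?w H"
  proof -
    have "H a = H b" if "(a, b) \<in> corners ?w" for a b
    proof -
      have "(a, b) \<in> connected_sides ?w" "(b, a) \<in> connected_sides ?w" using that by auto
      then show ?thesis unfolding H_def by (auto intro: rtrancl_trans)
    qed
    then show ?thesis unfolding closed_under_corners_def by auto
  qed
  from closed_to_flow[OF v(1) ne this] obtain col where col:
    "flow col (H (0, Left), H (0, Right)) ?w (H (0, Left), H (0, Right))"
    "\<And>i. i < length ?w \<Longrightarrow> before col (?w ! i) = (H (i, Left), H (i, Right))" by metis
  then obtain b where b: "flow col (H (0, Left), H (0, Right)) v b" "flow col b y (H (0, Left), H (0, Right))"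
    unfolding flow_append by auto
  have "before col (hd y) = b" using b(2) v(3) by (cases y) auto
  then have "b = (H (length v, Left), H (length v, Right))"
    using col(2)[of "length v"] v(3) by (simp add: nth_append hd_conv_nth)
  moreover have "val \<sigma> (H (0, Left), H (0, Right)) = val \<tau> b" using adjD[OF adj b] .
  ultimately have "H (0, \<sigma>) = H (length v, \<tau>)" by (cases \<sigma>; cases \<tau>) auto
  moreover have "H (0, \<sigma>)" by (simp add: H_def)
  ultimately show ?thesis by (simp add: H_def)
qed

lemma flow_segment:
  assumes "xs \<noteq> []" "\<And>i. Suc i < length xs \<Longrightarrow> after col (xs ! i) = before col (xs ! Suc i)"
  shows "flow col (before col (hd xs)) xs (after col (last xs))"
  using assms
proof (induction xs)
  case (Cons x xs)
  show ?case
  proof (cases "xs = []")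
    case False
    have "flow col (before col (hd xs)) xs (after col (last xs))"
      by (rule Cons.IH[OF False]) (use Cons.prems(2)[of "Suc _"] in auto)
    moreover have "after col x = before col (hd xs)"
      using Cons.prems(2)[of 0] False by (simp add: hd_conv_nth)
    ultimately show ?thesis using False by simp
  qed simp
qed simp

text \<open>
  One part of the face, cut along a chord between the two gaps, is coloured and everything else is
  not. The colours jump at both ends of the chord, from \<open>a\<close> to \<open>a'\<close> and from \<open>b\<close> to \<open>b'\<close>.
\<close>

lemma cut_flow:
  assumes v: "valid (v @ y)" "v \<noteq> []" "y \<noteq> []" and adj: "adj v y \<sigma> \<tau>"
  obtains col a a' b b' where "flow col a' v b" "flow col b' y a"
    "val \<sigma> a' \<noteq> val \<sigma> a" "val (flip \<sigma>) a' = val (flip \<sigma>) a"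
    "val \<tau> b' \<noteq> val \<tau> b" "val (flip \<tau>) b' = val (flip \<tau>) b"
    "(if \<sigma> = Left then val \<sigma> a' else val \<sigma> a) = (if \<tau> = Left then val \<tau> b else val \<tau> b')"
proof -
  let ?w = "v @ y" and ?x = "(0::nat, \<sigma>)" and ?y = "(length v, \<tau>)"
  have ne: "?w \<noteq> []" using v by simp
  have x: "?x \<in> sides ?w" "?y \<in> sides ?w" "?x \<noteq> ?y" using v sides_iff[OF ne] by auto
  have "\<exists>f :: nat \<times> corner \<Rightarrow> bool.
      (\<forall>z\<in>sides ?w. z \<noteq> ?x \<and> z \<noteq> ?y \<longrightarrow> f (fore ?w z) = f (hind ?w z)) \<and>
      f (fore ?w ?x) \<noteq> f (hind ?w ?x) \<and> f (fore ?w ?y) \<noteq> f (hind ?w ?y) \<and> f (fore ?w ?x) = f (hind ?w ?y)"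
    using cut_coloring[OF v(1) ne x(1) adj_connected[OF v adj]] x(3) by (elim disjE) (erule notE)
  then obtain f :: "nat \<times> corner \<Rightarrow> bool" where F:
      "(\<forall>z\<in>sides ?w. z \<noteq> ?x \<and> z \<noteq> ?y \<longrightarrow> f (fore ?w z) = f (hind ?w z)) \<and>
      f (fore ?w ?x) \<noteq> f (hind ?w ?x) \<and> f (fore ?w ?y) \<noteq> f (hind ?w ?y) \<and> f (fore ?w ?x) = f (hind ?w ?y)"
    by (elim exE) (rule that)
  note f = conjunct1[OF F] conjunct2[OF F, THEN conjunct1]
    conjunct2[OF F, THEN conjunct2, THEN conjunct1] conjunct2[OF F, THEN conjunct2, THEN conjunct2]
  define col where "col c d = f (c, d)" for c d
  let ?N = "length ?w"
  have hd: "val Left (before col (?w ! i)) = f (fore ?w (i, Left))"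
    "val Right (before col (?w ! i)) = f (hind ?w (i, Right))" for i
    by (auto simp: before_def col_def)
  have tl: "val Left (after col (?w ! pred ?w i)) = f (hind ?w (i, Left))"
    "val Right (after col (?w ! pred ?w i)) = f (fore ?w (i, Right))" for i
    by (auto simp: after_def col_def)
  have eq: "val \<rho> (before col (?w ! i)) = val \<rho> (after col (?w ! pred ?w i))"
    if "i < ?N" "(i, \<rho>) \<noteq> ?x" "(i, \<rho>) \<noteq> ?y" for i \<rho>
    using bspec[OF f(1), of "(i, \<rho>)"] that sides_iff[OF ne, of i \<rho>] hd[of i] tl[of i] by (cases \<rho>) auto
  have pS: "pred ?w (Suc i) = i" if "Suc i < ?N" for i using that by (auto simp: pred_def)
  have seg: "after col (?w ! i) = before col (?w ! Suc i)" if "Suc i < ?N" "Suc i \<noteq> length v" for i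
    by (rule state_eqI) (use eq[of "Suc i"] pS[OF that(1)] that in auto)
  have fv: "flow col (before col (hd v)) v (after col (last v))"
  proof (rule flow_segment[OF v(2)])
    fix i assume "Suc i < length v" then show "after col (v ! i) = before col (v ! Suc i)"
      using seg[of i] by (simp add: nth_append)
  qed
  have fy: "flow col (before col (hd y)) y (after col (last y))"
  proof (rule flow_segment[OF v(3)])
    fix i assume "Suc i < length y" then show "after col (y ! i) = before col (y ! Suc i)"
      using seg[of "length v + i"] by (simp add: nth_append)
  qed
  have len: "0 < length v" "0 < length y" using v(2,3) by simp_all
  then have len': "\<not> length v + length y - Suc 0 < length v"
    "(length v + length y - Suc 0) mod (length v + length y) = length v + length y - Suc 0"
    "length v + length y - Suc 0 - length v = length y - Suc 0" by (linarith, intro mod_less, linarith+)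
  have h0: "?w ! 0 = hd v" "?w ! pred ?w 0 = last y"
    using v(2,3) len' by (simp_all add: hd_conv_nth nth_append pred_def last_conv_nth del: length_greater_0_conv)
  have h1: "?w ! length v = hd y" "?w ! pred ?w (length v) = last v"
  proof -
    have e: "length v + length ?w - 1 = (length v - 1) + length ?w" using len(1) by arith
    have "length v - 1 < length ?w" using len unfolding length_append by linarith
    then have "pred ?w (length v) = length v - 1" unfolding pred_def e mod_add_self2 by (rule mod_less)
    then show "?w ! length v = hd y" "?w ! pred ?w (length v) = last v"
      using v(2,3) by (simp_all add: hd_conv_nth nth_append last_conv_nth)
  qed
  let ?a' = "before col (hd v)" and ?a = "after col (last y)" and ?b = "after col (last v)" and ?b' = "before col (hd y)"
  have "val \<sigma> ?a' \<noteq> val \<sigma> ?a"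
    using f(2) hd[of 0] tl[of 0] unfolding h0 by (cases \<sigma>) auto
  moreover have "val \<tau> ?b' \<noteq> val \<tau> ?b"
    using f(3) hd[of "length v"] tl[of "length v"] unfolding h1 by (cases \<tau>) auto
  moreover have "flip \<rho> \<noteq> \<rho>" for \<rho> by (cases \<rho>) auto
  then have "val (flip \<sigma>) ?a' = val (flip \<sigma>) ?a" "val (flip \<tau>) ?b' = val (flip \<tau>) ?b"
    using eq[of 0 "flip \<sigma>"] eq[of "length v" "flip \<tau>"] v(2,3) unfolding h0 h1 by auto
  moreover have "(if \<sigma> = Left then val \<sigma> ?a' else val \<sigma> ?a) = (if \<tau> = Left then val \<tau> ?b else val \<tau> ?b')"
    using f(4) hd[of 0] tl[of 0] hd[of "length v"] tl[of "length v"] unfolding h0 h1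
    by (cases \<sigma>; cases \<tau>) auto
  ultimately show ?thesis using that fv fy by blast
qed

section \<open>Operations on planar words\<close>

definition good :: "passage list \<Rightarrow> bool" where
  "good w \<longleftrightarrow> valid w \<and> planar w"

lemma good_iff: "good w \<longleftrightarrow> valid w \<and> colorable w"
  using planar_iff_colorable by (auto simp: good_def)

lemma valid_mset:
  assumes "mset w = mset w'" shows "valid w = valid w'"
proof -
  have "set w = set w'" using assms by (rule mset_eq_setD)
  moreover have "distinct (map (\<lambda>x. (crossing x, strand x)) w) = distinct (map (\<lambda>x. (crossing x, strand x)) w')"
    using assms by (intro mset_eq_imp_distinct_iff) simp
  ultimately show ?thesis by (simp add: valid_def)
qed

lemma valid_append:
  assumes "valid a" "valid b" "crossings a \<inter> crossings b = {}"
  shows "valid (a @ b)"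
  using assms unfolding valid_def by (auto simp: disjoint_iff image_iff)

lemma valid_filter:
  assumes "valid w" shows "valid (filter (\<lambda>x. crossing x \<notin> C) w)"
  using assms unfolding valid_def by (auto simp: distinct_map filter_map o_def intro: inj_on_subset)

fun turns :: "nat set \<Rightarrow> passage list \<Rightarrow> bool" where
  "turns T [] = False"
| "turns T (x # xs) = ((crossing x \<in> T) \<noteq> turns T xs)"

lemma jump_after: "(fst (after col x) \<noteq> snd (after col x)) =
    ((fst (before col x) \<noteq> snd (before col x)) \<noteq> turn (col (crossing x)))"
  by (cases "strand x") (simp_all add: after_def before_def turn_def, argo+)

lemma flow_jump:
  assumes "flow col p w q" "\<forall>c\<in>crossings w. turn (col c) = (c \<in> T)"
  shows "(fst q \<noteq> snd q) = ((fst p \<noteq> snd p) \<noteq> turns T w)"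
  using assms
proof (induction w arbitrary: p)
  case (Cons x xs)
  have "(fst q \<noteq> snd q) = ((fst (after col x) \<noteq> snd (after col x)) \<noteq> turns T xs)"
    by (rule Cons.IH) (use Cons.prems in auto)
  then show ?case using Cons.prems jump_after[of col x] by auto
qed auto

lemma colorable_rotate:
  assumes "colorable (a @ b)" shows "colorable (b @ a)"
  unfolding colorable_def
proof (intro allI)
  fix T j
  obtain col st where f: "flow col st (a @ b) st" "(fst st \<noteq> snd st) = (j \<noteq> turns T a)"
    "\<forall>c\<in>crossings (a @ b). turn (col c) = (c \<in> T)" using assms by (rule colorableE)
  then obtain m where m: "flow col st a m" "flow col m b st" by (auto simp: flow_append)
  have "(fst m \<noteq> snd m) = ((fst st \<noteq> snd st) \<noteq> turns T a)"
    by (rule flow_jump[OF m(1)]) (use f(3) in auto)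
  then have "(fst m \<noteq> snd m) = j" using f(2) by argo
  moreover have "flow col m (b @ a) m" unfolding flow_append using m by blast
  ultimately show "\<exists>col st. flow col st (b @ a) st \<and> (fst st \<noteq> snd st) = j \<and>
      (\<forall>c\<in>crossings (b @ a). turn (col c) = (c \<in> T))"
    using f(3) by (intro exI[of _ col] exI[of _ m]) auto
qed

lemma good_rotate: "good (a @ b) \<Longrightarrow> good (b @ a)"
  using colorable_rotate[of a b] valid_mset[of "a @ b" "b @ a"] by (simp add: good_iff)

definition rename :: "(nat \<Rightarrow> nat) \<Rightarrow> passage \<Rightarrow> passage" where
  "rename \<sigma> x = Passage (\<sigma> (crossing x)) (strand x) (mark x)"

lemma rename_sel [simp]: "crossing (rename \<sigma> x) = \<sigma> (crossing x)" "strand (rename \<sigma> x) = strand x"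
  "mark (rename \<sigma> x) = mark x" by (auto simp: rename_def)

lemma flow_rename: "flow col p (map (rename \<sigma>) w) q = flow (\<lambda>c. col (\<sigma> c)) p w q"
  by (induction w arbitrary: p) (auto simp: before_def after_def)

lemma good_rename:
  assumes "good w" "inj_on \<sigma> (crossings w)" shows "good (map (rename \<sigma>) w)"
proof -
  have v: "valid w" and c: "colorable w" using assms good_iff by auto
  have "distinct (map (\<lambda>x. (\<sigma> (crossing x), strand x)) w)"
    using v assms(2) unfolding valid_def by (auto simp: distinct_map inj_on_def)
  moreover have "Passage (\<sigma> (crossing x)) (opp (strand x)) (mark x) \<in> rename \<sigma> ` set w" if "x \<in> set w" for x
  proof (rule image_eqI[of _ _ "Passage (crossing x) (opp (strand x)) (mark x)"])
    show "Passage (crossing x) (opp (strand x)) (mark x) \<in> set w" using v that unfolding valid_def by blast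
  qed (simp add: rename_def)
  ultimately have "valid (map (rename \<sigma>) w)" unfolding valid_def by (auto simp: o_def)
  moreover have "colorable (map (rename \<sigma>) w)" unfolding colorable_def
  proof (intro allI)
    fix T j
    obtain col st where f: "flow col st w st" "(fst st \<noteq> snd st) = j"
      "\<forall>c\<in>crossings w. turn (col c) = (c \<in> {c. \<sigma> c \<in> T})" using c by (rule colorableE)
    define col' where "col' = (\<lambda>d. col (inv_into (crossings w) \<sigma> d))"
    have cc: "col' (\<sigma> c) = col c" if "c \<in> crossings w" for c
      using inv_into_f_f[OF assms(2) that] by (simp add: col'_def)
    have "flow (\<lambda>c. col' (\<sigma> c)) st w st" using f(1) flow_cong[of w "\<lambda>c. col' (\<sigma> c)" col st st] cc by simp
    then show "\<exists>col st. flow col st (map (rename \<sigma>) w) st \<and> (fst st \<noteq> snd st) = j \<and>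
      (\<forall>c\<in>crossings (map (rename \<sigma>) w). turn (col c) = (c \<in> T))"
      using f(2,3) cc by (intro exI[of _ col'] exI[of _ st]) (auto simp: flow_rename)
  qed
  ultimately show ?thesis by (simp add: good_iff)
qed

text \<open>
  A block which can be coloured from any state back to the same state, with any turns, is a closed
  curve in a small disc.
\<close>

lemma good_insert_block:
  assumes g: "good (xs @ ys)" and v: "valid Z" and d: "crossings Z \<inter> crossings (xs @ ys) = {}"
    and Z: "\<And>T st. \<exists>col. flow col st Z st \<and> (\<forall>c\<in>crossings Z. turn (col c) = (c \<in> T))"
  shows "good (xs @ Z @ ys)"
proof -
  have "valid (xs @ Z @ ys)"
    using valid_append[OF v, of "xs @ ys"] g d valid_mset[of "Z @ xs @ ys" "xs @ Z @ ys"] by (simp add: good_iff)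
  moreover have "colorable (xs @ Z @ ys)" unfolding colorable_def
  proof (intro allI)
    fix T j
    obtain col st where f: "flow col st (xs @ ys) st" "(fst st \<noteq> snd st) = j"
      "\<forall>c\<in>crossings (xs @ ys). turn (col c) = (c \<in> T)"
      using conjunct2[OF iffD1[OF good_iff g]] by (rule colorableE)
    then obtain m where m: "flow col st xs m" "flow col m ys st" by (auto simp: flow_append)
    obtain col' where c': "flow col' m Z m" "\<forall>c\<in>crossings Z. turn (col' c) = (c \<in> T)"
      using Z[of m T] by (elim exE conjE) (rule that)
    define D where "D = (\<lambda>c. if c \<in> crossings Z then col' c else col c)"
    have D: "D c = col c" if "c \<in> crossings (xs @ ys)" for c using d that unfolding D_def by auto
    have "flow D st xs m" by (rule flow_change[OF m(1)]) (use D in auto)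
    moreover have "flow D m ys st" by (rule flow_change[OF m(2)]) (use D in auto)
    moreover have "flow D m Z m" by (rule flow_change[OF c'(1)]) (auto simp: D_def)
    ultimately have "flow D st (xs @ Z @ ys) st" unfolding flow_append by blast
    moreover have "\<forall>c\<in>crossings (xs @ Z @ ys). turn (D c) = (c \<in> T)"
      using f(3) c'(2) d by (auto simp: D_def)
    ultimately show "\<exists>col st. flow col st (xs @ Z @ ys) st \<and> (fst st \<noteq> snd st) = j \<and>
      (\<forall>c\<in>crossings (xs @ Z @ ys). turn (col c) = (c \<in> T))"
      using f(2) by (intro exI[of _ D] exI[of _ st] conjI)
  qed
  ultimately show ?thesis by (simp add: good_iff)
qed

definition kink :: "nat \<Rightarrow> strand \<Rightarrow> mark \<Rightarrow> passage list" where
  "kink n s m = [Passage n s m, Passage n (opp s) m]"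

lemma valid_kink: "valid (kink n s m)" by (auto simp: valid_def kink_def)
lemma crossings_kink: "crossings (kink n s m) = {n}" by (auto simp: kink_def)

lemma good_kink:
  assumes "good (xs @ ys)" "n \<notin> crossings (xs @ ys)" shows "good (xs @ kink n s m @ ys)"
proof (rule good_insert_block[OF assms(1) valid_kink])
  fix T and st :: "bool \<times> bool"
  obtain L R where st: "st = (L, R)" by force
  show "\<exists>col. flow col st (kink n s m) st \<and> (\<forall>c\<in>crossings (kink n s m). turn (col c) = (c \<in> T))"
    by (rule exI[of _ "\<lambda>_. if s = SWNE then case_corner L (L \<noteq> (n \<in> T)) R R else case_corner (R \<noteq> (n \<in> T)) R L L"])
      (cases s; cases L; cases R; auto simp: st kink_def before_def after_def turn_def)
qed (use assms in \<open>auto simp: kink_def\<close>)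

text \<open>
  The local tangle that measures an arc: the arc runs into the bigon between \<open>k\<close> and \<open>l\<close> twice,
  entering it at \<open>k\<close> both times, and returns by crossing itself virtually at \<open>n\<close>.
\<close>

definition tangle :: "strand \<Rightarrow> strand \<Rightarrow> nat \<Rightarrow> nat \<Rightarrow> nat \<Rightarrow> passage list" where
  "tangle s t k l n =
    [Passage k s (Classical t), Passage l (opp s) (Classical (opp t)), Passage n s Virtual,
     Passage k (opp s) (Classical t), Passage l s (Classical (opp t)), Passage n (opp s) Virtual]"

lemma valid_tangle: "distinct [k, l, n] \<Longrightarrow> valid (tangle s t k l n)"
  by (auto simp: valid_def tangle_def)
lemma crossings_tangle: "crossings (tangle s t k l n) = {k, l, n}"
  by (auto simp: tangle_def)

lemma good_tangle:
  assumes "good (xs @ ys)" "distinct [k, l, n]" "{k, l, n} \<inter> crossings (xs @ ys) = {}"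
  shows "good (xs @ tangle s t k l n @ ys)"
proof (rule good_insert_block[OF assms(1) valid_tangle[OF assms(2)]])
  fix T and st :: "bool \<times> bool"
  obtain L R where st: "st = (L, R)" by force
  define t1 t2 t3 where "t1 = (k \<in> T)" "t2 = (l \<in> T)" "t3 = (n \<in> T)"
  define a where "a = (if s = SWNE then L else R)"
  define b where "b = (if s = SWNE then R else L)"
  define e where "e = (a \<noteq> (t1 \<noteq> (t2 \<noteq> t3)))"
  define u where "u = (t1 \<noteq> (a \<noteq> (b \<noteq> e)))"
  define v where "v = (t3 \<noteq> (a \<noteq> (b \<noteq> e)))"
  show "\<exists>col. flow col st (tangle s t k l n) st \<and> (\<forall>c\<in>crossings (tangle s t k l n). turn (col c) = (c \<in> T))"
  proof (cases s)
    case SWNE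
    have ab: "a = L" "b = R" by (simp_all add: a_def b_def SWNE)
    have t: "turn (case_corner L e R u) = (k \<in> T)" "turn (case_corner L e u v) = (l \<in> T)"
      "turn (case_corner L e v R) = (n \<in> T)"
      unfolding turn_def u_def v_def e_def ab t1_t2_t3_def[symmetric]
      by (cases L; cases R; cases t1; cases t2; cases t3; simp)+
    show ?thesis
      by (rule exI[of _ "\<lambda>c. if c = k then case_corner L e R u else if c = l then case_corner L e u v else case_corner L e v R"])
        (use assms(2) t in \<open>auto simp: st SWNE tangle_def before_def after_def\<close>)
  next
    case SENW
    have ab: "a = R" "b = L" by (simp_all add: a_def b_def SENW)
    have t: "turn (case_corner e R L u) = (k \<in> T)" "turn (case_corner e R u v) = (l \<in> T)"
      "turn (case_corner e R v L) = (n \<in> T)"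
      unfolding turn_def u_def v_def e_def ab t1_t2_t3_def[symmetric]
      by (cases L; cases R; cases t1; cases t2; cases t3; simp)+
    show ?thesis
      by (rule exI[of _ "\<lambda>c. if c = k then case_corner e R L u else if c = l then case_corner e R u v else case_corner e R v L"])
        (use assms(2) t in \<open>auto simp: st SENW tangle_def before_def after_def\<close>)
  qed
qed (use assms in \<open>auto simp: tangle_def\<close>)

text \<open>
  The two blocks of passages that a second Reidemeister move inserts.
\<close>

definition bigon1 :: "strand \<Rightarrow> mark \<Rightarrow> mark \<Rightarrow> nat \<Rightarrow> nat \<Rightarrow> passage list" where
  "bigon1 s m m' k l = [Passage k s m, Passage l (opp s) m']"

definition bigon2 :: "bool \<Rightarrow> strand \<Rightarrow> mark \<Rightarrow> mark \<Rightarrow> nat \<Rightarrow> nat \<Rightarrow> passage list" where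
  "bigon2 par s m m' k l = (if par then [Passage k (opp s) m, Passage l s m']
     else [Passage l s m', Passage k (opp s) m])"

lemma bigon_extension:
  assumes \<beta>: "\<beta> = (if par then opp s else s)"
    and c: "t1 = t2 \<and> a1 = a \<and> b1 = b \<and> val (sd \<beta>) a = val (sd s) b \<or>
      t1 \<noteq> t2 \<and> val (sd \<beta>) a1 \<noteq> val (sd \<beta>) a \<and> val (flip (sd \<beta>)) a1 = val (flip (sd \<beta>)) a \<and>
      val (sd s) b1 \<noteq> val (sd s) b \<and> val (flip (sd s)) b1 = val (flip (sd s)) b \<and>
      (if sd \<beta> = Left then val (sd \<beta>) a1 else val (sd \<beta>) a) = (if sd s = Left then val (sd s) b else val (sd s) b1)"
    and kl: "k \<noteq> l"
  shows "\<exists>f. flow f a (bigon1 s m m' k l) a1 \<and> flow f b (bigon2 par s m m' k l) b1 \<and>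
      turn (f k) = t1 \<and> turn (f l) = t2"
proof -
  obtain a0 a2 b0 b2 where ab: "a = (a0, a2)" "b = (b0, b2)" by force
  obtain c0 c2 d0 d2 where cd: "a1 = (c0, c2)" "b1 = (d0, d2)" by force
  consider "par" "s = SWNE" | "par" "s = SENW" | "\<not> par" "s = SWNE" | "\<not> par" "s = SENW" 
    by (cases s; cases par) auto
  then show ?thesis
  proof cases
    case 1
    define N where "N = ((t1 \<noteq> (a0 \<noteq> a2)) \<noteq> b2)"
    define N' where "N' = ((t2 \<noteq> (a0 \<noteq> N)) \<noteq> b2)"
    show ?thesis
      by (rule exI[of _ "\<lambda>c. if c = k then case_corner a0 b2 a2 N else case_corner a0 b2 N N'"])
        (use c kl 1 in \<open>simp add: \<beta> ab cd bigon1_def bigon2_def before_def after_def turn_def N_def N'_def, argo\<close>)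
  next
    case 2
    define N where "N = ((t1 \<noteq> (b0 \<noteq> a0)) \<noteq> a2)"
    define N' where "N' = ((t2 \<noteq> (b0 \<noteq> N)) \<noteq> a2)"
    show ?thesis
      by (rule exI[of _ "\<lambda>c. if c = k then case_corner b0 a2 a0 N else case_corner b0 a2 N N'"])
        (use c kl 2 in \<open>simp add: \<beta> ab cd bigon1_def bigon2_def before_def after_def turn_def N_def N'_def, argo\<close>)
  next
    case 3
    define E where "E = ((t1 \<noteq> (a0 \<noteq> a2)) \<noteq> b2)"
    show ?thesis
      by (rule exI[of _ "\<lambda>c. if c = k then case_corner a0 E a2 b2 else case_corner b0 E b2 a2"])
        (use c kl 3 in \<open>simp add: \<beta> ab cd bigon1_def bigon2_def before_def after_def turn_def E_def, argo\<close>)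
  next
    case 4
    define E where "E = ((t1 \<noteq> (b0 \<noteq> a2)) \<noteq> a0)"
    show ?thesis
      by (rule exI[of _ "\<lambda>c. if c = k then case_corner E a2 a0 b0 else case_corner E b2 b0 a0"])
        (use c kl 4 in \<open>simp add: \<beta> ab cd bigon1_def bigon2_def before_def after_def turn_def E_def, argo\<close>)
  qed
qed

text \<open>
  A colouring that turns at both or at none of \<open>k\<close> and \<open>l\<close> comes from a colouring of the old
  curve. If it turns at one of them, the two parts into which the bigon cuts the common face have
  different colours; such a colouring arises from \<open>cut_flow\<close>, and all turns can then be realised
  by adding colourings of the old curve.
\<close>

lemma good_bigon:
  assumes g: "good (v @ y)" and ne: "v \<noteq> []" "y \<noteq> []"
    and \<beta>: "\<beta> = (if par then opp s else s)" and adj: "adj v y (sd \<beta>) (sd s)"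
    and kl: "k \<noteq> l" "k \<notin> crossings (v @ y)" "l \<notin> crossings (v @ y)"
  shows "good (bigon1 s m m' k l @ v @ bigon2 par s m m' k l @ y)"
proof -
  let ?A = "bigon1 s m m' k l" and ?B = "bigon2 par s m m' k l"
  let ?w = "?A @ v @ ?B @ y"
  have vb: "valid (?A @ ?B)" using kl by (cases par) (auto simp: valid_def bigon1_def bigon2_def)
  have cAB: "crossings ?A = {k, l}" "crossings ?B = {k, l}" by (auto simp: bigon1_def bigon2_def)
  have v: "valid (v @ y)" and c: "colorable (v @ y)" using g good_iff by auto
  have "crossings (?A @ ?B) \<inter> crossings (v @ y) = {}"
    using kl(2,3) unfolding set_append image_Un cAB by blast
  then have "valid ((?A @ ?B) @ v @ y)" by (rule valid_append[OF vb v])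
  then have "valid ?w" using valid_mset[of "(?A @ ?B) @ v @ y" ?w] by simp
  moreover have "colorable ?w" unfolding colorable_def
  proof (intro allI)
    fix T j
    have "\<exists>col a a1 b b1. flow col a1 v b \<and> flow col b1 y a \<and> (fst a \<noteq> snd a) = j \<and>
        (\<forall>c\<in>crossings (v @ y). turn (col c) = (c \<in> T)) \<and>
        (\<exists>f. flow f a ?A a1 \<and> flow f b ?B b1 \<and> turn (f k) = (k \<in> T) \<and> turn (f l) = (l \<in> T))"
    proof (cases "(k \<in> T) = (l \<in> T)")
      case True
      obtain col st where f: "flow col st (v @ y) st" "(fst st \<noteq> snd st) = j"
        "\<forall>c\<in>crossings (v @ y). turn (col c) = (c \<in> T)" using c by (rule colorableE)
      then obtain b where b: "flow col st v b" "flow col b y st" by (auto simp: flow_append)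
      have "val (sd \<beta>) st = val (sd s) b" by (rule adjD[OF adj b])
      then have ex: "\<exists>f. flow f st ?A st \<and> flow f b ?B b \<and> turn (f k) = (k \<in> T) \<and> turn (f l) = (l \<in> T)"
        using True by (intro bigon_extension[OF \<beta> _ kl(1)]) simp
      have "flow col st v b \<and> flow col b y st \<and> (fst st \<noteq> snd st) = j \<and>
        (\<forall>c\<in>crossings (v @ y). turn (col c) = (c \<in> T)) \<and>
        (\<exists>f. flow f st ?A st \<and> flow f b ?B b \<and> turn (f k) = (k \<in> T) \<and> turn (f l) = (l \<in> T))"
        using f(2,3) b ex by (intro conjI)
      then show ?thesis by (intro exI)
    next
      case False
      obtain cd a a' b b' where cd: "flow cd a' v b" "flow cd b' y a"
        "val (sd \<beta>) a' \<noteq> val (sd \<beta>) a" "val (flip (sd \<beta>)) a' = val (flip (sd \<beta>)) a"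
        "val (sd s) b' \<noteq> val (sd s) b" "val (flip (sd s)) b' = val (flip (sd s)) b"
        "(if sd \<beta> = Left then val (sd \<beta>) a' else val (sd \<beta>) a) = (if sd s = Left then val (sd s) b else val (sd s) b')"
        by (rule cut_flow[OF v ne adj]) (rule that)
      obtain c0 p where f: "flow c0 p (v @ y) p" "(fst p \<noteq> snd p) = (j \<noteq> (fst a \<noteq> snd a))"
        "\<forall>c\<in>crossings (v @ y). turn (c0 c) = (c \<in> {c. (c \<in> T) \<noteq> turn (cd c)})" using c by (rule colorableE)
      then obtain q where q: "flow c0 p v q" "flow c0 q y p" by (auto simp: flow_append)
      let ?col = "\<lambda>c d. c0 c d \<noteq> cd c d"
      have fl: "flow ?col (xor_state p a') v (xor_state q b)" "flow ?col (xor_state q b') y (xor_state p a)"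
        by (rule flow_xor[OF q(1) cd(1)], rule flow_xor[OF q(2) cd(2)])
      have "(fst (xor_state p a) \<noteq> snd (xor_state p a)) = j"
        using f(2) unfolding xor_state_def fst_conv snd_conv by argo
      moreover have "\<forall>c\<in>crossings (v @ y). turn (?col c) = (c \<in> T)"
      proof
        fix c assume "c \<in> crossings (v @ y)"
        from bspec[OF f(3) this] show "turn (?col c) = (c \<in> T)" unfolding turn_xor mem_Collect_eq by argo
      qed
      moreover have "\<exists>f. flow f (xor_state p a) ?A (xor_state p a') \<and> flow f (xor_state q b) ?B (xor_state q b') \<and>
          turn (f k) = (k \<in> T) \<and> turn (f l) = (l \<in> T)"
      proof (intro bigon_extension[OF \<beta> _ kl(1)] disjI2 conjI)
        have pq: "val (sd \<beta>) p = val (sd s) q" by (rule adjD[OF adj q])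
        show "(k \<in> T) \<noteq> (l \<in> T)" by (rule False)
        show "val (sd \<beta>) (xor_state p a') \<noteq> val (sd \<beta>) (xor_state p a)"
          "val (flip (sd \<beta>)) (xor_state p a') = val (flip (sd \<beta>)) (xor_state p a)"
          "val (sd s) (xor_state q b') \<noteq> val (sd s) (xor_state q b)"
          "val (flip (sd s)) (xor_state q b') = val (flip (sd s)) (xor_state q b)"
          using cd(3-6) unfolding val_xor by argo+
        show "(if sd \<beta> = Left then val (sd \<beta>) (xor_state p a') else val (sd \<beta>) (xor_state p a)) =
          (if sd s = Left then val (sd s) (xor_state q b) else val (sd s) (xor_state q b'))"
          using cd(7) pq unfolding val_xor by (cases "sd \<beta> = Left"; cases "sd s = Left"; simp)
      qed
      ultimately have "flow ?col (xor_state p a') v (xor_state q b) \<and> flow ?col (xor_state q b') y (xor_state p a) \<and>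
        (fst (xor_state p a) \<noteq> snd (xor_state p a)) = j \<and>
        (\<forall>c\<in>crossings (v @ y). turn (?col c) = (c \<in> T)) \<and>
        (\<exists>f. flow f (xor_state p a) ?A (xor_state p a') \<and> flow f (xor_state q b) ?B (xor_state q b') \<and>
          turn (f k) = (k \<in> T) \<and> turn (f l) = (l \<in> T))"
        using fl by (intro conjI)
      then show ?thesis by (intro exI)
    qed
    then obtain col a a1 b b1 f where F: "flow col a1 v b \<and> flow col b1 y a \<and> (fst a \<noteq> snd a) = j \<and>
        (\<forall>c\<in>crossings (v @ y). turn (col c) = (c \<in> T)) \<and>
        flow f a ?A a1 \<and> flow f b ?B b1 \<and> turn (f k) = (k \<in> T) \<and> turn (f l) = (l \<in> T)"
      by (elim exE conjE) (rule that, intro conjI)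
    then have f: "flow col a1 v b" "flow col b1 y a" "(fst a \<noteq> snd a) = j"
      "\<forall>c\<in>crossings (v @ y). turn (col c) = (c \<in> T)" "flow f a ?A a1" "flow f b ?B b1"
      "turn (f k) = (k \<in> T)" "turn (f l) = (l \<in> T)"
      by simp_all
    define D where "D = (\<lambda>c. if c = k \<or> c = l then f c else col c)"
    have D: "D c = col c" if "c \<in> crossings (v @ y)" for c using kl that unfolding D_def by metis
    have D2: "D k = f k" "D l = f l" by (simp_all add: D_def)
    have "flow D a1 v b" by (rule flow_change[OF f(1)]) (use D in auto)
    moreover have "flow D b1 y a" by (rule flow_change[OF f(2)]) (use D in auto)
    moreover have "flow D a ?A a1" by (rule flow_change[OF f(5)]) (unfold cAB, use D2 in auto)
    moreover have "flow D b ?B b1" by (rule flow_change[OF f(6)]) (unfold cAB, use D2 in auto)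
    ultimately have "flow D a ?w a" unfolding flow_append by blast
    moreover have cw: "crossings ?w = insert k (insert l (crossings (v @ y)))"
      unfolding set_append image_Un cAB by blast
    have "\<forall>c\<in>crossings ?w. turn (D c) = (c \<in> T)"
    proof
      fix c assume "c \<in> crossings ?w"
      then consider "c = k" | "c = l" | "c \<in> crossings (v @ y)" unfolding cw by blast
      then show "turn (D c) = (c \<in> T)"
        by cases (simp only: D2 f(7), simp only: D2 f(8), simp only: D f(4)[rule_format])
    qed
    ultimately show "\<exists>col st. flow col st ?w st \<and> (fst st \<noteq> snd st) = j \<and>
      (\<forall>c\<in>crossings ?w. turn (col c) = (c \<in> T))"
      using f(3) by (intro exI[of _ D] exI[of _ a] conjI)
  qed
  ultimately show ?thesis by (simp add: good_iff)
qed

lemma cut_coloring_erase: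
  assumes "\<And>x. x \<in> set v \<Longrightarrow> crossing x \<in> C \<Longrightarrow> before col x = after col x"
    "flow col p v q"
  shows "flow col p (filter (\<lambda>x. crossing x \<notin> C) v) q"
  using assms by (induction v arbitrary: p) auto

lemma flow_no_jump:
  assumes "flow col p w q" "fst p = snd p" "\<And>c. c \<in> crossings w \<Longrightarrow> \<not> turn (col c)" 
  shows "fst q = snd q \<and> (\<forall>x\<in>set w. fst (before col x) = snd (before col x))"
  using assms
proof (induction w arbitrary: p)
  case (Cons x xs)
  have "fst (after col x) = snd (after col x)"
    using Cons.prems jump_after[of col x] by auto
  then show ?case using Cons.IH[of "after col x"] Cons.prems by auto
qed auto

lemma transversal_unchanged:
  assumes "fst (before col x) = snd (before col x)" "\<not> turn (col (crossing x))"
    "crossing y = crossing x" "strand y = opp (strand x)"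
  shows "before col y = after col y"
  using assms by (cases "strand x") (simp_all add: before_def after_def turn_def, satx+)

text \<open>
  A curve that returns parallel to itself can be cut short. In a colouring that has equal colours
  on both sides of \<open>P\<close> and does not turn there, the passages transversal to \<open>P\<close> leave the colours
  unchanged, so they can be erased together with \<open>P\<close>.
\<close>

lemma good_cut:
  assumes g: "good (bigon1 s m m' k l @ P @ bigon2 True s m m' k l @ v)"
    and kl: "k \<noteq> l" "{k, l} \<inter> crossings (P @ v) = {}"
  shows "good (filter (\<lambda>x. crossing x \<notin> crossings P) v)"
proof -
  let ?A = "bigon1 s m m' k l" and ?B = "bigon2 True s m m' k l"
  let ?w = "?A @ P @ ?B @ v" and ?v = "filter (\<lambda>x. crossing x \<notin> crossings P) v"
  have cAB: "crossings ?A = {k, l}" "crossings ?B = {k, l}" by (auto simp: bigon1_def bigon2_def)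
  have v: "valid ?w" and c: "colorable ?w" using g good_iff by auto
  have fv: "filter (\<lambda>x. crossing x \<notin> crossings P) v = filter (\<lambda>x. crossing x \<notin> crossings P \<union> {k, l}) v"
    by (rule filter_cong) (use kl(2) in auto)
  have "filter (\<lambda>x. crossing x \<notin> crossings P \<union> {k, l}) ?A = []"
    "filter (\<lambda>x. crossing x \<notin> crossings P \<union> {k, l}) ?B = []"
    "filter (\<lambda>x. crossing x \<notin> crossings P \<union> {k, l}) P = []"
    by (auto simp: bigon1_def bigon2_def filter_empty_conv)
  then have "filter (\<lambda>x. crossing x \<notin> crossings P \<union> {k, l}) ?w = ?v"
    unfolding filter_append fv by simp
  then have "valid ?v" using valid_filter[OF v, of "crossings P \<union> {k, l}"] by simp
  moreover have "colorable ?v" unfolding colorable_def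
  proof (intro allI)
    fix T j
    \<comment> \<open>Colours that differ at the base point must become equal along \<open>P\<close>, which is achieved by a turn at \<open>l\<close>.\<close>
    define T' where "T' = (T - crossings P - {k, l}) \<union> (if j then {l} else {})"
    obtain col a where f: "flow col a ?w a" "(fst a \<noteq> snd a) = j"
      "\<forall>c\<in>crossings ?w. turn (col c) = (c \<in> T')" using c by (rule colorableE)
    then obtain p q r where fl: "flow col a ?A p" "flow col p P q" "flow col q ?B r" "flow col r v a"
      unfolding flow_append by blast
    have tkl: "turn (col k) = False" "turn (col l) = j"
    proof -
      have ck: "k \<in> crossings ?w" "l \<in> crossings ?w" by (simp_all add: bigon1_def)
      show "turn (col k) = False" "turn (col l) = j"
        using bspec[OF f(3) ck(1)] bspec[OF f(3) ck(2)] kl(1) by (simp_all add: T'_def)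
    qed
    have tP: "\<not> turn (col c)" if "c \<in> crossings P" for c
    proof -
      have "c \<in> crossings ?w" "c \<notin> T'" using that kl(2) by (auto simp: T'_def split: if_splits)
      then show ?thesis using bspec[OF f(3)] by simp
    qed
    obtain a0 a1 where a: "a = (a0, a1)" by force
    have p0: "fst p = snd p"
      using fl(1) tkl f(2) kl(1) by (cases p; cases s) (simp_all add: a bigon1_def before_def after_def turn_def; satx)+
    note nj = flow_no_jump[OF fl(2) p0 tP]
    have "r = a"
      using fl(1,3) tkl p0 nj f(2) kl(1)
      by (cases s; cases r; cases p; cases q; simp add: a bigon1_def bigon2_def before_def after_def turn_def; satx)
    have "before col x = after col x" if x: "x \<in> set v" "crossing x \<in> crossings P" for x
    proof -
      obtain y where y: "y \<in> set P" "crossing x = crossing y" using x(2) by auto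
      let ?key = "\<lambda>x. (crossing x, strand x)"
      have d: "set (map ?key P) \<inter> set (map ?key v) = {}"
        using v unfolding valid_def map_append distinct_append set_append by blast
      have "?key x \<in> set (map ?key v)" "?key y \<in> set (map ?key P)" using x y unfolding set_map by blast+
      then have "?key x \<noteq> ?key y" using d by (metis disjoint_iff)
      then have "strand x \<noteq> strand y" using y by simp
      then show ?thesis
        using transversal_unchanged[of col y x] nj y tP[of "crossing y"] by (auto simp: neq_opp)
    qed
    then have "flow col a ?v a" using cut_coloring_erase[of v "crossings P" col r a] fl(4) \<open>r = a\<close> by auto
    moreover have "turn (col c) = (c \<in> T)" if "c \<in> crossings ?v" for c
    proof -
      have "c \<in> crossings ?w" "c \<notin> crossings P" "c \<noteq> k" "c \<noteq> l" using that kl(2) by auto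
      then show ?thesis using bspec[OF f(3), of c] by (simp add: T'_def)
    qed
    ultimately show "\<exists>col st. flow col st ?v st \<and> (fst st \<noteq> snd st) = j \<and>
      (\<forall>c\<in>crossings ?v. turn (col c) = (c \<in> T))"
      using f(2) by (intro exI[of _ col] exI[of _ a]) simp
  qed
  ultimately show ?thesis by (simp add: good_iff)
qed

text \<open>
  A third Reidemeister move replaces one triangle by another. The colours around it stay, and \<open>X\<close>
  below is the colour of the new triangle that keeps the turns.
\<close>

lemma good_triangle:
  assumes "distinct [k, m, w]" "{k, m, w} \<inter> crossings (u1 @ u2 @ u3) = {}"
    and XY: "{(X1, X1'), (X2, X2')} =
      {([Passage w (opp s) mw, Passage k (opp s) mk], [Passage k (opp s) mk, Passage w (opp s) mw]),
       ([Passage w s mw, Passage m (opp s) mm], [Passage m (opp s) mm, Passage w s mw])}"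
    and g: "good ([Passage k s mk, Passage m s mm] @ u1 @ X1 @ u2 @ X2 @ u3)"
  shows "good ([Passage m s mm, Passage k s mk] @ u1 @ X1' @ u2 @ X2' @ u3)"
proof -
  let ?Z = "[Passage k s mk, Passage m s mm]" and ?Z' = "[Passage m s mm, Passage k s mk]"
  let ?w = "?Z @ u1 @ X1 @ u2 @ X2 @ u3" and ?w' = "?Z' @ u1 @ X1' @ u2 @ X2' @ u3"
  let ?B = "[Passage w (opp s) mw, Passage k (opp s) mk]" and ?B' = "[Passage k (opp s) mk, Passage w (opp s) mw]"
  let ?C = "[Passage w s mw, Passage m (opp s) mm]" and ?C' = "[Passage m (opp s) mm, Passage w s mw]"
  have cases: "X1 = ?B \<and> X1' = ?B' \<and> X2 = ?C \<and> X2' = ?C' \<or> X1 = ?C \<and> X1' = ?C' \<and> X2 = ?B \<and> X2' = ?B'"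
    using XY assms(1) by (auto simp: doubleton_eq_iff)
  have ms: "mset ?w = mset ?w'" using cases by auto
  have cr: "crossings ?w = insert k (insert m (insert w (crossings (u1 @ u2 @ u3))))"
    using cases by auto
  have "crossings ?w' = crossings ?w" using mset_eq_setD[OF ms] by simp
  have "valid ?w'" using valid_mset[OF ms] g good_iff by auto
  moreover have "colorable ?w'" unfolding colorable_def
  proof (intro allI)
    fix T j
    obtain col a where f: "flow col a ?w a" "(fst a \<noteq> snd a) = j"
      "\<forall>c\<in>crossings ?w. turn (col c) = (c \<in> T)" using conjunct2[OF iffD1[OF good_iff g]] by (rule colorableE)
    then obtain a' b b' c c' where fl: "flow col a ?Z a'" "flow col a' u1 b" "flow col b X1 b'"
      "flow col b' u2 c" "flow col c X2 c'" "flow col c' u3 a"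
      unfolding flow_append by blast
    define q where "q = (if X1 = ?B then b else c)"
    define q' where "q' = (if X1 = ?B then b' else c')"
    define r where "r = (if X1 = ?B then c else b)"
    define r' where "r' = (if X1 = ?B then c' else b')"
    have BC: "?B \<noteq> ?C" by simp
    have qr: "flow col q ?B q'" "flow col r ?C r'"
      using fl cases BC by (auto simp: q_def q'_def r_def r'_def simp del: flow.simps)
    define X where "X = (if s = SENW then (turn (col k) \<noteq> (fst a' \<noteq> snd q)) \<noteq> snd a'
        else (turn (col k) \<noteq> (snd a' \<noteq> fst q)) \<noteq> fst a')"
    define fk where "fk = (if s = SENW then case_corner (fst a') X (snd q) (snd a') else case_corner X (snd a') (fst q) (fst a'))"
    define fm where "fm = (if s = SENW then case_corner (fst r) (snd a) (fst a) X else case_corner (fst a) (snd r) (snd a) X)"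
    define fw where "fw = (if s = SENW then case_corner (snd a') (snd a) X (fst q') else case_corner (fst a) (fst a') X (snd q'))"
    define D where "D = (\<lambda>d. if d = k then fk else if d = m then fm else if d = w then fw else col d)"
    have Dk: "D k = fk" "D m = fm" "D w = fw" using assms(1) by (auto simp: D_def)
    have "flow D a ?Z' a' \<and> flow D q ?B' q' \<and> flow D r ?C' r' \<and>
      turn fk = turn (col k) \<and> turn fm = turn (col m) \<and> turn fw = turn (col w)"
      using fl(1) qr
      by (cases s; cases a; cases a'; cases q; cases q'; cases r; cases r';
          simp add: Dk fk_def fm_def fw_def before_def after_def turn_def X_def; satx)
    then have N: "flow D a ?Z' a'" "flow D q ?B' q'" "flow D r ?C' r'"
      "turn fk = turn (col k)" "turn fm = turn (col m)" "turn fw = turn (col w)" by blast+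
    have 1: "flow D b X1' b'" "flow D c X2' c'"
      using N(2,3) cases BC by (auto simp: q_def q'_def r_def r'_def simp del: flow.simps)
    have "D d = col d" if "d \<in> crossings (u1 @ u2 @ u3)" for d using that assms(2) by (auto simp: D_def)
    then have D: "D d = col d" if "d \<in> crossings u1 \<union> crossings u2 \<union> crossings u3" for d
      using that unfolding set_append image_Un by blast
    have "flow D a' u1 b" "flow D b' u2 c" "flow D c' u3 a"
      by (rule flow_change[OF fl(2)] flow_change[OF fl(4)] flow_change[OF fl(6)]; use D in blast)+
    then have "flow D a ?w' a" unfolding flow_append using N(1) 1 by blast
    moreover have "turn (D d) = (d \<in> T)" if "d \<in> crossings ?w'" for d
    proof -
      have d: "d \<in> crossings ?w" using that \<open>crossings ?w' = crossings ?w\<close> by (simp only:)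
      have "turn (D d) = turn (col d)" by (simp add: D_def N(4-6))
      then show ?thesis using bspec[OF f(3) d] by simp
    qed
    ultimately show "\<exists>col st. flow col st ?w' st \<and> (fst st \<noteq> snd st) = j \<and>
      (\<forall>c\<in>crossings ?w'. turn (col c) = (c \<in> T))"
      using f(2) by (intro exI[of _ D] exI[of _ a]) simp
  qed
  ultimately show ?thesis by (simp add: good_iff)
qed

section \<open>Moves of words\<close>

lemma diagram_iff: "diagram (Diagram w x) \<longleftrightarrow> good w \<and> fst x \<in> edges w"
  by (auto simp: diagram_def good_def valid_def)

abbreviation cls :: "passage list \<Rightarrow> nat set" where
  "cls w \<equiv> classical (Diagram w (0, Left))"

lemma cls_eq: "classical (Diagram w x) = crossing ` {x \<in> set w. mark x \<noteq> Virtual}"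
  by (simp add: classical_def)

lemma zero_edge [simp]: "0 \<in> edges w" by (simp add: edges_def)

lemma edge_0 [simp]: "edge w 0 = 0" by (simp add: edge_def)

lemma region_refl: "x \<in> region w J x" by (simp add: region_def Let_def)

lemma region_sym: "y \<in> region w J x \<Longrightarrow> x \<in> region w J y"
  unfolding region_def Let_def Image_singleton_iff by (rule symD[OF sym_rtrancl[OF sym_Un_converse]])

lemma same_outerI:
  assumes "(e, e') \<in> E" shows "same_outer E J J' (Diagram w (e, \<sigma>)) (Diagram w' (e', \<sigma>))"
  unfolding same_outer_def diagram.sel using assms region_refl by blast

lemma edge_in_edges: "edge w i \<in> edges w"
  by (cases w) (auto simp: edge_def edges_def)

lemma edge_less: "i \<in> edges w \<Longrightarrow> edge w i = i"
  by (cases w) (auto simp: edge_def edges_def)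

lemma move_diagram: "move D D' F E \<Longrightarrow> diagram D \<and> diagram D'"
  by (induction rule: move.induct)
    (auto simp: isotopy_def detour_def R1_def R2_def R3_def local_move_def Let_def)

text \<open>
  A trivial detour of a segment of the edge \<open>e\<close> allows the point at infinity to pass through \<open>e\<close>.
\<close>

lemma outer_detour:
  assumes w: "good w" "fst x \<in> edges w" "fst y \<in> edges w" "e \<in> edges w" and y: "y \<in> region w {e} x"
  obtains E where "detour (Diagram w x) (Diagram w y) E" "\<And>i. i \<in> edges w \<Longrightarrow> (i, i) \<in> E"
proof -
  let ?u = "take e w" and ?v = "drop e w"
  define E where "E = {(edge w i, edge w i') | i i'. i \<le> length ?u \<and> i' \<le> length ?u \<and>
               length (erase [] (take i ?u)) = length (erase [] (take i' ?u))} \<union>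
            {(edge w (length (?u @ []) + i), edge w (length (?u @ []) + i')) | i i'.
               i \<le> length ?v \<and> i' \<le> length ?v \<and>
               length (erase [] (take i ?v)) = length (erase [] (take i' ?v))}"
  have lu: "length ?u = e" using w(4) by (cases w) (auto simp: edges_def)
  have E: "(i, i) \<in> E" if i: "i \<in> edges w" for i
  proof (cases "i \<le> e")
    case True
    have "(edge w i, edge w i) \<in> E" unfolding E_def
      by (rule UnI1, rule CollectI, rule exI[of _ i], rule exI[of _ i]) (use True lu in simp)
    then show ?thesis using edge_less[OF i] by simp
  next
    case False
    then have ie: "i - e \<le> length ?v" "e + (i - e) = i" using i by (auto simp: edges_def)
    have "(edge w i, edge w i) \<in> E" unfolding E_def
      by (rule UnI2, rule CollectI, rule exI[of _ "i - e"], rule exI[of _ "i - e"]) (use ie lu in simp)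
    then show ?thesis using edge_less[OF i] by simp
  qed
  have J: "{edge w (length ?u + i) | i. i \<le> length ([] :: passage list)} = {e}"
    using lu edge_less[OF w(4)] by auto
  have "x \<in> region w {e} y" using y by (rule region_sym)
  then have so: "same_outer E {e} {e} (Diagram w x) (Diagram w y)"
    unfolding same_outer_def using E[OF w(2)] region_refl[of x w "{e}"]
    by (intro bexI[of _ "(fst x, fst x)"]) (auto intro!: exI[of _ "snd x"])
  then have "detour (Diagram w x) (Diagram w y) E"
    unfolding detour_def
    by (intro conjI, simp_all only: diagram_iff w simp_thms diagram.sel)
      (rule exI[of _ ?u], rule exI[of _ "[]"], rule exI[of _ ?v], rule exI[of _ ?u], rule exI[of _ "[]"], rule exI[of _ ?v],
        intro conjI; (rule E_def | unfold J, rule so | simp))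
  then show ?thesis using that E by blast
qed

text \<open>
  All edge sides are connected by such steps, so the choice of the unbounded face does not matter.
\<close>

definition side_step :: "passage list \<Rightarrow> ((nat \<times> side) \<times> (nat \<times> side)) set" where
  "side_step w = {(x, y). fst x \<in> edges w \<and> fst y \<in> edges w \<and> (\<exists>e\<in>edges w. y \<in> region w {e} x)}"

lemma side_steps:
  assumes v: "valid w" and i: "i \<in> edges w"
  shows "((0, Left), (i, \<sigma>)) \<in> (side_step w)\<^sup>*" "((i, \<sigma>), (0, Left)) \<in> (side_step w)\<^sup>*"
proof -
  have c: "(x, y) \<in> side_step w" if "(x, y) \<in> corners w \<union> (corners w)\<inverse>" for x y
  proof -
    have "x \<in> sides w" "y \<in> sides w" using that corners_sides[OF v] by auto
    then have "fst x \<in> edges w" "fst y \<in> edges w" by (auto simp: sides_def)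
    moreover have "y \<in> region w {0} x" using that unfolding region_def Let_def by auto
    ultimately show ?thesis unfolding side_step_def using zero_edge by blast
  qed
  have f: "((e, \<sigma>), (e, \<tau>)) \<in> side_step w" if "e \<in> edges w" for e \<sigma> \<tau>
  proof -
    have "(e, \<tau>) \<in> region w {e} (e, \<sigma>)"
      unfolding region_def Let_def by (cases \<sigma>; cases \<tau>) (auto intro: r_into_rtrancl)
    then show ?thesis using that unfolding side_step_def by auto
  qed
  have sym: "(y, x) \<in> side_step w" if "(x, y) \<in> corners w" for x y using c that by auto
  let ?P = "\<lambda>i. ((0, Left), (i, Left)) \<in> (side_step w)\<^sup>* \<and> ((i, Left), (0, Left)) \<in> (side_step w)\<^sup>*"
  have "?P i"
  proof (cases "w = []")
    case True then show ?thesis using i by (simp add: edges_def)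
  next
    case False
    have il: "i < length w" using i False by (cases w) (auto simp: edges_def)
    show ?thesis
    proof (rule edge_induct[OF False il, of ?P])
      fix i assume i: "i < length w" and IH: "?P i"
      have st: "((i, Left), (edge w (Suc i), Left)) \<in> (side_step w)\<^sup>* \<and> ((edge w (Suc i), Left), (i, Left)) \<in> (side_step w)\<^sup>*"
        using v i
      proof (cases rule: nth_position_cases)
        case (1 c)
        note s = corner_sides[OF v 1(1)]
        have e: "sw w c \<in> edges w" "nw w c \<in> edges w" using s by (auto simp: sides_def)
        have ei: "edge w (Suc (sw w c)) = ne w c" using 1(2,3) by simp
        have "((sw w c, Left), (nw w c, Left)) \<in> corners w" "((ne w c, Left), (nw w c, Right)) \<in> corners w"
          using 1(1) unfolding corners_def by auto
        then have "((sw w c, Left), (nw w c, Left)) \<in> side_step w" "((nw w c, Left), (sw w c, Left)) \<in> side_step w"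
          "((ne w c, Left), (nw w c, Right)) \<in> side_step w" "((nw w c, Right), (ne w c, Left)) \<in> side_step w"
          using c by auto
        then show ?thesis using f[OF e(2), of Left Right] f[OF e(2), of Right Left]
          unfolding 1(2) ei by (meson converse_rtrancl_into_rtrancl rtrancl.rtrancl_refl)
      next
        case (2 c)
        note s = corner_sides[OF v 2(1)]
        have e: "sw w c \<in> edges w" "nw w c \<in> edges w" using s by (auto simp: sides_def)
        have ei: "edge w (Suc (se w c)) = nw w c" using 2(2,3) by simp
        have "((sw w c, Left), (nw w c, Left)) \<in> corners w" "((sw w c, Right), (se w c, Left)) \<in> corners w"
          using 2(1) unfolding corners_def by auto
        then have "((sw w c, Left), (nw w c, Left)) \<in> side_step w" "((nw w c, Left), (sw w c, Left)) \<in> side_step w"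
          "((sw w c, Right), (se w c, Left)) \<in> side_step w" "((se w c, Left), (sw w c, Right)) \<in> side_step w"
          using c by auto
        then show ?thesis using f[OF e(1), of Left Right] f[OF e(1), of Right Left]
          unfolding 2(2) ei by (meson converse_rtrancl_into_rtrancl rtrancl.rtrancl_refl)
      qed
      show "?P (edge w (Suc i))" using IH st by (meson rtrancl_trans)
    qed simp
  qed
  then show "((0, Left), (i, \<sigma>)) \<in> (side_step w)\<^sup>*" "((i, \<sigma>), (0, Left)) \<in> (side_step w)\<^sup>*"
    using f[OF i, of Left \<sigma>] f[OF i, of \<sigma> Left] by (meson rtrancl.rtrancl_into_rtrancl converse_rtrancl_into_rtrancl)+
qed

lemma all_side_steps:
  assumes "valid w" "fst x \<in> edges w" "fst y \<in> edges w"
  shows "(x, y) \<in> (side_step w)\<^sup>*"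
  using side_steps[OF assms(1,2), of "snd x"] side_steps[OF assms(1,3), of "snd y"]
  by (metis prod.collapse rtrancl_trans)

lemma local_move_words:
  assumes "good (weave us As)" "good (weave us Bs)" "length us = Suc (length As)" "length Bs = length As"
  shows "\<exists>E. local_move us As Bs (Diagram (weave us As) (0, Left)) (Diagram (weave us Bs) (0, Left)) E"
proof -
  let ?w = "weave us As" and ?w' = "weave us Bs"
  define E where "E = {(edge ?w (length (weave (take j us) (take j As)) + i),
           edge ?w' (length (weave (take j us) (take j Bs)) + i)) | j i.
             j < length us \<and> i \<le> length (us ! j)}"
  have "(edge ?w (length (weave (take 0 us) (take 0 As)) + 0),
           edge ?w' (length (weave (take 0 us) (take 0 Bs)) + 0)) \<in> E"
    unfolding E_def
  proof (rule CollectI, rule exI[of _ 0], rule exI[of _ 0], intro conjI refl)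
    show "0 < length us" using assms(3) by simp
  qed simp
  then have "(0, 0) \<in> E" by simp
  then have "same_outer E {} {} (Diagram ?w (0, Left)) (Diagram ?w' (0, Left))"
    by (rule same_outerI)
  then show ?thesis unfolding local_move_def using assms
    by (intro exI[of _ E]) (simp add: diagram_iff E_def)
qed

lemma detour_words:
  assumes "good (u @ P @ v)" "good (u' @ P' @ v')" "\<forall>x \<in> set P \<union> set P'. mark x = Virtual"
    "erase P u = erase P' u'" "erase P v = erase P' v'"
  obtains E where "detour (Diagram (u @ P @ v) (0, Left)) (Diagram (u' @ P' @ v') (0, Left)) E"
    "\<And>i i'. i \<le> length u \<Longrightarrow> i' \<le> length u' \<Longrightarrow> length (erase P (take i u)) = length (erase P' (take i' u')) \<Longrightarrow>
       (edge (u @ P @ v) i, edge (u' @ P' @ v') i') \<in> E"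
proof -
  let ?w = "u @ P @ v" and ?w' = "u' @ P' @ v'"
  define E where "E = {(edge ?w i, edge ?w' i') | i i'.
               i \<le> length u \<and> i' \<le> length u' \<and>
               length (erase P (take i u)) = length (erase P' (take i' u'))} \<union>
            {(edge ?w (length (u @ P) + i), edge ?w' (length (u' @ P') + i')) | i i'.
               i \<le> length v \<and> i' \<le> length v' \<and>
               length (erase P (take i v)) = length (erase P' (take i' v'))}"
  have E: "(edge ?w i, edge ?w' i') \<in> E"
    if "i \<le> length u" "i' \<le> length u'" "length (erase P (take i u)) = length (erase P' (take i' u'))" for i i'
    using that unfolding E_def by blast
  have "(edge ?w 0, edge ?w' 0) \<in> E" by (rule E) (auto simp: erase_def)
  then have "(0, 0) \<in> E" by simp
  then have so: "same_outer E J J' (Diagram ?w (0, Left)) (Diagram ?w' (0, Left))" for J J'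
    by (rule same_outerI)
  have "detour (Diagram ?w (0, Left)) (Diagram ?w' (0, Left)) E"
    unfolding detour_def
    by (intro conjI, simp_all only: diagram_iff fst_conv zero_edge assms(1,2) simp_thms diagram.sel)
      (rule exI[of _ u], rule exI[of _ P], rule exI[of _ v], rule exI[of _ u'], rule exI[of _ P'], rule exI[of _ v'],
        intro conjI; (rule refl | rule assms(3-5) | rule E_def | rule so))
  then show ?thesis using that E by blast
qed

lemma isotopy_words:
  assumes "good (a @ b)" "inj_on \<sigma> (crossings (a @ b))"
  obtains x E where "fst x \<in> edges (a @ b)"
    "isotopy \<sigma> (Diagram (a @ b) x) (Diagram (map (rename \<sigma>) (b @ a)) (0, Left)) E"
proof -
  let ?w = "a @ b" and ?w' = "map (rename \<sigma>) (b @ a)" and ?k = "length a"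
  define E where "E = {(edge ?w (i + ?k), i) | i. i \<in> edges ?w'}"
  let ?x = "(edge ?w ?k, Left)"
  have "(edge ?w (0 + ?k), 0) \<in> E" unfolding E_def using zero_edge by blast
  then have so: "same_outer E {} {} (Diagram ?w ?x) (Diagram ?w' (0, Left))"
    by (intro same_outerI) simp
  have rn: "(\<lambda>x. Passage (\<sigma> (crossing x)) (strand x) (mark x)) = rename \<sigma>"
    by (simp add: rename_def fun_eq_iff)
  have "good (map (rename \<sigma>) (b @ a))"
    using assms good_rotate by (intro good_rename) (auto simp: Un_commute)
  then have "isotopy \<sigma> (Diagram ?w ?x) (Diagram ?w' (0, Left)) E"
    unfolding isotopy_def
    using assms so edge_in_edges by (auto simp: diagram_iff rn E_def intro!: exI[of _ ?k] rotate_append[of "map (rename \<sigma>) a"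
      "map (rename \<sigma>) b", unfolded length_map, symmetric])
  then show ?thesis using that edge_in_edges by (metis fst_conv)
qed

lemma R2_words:
  fixes u v x s t k l pl
  defines "A \<equiv> bigon1 s (Classical t) (Classical (opp t)) k l"
    and "B \<equiv> bigon2 pl s (Classical t) (Classical (opp t)) k l"
  assumes "good (u @ v @ x)" "good (u @ A @ v @ B @ x)"
  obtains E where "R2 pl k l (edge (u @ v @ x) (length u)) (edge (u @ v @ x) (length (u @ v)))
      (Diagram (u @ v @ x) (0, Left)) (Diagram (u @ A @ v @ B @ x) (0, Left)) E"
proof -
  have "\<exists>E. local_move [u, v, x] [[], []] [A, B] (Diagram (u @ v @ x) (0, Left))
      (Diagram (u @ A @ v @ B @ x) (0, Left)) E"
    using local_move_words[of "[u, v, x]" "[[], []]" "[A, B]"] assms by simp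
  then obtain E where lm: "local_move [u, v, x] [[], []] [A, B] (Diagram (u @ v @ x) (0, Left))
      (Diagram (u @ A @ v @ B @ x) (0, Left)) E" by (rule exE)
  have "R2 pl k l (edge (u @ v @ x) (length u)) (edge (u @ v @ x) (length (u @ v)))
      (Diagram (u @ v @ x) (0, Left)) (Diagram (u @ A @ v @ B @ x) (0, Left)) E"
    unfolding R2_def Let_def
    by (rule exI[of _ u], rule exI[of _ v], rule exI[of _ x], rule exI[of _ s], rule exI[of _ t])
      (use lm in \<open>cases pl; simp add: A_def B_def bigon1_def bigon2_def\<close>)
  then show ?thesis by (rule that)
qed

locale parity =
  fixes K :: "diagram set" and p :: "diagram \<Rightarrow> nat \<Rightarrow> 'a::ab_group_add"
  assumes knot: "virtual_knot K" and parity: "oriented_parity K p"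
begin

text \<open>
  In view of \<open>outer_irrelevant\<close> below, a word stands for the diagram whose unbounded face is on
  the left of edge \<open>0\<close>.
\<close>

definition inK :: "passage list \<Rightarrow> bool" where
  "inK w \<longleftrightarrow> Diagram w (0, Left) \<in> K"

definition par :: "passage list \<Rightarrow> nat \<Rightarrow> 'a" where
  "par w = p (Diagram w (0, Left))"

lemma K_move: "D \<in> K \<Longrightarrow> move D D' F E \<Longrightarrow> D' \<in> K"
  using knot unfolding virtual_knot_def by (auto intro: rtranclp.rtrancl_into_rtrancl)

lemma K_move_iff: "move D D' F E \<Longrightarrow> D \<in> K \<longleftrightarrow> D' \<in> K"
  using K_move move.inverse by blast

lemma p_move: "D \<in> K \<Longrightarrow> move D D' F E \<Longrightarrow> (c, c') \<in> F \<Longrightarrow> p D c = p D' c'"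
proof -
  assume k: "D \<in> K" "move D D' F E" "(c, c') \<in> F"
  have "\<forall>D\<in>K. \<forall>D'\<in>K. \<forall>F E. move D D' F E \<longrightarrow> (\<forall>(v, v')\<in>F. p D v = p D' v')"
    using parity unfolding oriented_parity_def by (rule conjunct1)
  then have "\<forall>(v, v')\<in>F. p D v = p D' v'" using k(1) K_move[OF k(1,2)] k(2) by metis
  then show ?thesis using k(3) by auto
qed

lemma K_diagram:
  assumes "D \<in> K" shows "diagram D"
proof -
  obtain D0 where D0: "diagram D0" "(\<lambda>D D'. \<exists>F E. move D D' F E)\<^sup>*\<^sup>* D0 D"
    using knot assms unfolding virtual_knot_def by auto
  from D0(2,1) show ?thesis by (induction rule: rtranclp_induct) (use move_diagram in blast)+
qed

lemma inK_good: "inK w \<Longrightarrow> good w"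
  using K_diagram[of "Diagram w (0, Left)"] unfolding inK_def diagram_iff by blast

lemma outer_irrelevant:
  assumes "Diagram w x \<in> K" "fst y \<in> edges w"
  shows "Diagram w y \<in> K \<and> (\<forall>c\<in>cls w. p (Diagram w y) c = p (Diagram w x) c)"
proof -
  have d: "good w" "fst x \<in> edges w" using K_diagram[OF assms(1)] diagram_iff by auto
  then have "(x, y) \<in> (side_step w)\<^sup>*" using all_side_steps[of w x y] assms(2) good_iff by auto
  then show ?thesis
  proof (induction rule: rtrancl_induct)
    case (step y z)
    then obtain e where e: "fst y \<in> edges w" "fst z \<in> edges w" "e \<in> edges w" "z \<in> region w {e} y"
      by (auto simp: side_step_def)
    obtain E where E: "detour (Diagram w y) (Diagram w z) E" using outer_detour[OF d(1) e] by blast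
    note m = move.detour[OF E]
    have z: "Diagram w z \<in> K" using K_move m step.IH by blast
    have "p (Diagram w z) c = p (Diagram w x) c" if c: "c \<in> cls w" for c
    proof -
      have "(c, c) \<in> Id_on (classical (Diagram w y))" using c by (simp only: cls_eq Id_on_iff simp_thms)
      then have "p (Diagram w y) c = p (Diagram w z) c" by (rule p_move[OF conjunct1[OF step.IH] m])
      moreover have "p (Diagram w y) c = p (Diagram w x) c" using conjunct2[OF step.IH] c by (rule bspec)
      ultimately show ?thesis by simp
    qed
    then show ?case using z by blast
  qed (use assms in simp)
qed

lemma inK_outer: "fst x \<in> edges w \<Longrightarrow> Diagram w x \<in> K \<longleftrightarrow> inK w"
  using outer_irrelevant[of w x "(0, Left)"] outer_irrelevant[of w "(0, Left)" x] by (auto simp: inK_def)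

lemma par_outer: "Diagram w x \<in> K \<Longrightarrow> c \<in> cls w \<Longrightarrow> p (Diagram w x) c = par w c"
  using outer_irrelevant[of w x "(0, Left)"] by (auto simp: par_def)

lemma K_inK: "D \<in> K \<Longrightarrow> inK (curve D)"
  using inK_outer K_diagram by (metis diagram.exhaust_sel diagram_iff)

lemma isotopy_par:
  assumes "inK (a @ b)" "inj_on \<sigma> (crossings (a @ b))"
  shows "inK (map (rename \<sigma>) (b @ a))"
    "c \<in> cls (a @ b) \<Longrightarrow> par (map (rename \<sigma>) (b @ a)) (\<sigma> c) = par (a @ b) c"
proof -
  obtain x E where x: "fst x \<in> edges (a @ b)" and
    i: "isotopy \<sigma> (Diagram (a @ b) x) (Diagram (map (rename \<sigma>) (b @ a)) (0, Left)) E"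
    using isotopy_words[OF inK_good[OF assms(1)] assms(2)] by blast
  note m = move.isotopy[OF i]
  have k: "Diagram (a @ b) x \<in> K" using x assms(1) inK_outer by blast
  then show "inK (map (rename \<sigma>) (b @ a))" using K_move[OF _ m] by (simp add: inK_def)
  assume c: "c \<in> cls (a @ b)"
  then show "par (map (rename \<sigma>) (b @ a)) (\<sigma> c) = par (a @ b) c"
    using p_move[OF k m, of c "\<sigma> c"] par_outer[OF k c] by (simp add: cls_eq par_def)
qed

lemma rename_id: "map (rename id) w = w" "map (rename (\<lambda>x. x)) w = w"
  by (simp_all add: rename_def map_idI)

lemma inK_rotate: "inK (a @ b) \<longleftrightarrow> inK (b @ a)"
  using isotopy_par(1)[of a b id] isotopy_par(1)[of b a id] by (auto simp: rename_id)

lemma par_rotate: "inK (a @ b) \<Longrightarrow> c \<in> cls (a @ b) \<Longrightarrow> par (b @ a) c = par (a @ b) c"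
  using isotopy_par(2)[of a b id c] by (simp add: rename_id)

lemma par_rename:
  assumes "inK w" "inj_on \<sigma> (crossings w)" "c \<in> cls w"
  shows "par (map (rename \<sigma>) w) (\<sigma> c) = par w c"
  using isotopy_par(2)[of "[]" w \<sigma> c] assms by simp

lemma inK_rename: "inK w \<Longrightarrow> inj_on \<sigma> (crossings w) \<Longrightarrow> inK (map (rename \<sigma>) w)"
  using isotopy_par(1)[of "[]" w \<sigma>] by simp

lemma detour_par:
  assumes "inK (u @ P @ v)" "good (u' @ P' @ v')" "\<forall>x \<in> set P \<union> set P'. mark x = Virtual"
    "erase P u = erase P' u'" "erase P v = erase P' v'"
  shows "inK (u' @ P' @ v')" "c \<in> cls (u @ P @ v) \<Longrightarrow> par (u' @ P' @ v') c = par (u @ P @ v) c"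
proof -
  obtain E where "detour (Diagram (u @ P @ v) (0, Left)) (Diagram (u' @ P' @ v') (0, Left)) E"
    using detour_words[OF inK_good[OF assms(1)] assms(2-5)] by blast
  note m = move.detour[OF this]
  have k: "Diagram (u @ P @ v) (0, Left) \<in> K" using assms(1) by (simp add: inK_def)
  then show "inK (u' @ P' @ v')" using K_move[OF _ m] by (simp add: inK_def)
  assume "c \<in> cls (u @ P @ v)"
  then show "par (u' @ P' @ v') c = par (u @ P @ v) c"
    using p_move[OF k m, of c c] by (simp add: par_def Id_on_iff)
qed

lemma R1_par:
  assumes "good (u @ v)" "good (u @ kink c s (Classical t) @ v)"
  shows "inK (u @ v) \<longleftrightarrow> inK (u @ kink c s (Classical t) @ v)"
    "inK (u @ v) \<Longrightarrow> d \<in> cls (u @ v) \<Longrightarrow> par (u @ kink c s (Classical t) @ v) d = par (u @ v) d"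
proof -
  have "\<exists>E. local_move [u, v] [[]] [kink c s (Classical t)] (Diagram (u @ v) (0, Left))
      (Diagram (u @ kink c s (Classical t) @ v) (0, Left)) E"
    using local_move_words[of "[u, v]" "[[]]" "[kink c s (Classical t)]"] assms by simp
  then obtain E where "R1 c (Diagram (u @ v) (0, Left)) (Diagram (u @ kink c s (Classical t) @ v) (0, Left)) E"
    unfolding R1_def kink_def by blast
  note m = move.R1[OF this]
  show "inK (u @ v) \<longleftrightarrow> inK (u @ kink c s (Classical t) @ v)"
    using K_move_iff[OF m] by (simp add: inK_def)
  assume "inK (u @ v)" "d \<in> cls (u @ v)"
  then show "par (u @ kink c s (Classical t) @ v) d = par (u @ v) d"
    using p_move[OF _ m, of d d] by (simp add: par_def inK_def Id_on_iff)
qed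

lemma R2_par:
  fixes u v x s t k l pl
  defines "A \<equiv> bigon1 s (Classical t) (Classical (opp t)) k l"
    and "B \<equiv> bigon2 pl s (Classical t) (Classical (opp t)) k l"
  assumes "good (u @ v @ x)" "good (u @ A @ v @ B @ x)"
  shows "inK (u @ v @ x) \<longleftrightarrow> inK (u @ A @ v @ B @ x)"
    "inK (u @ v @ x) \<Longrightarrow> d \<in> cls (u @ v @ x) \<Longrightarrow> par (u @ A @ v @ B @ x) d = par (u @ v @ x) d"
    "inK (u @ v @ x) \<Longrightarrow> par (u @ A @ v @ B @ x) l = - par (u @ A @ v @ B @ x) k"
proof -
  obtain E where R: "R2 pl k l (edge (u @ v @ x) (length u)) (edge (u @ v @ x) (length (u @ v)))
      (Diagram (u @ v @ x) (0, Left)) (Diagram (u @ A @ v @ B @ x) (0, Left)) E"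
    using R2_words[of u v x s t k l pl] assms(3,4) unfolding A_def B_def by blast
  note m = move.R2[OF R]
  show i: "inK (u @ v @ x) \<longleftrightarrow> inK (u @ A @ v @ B @ x)"
    using K_move_iff[OF m] by (simp add: inK_def)
  assume w: "inK (u @ v @ x)"
  show "d \<in> cls (u @ v @ x) \<Longrightarrow> par (u @ A @ v @ B @ x) d = par (u @ v @ x) d"
    using p_move[OF _ m, of d d] w by (simp add: par_def inK_def Id_on_iff)
  have "par (u @ A @ v @ B @ x) k + par (u @ A @ v @ B @ x) l = 0"
    using parity R w i unfolding oriented_parity_def inK_def par_def by blast
  then show "par (u @ A @ v @ B @ x) l = - par (u @ A @ v @ B @ x) k"
    by (simp add: add.commute eq_neg_iff_add_eq_0)
qed

end

section \<open>The value of an arc\<close>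

definition fresh :: "passage list \<Rightarrow> nat" where
  "fresh w = Suc (Max (insert 0 (crossings w)))"

lemma fresh: "fresh w + i \<notin> crossings w"
proof
  assume "fresh w + i \<in> crossings w"
  then have "fresh w + i \<le> Max (insert 0 (crossings w))" by (intro Max_ge) auto
  then show False by (simp add: fresh_def)
qed

lemma fresh_names:
  obtains k l n where "distinct [k, l, n]" "{k, l, n} \<inter> crossings w = {}"
  using fresh[of w 0] fresh[of w 1] fresh[of w 2]
  by (intro that[of "fresh w + 0" "fresh w + 1" "fresh w + 2"]) auto

lemma erase_append [simp]: "erase P (a @ b) = erase P a @ erase P b"
  by (simp add: erase_def)

lemma erase_disjoint: "crossings P \<inter> crossings u = {} \<Longrightarrow> erase P u = u"
  unfolding erase_def by (intro filter_True) auto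

lemma erase_Nil [simp]: "erase [] u = u" by (simp add: erase_def)

lemma erase_Cons [simp]:
  "erase P (x # u) = (if crossing x \<in> crossings P then erase P u else x # erase P u)"
  by (simp add: erase_def)

lemma cls_Nil [simp]: "cls [] = {}" by (simp add: cls_eq)

lemma cls_Cons: "cls (x # w) = (if mark x = Virtual then {} else {crossing x}) \<union> cls w"
  by (auto simp: cls_eq)

lemma cls_append: "cls (a @ b) = cls a \<union> cls b"
  by (auto simp: cls_eq)

lemma cls_sub: "cls w \<subseteq> crossings w" by (auto simp: cls_eq)

lemma tangle_eq: "tangle s t k l n = bigon1 s (Classical t) (Classical (opp t)) k l @ [Passage n s Virtual] @
    bigon2 True s (Classical t) (Classical (opp t)) k l @ [Passage n (opp s) Virtual]"
  by (simp add: tangle_def bigon1_def bigon2_def)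

lemma cls_tangle: "cls (tangle s t k l n) = {k, l}"
  by (auto simp: cls_Cons tangle_def)

context parity
begin

lemma virtual_kink:
  assumes "inK (u @ v)" "n \<notin> crossings (u @ v)"
  shows "inK (u @ kink n s Virtual @ v)"
    "c \<in> cls (u @ v) \<Longrightarrow> par (u @ kink n s Virtual @ v) c = par (u @ v) c"
proof -
  have e: "erase (kink n s Virtual) u = u" "erase (kink n s Virtual) v = v"
    by (rule erase_disjoint, use assms(2) in \<open>simp add: crossings_kink image_Un\<close>)+
  note d = detour_par(1)[of u "[]" v u "kink n s Virtual" v] detour_par(2)[of u "[]" v u "kink n s Virtual" v c]
  show "inK (u @ kink n s Virtual @ v)"
    "c \<in> cls (u @ v) \<Longrightarrow> par (u @ kink n s Virtual @ v) c = par (u @ v) c"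
    using d assms(1) good_kink[OF inK_good[OF assms(1)] assms(2)] e by (auto simp: kink_def)
qed

lemma inK_tangle:
  assumes "inK (u @ v)" "distinct [k, l, n]" "{k, l, n} \<inter> crossings (u @ v) = {}"
  shows "inK (u @ tangle s t k l n @ v)"
proof -
  have n: "n \<notin> crossings (u @ v)" using assms(3) by blast
  have 1: "inK (u @ [Passage n s Virtual] @ ([Passage n (opp s) Virtual] @ v))"
    using virtual_kink(1)[OF assms(1) n, of s] by (simp add: kink_def)
  have 2: "good (u @ tangle s t k l n @ v)" using good_tangle[OF inK_good[OF assms(1)] assms(2,3)] .
  show ?thesis
    using R2_par(1)[of u "[Passage n s Virtual]" "[Passage n (opp s) Virtual] @ v" s t k l True] 1 2
      inK_good[OF 1] by (simp add: tangle_eq)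
qed

text \<open>
  The value of the arc through the gap between \<open>u\<close> and \<open>v\<close>. The strands at \<open>k\<close> are distinguished
  by \<open>s\<close>, and \<open>t\<close> tells which of them is above; neither matters in the end, see \<open>arc_value_opp\<close>
  and \<open>arc_value_mark\<close>.
\<close>

definition arc_value :: "strand \<Rightarrow> strand \<Rightarrow> passage list \<Rightarrow> passage list \<Rightarrow> 'a" where
  "arc_value s t u v = (let f = fresh (u @ v) in par (u @ tangle s t f (f + 1) (f + 2) @ v) f)"

lemma arc_value_eq:
  assumes "inK (u @ v)" and k: "distinct [k, l, n]" "{k, l, n} \<inter> crossings (u @ v) = {}"
  shows "par (u @ tangle s t k l n @ v) k = arc_value s t u v"
proof -
  let ?f = "fresh (u @ v)"
  have f: "distinct [?f, ?f + 1, ?f + 2]" "{?f, ?f + 1, ?f + 2} \<inter> crossings (u @ v) = {}"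
    using fresh[of "u @ v" 0] fresh[of "u @ v" 1] fresh[of "u @ v" 2] by auto
  define \<sigma> where "\<sigma> = (\<lambda>c. if c = ?f then k else if c = ?f + 1 then l else if c = ?f + 2 then n else c)"
  let ?w = "u @ tangle s t ?f (?f + 1) (?f + 2) @ v"
  have id: "\<sigma> c = c" if c: "c \<in> crossings (u @ v)" for c
  proof -
    have "c \<noteq> ?f" "c \<noteq> ?f + 1" "c \<noteq> ?f + 2" using c f(2) by blast+
    then show ?thesis by (simp only: \<sigma>_def if_False)
  qed
  have cw: "crossings ?w = {?f, ?f + 1, ?f + 2} \<union> crossings (u @ v)"
    unfolding set_append image_Un crossings_tangle by blast
  have s3: "\<sigma> ?f = k" "\<sigma> (?f + 1) = l" "\<sigma> (?f + 2) = n" by (auto simp: \<sigma>_def)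
  have inj: "inj_on \<sigma> (crossings ?w)"
  proof (rule inj_onI)
    fix a b assume a: "a \<in> crossings ?w" and b: "b \<in> crossings ?w" and e: "\<sigma> a = \<sigma> b"
    consider "a \<in> crossings (u @ v)" | "a \<in> {?f, ?f + 1, ?f + 2}" using a unfolding cw by blast
    then show "a = b"
    proof cases
      case 1
      have "b \<notin> {?f, ?f + 1, ?f + 2}"
      proof
        assume "b \<in> {?f, ?f + 1, ?f + 2}"
        then have "\<sigma> b \<in> {k, l, n}" using s3 by auto
        then show False using e id[OF 1] 1 k(2) by auto
      qed
      then have "b \<in> crossings (u @ v)" using b unfolding cw by blast
      then show ?thesis using e id[OF 1] id[of b] by simp
    next
      case 2
      then have "\<sigma> a \<in> {k, l, n}" using s3 by auto
      have "b \<notin> crossings (u @ v)"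
      proof
        assume bb: "b \<in> crossings (u @ v)"
        then have "b \<in> {k, l, n}" using \<open>\<sigma> a \<in> {k, l, n}\<close> e id[OF bb] by (simp only:)
        then show False using bb k(2) by blast
      qed
      then have "b \<in> {?f, ?f + 1, ?f + 2}" using b unfolding cw by blast
      then show ?thesis using 2 e s3 k(1) by auto
    qed
  qed
  have "map (rename \<sigma>) u = u" "map (rename \<sigma>) v = v"
    using id by (auto intro!: map_idI simp: rename_def)
  then have m: "map (rename \<sigma>) ?w = u @ tangle s t k l n @ v"
    by (simp add: tangle_def rename_def \<sigma>_def)
  have "?f \<in> cls ?w" by (simp add: cls_append cls_tangle)
  from par_rename[OF inK_tangle[OF assms(1) f] inj this]
  have "par (u @ tangle s t k l n @ v) k = par ?w ?f" unfolding m s3 .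
  then show ?thesis by (simp add: arc_value_def Let_def)
qed

text \<open>
  A move commutes with the insertion of the tangle at a place not touched by the move.
\<close>

lemma arc_value_transfer:
  assumes "inK (u @ v)" "inK (u' @ v')"
    and T: "\<And>k l n. distinct [k, l, n] \<Longrightarrow> {k, l, n} \<inter> crossings (u @ v) = {} \<Longrightarrow> {k, l, n} \<inter> crossings (u' @ v') = {} \<Longrightarrow>
      inK (u @ tangle s t k l n @ v) \<Longrightarrow> good (u' @ tangle s t k l n @ v') \<Longrightarrow>
      k \<in> cls (u @ tangle s t k l n @ v) \<Longrightarrow>
      par (u @ tangle s t k l n @ v) k = par (u' @ tangle s t k l n @ v') k"
  shows "arc_value s t u v = arc_value s t u' v'"
proof -
  obtain k l n where k: "distinct [k, l, n]" "{k, l, n} \<inter> crossings ((u @ v) @ u' @ v') = {}"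
    by (rule fresh_names)
  have k1: "{k, l, n} \<inter> crossings (u @ v) = {}" and k2: "{k, l, n} \<inter> crossings (u' @ v') = {}"
    using k(2) by (simp_all add: image_Un)
  have "k \<in> cls (u @ tangle s t k l n @ v)" by (simp add: cls_append cls_tangle)
  from T[OF k(1) k1 k2 inK_tangle[OF assms(1) k(1) k1] good_tangle[OF inK_good[OF assms(2)] k(1) k2] this]
  show ?thesis by (simp add: arc_value_eq[OF assms(1) k(1) k1] arc_value_eq[OF assms(2) k(1) k2])
qed

lemma arc_value_rotate:
  assumes "inK (a @ b @ c)" shows "arc_value s t (a @ b) c = arc_value s t b (c @ a)"
proof (rule arc_value_transfer)
  show "inK ((a @ b) @ c)" using assms by simp
  then show "inK (b @ c @ a)" using inK_rotate[of a "b @ c"] by simp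
  fix k l n
  assume i: "inK ((a @ b) @ tangle s t k l n @ c)" and k: "k \<in> cls ((a @ b) @ tangle s t k l n @ c)"
  show "par ((a @ b) @ tangle s t k l n @ c) k = par (b @ tangle s t k l n @ c @ a) k"
    using par_rotate[of a "b @ tangle s t k l n @ c" k] i k by simp
qed

lemma arc_value_detour:
  assumes "inK (u1 @ u2 @ P @ v)" "good (u1' @ u2' @ P' @ v')" "\<forall>x \<in> set P \<union> set P'. mark x = Virtual"
    "erase P u1 = erase P' u1'" "erase P u2 = erase P' u2'" "erase P v = erase P' v'"
  shows "arc_value s t u1 (u2 @ P @ v) = arc_value s t u1' (u2' @ P' @ v')"
proof (rule arc_value_transfer)
  show "inK (u1 @ u2 @ P @ v)" by fact
  show "inK (u1' @ u2' @ P' @ v')"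
    using detour_par(1)[of "u1 @ u2" P v "u1' @ u2'" P' v'] assms by simp
  fix k l n
  let ?T = "tangle s t k l n"
  assume k: "{k, l, n} \<inter> crossings (u1 @ u2 @ P @ v) = {}" "{k, l, n} \<inter> crossings (u1' @ u2' @ P' @ v') = {}"
    and i: "inK (u1 @ ?T @ u2 @ P @ v)" "good (u1' @ ?T @ u2' @ P' @ v')" "k \<in> cls (u1 @ ?T @ u2 @ P @ v)"
  have "erase P ?T = ?T" "erase P' ?T = ?T"
    by (rule erase_disjoint, use k in \<open>simp add: crossings_tangle image_Un\<close>)+
  then show "par (u1 @ ?T @ u2 @ P @ v) k = par (u1' @ ?T @ u2' @ P' @ v') k"
    using detour_par(2)[of "u1 @ ?T @ u2" P v "u1' @ ?T @ u2'" P' v' k] assms i by simp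
qed

lemma arc_value_detour_after:
  assumes "inK (u @ P @ v1 @ v2)" "good (u' @ P' @ v1' @ v2')" "\<forall>x \<in> set P \<union> set P'. mark x = Virtual"
    "erase P u = erase P' u'" "erase P v1 = erase P' v1'" "erase P v2 = erase P' v2'"
  shows "arc_value s t (u @ P @ v1) v2 = arc_value s t (u' @ P' @ v1') v2'"
proof (rule arc_value_transfer)
  show "inK ((u @ P @ v1) @ v2)" using assms by simp
  show "inK ((u' @ P' @ v1') @ v2')"
    using detour_par(1)[of u P "v1 @ v2" u' P' "v1' @ v2'"] assms by simp
  fix k l n
  let ?T = "tangle s t k l n"
  assume k: "{k, l, n} \<inter> crossings ((u @ P @ v1) @ v2) = {}"
    "{k, l, n} \<inter> crossings ((u' @ P' @ v1') @ v2') = {}"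
    and i: "inK ((u @ P @ v1) @ ?T @ v2)" "good ((u' @ P' @ v1') @ ?T @ v2')" "k \<in> cls ((u @ P @ v1) @ ?T @ v2)"
  have "erase P ?T = ?T" "erase P' ?T = ?T"
    by (rule erase_disjoint, use k in \<open>simp add: crossings_tangle image_Un\<close>)+
  then show "par ((u @ P @ v1) @ ?T @ v2) k = par ((u' @ P' @ v1') @ ?T @ v2') k"
    using detour_par(2)[of u P "v1 @ ?T @ v2" u' P' "v1' @ ?T @ v2'" k] assms i by simp
qed

lemma arc_value_rename:
  assumes "inK (u @ v)" "inj_on \<sigma> (crossings (u @ v))"
  shows "arc_value s t (map (rename \<sigma>) u) (map (rename \<sigma>) v) = arc_value s t u v"
proof (rule arc_value_transfer[symmetric])
  show i: "inK (u @ v)" by fact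
  show "inK (map (rename \<sigma>) u @ map (rename \<sigma>) v)" using inK_rename[OF assms] by simp
  fix k l n
  let ?T = "tangle s t k l n"
  assume k: "distinct [k, l, n]" "{k, l, n} \<inter> crossings (u @ v) = {}"
    "{k, l, n} \<inter> crossings (map (rename \<sigma>) u @ map (rename \<sigma>) v) = {}"
    and i: "inK (u @ ?T @ v)" "k \<in> cls (u @ ?T @ v)"
  define \<tau> where "\<tau> c = (if c \<in> {k, l, n} then c else \<sigma> c)" for c
  have t: "\<tau> c = \<sigma> c" if c: "c \<in> crossings (u @ v)" for c
  proof -
    have "c \<notin> {k, l, n}" using c k(2) by blast
    then show ?thesis by (simp only: \<tau>_def if_False)
  qed
  have "crossings (map (rename \<sigma>) u @ map (rename \<sigma>) v) = \<sigma> ` crossings (u @ v)"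
    by (simp add: image_Un image_image)
  then have im: "\<sigma> c \<notin> {k, l, n}" if "c \<in> crossings (u @ v)" for c using that k(3) by blast
  have cw: "crossings (u @ ?T @ v) = {k, l, n} \<union> crossings (u @ v)"
    unfolding set_append image_Un crossings_tangle by blast
  have "inj_on \<tau> (crossings (u @ ?T @ v))"
  proof (rule inj_onI)
    fix a b assume a: "a \<in> crossings (u @ ?T @ v)" and b: "b \<in> crossings (u @ ?T @ v)" and e: "\<tau> a = \<tau> b"
    have "a = b" if "a \<in> crossings (u @ v)" "b \<in> crossings (u @ v)"
      using e t[OF that(1)] t[OF that(2)] assms(2) that by (simp add: inj_onD)
    moreover have False if "x \<in> crossings (u @ v)" "y \<in> {k, l, n}" "\<tau> x = \<tau> y" for x y
      using im[OF that(1)] t[OF that(1)] that(2,3) by (simp add: \<tau>_def split: if_splits)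
    moreover have "a = b" if "a \<in> {k, l, n}" "b \<in> {k, l, n}" using that e by (simp add: \<tau>_def)
    ultimately show "a = b" using a b e unfolding cw by (metis Un_iff)
  qed
  from par_rename[OF i(1) this i(2)]
  have "par (map (rename \<tau>) (u @ ?T @ v)) k = par (u @ ?T @ v) k" by (simp add: \<tau>_def)
  moreover have "map (rename \<tau>) u = map (rename \<sigma>) u" "map (rename \<tau>) v = map (rename \<sigma>) v"
    using t by (auto simp: rename_def)
  moreover have "map (rename \<tau>) ?T = ?T" by (simp add: tangle_def rename_def \<tau>_def)
  ultimately show "par (u @ ?T @ v) k = par (map (rename \<sigma>) u @ ?T @ map (rename \<sigma>) v) k" by simp
qed

text \<open>
  A detour of the strand transversal to \<open>x\<close> moves this strand across the tangle \<open>T\<close>.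
\<close>

lemma virtual_slide:
  assumes i: "inK (u @ T @ x # v)" and g: "good (u @ x # T @ v)" and x: "mark x = Virtual"
    and T: "crossing x \<notin> crossings T"
  shows "inK (u @ x # T @ v)" "c \<in> cls (u @ T @ x # v) \<Longrightarrow> par (u @ T @ x # v) c = par (u @ x # T @ v) c"
proof -
  let ?y = "Passage (crossing x) (opp (strand x)) (mark x)"
  have "valid (u @ T @ x # v)" using inK_good[OF i] by (simp add: good_iff)
  then have "?y \<in> set (u @ T @ x # v)" unfolding valid_def by auto
  moreover have "?y \<noteq> x" by (cases x) auto
  moreover have "?y \<notin> set T" using T by (metis imageI passage.sel(1))
  ultimately have "?y \<in> set u \<or> ?y \<in> set v" by auto
  then consider a b where "u = a @ ?y # b" | a b where "v = a @ ?y # b" by (metis split_list)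
  then have "inK (u @ x # T @ v) \<and> (c \<in> cls (u @ T @ x # v) \<longrightarrow> par (u @ T @ x # v) c = par (u @ x # T @ v) c)"
  proof cases
    case u: (1 a b)
    show ?thesis
      using detour_par(1)[of a "[?y]" "b @ T @ x # v" a "[?y]" "b @ x # T @ v"]
        detour_par(2)[of a "[?y]" "b @ T @ x # v" a "[?y]" "b @ x # T @ v" c] i g x
      unfolding u by (auto simp: erase_def)
  next
    case (2 a b)
    show ?thesis
      using detour_par(1)[of "u @ T @ x # a" "[?y]" b "u @ x # T @ a" "[?y]" b]
        detour_par(2)[of "u @ T @ x # a" "[?y]" b "u @ x # T @ a" "[?y]" b c] i g x
      unfolding 2 by (auto simp: erase_def)
  qed
  then show "inK (u @ x # T @ v)"
    "c \<in> cls (u @ T @ x # v) \<Longrightarrow> par (u @ T @ x # v) c = par (u @ x # T @ v) c"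
    by blast+
qed

lemma arc_value_virtual:
  assumes "inK (u @ x # v)" "mark x = Virtual"
  shows "arc_value s t u (x # v) = arc_value s t (u @ [x]) v"
proof (rule arc_value_transfer)
  show "inK (u @ x # v)" "inK ((u @ [x]) @ v)" using assms by auto
  fix k l n
  let ?T = "tangle s t k l n"
  assume k: "{k, l, n} \<inter> crossings (u @ x # v) = {}" and
    i: "inK (u @ ?T @ x # v)" "good ((u @ [x]) @ ?T @ v)" "k \<in> cls (u @ ?T @ x # v)"
  have "crossing x \<notin> crossings ?T" using k unfolding crossings_tangle by auto
  then show "par (u @ ?T @ x # v) k = par ((u @ [x]) @ ?T @ v) k"
    using virtual_slide(2)[of u ?T x v k] i assms(2) by simp
qed

lemma arc_value_virtuals:
  assumes "inK (u @ P @ v)" "\<forall>x\<in>set P. mark x = Virtual"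
  shows "arc_value s t u (P @ v) = arc_value s t (u @ P) v"
  using assms
proof (induction P arbitrary: u)
  case (Cons x P)
  then show ?case using arc_value_virtual[of u x "P @ v" s t] Cons.IH[of "u @ [x]"] by simp
qed simp

lemma arc_value_R1:
  assumes "inK (u1 @ u2 @ v)" "good (u1 @ u2 @ kink c r (Classical q) @ v)"
  shows "arc_value s t u1 (u2 @ kink c r (Classical q) @ v) = arc_value s t u1 (u2 @ v)"
proof (rule arc_value_transfer[symmetric])
  let ?k = "kink c r (Classical q)"
  show "inK (u1 @ u2 @ v)" by fact
  show "inK (u1 @ u2 @ ?k @ v)" using R1_par(1)[of "u1 @ u2" v c r q] assms inK_good by simp
  fix k l n
  let ?T = "tangle s t k l n"
  assume i: "inK (u1 @ ?T @ u2 @ v)" "good (u1 @ ?T @ u2 @ ?k @ v)" "k \<in> cls (u1 @ ?T @ u2 @ v)"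
  show "par (u1 @ ?T @ u2 @ v) k = par (u1 @ ?T @ u2 @ ?k @ v) k"
    using R1_par(2)[of "u1 @ ?T @ u2" v c r q k] i inK_good[OF i(1)] by simp
qed

lemma arc_value_R1_after:
  assumes "inK (u @ v1 @ v2)" "good (u @ kink c r (Classical q) @ v1 @ v2)"
  shows "arc_value s t (u @ kink c r (Classical q) @ v1) v2 = arc_value s t (u @ v1) v2"
proof (rule arc_value_transfer[symmetric])
  let ?k = "kink c r (Classical q)"
  show "inK ((u @ v1) @ v2)" using assms by simp
  show "inK ((u @ ?k @ v1) @ v2)" using R1_par(1)[of "u" "v1 @ v2" c r q] assms inK_good by simp
  fix k l n
  let ?T = "tangle s t k l n"
  assume i: "inK ((u @ v1) @ ?T @ v2)" "good ((u @ ?k @ v1) @ ?T @ v2)" "k \<in> cls ((u @ v1) @ ?T @ v2)"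
  show "par ((u @ v1) @ ?T @ v2) k = par ((u @ ?k @ v1) @ ?T @ v2) k"
    using R1_par(2)[of u "v1 @ ?T @ v2" c r q k] i inK_good[OF i(1)] by simp
qed

lemma arc_value_R2:
  fixes r q e f pl
  defines "A \<equiv> bigon1 r (Classical q) (Classical (opp q)) e f"
    and "B \<equiv> bigon2 pl r (Classical q) (Classical (opp q)) e f"
  shows "inK (u1 @ u2 @ v @ x) \<Longrightarrow> good (u1 @ u2 @ A @ v @ B @ x) \<Longrightarrow>
      arc_value s t u1 (u2 @ A @ v @ B @ x) = arc_value s t u1 (u2 @ v @ x)"
    and "inK (u @ v1 @ v2 @ x) \<Longrightarrow> good (u @ A @ v1 @ v2 @ B @ x) \<Longrightarrow>
      arc_value s t (u @ A @ v1) (v2 @ B @ x) = arc_value s t (u @ v1) (v2 @ x)"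
    and "inK (u @ v @ x1 @ x2) \<Longrightarrow> good (u @ A @ v @ B @ x1 @ x2) \<Longrightarrow>
      arc_value s t (u @ A @ v @ B @ x1) x2 = arc_value s t (u @ v @ x1) x2"
proof -
  note R = R2_par[where s = r and t = q and k = e and l = f and pl = pl, folded A_def B_def]
  show "arc_value s t u1 (u2 @ A @ v @ B @ x) = arc_value s t u1 (u2 @ v @ x)"
    if a: "inK (u1 @ u2 @ v @ x)" "good (u1 @ u2 @ A @ v @ B @ x)"
  proof (rule arc_value_transfer[symmetric])
    show "inK (u1 @ u2 @ v @ x)" by fact
    show "inK (u1 @ u2 @ A @ v @ B @ x)" using R(1)[of "u1 @ u2" v x] a inK_good by simp
    fix k l n
    let ?T = "tangle s t k l n"
    assume i: "inK (u1 @ ?T @ u2 @ v @ x)" "good (u1 @ ?T @ u2 @ A @ v @ B @ x)" "k \<in> cls (u1 @ ?T @ u2 @ v @ x)"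
    show "par (u1 @ ?T @ u2 @ v @ x) k = par (u1 @ ?T @ u2 @ A @ v @ B @ x) k"
      using R(2)[of "u1 @ ?T @ u2" v x k] i inK_good[OF i(1)] by simp
  qed
  show "arc_value s t (u @ A @ v1) (v2 @ B @ x) = arc_value s t (u @ v1) (v2 @ x)"
    if a: "inK (u @ v1 @ v2 @ x)" "good (u @ A @ v1 @ v2 @ B @ x)"
  proof (rule arc_value_transfer[symmetric])
    show "inK ((u @ v1) @ v2 @ x)" using a by simp
    show "inK ((u @ A @ v1) @ v2 @ B @ x)" using R(1)[of u "v1 @ v2" x] a inK_good by simp
    fix k l n
    let ?T = "tangle s t k l n"
    assume i: "inK ((u @ v1) @ ?T @ v2 @ x)" "good ((u @ A @ v1) @ ?T @ v2 @ B @ x)" "k \<in> cls ((u @ v1) @ ?T @ v2 @ x)"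
    show "par ((u @ v1) @ ?T @ v2 @ x) k = par ((u @ A @ v1) @ ?T @ v2 @ B @ x) k"
      using R(2)[of u "v1 @ ?T @ v2" x k] i inK_good[OF i(1)] by simp
  qed
  show "arc_value s t (u @ A @ v @ B @ x1) x2 = arc_value s t (u @ v @ x1) x2"
    if a: "inK (u @ v @ x1 @ x2)" "good (u @ A @ v @ B @ x1 @ x2)"
  proof (rule arc_value_transfer[symmetric])
    show "inK ((u @ v @ x1) @ x2)" using a by simp
    show "inK ((u @ A @ v @ B @ x1) @ x2)" using R(1)[of u v "x1 @ x2"] a inK_good by simp
    fix k l n
    let ?T = "tangle s t k l n"
    assume i: "inK ((u @ v @ x1) @ ?T @ x2)" "good ((u @ A @ v @ B @ x1) @ ?T @ x2)" "k \<in> cls ((u @ v @ x1) @ ?T @ x2)"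
    show "par ((u @ v @ x1) @ ?T @ x2) k = par ((u @ A @ v @ B @ x1) @ ?T @ x2) k"
      using R(2)[of u v "x1 @ ?T @ x2" k] i inK_good[OF i(1)] by simp
  qed
qed

text \<open>
  The part \<open>P\<close> of the curve between two segments of one arc has virtual crossings only. Therefore
  a detour replaces it by a single virtual loop, which gives the local tangle.
\<close>

lemma self_bigon:
  fixes s t k l
  defines "A \<equiv> bigon1 s (Classical t) (Classical (opp t)) k l"
    and "B \<equiv> bigon2 True s (Classical t) (Classical (opp t)) k l"
  assumes i: "inK (A @ P @ B @ v)" "inK (P @ v)" and P: "\<forall>x\<in>set P. mark x = Virtual"
    and kl: "k \<noteq> l" "{k, l} \<inter> crossings (P @ v) = {}"
  shows "par (A @ P @ B @ v) k = arc_value s t [] (P @ v)"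
proof -
  let ?v = "erase P v"
  have gv: "good ?v" using good_cut[of s _ _ k l P v] inK_good[OF i(1)] kl unfolding A_def B_def erase_def by blast
  have iv: "inK ?v" using detour_par(1)[of "[]" P v "[]" "[]" ?v] i(2) gv P by (simp add: erase_def)
  have d: "arc_value s t [] (P @ v) = arc_value s t [] ?v"
    using arc_value_detour[of "[]" "[]" P v "[]" "[]" "[]" ?v s t] i(2) gv P by (simp add: erase_def)
  obtain n where n: "n \<notin> crossings (A @ P @ B @ v)" using fresh by blast
  have cr: "crossings A = {k, l}" "crossings B = {k, l}" by (auto simp: A_def B_def bigon1_def bigon2_def)
  have sub: "crossings ?v \<subseteq> crossings (P @ v)" by (auto simp: erase_def)
  have f: "distinct [k, l, n]" "{k, l, n} \<inter> crossings ([] @ ?v) = {}"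
    using kl n sub cr by (auto simp: image_Un)
  have T: "tangle s t k l n = A @ [Passage n s Virtual] @ B @ [Passage n (opp s) Virtual]"
    by (simp add: tangle_eq A_def B_def)
  have "good (tangle s t k l n @ ?v)" using good_tangle[of "[]" ?v k l n s t] gv f by simp
  moreover have "erase P A = A" "erase P B = B" "erase [Passage n s Virtual] A = A" "erase [Passage n s Virtual] B = B"
    using kl n cr by (auto intro!: erase_disjoint simp: image_Un)
  moreover have "erase [Passage n s Virtual] ?v = ?v"
    using n sub by (intro erase_disjoint) (auto simp: image_Un)
  moreover have "k \<in> cls (A @ P @ B @ v)" by (simp add: A_def bigon1_def cls_Cons)
  ultimately have "par (tangle s t k l n @ ?v) k = par (A @ P @ B @ v) k"
    using detour_par(2)[of A P "B @ v" A "[Passage n s Virtual]" "B @ [Passage n (opp s) Virtual] @ ?v" k] i(1) P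
    by (simp add: T)
  moreover have "par (tangle s t k l n @ ?v) k = arc_value s t [] ?v" using arc_value_eq[of "[]" ?v k l n s t] iv f by simp
  ultimately show ?thesis using d by simp
qed

end

section \<open>Triangles\<close>

lemma face_triangle:
  assumes v: "valid w" "w \<noteq> []" and x: "x1 \<in> sides w" "x2 \<in> sides w" "x3 \<in> sides w"
    and c: "fore w x1 = hind w x2" "fore w x2 = hind w x3" "fore w x3 = hind w x1"
  shows "region w {} x1 = {x1, x2, x3}"
proof
  show "region w {} x1 \<subseteq> {x1, x2, x3}"
  proof
    fix y assume "y \<in> region w {} x1"
    then have "(x1, y) \<in> connected_sides w" by (simp add: region_eq)
    then show "y \<in> {x1, x2, x3}"
    proof (induction rule: rtrancl_induct)
      case (step y z)
      have z: "z \<in> sides w"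
        "fore w y = hind w z \<or> hind w y = fore w z" using corners_iff[OF v, of y z] step(2) by auto
      have "z \<in> {x1, x2, x3}" if "fore w y = hind w z"
        using step.IH that c hind_inj[OF v z(1)] x by (metis insert_iff singletonD)
      moreover have "z \<in> {x1, x2, x3}" if "hind w y = fore w z"
        using step.IH that c fore_inj[OF v z(1)] x by (metis insert_iff singletonD)
      ultimately show ?case using z(2) by blast
    qed simp
  qed
  have "(x1, x2) \<in> corners w \<union> (corners w)\<inverse>" "(x2, x3) \<in> corners w \<union> (corners w)\<inverse>"
    using corners_iff[OF v] x c by blast+
  then show "{x1, x2, x3} \<subseteq> region w {} x1"
    unfolding region_eq by (auto intro: rtrancl_into_rtrancl)
qed

text \<open>
  With this the incidence sign is read off from the corners that the face occupies.
\<close>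

lemma incidence_fore:
  assumes v: "valid w" "w \<noteq> []" and c: "c \<in> crossings w" and x: "x \<in> sides w"
    and \<Delta>: "\<Delta> = region w {} x"
  shows "incidence w \<Delta> c = (if (c, West) \<in> fore w ` \<Delta> \<or> (c, East) \<in> fore w ` \<Delta> then 1 else -1)"
proof -
  note s = corner_sides[OF v(1) c]
  have sub: "\<Delta> \<subseteq> sides w" using connected_in_sides[OF v(1)] x unfolding \<Delta> region_eq by auto
  have cl: "z \<in> \<Delta>" if "y \<in> \<Delta>" "(y, z) \<in> corners w \<union> (corners w)\<inverse>" for y z
    using that unfolding \<Delta> region_eq by (auto intro: rtrancl_into_rtrancl)
  have W: "(sw w c, Left) \<in> \<Delta> \<longleftrightarrow> (c, West) \<in> fore w ` \<Delta>"
    and E: "(ne w c, Right) \<in> \<Delta> \<longleftrightarrow> (c, East) \<in> fore w ` \<Delta>"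
  proof -
    have f: "fore w y = (c, West) \<longleftrightarrow> y = (sw w c, Left)"
      "fore w y = (c, East) \<longleftrightarrow> y = (ne w c, Right)" if "y \<in> sides w" for y
      using fore_iff[OF v(1) that v(2), of c West] fore_iff[OF v(1) that v(2), of c East] c by simp_all
    show "(sw w c, Left) \<in> \<Delta> \<longleftrightarrow> (c, West) \<in> fore w ` \<Delta>"
      using f(1) sub s(1) by (metis (no_types, lifting) imageE image_eqI subsetD)
    show "(ne w c, Right) \<in> \<Delta> \<longleftrightarrow> (c, East) \<in> fore w ` \<Delta>"
      using f(2) sub s(3) by (metis (no_types, lifting) imageE image_eqI subsetD)
  qed
  have "((sw w c, Left), (nw w c, Left)) \<in> corners w" "((se w c, Right), (ne w c, Right)) \<in> corners w"
    using c unfolding corners_def by auto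
  then have "(sw w c, Left) \<in> \<Delta> \<longleftrightarrow> (nw w c, Left) \<in> \<Delta>"
    "(se w c, Right) \<in> \<Delta> \<longleftrightarrow> (ne w c, Right) \<in> \<Delta>"
    using cl by blast+
  then show ?thesis unfolding incidence_def using W E by simp
qed

fun fore2 :: "passage \<Rightarrow> passage \<Rightarrow> side \<Rightarrow> nat \<times> corner" where
  "fore2 p q Left = (crossing q, cin (strand q) Left)"
| "fore2 p q Right = (crossing p, cout (strand p) Right)"

fun hind2 :: "passage \<Rightarrow> passage \<Rightarrow> side \<Rightarrow> nat \<times> corner" where
  "hind2 p q Left = (crossing p, cout (strand p) Left)"
| "hind2 p q Right = (crossing q, cin (strand q) Right)"

lemma fore_inner:
  assumes "w = u @ p # q # v"
  shows "fore w (length u + 1, \<sigma>) = fore2 p q \<sigma>" "hind w (length u + 1, \<sigma>) = hind2 p q \<sigma>"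
proof -
  have "length u + 1 + length w - 1 = length u + length w" by simp
  then have "pred w (length u + 1) = length u" unfolding pred_def using assms by (simp only: mod_add_self2) simp
  moreover have "w ! (length u + 1) = q" "w ! length u = p" using assms by (auto simp: nth_append)
  ultimately have "w ! (length u + 1) = q" "pred w (length u + 1) = length u" "w ! length u = p" by simp_all
  then show "fore w (length u + 1, \<sigma>) = fore2 p q \<sigma>" "hind w (length u + 1, \<sigma>) = hind2 p q \<sigma>"
    by (cases \<sigma>; simp)+
qed

lemma zmult_1 [simp]: "zmult 1 x = x" by (simp add: zmult_def)
lemma zmult_m1 [simp]: "zmult (- 1) x = - x" by (simp add: zmult_def)
lemma zmult_0 [simp]: "zmult 0 x = 0" by (simp add: zmult_def)

text \<open>
  The edges inside \<open>[a, b]\<close>, \<open>[c, d]\<close> and \<open>[x, y]\<close> bound a face on the sides \<open>\<sigma>1\<close>,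
  \<open>\<sigma>2\<close> and \<open>\<sigma>3\<close>. The two alternatives are the two cyclic orders in which the
  boundary of the face may meet them.
\<close>

definition triangle :: "passage \<Rightarrow> passage \<Rightarrow> side \<Rightarrow> passage \<Rightarrow> passage \<Rightarrow> side \<Rightarrow> passage \<Rightarrow> passage \<Rightarrow> side \<Rightarrow> bool" where
  "triangle a b \<sigma>1 c d \<sigma>2 x y \<sigma>3 \<longleftrightarrow>
     fore2 a b \<sigma>1 = hind2 c d \<sigma>2 \<and> fore2 c d \<sigma>2 = hind2 x y \<sigma>3 \<and> fore2 x y \<sigma>3 = hind2 a b \<sigma>1 \<or>
     fore2 a b \<sigma>1 = hind2 x y \<sigma>3 \<and> fore2 x y \<sigma>3 = hind2 c d \<sigma>2 \<and> fore2 c d \<sigma>2 = hind2 a b \<sigma>1"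

lemma triangle_region:
  fixes u0 u1 u2 u3 :: "passage list" and a b c d x y :: passage
  defines "w \<equiv> u0 @ [a, b] @ u1 @ [c, d] @ u2 @ [x, y] @ u3"
    and "x1 \<equiv> length u0 + 1" and "x2 \<equiv> length u0 + length u1 + 3"
      and "x3 \<equiv> length u0 + length u1 + length u2 + 5"
  assumes v: "valid w" and t: "triangle a b \<sigma>1 c d \<sigma>2 x y \<sigma>3"
  shows "region w {} (x1, \<sigma>1) = {(x1, \<sigma>1), (x2, \<sigma>2), (x3, \<sigma>3)}" (is ?A)
    "fore w ` {(x1, \<sigma>1), (x2, \<sigma>2), (x3, \<sigma>3)} = {fore2 a b \<sigma>1, fore2 c d \<sigma>2, fore2 x y \<sigma>3}" (is ?B)
    "(x1, \<sigma>1) \<in> sides w"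
proof -
  have ne: "w \<noteq> []" by (simp add: w_def)
  have s: "(x1, \<sigma>1) \<in> sides w" "(x2, \<sigma>2) \<in> sides w" "(x3, \<sigma>3) \<in> sides w"
    using sides_iff[OF ne] by (auto simp: w_def x1_def x2_def x3_def)
  have f1: "fore w (x1, \<sigma>1) = fore2 a b \<sigma>1" "hind w (x1, \<sigma>1) = hind2 a b \<sigma>1"
    using fore_inner[of w u0 a b "u1 @ [c, d] @ u2 @ [x, y] @ u3"] by (simp_all add: w_def x1_def)
  have f2: "fore w (x2, \<sigma>2) = fore2 c d \<sigma>2" "hind w (x2, \<sigma>2) = hind2 c d \<sigma>2"
    using fore_inner[of w "u0 @ [a, b] @ u1" c d "u2 @ [x, y] @ u3"] by (simp_all add: w_def x2_def eval_nat_numeral)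
  have f3: "fore w (x3, \<sigma>3) = fore2 x y \<sigma>3" "hind w (x3, \<sigma>3) = hind2 x y \<sigma>3"
    using fore_inner[of w "u0 @ [a, b] @ u1 @ [c, d] @ u2" x y u3] by (simp_all add: w_def x3_def eval_nat_numeral add.assoc)
  show ?A
    using t face_triangle[OF v ne s(1,2,3)] face_triangle[OF v ne s(1,3,2)]
    unfolding triangle_def f1 f2 f3 by (metis insert_commute)
  show ?B by (simp only: image_insert image_empty f1 f2 f3)
  show "(x1, \<sigma>1) \<in> sides w" by fact
qed

context parity
begin

lemma R3_par:
  fixes u0 u1 u2 u3 :: "passage list" and a b c d x y :: passage
  defines "w \<equiv> u0 @ [a, b] @ u1 @ [c, d] @ u2 @ [x, y] @ u3"
    and "w' \<equiv> u0 @ [b, a] @ u1 @ [d, c] @ u2 @ [y, x] @ u3"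
  assumes g: "good w" "good w'" and t: "triangle a b \<sigma>1 c d \<sigma>2 x y \<sigma>3"
    and m: "\<forall>z \<in> {a, b, c, d, x, y}. mark z \<noteq> Virtual"
      "\<exists>(z, z') \<in> {(a, b), (c, d), (x, y)}. over z \<and> over z'"
      "\<exists>(z, z') \<in> {(a, b), (c, d), (x, y)}. under z \<and> under z'"
  shows "inK w \<longleftrightarrow> inK w'" "inK w \<Longrightarrow> e \<in> cls w \<Longrightarrow> par w' e = par w e"
    "inK w \<Longrightarrow> (\<Sum>v\<in>crossing ` {a, b, c, d, x, y}. zmult (if
       (v, West) \<in> {fore2 a b \<sigma>1, fore2 c d \<sigma>2, fore2 x y \<sigma>3} \<or>
       (v, East) \<in> {fore2 a b \<sigma>1, fore2 c d \<sigma>2, fore2 x y \<sigma>3} then 1 else - 1) (par w v)) = 0"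
proof -
  let ?\<Delta> = "{(length u0 + 1, \<sigma>1), (length u0 + length u1 + 3, \<sigma>2), (length u0 + length u1 + length u2 + 5, \<sigma>3)}"
  have v: "valid w" "w \<noteq> []" using g by (auto simp: good_iff w_def)
  note tr = triangle_region[OF v(1)[unfolded w_def] t, folded w_def]
  obtain E where lm: "local_move [u0, u1, u2, u3] [[a, b], [c, d], [x, y]] [[b, a], [d, c], [y, x]]
      (Diagram w (0, Left)) (Diagram w' (0, Left)) E"
    using local_move_words[of "[u0, u1, u2, u3]" "[[a, b], [c, d], [x, y]]" "[[b, a], [d, c], [y, x]]"] g
    by (auto simp: w_def w'_def)
  have face: "?\<Delta> \<in> faces w" using tr(1,3) unfolding faces_def sides_def[symmetric] by (metis imageI)
  have card: "card ?\<Delta> = 3" by simp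
  have R: "R3 ?\<Delta> (crossing ` {a, b, c, d, x, y}) (Diagram w (0, Left)) (Diagram w' (0, Left)) E"
    unfolding R3_def diagram.sel
    by (rule exI[of _ u0], rule exI[of _ u1], rule exI[of _ u2], rule exI[of _ u3], rule exI[of _ a], rule exI[of _ b],
        rule exI[of _ c], rule exI[of _ d], rule exI[of _ x], rule exI[of _ y], intro conjI)
      (rule lm refl m face card | simp)+
  note mv = move.R3[OF R]
  show "inK w \<longleftrightarrow> inK w'" using K_move_iff[OF mv] by (simp add: inK_def)
  assume i: "inK w"
  then show "e \<in> cls w \<Longrightarrow> par w' e = par w e"
    using p_move[OF _ mv, of e e] by (simp add: par_def inK_def Id_on_iff)
  have "inK w'" using K_move_iff[OF mv] i by (simp add: inK_def)
  then have 0: "(\<Sum>v\<in>crossing ` {a, b, c, d, x, y}. zmult (incidence w ?\<Delta> v) (par w v)) = 0"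
  proof -
    have "\<forall>D\<in>K. \<forall>D'\<in>K. \<forall>\<Delta> V E. R3 \<Delta> V D D' E \<longrightarrow> (\<Sum>v\<in>V. zmult (incidence (curve D) \<Delta> v) (p D v)) = 0"
      using parity unfolding oriented_parity_def by (elim conjE)
    from this[rule_format, OF i[unfolded inK_def] \<open>inK w'\<close>[unfolded inK_def] R]
    show ?thesis by (simp only: diagram.sel par_def)
  qed
  have inc: "incidence w ?\<Delta> v = (if (v, West) \<in> {fore2 a b \<sigma>1, fore2 c d \<sigma>2, fore2 x y \<sigma>3} \<or>
       (v, East) \<in> {fore2 a b \<sigma>1, fore2 c d \<sigma>2, fore2 x y \<sigma>3} then 1 else - 1)"
    if "v \<in> crossing ` {a, b, c, d, x, y}" for v
  proof -
    have "v \<in> crossings w" using that by (auto simp: w_def)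
    from incidence_fore[OF v this tr(3) tr(1)[symmetric]] show ?thesis unfolding tr(2) .
  qed
  show "(\<Sum>v\<in>crossing ` {a, b, c, d, x, y}. zmult (if
       (v, West) \<in> {fore2 a b \<sigma>1, fore2 c d \<sigma>2, fore2 x y \<sigma>3} \<or>
       (v, East) \<in> {fore2 a b \<sigma>1, fore2 c d \<sigma>2, fore2 x y \<sigma>3} then 1 else - 1) (par w v)) = 0"
    by (rule trans[OF sum.cong[OF refl] 0]) (simp only: inc)
qed

end

lemma other_crossings:
  assumes v: "valid W" and m: "mset W = mset (x # y # R)" and xy: "crossing y = crossing x" "strand y = opp (strand x)"
  shows "crossing x \<notin> crossings R"
proof
  let ?key = "\<lambda>x. (crossing x, strand x)"
  have "valid (x # y # R)" using valid_mset[OF m] v by simp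
  then have d: "?key x \<notin> ?key ` set R" "?key y \<notin> ?key ` set R" unfolding valid_def by simp_all
  assume "crossing x \<in> crossings R"
  then obtain z where z: "z \<in> set R" "crossing z = crossing x" by auto
  then have "?key z = ?key x \<or> ?key z = ?key y" using xy by (cases "strand z = strand x") (auto simp: neq_opp)
  moreover have "?key z \<in> ?key ` set R" using z(1) by (rule imageI)
  ultimately show False using d by metis
qed

section \<open>Tips\<close>

text \<open>
  The strand at gap \<open>0\<close>, called \<open>z\<close>, and the strand at gap \<open>length U\<close>, called \<open>x\<close>, can be made
  parallel across a common face. If \<open>s\<close> is \<open>SENW\<close>, then \<open>x\<close> lies on the left of \<open>z\<close>.
\<close>

definition facing :: "strand \<Rightarrow> passage list \<Rightarrow> passage list \<Rightarrow> bool" where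
  "facing s U V \<longleftrightarrow> adj U V (flip (sd s)) (sd s)"

definition tip :: "strand \<Rightarrow> strand \<Rightarrow> nat \<Rightarrow> nat \<Rightarrow> passage list \<Rightarrow> passage list \<Rightarrow> passage list" where
  "tip s t k l U V = bigon1 s (Classical t) (Classical (opp t)) k l @ U @
     bigon2 True s (Classical t) (Classical (opp t)) k l @ V"

lemma adj_nonempty:
  assumes "good (U @ V)" "adj U V \<sigma> (flip \<sigma>)" shows "U \<noteq> []" "V \<noteq> []"
proof -
  obtain col st where f: "flow col st (U @ V) st" "(fst st \<noteq> snd st) = True"
    using conjunct2[OF iffD1[OF good_iff assms(1)]] by (rule colorableE[where b = True and T = "{}"]) (rule that)
  then obtain m where m: "flow col st U m" "flow col m V st" by (auto simp: flow_append)
  have "val \<sigma> st = val (flip \<sigma>) m" by (rule adjD[OF assms(2) m])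
  then have "st \<noteq> m" using f(2) by (cases \<sigma>) auto
  then show "U \<noteq> []" "V \<noteq> []" using m by auto
qed

lemma good_tip:
  assumes "good (U @ V)" "facing s U V" "k \<noteq> l" "{k, l} \<inter> crossings (U @ V) = {}"
  shows "good (tip s t k l U V)"
proof -
  have "U \<noteq> []" "V \<noteq> []" using adj_nonempty[OF assms(1)] assms(2)[unfolded facing_def]
    by (metis flip_flip)+
  then show ?thesis unfolding tip_def
    by (intro good_bigon[where \<beta> = "opp s"]) (use assms in \<open>auto simp: facing_def\<close>)
qed

context parity
begin

lemma inK_tip:
  assumes "inK (U @ V)" "facing s U V" "k \<noteq> l" "{k, l} \<inter> crossings (U @ V) = {}"
  shows "inK (tip s t k l U V)" "c \<in> cls (U @ V) \<Longrightarrow> par (tip s t k l U V) c = par (U @ V) c"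
    "par (tip s t k l U V) l = - par (tip s t k l U V) k"
  using R2_par[of "[]" U V s t k l True] good_tip[OF inK_good[OF assms(1)] assms(2-4), of t] inK_good[OF assms(1)] assms(1)
  by (simp_all add: tip_def)

text \<open>
  The parity of the crossing at which \<open>z\<close> and \<open>x\<close> enter the bigon of the tip.
\<close>

definition tip_value :: "strand \<Rightarrow> strand \<Rightarrow> passage list \<Rightarrow> passage list \<Rightarrow> 'a" where
  "tip_value s t U V = (let f = fresh (U @ V) in par (tip s t f (f + 1) U V) f)"

lemma tip_value_eq:
  assumes i: "inK (U @ V)" "facing s U V" and k: "k \<noteq> l" "{k, l} \<inter> crossings (U @ V) = {}"
  shows "par (tip s t k l U V) k = tip_value s t U V"
proof -
  let ?f = "fresh (U @ V)"
  have f: "?f \<noteq> ?f + 1" "{?f, ?f + 1} \<inter> crossings (U @ V) = {}"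
    using fresh[of "U @ V" 0] fresh[of "U @ V" 1] by auto
  define \<sigma> where "\<sigma> = (\<lambda>c. if c = ?f then k else if c = ?f + 1 then l else c)"
  let ?w = "tip s t ?f (?f + 1) U V"
  have id: "\<sigma> c = c" if c: "c \<in> crossings (U @ V)" for c
  proof -
    have "c \<noteq> ?f" "c \<noteq> ?f + 1" using c f(2) by blast+
    then show ?thesis by (simp only: \<sigma>_def if_False)
  qed
  have cw: "crossings ?w = {?f, ?f + 1} \<union> crossings (U @ V)"
    by (auto simp: tip_def bigon1_def bigon2_def)
  have s3: "\<sigma> ?f = k" "\<sigma> (?f + 1) = l" by (auto simp: \<sigma>_def)
  have old: "a = b" if a: "a \<in> crossings (U @ V)" and b: "b \<in> crossings ?w" and e: "\<sigma> a = \<sigma> b" for a b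
  proof -
    have "b \<notin> {?f, ?f + 1}"
    proof
      assume "b \<in> {?f, ?f + 1}"
      then have "\<sigma> b \<in> {k, l}" using s3 by auto
      then have "a \<in> {k, l}" using e id[OF a] by simp
      then show False using a k(2) by blast
    qed
    then have "b \<in> crossings (U @ V)" using b unfolding cw by blast
    then show ?thesis using e id[OF a] id[of b] by simp
  qed
  have inj: "inj_on \<sigma> (crossings ?w)"
  proof (rule inj_onI)
    fix a b assume a: "a \<in> crossings ?w" and b: "b \<in> crossings ?w" and e: "\<sigma> a = \<sigma> b"
    show "a = b"
    proof (cases "a \<in> crossings (U @ V) \<or> b \<in> crossings (U @ V)")
      case True then show ?thesis
        by (elim disjE) (rule old[OF _ b e], assumption, rule old[OF _ a e[symmetric], symmetric], assumption)
    next
      case False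
      then have "a \<in> {?f, ?f + 1}" "b \<in> {?f, ?f + 1}" using a b unfolding cw by blast+
      then show ?thesis using e s3 k(1) by auto
    qed
  qed
  have "map (rename \<sigma>) U = U" "map (rename \<sigma>) V = V"
    using id by (auto intro!: map_idI simp: rename_def)
  then have m: "map (rename \<sigma>) ?w = tip s t k l U V"
    by (simp add: tip_def bigon1_def bigon2_def rename_def \<sigma>_def)
  have "?f \<in> cls ?w" by (simp add: cls_append cls_Cons tip_def bigon1_def)
  from par_rename[OF inK_tip(1)[OF i f] inj this] show ?thesis unfolding m s3 by (simp add: tip_value_def Let_def)
qed

text \<open>
  The crossings \<open>l\<close> and \<open>w\<close> bound a bigon as well. Removing it by a second Reidemeister move
  leaves \<open>k\<close> in the place of \<open>w\<close>.
\<close>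

lemma tip_below:
  fixes w s m
  defines "x \<equiv> Passage w s (Classical m)" and "y \<equiv> Passage w (opp s) (Classical m)"
  assumes i: "inK (x # U @ y # V)"
  shows "facing s (x # U) (y # V)" "tip_value s m (x # U) (y # V) = par (x # U @ y # V) w"
proof -
  show fc: "facing s (x # U) (y # V)" unfolding facing_def adj_def
    by (intro allI impI) (cases s; auto simp: before_def x_def y_def)
  obtain k l n where "distinct [k, l, n]" "{k, l, n} \<inter> crossings (x # U @ y # V) = {}" by (rule fresh_names)
  then have k: "k \<noteq> l" "{k, l} \<inter> crossings ((x # U) @ (y # V)) = {}" by auto
  have i': "inK ((x # U) @ (y # V))" using i by simp
  let ?T = "tip s m k l (x # U) (y # V)"
  have T: "inK ?T" "par ?T l = - par ?T k" using inK_tip[OF i' fc k] by blast+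
  define \<sigma> where "\<sigma> c = (if c = w then k else c)" for c
  have wU: "w \<notin> crossings (U @ V)"
  proof -
    have "valid (x # U @ y # V)" using inK_good[OF i] good_iff by blast
    from other_crossings[OF this, of x y "U @ V"] show ?thesis by (simp add: x_def y_def)
  qed
  have inj: "inj_on \<sigma> (crossings (x # U @ y # V))"
    using k(2) by (auto simp: inj_on_def \<sigma>_def)
  have "map (rename \<sigma>) U = U" "map (rename \<sigma>) V = V"
    using wU by (auto intro!: map_idI simp: rename_def \<sigma>_def)
  then have B: "map (rename \<sigma>) (x # U @ y # V) = [Passage k s (Classical m)] @ (U @ [Passage k (opp s) (Classical m)]) @ V" (is "_ = ?B")
    by (simp add: x_def y_def rename_def \<sigma>_def)
  have iB: "inK ?B" using inK_rename[OF i inj] unfolding B .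
  have "w \<in> cls (x # U @ y # V)" by (simp add: cls_Cons x_def)
  from par_rename[OF i inj this] have "par ?B k = par (x # U @ y # V) w" unfolding B by (simp add: \<sigma>_def)
  moreover have "?T = [Passage k s (Classical m)] @ bigon1 (opp s) (Classical (opp m)) (Classical (opp (opp m))) l w @
      (U @ [Passage k (opp s) (Classical m)]) @ bigon2 True (opp s) (Classical (opp m)) (Classical (opp (opp m))) l w @ V"
    by (simp add: tip_def bigon1_def bigon2_def x_def y_def)
  then have "par ?T k = par ?B k"
    using R2_par(2)[of "[Passage k s (Classical m)]" "U @ [Passage k (opp s) (Classical m)]" V "opp s" "opp m" l w True k]
      T(1) iB inK_good[OF T(1)] inK_good[OF iB] by (simp add: cls_Cons)
  ultimately show "tip_value s m (x # U) (y # V) = par (x # U @ y # V) w"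
    using tip_value_eq[OF i' fc k, of m] by simp
qed

text \<open>
  Now \<open>k\<close> and \<open>w\<close> bound a bigon, so their parities cancel; removing it leaves \<open>l\<close> in the place of
  \<open>w\<close>.
\<close>

lemma tip_above:
  fixes w s m
  defines "x \<equiv> Passage w s (Classical m)" and "y \<equiv> Passage w (opp s) (Classical m)"
  assumes i: "inK ((U @ [x]) @ V @ [y])"
  shows "facing s (U @ [x]) (V @ [y])" "tip_value s (opp m) (U @ [x]) (V @ [y]) = - par ((U @ [x]) @ V @ [y]) w"
proof -
  show fc: "facing s (U @ [x]) (V @ [y])" unfolding facing_def adj_def
    by (intro allI impI) (cases s; auto simp: before_def after_def flow_append x_def y_def)
  obtain k l n where "distinct [k, l, n]" "{k, l, n} \<inter> crossings ((U @ [x]) @ V @ [y]) = {}" by (rule fresh_names)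
  then have k: "k \<noteq> l" "{k, l} \<inter> crossings ((U @ [x]) @ V @ [y]) = {}" by auto
  let ?T = "tip s (opp m) k l (U @ [x]) (V @ [y])"
  have wc: "w \<in> cls ((U @ [x]) @ V @ [y])" by (simp add: cls_append cls_Cons x_def)
  have T: "inK ?T" "par ?T w = par ((U @ [x]) @ V @ [y]) w" using inK_tip[OF i fc k] wc by blast+
  define \<sigma> where "\<sigma> c = (if c = w then l else c)" for c
  have wU: "w \<notin> crossings (U @ V)"
  proof -
    have "valid ((U @ [x]) @ V @ [y])" using inK_good[OF i] good_iff by blast
    from other_crossings[OF this, of x y "U @ V"] show ?thesis by (simp add: x_def y_def)
  qed
  have inj: "inj_on \<sigma> (crossings ((U @ [x]) @ V @ [y]))"
    using k(2) by (auto simp: inj_on_def \<sigma>_def)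
  have "map (rename \<sigma>) U = U" "map (rename \<sigma>) V = V"
    using wU by (auto intro!: map_idI simp: rename_def \<sigma>_def)
  then have B: "map (rename \<sigma>) ((U @ [x]) @ V @ [y]) = (U @ [Passage l s (Classical m)] @ V) @ [Passage l (opp s) (Classical m)]" (is "_ = ?B @ ?l")
    by (simp add: x_def y_def rename_def \<sigma>_def)
  have "inK (?B @ ?l)" using inK_rename[OF i inj] unfolding B .
  then have iB: "inK ((?l @ U) @ ([Passage l s (Classical m)] @ V) @ [])" using inK_rotate[of ?B ?l] by simp
  let ?A1 = "bigon1 s (Classical m) (Classical (opp m)) w k" and ?A2 = "bigon2 True s (Classical m) (Classical (opp m)) w k"
  have e: "?T = [Passage k s (Classical (opp m))] @ (?l @ U @ ?A1 @ [Passage l s (Classical m)] @ V @ [y])"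
    by (simp add: tip_def bigon1_def bigon2_def x_def y_def)
  have e2: "(?l @ U @ ?A1 @ [Passage l s (Classical m)] @ V @ [y]) @ [Passage k s (Classical (opp m))] =
      (?l @ U) @ ?A1 @ ([Passage l s (Classical m)] @ V) @ ?A2 @ []"
    by (simp add: bigon1_def bigon2_def y_def)
  have iR: "inK ((?l @ U) @ ?A1 @ ([Passage l s (Classical m)] @ V) @ ?A2 @ [])"
    using T(1) inK_rotate unfolding e e2[symmetric] by blast
  have pr: "par ((?l @ U) @ ?A1 @ ([Passage l s (Classical m)] @ V) @ ?A2 @ []) c = par ?T c" if "c \<in> cls ?T" for c
    using par_rotate[of "[Passage k s (Classical (opp m))]" _ c] T(1) that unfolding e e2[symmetric] by blast
  have kw: "k \<in> cls ?T" "w \<in> cls ?T" by (simp_all add: tip_def bigon1_def cls_Cons cls_append x_def)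
  have "par ?T k = - par ?T w"
    using R2_par(3)[of "?l @ U" "[Passage l s (Classical m)] @ V" "[]" s m w k True]
      inK_good[OF iR] inK_good[OF iB] iB pr[OF kw(1)] pr[OF kw(2)] by simp
  then show "tip_value s (opp m) (U @ [x]) (V @ [y]) = - par ((U @ [x]) @ V @ [y]) w"
    using tip_value_eq[OF i fc k, of "opp m"] T(2) by simp
qed

end

section \<open>The relation at a corner\<close>

lemma flow_split:
  assumes "flow col a (xs @ ys) c" obtains b where "flow col a xs b" "flow col b ys c"
  using assms unfolding flow_append by (elim exE conjE) (rule that)

lemma flow_join: "flow col a xs b \<Longrightarrow> flow col b ys c \<Longrightarrow> flow col a (xs @ ys) c"
  unfolding flow_append by (rule exI, rule conjI)

context parity
begin

lemma R2_insert:
  fixes u v x s t k l pl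
  defines "A \<equiv> bigon1 s (Classical t) (Classical (opp t)) k l"
    and "B \<equiv> bigon2 pl s (Classical t) (Classical (opp t)) k l"
  assumes i: "inK (u @ v @ x)" and ne: "v \<noteq> []" "x @ u \<noteq> []"
    and a: "adj v (x @ u) (sd (if pl then opp s else s)) (sd s)"
    and k: "k \<noteq> l" "{k, l} \<inter> crossings (u @ v @ x) = {}"
  shows "inK (u @ A @ v @ B @ x)" "c \<in> cls (u @ v @ x) \<Longrightarrow> par (u @ A @ v @ B @ x) c = par (u @ v @ x) c"
    "par (u @ A @ v @ B @ x) l = - par (u @ A @ v @ B @ x) k"
proof -
  have "good (v @ (x @ u))" using good_rotate[of u "v @ x"] inK_good[OF i] by simp
  then have "good (A @ v @ B @ (x @ u))" unfolding A_def B_def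
    by (intro good_bigon[OF _ ne refl a]) (use k in auto)
  then have g: "good (u @ A @ v @ B @ x)" using good_rotate[of "A @ v @ B @ x" u] by simp
  note R = R2_par[OF inK_good[OF i] g[unfolded A_def B_def], folded A_def B_def]
  show "inK (u @ A @ v @ B @ x)" "c \<in> cls (u @ v @ x) \<Longrightarrow> par (u @ A @ v @ B @ x) c = par (u @ v @ x) c"
    "par (u @ A @ v @ B @ x) l = - par (u @ A @ v @ B @ x) k"
    using R i by blast+
qed

text \<open>
  The strand \<open>z\<close> is moved across \<open>w\<close>. The tip \<open>k\<close>, \<open>l\<close> is on the outgoing edge of the one strand
  of \<open>w\<close>, and a removable bigon \<open>m\<close>, \<open>n\<close> is made on the outgoing edge of the other one. A third
  Reidemeister move at the triangle \<open>k\<close>, \<open>m\<close>, \<open>w\<close> relates the parities. After another one at \<open>l\<close>,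
  \<open>n\<close>, \<open>w\<close> the bigon \<open>k\<close>, \<open>l\<close> is removable, and \<open>m\<close>, \<open>n\<close> are the tip on the incoming edge.
\<close>

lemma corner_tips_first:
  fixes w k l m n :: nat and s t q :: strand
  defines "s' \<equiv> opp s" and "t' \<equiv> opp t"
  assumes d: "distinct [k, l, m, n, w]" "{k, l, m, n, w} \<inter> crossings (U1 @ U2 @ U3) = {}"
    and 1: "inK ([Passage k s (Classical t), Passage l s' (Classical t')] @ U1 @
      [Passage w s' (Classical q), Passage k s' (Classical t), Passage l s (Classical t')] @ U2 @
      [Passage w s (Classical q)] @ U3)" (is "inK ?T1")
    and 2: "inK ([Passage m s (Classical t), Passage n s' (Classical t')] @ U1 @
      [Passage w s' (Classical q)] @ U2 @
      [Passage m s' (Classical t), Passage n s (Classical t'), Passage w s (Classical q)] @ U3)" (is "inK ?T2")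
  shows "par ?T1 k = par ?T1 w + par ?T2 m"
proof -
  let ?ks = "Passage k s (Classical t)" and ?ks' = "Passage k s' (Classical t)"
  let ?ls = "Passage l s (Classical t')" and ?ls' = "Passage l s' (Classical t')"
  let ?ms = "Passage m s (Classical t)" and ?ms' = "Passage m s' (Classical t)"
  let ?ns = "Passage n s (Classical t')" and ?ns' = "Passage n s' (Classical t')"
  let ?ws = "Passage w s (Classical q)" and ?ws' = "Passage w s' (Classical q)"
  let ?W1 = "[?ks, ?ms] @ ([?ns', ?ls'] @ U1) @ [?ws', ?ks'] @ ([?ls] @ U2) @ [?ws, ?ms'] @ ([?ns] @ U3)"
  let ?W2 = "[?ms, ?ks] @ ([?ns', ?ls'] @ U1) @ [?ks', ?ws'] @ ([?ls] @ U2) @ [?ms', ?ws] @ ([?ns] @ U3)"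
  let ?W3 = "[?ms, ?ks] @ [?ls', ?ns'] @ (U1 @ [?ks']) @ [?ls, ?ws'] @ (U2 @ [?ms']) @ [?ns, ?ws] @ U3"
  have b1: "bigon1 s (Classical t) (Classical (opp t)) a b = [Passage a s (Classical t), Passage b s' (Classical t')]"
    and b2: "bigon2 True s (Classical t) (Classical (opp t)) a b = [Passage a s' (Classical t), Passage b s (Classical t')]" for a b
    by (simp_all add: bigon1_def bigon2_def s'_def t'_def)
  have W1: "inK ?W1" "par ?W1 k = par ?T1 k" "par ?W1 w = par ?T1 w"
  proof -
    have a: "adj ([?ls'] @ U1 @ [?ws', ?ks', ?ls] @ U2 @ [?ws]) (U3 @ [?ks]) (sd (if True then opp s else s)) (sd s)"
      unfolding adj_def by (intro allI impI) (cases s; auto simp: before_def after_def flow_append s'_def)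
    have i: "inK ([?ks] @ ([?ls'] @ U1 @ [?ws', ?ks', ?ls] @ U2 @ [?ws]) @ U3)" using 1 by simp
    have f: "m \<noteq> n" "{m, n} \<inter> crossings ([?ks] @ ([?ls'] @ U1 @ [?ws', ?ks', ?ls] @ U2 @ [?ws]) @ U3) = {}"
      using d by (auto simp: image_Un)
    note R = R2_insert[OF i _ _ a f, where t = t, unfolded b1 b2, simplified]
    show "inK ?W1" "par ?W1 k = par ?T1 k" "par ?W1 w = par ?T1 w"
      using R by (simp_all add: cls_Cons cls_append)
  qed
  have W3: "inK ?W3" "par ?W3 m = par ?T2 m"
  proof -
    have a: "adj ([?ns'] @ U1) ([?ws'] @ U2 @ [?ms', ?ns, ?ws] @ U3 @ [?ms]) (sd (if True then opp s else s)) (sd s)"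
      unfolding adj_def by (intro allI impI) (cases s; auto simp: before_def after_def flow_append s'_def)
    have a: "adj ([?ns'] @ U1) (([?ws'] @ U2 @ [?ms', ?ns, ?ws] @ U3) @ [?ms]) (sd (if True then opp s else s)) (sd s)"
      using a by simp
    have i: "inK ([?ms] @ ([?ns'] @ U1) @ ([?ws'] @ U2 @ [?ms', ?ns, ?ws] @ U3))" using 2 by simp
    have f: "k \<noteq> l" "{k, l} \<inter> crossings ([?ms] @ ([?ns'] @ U1) @ ([?ws'] @ U2 @ [?ms', ?ns, ?ws] @ U3)) = {}"
      using d by (auto simp: image_Un)
    note R = R2_insert[OF i _ _ a f, where t = t, unfolded b1 b2, simplified]
    show "inK ?W3" "par ?W3 m = par ?T2 m"
      using R by (simp_all add: cls_Cons cls_append)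
  qed
  have W2: "good ?W2"
    by (rule good_triangle[where k = k and m = m and w = w and s = s and ?X1.0 = "[?ws', ?ks']" and ?X2.0 = "[?ws, ?ms']",
          OF _ _ _ inK_good[OF W1(1)]])
      (use d in \<open>auto simp: s'_def image_Un\<close>)
  have tr1: "triangle ?ks ?ms (flip (sd s)) ?ws' ?ks' (flip (sd s)) ?ws ?ms' (sd s)"
    by (cases s) (simp_all add: triangle_def s'_def)
  note R1 = R3_par[where ?u0.0 = "[]", unfolded append_Nil, OF inK_good[OF W1(1)] W2 tr1]
  have ov1: "\<exists>(z, z')\<in>{(?ks, ?ms), (?ws', ?ks'), (?ws, ?ms')}. over z \<and> over z'"
    "\<exists>(z, z')\<in>{(?ks, ?ms), (?ws', ?ks'), (?ws, ?ms')}. under z \<and> under z'"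
    by (cases s; cases t; cases q; simp add: over_def under_def s'_def)+
  have W2': "inK ?W2" "par ?W2 m = par ?W1 m"
    using R1(1,2)[OF _ ov1] W1(1) by (simp_all add: cls_Cons)
  have "par ?W1 k = par ?W1 w + par ?W1 m"
  proof -
    have "crossing ` {?ks, ?ms, ?ws', ?ks', ?ws, ?ms'} = {k, m, w}" by auto
    then have "(\<Sum>v\<in>{k, m, w}. zmult (if
       (v, West) \<in> {fore2 ?ks ?ms (flip (sd s)), fore2 ?ws' ?ks' (flip (sd s)), fore2 ?ws ?ms' (sd s)} \<or>
       (v, East) \<in> {fore2 ?ks ?ms (flip (sd s)), fore2 ?ws' ?ks' (flip (sd s)), fore2 ?ws ?ms' (sd s)} then 1 else - 1) (par ?W1 v)) = 0"
      using R1(3)[OF _ ov1 W1(1)] by simp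
    moreover have "m \<noteq> k" "w \<noteq> k" "m \<noteq> w" "w \<noteq> m" "k \<noteq> m"
      "k \<noteq> w" using d(1) by auto
    ultimately have "par ?W1 k + (- par ?W1 m - par ?W1 w) = 0"
      unfolding s'_def by (cases s) (simp_all del: append.simps)
    then show ?thesis by (simp add: algebra_simps)
  qed
  moreover have "par ?W3 m = par ?W2 m"
  proof -
    have tr2: "triangle ?ns' ?ls' (sd s) ?ws' ?ls (flip (sd s)) ?ws ?ns (sd s)"
      by (cases s) (simp_all add: triangle_def s'_def)
    have ov2: "\<exists>(z, z')\<in>{(?ns', ?ls'), (?ws', ?ls), (?ws, ?ns)}. over z \<and> over z'"
      "\<exists>(z, z')\<in>{(?ns', ?ls'), (?ws', ?ls), (?ws, ?ns)}. under z \<and> under z'"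
      by (cases s; cases t; cases q; simp add: over_def under_def s'_def t'_def)+
    have e2: "?W2 = [?ms, ?ks] @ [?ns', ?ls'] @ (U1 @ [?ks']) @ [?ws', ?ls] @ (U2 @ [?ms']) @ [?ws, ?ns] @ U3"
      by simp
    show ?thesis
      using R3_par(2)[OF W2[unfolded e2] inK_good[OF W3(1)] tr2 _ ov2, of m] W2'(1)
      unfolding e2 by (simp add: cls_Cons)
  qed
  ultimately show ?thesis using W1(2,3) W2'(2) W3(2) by simp
qed

text \<open>
  The same moves, when \<open>z\<close> meets the two passages of \<open>w\<close> in the other order.
\<close>

lemma corner_tips_second:
  fixes w k l m n :: nat and s t q :: strand
  defines "s' \<equiv> opp s" and "t' \<equiv> opp t"
  assumes d: "distinct [k, l, m, n, w]" "{k, l, m, n, w} \<inter> crossings (U1 @ U2 @ U3) = {}"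
    and 1: "inK ([Passage k s (Classical t), Passage l s' (Classical t')] @ U1 @
      [Passage w s (Classical q)] @ U2 @
      [Passage w s' (Classical q), Passage k s' (Classical t), Passage l s (Classical t')] @ U3)" (is "inK ?T1")
    and 2: "inK ([Passage m s (Classical t), Passage n s' (Classical t')] @ U1 @
      [Passage m s' (Classical t), Passage n s (Classical t'), Passage w s (Classical q)] @ U2 @
      [Passage w s' (Classical q)] @ U3)" (is "inK ?T2")
  shows "par ?T1 k = par ?T1 w + par ?T2 m"
proof -
  let ?ks = "Passage k s (Classical t)" and ?ks' = "Passage k s' (Classical t)"
  let ?ls = "Passage l s (Classical t')" and ?ls' = "Passage l s' (Classical t')"
  let ?ms = "Passage m s (Classical t)" and ?ms' = "Passage m s' (Classical t)"
  let ?ns = "Passage n s (Classical t')" and ?ns' = "Passage n s' (Classical t')"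
  let ?ws = "Passage w s (Classical q)" and ?ws' = "Passage w s' (Classical q)"
  let ?W1 = "[?ks, ?ms] @ ([?ns', ?ls'] @ U1) @ [?ws, ?ms'] @ ([?ns] @ U2) @ [?ws', ?ks'] @ ([?ls] @ U3)"
  let ?W2 = "[?ms, ?ks] @ ([?ns', ?ls'] @ U1) @ [?ms', ?ws] @ ([?ns] @ U2) @ [?ks', ?ws'] @ ([?ls] @ U3)"
  let ?W3 = "[?ms, ?ks] @ [?ls', ?ns'] @ (U1 @ [?ms']) @ [?ns, ?ws] @ (U2 @ [?ks']) @ [?ls, ?ws'] @ U3"
  have b1: "bigon1 s (Classical t) (Classical (opp t)) a b = [Passage a s (Classical t), Passage b s' (Classical t')]"
    and b2: "bigon2 True s (Classical t) (Classical (opp t)) a b = [Passage a s' (Classical t), Passage b s (Classical t')]" for a b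
    by (simp_all add: bigon1_def bigon2_def s'_def t'_def)
  have W1: "inK ?W1" "par ?W1 k = par ?T1 k" "par ?W1 w = par ?T1 w"
  proof -
    have a: "adj ([?ls'] @ U1 @ [?ws]) ((U2 @ [?ws', ?ks', ?ls] @ U3) @ [?ks]) (sd (if True then opp s else s)) (sd s)"
      unfolding adj_def by (intro allI impI) (cases s; auto simp: before_def after_def flow_append s'_def)
    have i: "inK ([?ks] @ ([?ls'] @ U1 @ [?ws]) @ (U2 @ [?ws', ?ks', ?ls] @ U3))" using 1 by simp
    have f: "m \<noteq> n" "{m, n} \<inter> crossings ([?ks] @ ([?ls'] @ U1 @ [?ws]) @ (U2 @ [?ws', ?ks', ?ls] @ U3)) = {}"
      using d by (auto simp: image_Un)
    note R = R2_insert[OF i _ _ a f, where t = t, unfolded b1 b2, simplified]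
    show "inK ?W1" "par ?W1 k = par ?T1 k" "par ?W1 w = par ?T1 w"
      using R by (simp_all add: cls_Cons cls_append)
  qed
  have W3: "inK ?W3" "par ?W3 m = par ?T2 m"
  proof -
    have a: "adj ([?ns'] @ U1 @ [?ms', ?ns, ?ws] @ U2) (([?ws'] @ U3) @ [?ms]) (sd (if True then opp s else s)) (sd s)"
      unfolding adj_def by (intro allI impI) (cases s; auto simp: before_def after_def flow_append s'_def)
    have i: "inK ([?ms] @ ([?ns'] @ U1 @ [?ms', ?ns, ?ws] @ U2) @ ([?ws'] @ U3))" using 2 by simp
    have f: "k \<noteq> l" "{k, l} \<inter> crossings ([?ms] @ ([?ns'] @ U1 @ [?ms', ?ns, ?ws] @ U2) @ ([?ws'] @ U3)) = {}"
      using d by (auto simp: image_Un)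
    note R = R2_insert[OF i _ _ a f, where t = t, unfolded b1 b2, simplified]
    show "inK ?W3" "par ?W3 m = par ?T2 m"
      using R by (simp_all add: cls_Cons cls_append)
  qed
  have W2: "good ?W2"
    by (rule good_triangle[where k = k and m = m and w = w and s = s and ?X1.0 = "[?ws, ?ms']" and ?X2.0 = "[?ws', ?ks']",
          OF _ _ _ inK_good[OF W1(1)]])
      (use d in \<open>auto simp: s'_def image_Un\<close>)
  have tr1: "triangle ?ks ?ms (flip (sd s)) ?ws ?ms' (sd s) ?ws' ?ks' (flip (sd s))"
    by (cases s) (simp_all add: triangle_def s'_def)
  note R1 = R3_par[where ?u0.0 = "[]", unfolded append_Nil, OF inK_good[OF W1(1)] W2 tr1]
  have ov1: "\<exists>(z, z')\<in>{(?ks, ?ms), (?ws, ?ms'), (?ws', ?ks')}. over z \<and> over z'"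
    "\<exists>(z, z')\<in>{(?ks, ?ms), (?ws, ?ms'), (?ws', ?ks')}. under z \<and> under z'"
    by (cases s; cases t; cases q; simp add: over_def under_def s'_def)+
  have W2': "inK ?W2" "par ?W2 m = par ?W1 m"
    using R1(1,2)[OF _ ov1] W1(1) by (simp_all add: cls_Cons)
  have "par ?W1 k = par ?W1 w + par ?W1 m"
  proof -
    have "crossing ` {?ks, ?ms, ?ws, ?ms', ?ws', ?ks'} = {k, m, w}" by auto
    then have "(\<Sum>v\<in>{k, m, w}. zmult (if
       (v, West) \<in> {fore2 ?ks ?ms (flip (sd s)), fore2 ?ws ?ms' (sd s), fore2 ?ws' ?ks' (flip (sd s))} \<or>
       (v, East) \<in> {fore2 ?ks ?ms (flip (sd s)), fore2 ?ws ?ms' (sd s), fore2 ?ws' ?ks' (flip (sd s))} then 1 else - 1) (par ?W1 v)) = 0"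
      using R1(3)[OF _ ov1 W1(1)] by simp
    moreover have "m \<noteq> k" "w \<noteq> k" "m \<noteq> w" "w \<noteq> m" "k \<noteq> m"
      "k \<noteq> w" using d(1) by auto
    ultimately have "par ?W1 k + (- par ?W1 m - par ?W1 w) = 0"
      unfolding s'_def by (cases s) (simp_all del: append.simps)
    then show ?thesis by (simp add: algebra_simps)
  qed
  moreover have "par ?W3 m = par ?W2 m"
  proof -
    have tr2: "triangle ?ns' ?ls' (sd s) ?ws ?ns (sd s) ?ws' ?ls (flip (sd s))"
      by (cases s) (simp_all add: triangle_def s'_def)
    have ov2: "\<exists>(z, z')\<in>{(?ns', ?ls'), (?ws, ?ns), (?ws', ?ls)}. over z \<and> over z'"
      "\<exists>(z, z')\<in>{(?ns', ?ls'), (?ws, ?ns), (?ws', ?ls)}. under z \<and> under z'"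
      by (cases s; cases t; cases q; simp add: over_def under_def s'_def t'_def)+
    have e2: "?W2 = [?ms, ?ks] @ [?ns', ?ls'] @ (U1 @ [?ms']) @ [?ws, ?ns] @ (U2 @ [?ks']) @ [?ws', ?ls] @ U3"
      by simp
    show ?thesis
      using R3_par(2)[OF W2[unfolded e2] inK_good[OF W3(1)] tr2 _ ov2, of m] W2'(1)
      unfolding e2 by (simp add: cls_Cons)
  qed
  ultimately show ?thesis using W1(2,3) W2'(2) W3(2) by simp
qed

text \<open>
  The face of \<open>z\<close> has a corner at \<open>w\<close> between the outgoing edge of the passage \<open>y\<close> and the
  incoming edge of the passage \<open>x\<close>. In this lemma the knot, read from \<open>z\<close>, meets \<open>y\<close> first; in the
  next one it meets \<open>x\<close> first.
\<close>

lemma corner_first: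
  fixes w s q
  defines "x \<equiv> Passage w s (Classical q)" and "y \<equiv> Passage w (opp s) (Classical q)"
  assumes i: "inK (U1 @ [y] @ U2 @ [x] @ U3)" and f: "facing s (U1 @ [y]) (U2 @ [x] @ U3)"
  shows "facing s (U1 @ [y] @ U2) ([x] @ U3)"
    "tip_value s t (U1 @ [y]) (U2 @ [x] @ U3) - tip_value s t (U1 @ [y] @ U2) ([x] @ U3) = par (U1 @ [y] @ U2 @ [x] @ U3) w"
proof -
  let ?B = "U1 @ [y] @ U2 @ [x] @ U3"
  show f2: "facing s (U1 @ [y] @ U2) ([x] @ U3)"
    unfolding facing_def
  proof (unfold adj_def, intro allI impI)
    fix col a b
    assume fl: "flow col a (U1 @ [y] @ U2) b" "flow col b ([x] @ U3) a"
    obtain m where m: "flow col a (U1 @ [y]) m" "flow col m U2 b"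
      by (rule flow_split[of col a "U1 @ [y]" U2 b]) (use fl(1) in simp)
    from this(2) have "flow col m (U2 @ [x] @ U3) a" by (rule flow_join) (rule fl(2))
    from adjD[OF f[unfolded facing_def] m(1) this] have "val (flip (sd s)) a = val (sd s) m" .
    moreover have "m = after col y" "b = before col x"
      using m fl(2) flow_split[of col _ U1 "[y]" m] by (auto elim!: flow_split)
    ultimately show "val (flip (sd s)) a = val (sd s) b"
      by (cases s) (simp_all add: before_def after_def x_def y_def)
  qed
  obtain k l n where kl: "distinct [k, l, n]" "{k, l, n} \<inter> crossings ?B = {}" by (rule fresh_names)
  obtain m n' n'' where mn: "distinct [m, n', n'']"
    "{m, n', n''} \<inter> crossings (?B @ [Passage k s Virtual, Passage l s Virtual]) = {}"
    by (rule fresh_names)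
  have "w \<notin> crossings (U1 @ U2 @ U3)"
  proof -
    have "valid ?B" using inK_good[OF i] good_iff by blast
    from other_crossings[OF this, of x y "U1 @ U2 @ U3"] show ?thesis by (simp add: x_def y_def)
  qed
  then have d: "distinct [k, l, m, n', w]" "{k, l, m, n', w} \<inter> crossings (U1 @ U2 @ U3) = {}"
    using kl mn by (auto simp: image_Un x_def y_def)
  have i1: "inK ((U1 @ [y]) @ (U2 @ [x] @ U3))" and i2: "inK ((U1 @ [y] @ U2) @ ([x] @ U3))" using i by simp_all
  have k1: "k \<noteq> l" "{k, l} \<inter> crossings ((U1 @ [y]) @ (U2 @ [x] @ U3)) = {}" using kl by auto
  have k2: "m \<noteq> n'" "{m, n'} \<inter> crossings ((U1 @ [y] @ U2) @ ([x] @ U3)) = {}" using mn by auto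
  note T1 = inK_tip[OF i1 f k1, where t = t] and T2 = inK_tip[OF i2 f2 k2, where t = t]
  have wc: "w \<in> cls ((U1 @ [y]) @ (U2 @ [x] @ U3))" by (simp add: cls_append cls_Cons x_def)
  have "par (tip s t k l (U1 @ [y]) (U2 @ [x] @ U3)) k = par (tip s t k l (U1 @ [y]) (U2 @ [x] @ U3)) w +
      par (tip s t m n' (U1 @ [y] @ U2) ([x] @ U3)) m"
    using corner_tips_first[OF d, of s t q] T1(1) T2(1) by (simp add: tip_def bigon1_def bigon2_def x_def y_def)
  then show "tip_value s t (U1 @ [y]) (U2 @ [x] @ U3) - tip_value s t (U1 @ [y] @ U2) ([x] @ U3) = par ?B w"
    unfolding diff_eq_eq using tip_value_eq[OF i1 f k1, where t = t] tip_value_eq[OF i2 f2 k2, where t = t] T1(2)[OF wc] by simp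
qed

lemma corner_second:
  fixes w s q
  defines "x \<equiv> Passage w s (Classical q)" and "y \<equiv> Passage w (opp s) (Classical q)"
  assumes i: "inK (U1 @ [x] @ U2 @ [y] @ U3)" and f: "facing s (U1 @ [x] @ U2 @ [y]) U3"
  shows "facing s U1 ([x] @ U2 @ [y] @ U3)"
    "tip_value s t (U1 @ [x] @ U2 @ [y]) U3 - tip_value s t U1 ([x] @ U2 @ [y] @ U3) = par (U1 @ [x] @ U2 @ [y] @ U3) w"
proof -
  let ?B = "U1 @ [x] @ U2 @ [y] @ U3"
  show f2: "facing s U1 ([x] @ U2 @ [y] @ U3)"
    unfolding facing_def
  proof (unfold adj_def, intro allI impI)
    fix col a b
    assume fl: "flow col a U1 b" "flow col b ([x] @ U2 @ [y] @ U3) a"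
    obtain m where m: "flow col b ([x] @ U2 @ [y]) m" "flow col m U3 a"
      by (rule flow_split[of col b "[x] @ U2 @ [y]" U3 a]) (use fl(2) in simp)
    from this(1) have "flow col a (U1 @ [x] @ U2 @ [y]) m" by (rule flow_join[OF fl(1)])
    from adjD[OF f[unfolded facing_def] this m(2)] have "val (flip (sd s)) a = val (sd s) m" .
    moreover have "m = after col y" "b = before col x" using m fl(2) by (auto elim!: flow_split)
    ultimately show "val (flip (sd s)) a = val (sd s) b"
      by (cases s) (simp_all add: before_def after_def x_def y_def)
  qed
  obtain k l n where kl: "distinct [k, l, n]" "{k, l, n} \<inter> crossings ?B = {}" by (rule fresh_names)
  obtain m n' n'' where mn: "distinct [m, n', n'']"
    "{m, n', n''} \<inter> crossings (?B @ [Passage k s Virtual, Passage l s Virtual]) = {}"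
    by (rule fresh_names)
  have "w \<notin> crossings (U1 @ U2 @ U3)"
  proof -
    have "valid ?B" using inK_good[OF i] good_iff by blast
    from other_crossings[OF this, of x y "U1 @ U2 @ U3"] show ?thesis by (simp add: x_def y_def)
  qed
  then have d: "distinct [k, l, m, n', w]" "{k, l, m, n', w} \<inter> crossings (U1 @ U2 @ U3) = {}"
    using kl mn by (auto simp: image_Un x_def y_def)
  have i1: "inK ((U1 @ [x] @ U2 @ [y]) @ U3)" and i2: "inK (U1 @ ([x] @ U2 @ [y] @ U3))" using i by simp_all
  have k1: "k \<noteq> l" "{k, l} \<inter> crossings ((U1 @ [x] @ U2 @ [y]) @ U3) = {}" using kl by auto
  have k2: "m \<noteq> n'" "{m, n'} \<inter> crossings (U1 @ ([x] @ U2 @ [y] @ U3)) = {}" using mn by auto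
  note T1 = inK_tip[OF i1 f k1, where t = t] and T2 = inK_tip[OF i2 f2 k2, where t = t]
  have wc: "w \<in> cls ((U1 @ [x] @ U2 @ [y]) @ U3)" by (simp add: cls_append cls_Cons x_def)
  have "par (tip s t k l (U1 @ [x] @ U2 @ [y]) U3) k = par (tip s t k l (U1 @ [x] @ U2 @ [y]) U3) w +
      par (tip s t m n' U1 ([x] @ U2 @ [y] @ U3)) m"
    using corner_tips_second[OF d, of s t q] T1(1) T2(1) by (simp add: tip_def bigon1_def bigon2_def x_def y_def)
  then show "tip_value s t (U1 @ [x] @ U2 @ [y]) U3 - tip_value s t U1 ([x] @ U2 @ [y] @ U3) = par ?B w"
    unfolding diff_eq_eq using tip_value_eq[OF i1 f k1, where t = t] tip_value_eq[OF i2 f2 k2, where t = t] T1(2)[OF wc] by simp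
qed

end

section \<open>Changing one strand of a tip\<close>

lemma corner_facing_first:
  assumes "crossing y = crossing x" "strand x = s" "strand y = opp s"
    and f: "facing s (U1 @ [y] @ U2) ([x] @ U3)"
  shows "facing s (U1 @ [y]) (U2 @ [x] @ U3)"
  unfolding facing_def
proof (unfold adj_def, intro allI impI)
  fix col a m
  assume fl: "flow col a (U1 @ [y]) m" "flow col m (U2 @ [x] @ U3) a"
  obtain b where b: "flow col m U2 b" "flow col b ([x] @ U3) a"
    using fl(2) by (rule flow_split)
  have "flow col a (U1 @ [y] @ U2) b" using flow_join[OF fl(1) b(1)] by simp
  from adjD[OF f[unfolded facing_def] this b(2)] have "val (flip (sd s)) a = val (sd s) b" .
  moreover have "m = after col y" "b = before col x" using fl b(2) by (auto elim!: flow_split)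
  ultimately show "val (flip (sd s)) a = val (sd s) m"
    using assms(1-3) by (cases s) (simp_all add: before_def after_def)
qed

lemma corner_facing_second:
  assumes "crossing y = crossing x" "strand x = s" "strand y = opp s"
    and f: "facing s U1 ([x] @ U2 @ [y] @ U3)"
  shows "facing s (U1 @ [x] @ U2 @ [y]) U3"
  unfolding facing_def
proof (unfold adj_def, intro allI impI)
  fix col a m
  assume fl: "flow col a (U1 @ [x] @ U2 @ [y]) m" "flow col m U3 a"
  obtain b where b: "flow col a U1 b" "flow col b ([x] @ U2 @ [y]) m"
    using fl(1) by (rule flow_split)
  have "flow col b ([x] @ U2 @ [y] @ U3) a" using flow_join[OF b(2) fl(2)] by simp
  from adjD[OF f[unfolded facing_def] b(1) this] have "val (flip (sd s)) a = val (sd s) b" .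
  moreover have "m = after col y" "b = before col x" using b(2) by (auto elim!: flow_split)
  ultimately show "val (flip (sd s)) a = val (sd s) m"
    using assms(1-3) by (cases s) (simp_all add: before_def after_def)
qed

lemma flow_bigon:
  assumes "flow col p (bigon1 s m m' k l) p'" "flow col q (bigon2 False s m m' k l) q'"
  shows "val (sd s) p = val (sd s) q'" "val (sd s) p' = val (sd s) q"
    "val (sd s) p = val (sd s) p' \<Longrightarrow> p = p' \<and> q = q'"
  using assms by (cases s; auto simp: bigon1_def bigon2_def before_def after_def)+

text \<open>
  An antiparallel bigon cuts the common face of three strands into two parts, and the third strand
  stays in one of them. If one colouring excluded the first part and another one the second, their
  sum would colour both parts alike, but not like the side of \<open>z\<close>.
\<close>

lemma facing_dichotomy:
  fixes s m m' k l
  defines "A \<equiv> bigon1 s m m' k l" and "B \<equiv> bigon2 False s m m' k l"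
  assumes f1: "facing s Yb (Y @ Ya)"
  shows "facing s (Yb @ A) (Y @ B @ Ya) \<or> facing s (Yb @ A @ Y @ B) Ya"
proof (rule ccontr)
  have key: "val (flip (sd s)) a = val (sd s) p"
    if "flow col a Yb p" "flow col p A p'" "flow col p' Y q" "flow col q B q'" "flow col q' Ya a"
      "val (sd s) p = val (sd s) p'" for col a p p' q q'
  proof -
    have e: "p = p'" "q = q'" using flow_bigon(3)[OF that(2,4)[unfolded A_def B_def] that(6)] by simp_all
    have "flow col p (Y @ Ya) a" using flow_join[OF that(3)] that(5) e by simp
    from adjD[OF f1[unfolded facing_def] that(1) this] show ?thesis .
  qed
  assume "\<not> ?thesis"
  then have n1: "\<not> facing s (Yb @ A) (Y @ B @ Ya)" and n2: "\<not> facing s (Yb @ A @ Y @ B) Ya" by auto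
  obtain c1 a1 r1 where h1: "flow c1 a1 (Yb @ A) r1" "flow c1 r1 (Y @ B @ Ya) a1"
    "val (flip (sd s)) a1 \<noteq> val (sd s) r1" using n1 unfolding facing_def adj_def by blast
  obtain p1 where p1: "flow c1 a1 Yb p1" "flow c1 p1 A r1" using h1(1) by (rule flow_split)
  obtain q1 where q1: "flow c1 r1 Y q1" "flow c1 q1 (B @ Ya) a1" using h1(2) by (rule flow_split)
  obtain s1 where s1: "flow c1 q1 B s1" "flow c1 s1 Ya a1" using q1(2) by (rule flow_split)
  obtain c2 a2 r2 where h2: "flow c2 a2 (Yb @ A @ Y @ B) r2" "flow c2 r2 Ya a2"
    "val (flip (sd s)) a2 \<noteq> val (sd s) r2" using n2 unfolding facing_def adj_def by blast
  obtain p2 where p2: "flow c2 a2 Yb p2" "flow c2 p2 (A @ Y @ B) r2" using h2(1) by (rule flow_split)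
  obtain q2 where q2: "flow c2 p2 A q2" "flow c2 q2 (Y @ B) r2" using p2(2) by (rule flow_split)
  obtain s2 where s2: "flow c2 q2 Y s2" "flow c2 s2 B r2" using q2(2) by (rule flow_split)
  note x = flow_xor[OF p1(1) p2(1)] flow_xor[OF p1(2) q2(1)] flow_xor[OF q1(1) s2(1)]
    flow_xor[OF s1(1) s2(2)] flow_xor[OF s1(2) h2(2)]
  note k1 = key[OF p1(1,2) q1(1) s1(1,2)] and k2 = key[OF p2(1) q2(1) s2(1,2) h2(2)]
  note b1 = flow_bigon(1,2)[OF p1(2)[unfolded A_def] s1(1)[unfolded B_def]]
  note b2 = flow_bigon(1,2)[OF q2(1)[unfolded A_def] s2(2)[unfolded B_def]]
  show False using key[OF x] h1(3) h2(3) k1 k2 b1 b2 unfolding val_xor by argo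
qed

context parity
begin

lemma tip_value_transfer:
  assumes i: "inK (U @ V)" "facing s U V" "inK (U' @ V')" "facing s U' V'"
    and T: "\<And>k l. k \<noteq> l \<Longrightarrow> {k, l} \<inter> crossings (U @ V) = {} \<Longrightarrow> {k, l} \<inter> crossings (U' @ V') = {} \<Longrightarrow>
      inK (tip s t k l U V) \<Longrightarrow> inK (tip s t k l U' V') \<Longrightarrow> k \<in> cls (tip s t k l U V) \<Longrightarrow>
      par (tip s t k l U V) k = par (tip s t k l U' V') k"
  shows "tip_value s t U V = tip_value s t U' V'"
proof -
  obtain k l n where k: "distinct [k, l, n]" "{k, l, n} \<inter> crossings ((U @ V) @ U' @ V') = {}"
    by (rule fresh_names)
  have k1: "k \<noteq> l" "{k, l} \<inter> crossings (U @ V) = {}" and k2: "{k, l} \<inter> crossings (U' @ V') = {}"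
    using k by (simp_all add: image_Un)
  have "k \<in> cls (tip s t k l U V)" by (simp add: tip_def bigon1_def cls_Cons)
  from T[OF k1 k2 inK_tip(1)[OF i(1,2) k1] inK_tip(1)[OF i(3,4) k1(1) k2] this]
  show ?thesis using tip_value_eq[OF i(1,2) k1, of t] tip_value_eq[OF i(3,4) k1(1) k2, of t] by simp
qed

lemma tip_value_R2:
  fixes s q k l pl r
  defines "A \<equiv> bigon1 r (Classical q) (Classical (opp q)) k l"
    and "B \<equiv> bigon2 pl r (Classical q) (Classical (opp q)) k l"
  assumes D: "inK (Yb @ Y @ Ya)" "inK (Yb @ A @ Y @ B @ Ya)"
  shows "facing s Yb (Y @ Ya) \<Longrightarrow> facing s Yb (A @ Y @ B @ Ya) \<Longrightarrow>
      tip_value s t Yb (A @ Y @ B @ Ya) = tip_value s t Yb (Y @ Ya)"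
    "facing s Yb (Y @ Ya) \<Longrightarrow> facing s (Yb @ A) (Y @ B @ Ya) \<Longrightarrow>
      tip_value s t (Yb @ A) (Y @ B @ Ya) = tip_value s t Yb (Y @ Ya)"
    "facing s (Yb @ Y) Ya \<Longrightarrow> facing s (Yb @ A @ Y) (B @ Ya) \<Longrightarrow>
      tip_value s t (Yb @ A @ Y) (B @ Ya) = tip_value s t (Yb @ Y) Ya"
    "facing s (Yb @ Y) Ya \<Longrightarrow> facing s (Yb @ A @ Y @ B) Ya \<Longrightarrow>
      tip_value s t (Yb @ A @ Y @ B) Ya = tip_value s t (Yb @ Y) Ya"
proof -
  have R: "inK (u @ v @ x) \<Longrightarrow> inK (u @ A @ v @ B @ x) \<Longrightarrow> c \<in> cls (u @ v @ x) \<Longrightarrow>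
      par (u @ A @ v @ B @ x) c = par (u @ v @ x) c" for u v x c
    using R2_par(2)[of u v x r q k l pl c, folded A_def B_def] inK_good by blast
  let ?Z = "\<lambda>m n. bigon1 s (Classical t) (Classical (opp t)) m n"
  let ?X = "\<lambda>m n. bigon2 True s (Classical t) (Classical (opp t)) m n"
  show "tip_value s t Yb (A @ Y @ B @ Ya) = tip_value s t Yb (Y @ Ya)"
    if f: "facing s Yb (Y @ Ya)" "facing s Yb (A @ Y @ B @ Ya)"
  proof (rule tip_value_transfer[symmetric])
    fix m n assume "inK (tip s t m n Yb (Y @ Ya))" "inK (tip s t m n Yb (A @ Y @ B @ Ya))"
      "m \<in> cls (tip s t m n Yb (Y @ Ya))"
    then show "par (tip s t m n Yb (Y @ Ya)) m = par (tip s t m n Yb (A @ Y @ B @ Ya)) m"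
      using R[of "?Z m n @ Yb @ ?X m n" Y Ya m] by (simp add: tip_def)
  qed (use D f in simp_all)
  show "tip_value s t (Yb @ A) (Y @ B @ Ya) = tip_value s t Yb (Y @ Ya)"
    if f: "facing s Yb (Y @ Ya)" "facing s (Yb @ A) (Y @ B @ Ya)"
  proof (rule tip_value_transfer[symmetric])
    fix m n assume "inK (tip s t m n Yb (Y @ Ya))" "inK (tip s t m n (Yb @ A) (Y @ B @ Ya))"
      "m \<in> cls (tip s t m n Yb (Y @ Ya))"
    then show "par (tip s t m n Yb (Y @ Ya)) m = par (tip s t m n (Yb @ A) (Y @ B @ Ya)) m"
      using R[of "?Z m n @ Yb" "?X m n @ Y" Ya m] by (simp add: tip_def)
  qed (use D f in simp_all)
  show "tip_value s t (Yb @ A @ Y) (B @ Ya) = tip_value s t (Yb @ Y) Ya"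
    if f: "facing s (Yb @ Y) Ya" "facing s (Yb @ A @ Y) (B @ Ya)"
  proof (rule tip_value_transfer[symmetric])
    fix m n assume "inK (tip s t m n (Yb @ Y) Ya)" "inK (tip s t m n (Yb @ A @ Y) (B @ Ya))"
      "m \<in> cls (tip s t m n (Yb @ Y) Ya)"
    then show "par (tip s t m n (Yb @ Y) Ya) m = par (tip s t m n (Yb @ A @ Y) (B @ Ya)) m"
      using R[of "?Z m n @ Yb" "Y @ ?X m n" Ya m] by (simp add: tip_def)
  qed (use D f in simp_all)
  show "tip_value s t (Yb @ A @ Y @ B) Ya = tip_value s t (Yb @ Y) Ya"
    if f: "facing s (Yb @ Y) Ya" "facing s (Yb @ A @ Y @ B) Ya"
  proof (rule tip_value_transfer[symmetric])
    fix m n assume "inK (tip s t m n (Yb @ Y) Ya)" "inK (tip s t m n (Yb @ A @ Y @ B) Ya)"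
      "m \<in> cls (tip s t m n (Yb @ Y) Ya)"
    then show "par (tip s t m n (Yb @ Y) Ya) m = par (tip s t m n (Yb @ A @ Y @ B) Ya) m"
      using R[of "?Z m n @ Yb" "Y" "?X m n @ Ya" m] by (simp add: tip_def)
  qed (use D f in simp_all)
qed

text \<open>
  Two strands both face \<open>z\<close>. After an antiparallel second Reidemeister move on them, \<open>z\<close> faces a
  corner of \<open>k\<close> or of \<open>l\<close>, and the corner relation there compares the tips at the two strands. The
  result does not mention \<open>z\<close>.
\<close>

lemma antiparallel_test:
  fixes s q k l
  defines "A \<equiv> bigon1 s (Classical q) (Classical (opp q)) k l"
    and "B \<equiv> bigon2 False s (Classical q) (Classical (opp q)) k l"
  assumes i: "inK (Yb @ Y @ Ya)" and f: "facing s Yb (Y @ Ya)" "facing s (Yb @ Y) Ya" and ne: "Y \<noteq> []"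
    and k: "k \<noteq> l" "{k, l} \<inter> crossings (Yb @ Y @ Ya) = {}"
  shows "inK (Yb @ A @ Y @ B @ Ya)" "tip_value s t Yb (Y @ Ya) - tip_value s t (Yb @ Y) Ya = par (Yb @ A @ Y @ B @ Ya) l"
    "par (Yb @ A @ Y @ B @ Ya) l = - par (Yb @ A @ Y @ B @ Ya) k"
proof -
  let ?D = "Yb @ A @ Y @ B @ Ya"
  have "adj Y (Ya @ Yb) (sd (if False then opp s else s)) (sd s)"
  proof (unfold adj_def, intro allI impI)
    fix col a b assume fl: "flow col a Y b" "flow col b (Ya @ Yb) a"
    obtain z where z: "flow col b Ya z" "flow col z Yb a" using fl(2) by (rule flow_split)
    show "val (sd (if False then opp s else s)) a = val (sd s) b"
      using adjD[OF f(1)[unfolded facing_def] z(2) flow_join[OF fl(1) z(1)]]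
        adjD[OF f(2)[unfolded facing_def] flow_join[OF z(2) fl(1)] z(1)] by simp
  qed
  moreover have "Ya @ Yb \<noteq> []"
    using adj_nonempty(1)[of Yb "Y @ Ya" "flip (sd s)"] f(1) inK_good[OF i] unfolding facing_def by simp
  ultimately have R: "inK ?D" "par ?D l = - par ?D k"
    using R2_insert(1,3)[OF i ne _ _ k, of False s q, folded A_def B_def] by blast+
  then show "inK ?D" "par ?D l = - par ?D k" by blast+
  note T = tip_value_R2[of Yb Y Ya s q k l False, folded A_def B_def, OF i R(1), where s = s and t = t]
  have A: "A = [Passage k s (Classical q), Passage l (opp s) (Classical (opp q))]"
    and B: "B = [Passage l s (Classical (opp q)), Passage k (opp s) (Classical q)]"
    by (simp_all add: A_def B_def bigon1_def bigon2_def)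
  consider "facing s (Yb @ A) (Y @ B @ Ya)" | "facing s (Yb @ A @ Y @ B) Ya"
    using facing_dichotomy[OF f(1), of "Classical q" "Classical (opp q)" k l] unfolding A_def B_def by blast
  then show "tip_value s t Yb (Y @ Ya) - tip_value s t (Yb @ Y) Ya = par ?D l"
  proof cases
    case 1
    have g: "facing s (Yb @ A @ Y) (B @ Ya)"
      "tip_value s t (Yb @ A) (Y @ B @ Ya) - tip_value s t (Yb @ A @ Y) (B @ Ya) = par ?D l"
      using corner_first(1)[of "Yb @ [Passage k s (Classical q)]" l s "opp q" Y "[Passage k (opp s) (Classical q)] @ Ya"]
        corner_first(2)[of "Yb @ [Passage k s (Classical q)]" l s "opp q" Y "[Passage k (opp s) (Classical q)] @ Ya" t]
        R(1) 1 by (simp_all add: A B)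
    show ?thesis using T(2)[OF f(1) 1] T(3)[OF f(2) g(1)] g(2) by simp
  next
    case 2
    have g: "facing s Yb (A @ Y @ B @ Ya)" "tip_value s t (Yb @ A @ Y @ B) Ya - tip_value s t Yb (A @ Y @ B @ Ya) = par ?D k"
      using corner_second(1)[of Yb k s q "[Passage l (opp s) (Classical (opp q))] @ Y @ [Passage l s (Classical (opp q))]" Ya]
        corner_second(2)[of Yb k s q "[Passage l (opp s) (Classical (opp q))] @ Y @ [Passage l s (Classical (opp q))]" Ya t]
        R(1) 2 by (simp_all add: A B)
    show ?thesis using T(4)[OF f(2) 2] T(1)[OF f(1) g(1)] g(2) R(2) by (metis minus_diff_eq)
  qed
qed

end

abbreviation virt :: "nat \<Rightarrow> strand \<Rightarrow> passage" where "virt n s \<equiv> Passage n s Virtual"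

lemma erase_empty [simp]: "erase P [] = []"
  by (simp add: erase_def)

lemma flow_kink: "flow col a (kink n s m) b \<Longrightarrow> a = b"
  by (cases s) (auto simp: kink_def before_def after_def)

lemma facing_kink:
  "facing s (Yb @ Y2) Ya \<Longrightarrow> facing s (Yb @ kink n r m @ Y2) Ya"
  "facing s Yb (Y1 @ Ya) \<Longrightarrow> facing s Yb (Y1 @ kink n r m @ Ya)"
proof -
  have skip: "flow col a (u @ v) b" if "flow col a (u @ kink n r m @ v) b" for col a u v b
  proof -
    obtain p where p: "flow col a u p"
      "flow col p (kink n r m @ v) b" using \<open>flow col a (u @ kink n r m @ v) b\<close> by (rule flow_split)
    obtain q where "flow col p (kink n r m) q" "flow col q v b" using p(2) by (rule flow_split)
    with flow_kink show ?thesis using flow_join[OF p(1)] by metis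
  qed
  show "facing s (Yb @ Y2) Ya \<Longrightarrow> facing s (Yb @ kink n r m @ Y2) Ya"
    unfolding facing_def adj_def using skip by blast
  show "facing s Yb (Y1 @ Ya) \<Longrightarrow> facing s Yb (Y1 @ kink n r m @ Ya)"
    unfolding facing_def adj_def using skip by blast
qed

lemma facing_loop:
  assumes "adj X Z (flip (sd s)) (flip (sd s))"
  shows "facing s (X @ [Passage n s m]) ([Passage n (opp s) m] @ Z)"
  unfolding facing_def
proof (unfold adj_def, intro allI impI)
  fix col a b
  assume fl: "flow col a (X @ [Passage n s m]) b" "flow col b ([Passage n (opp s) m] @ Z) a"
  obtain p where p: "flow col a X p" "flow col p [Passage n s m] b" using fl(1) by (rule flow_split)
  obtain q where q: "flow col b [Passage n (opp s) m] q" "flow col q Z a" using fl(2) by (rule flow_split)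
  have "flow col p (kink n s m) q" using flow_join[OF p(2) q(1)] by (simp add: kink_def)
  then have "p = q" by (rule flow_kink)
  then have "val (flip (sd s)) a = val (flip (sd s)) p" using adjD[OF assms p(1)] q(2) by simp
  then show "val (flip (sd s)) a = val (sd s) b"
    using p(2) q(1) \<open>p = q\<close> by (cases s) (auto simp: before_def after_def)
qed

context parity
begin

lemma tip_value_detour_first:
  assumes i: "inK ((u1 @ P @ u2) @ V)" "facing s (u1 @ P @ u2) V"
    and i': "inK ((u1' @ P' @ u2') @ V')" "facing s (u1' @ P' @ u2') V'"
    and e: "\<forall>x \<in> set P \<union> set P'. mark x = Virtual"
    "erase P u1 = erase P' u1'" "erase P u2 = erase P' u2'" "erase P V = erase P' V'"
  shows "tip_value s t (u1 @ P @ u2) V = tip_value s t (u1' @ P' @ u2') V'"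
proof (rule tip_value_transfer[OF i i'])
  fix k l
  let ?A = "bigon1 s (Classical t) (Classical (opp t)) k l" and ?B = "bigon2 True s (Classical t) (Classical (opp t)) k l"
  assume k: "{k, l} \<inter> crossings ((u1 @ P @ u2) @ V) = {}" "{k, l} \<inter> crossings ((u1' @ P' @ u2') @ V') = {}"
    and T: "inK (tip s t k l (u1 @ P @ u2) V)" "inK (tip s t k l (u1' @ P' @ u2') V')"
      "k \<in> cls (tip s t k l (u1 @ P @ u2) V)"
  have "erase P ?A = ?A" "erase P' ?A = ?A" "erase P ?B = ?B" "erase P' ?B = ?B"
    by (rule erase_disjoint, use k in \<open>simp add: bigon1_def bigon2_def image_Un\<close>)+
  then show "par (tip s t k l (u1 @ P @ u2) V) k = par (tip s t k l (u1' @ P' @ u2') V') k"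
    using detour_par(2)[of "?A @ u1" P "u2 @ ?B @ V" "?A @ u1'" P' "u2' @ ?B @ V'" k] T inK_good[OF T(2)] e
    by (simp add: tip_def)
qed

lemma tip_value_detour_second:
  assumes i: "inK (U @ v1 @ P @ v2)" "facing s U (v1 @ P @ v2)"
    and i': "inK (U' @ v1' @ P' @ v2')" "facing s U' (v1' @ P' @ v2')"
    and e: "\<forall>x \<in> set P \<union> set P'. mark x = Virtual"
    "erase P U = erase P' U'" "erase P v1 = erase P' v1'" "erase P v2 = erase P' v2'"
  shows "tip_value s t U (v1 @ P @ v2) = tip_value s t U' (v1' @ P' @ v2')"
proof (rule tip_value_transfer[OF i i'])
  fix k l
  let ?A = "bigon1 s (Classical t) (Classical (opp t)) k l" and ?B = "bigon2 True s (Classical t) (Classical (opp t)) k l"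
  assume k: "{k, l} \<inter> crossings (U @ v1 @ P @ v2) = {}" "{k, l} \<inter> crossings (U' @ v1' @ P' @ v2') = {}"
    and T: "inK (tip s t k l U (v1 @ P @ v2))" "inK (tip s t k l U' (v1' @ P' @ v2'))"
      "k \<in> cls (tip s t k l U (v1 @ P @ v2))"
  have "erase P ?A = ?A" "erase P' ?A = ?A" "erase P ?B = ?B" "erase P' ?B = ?B"
    by (rule erase_disjoint, use k in \<open>simp add: bigon1_def bigon2_def image_Un\<close>)+
  then show "par (tip s t k l U (v1 @ P @ v2)) k = par (tip s t k l U' (v1' @ P' @ v2')) k"
    using detour_par(2)[of "?A @ U @ ?B @ v1" P "v2" "?A @ U' @ ?B @ v1'" P' "v2'" k] T inK_good[OF T(2)] e
    by (simp add: tip_def)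
qed

lemma tip_value_kink_first:
  assumes "inK ((Yb @ Y2) @ Ya)" "facing s (Yb @ Y2) Ya" "n \<notin> crossings (Yb @ Y2 @ Ya)"
  shows "inK (Yb @ kink n r Virtual @ Y2 @ Ya)" "tip_value s t (Yb @ kink n r Virtual @ Y2) Ya = tip_value s t (Yb @ Y2) Ya"
proof -
  have e: "erase (kink n r Virtual) Yb = Yb" "erase (kink n r Virtual) Y2 = Y2" "erase (kink n r Virtual) Ya = Ya"
    by (rule erase_disjoint, use assms(3) in \<open>simp add: crossings_kink image_Un\<close>)+
  show i: "inK (Yb @ kink n r Virtual @ Y2 @ Ya)" using virtual_kink(1)[of Yb "Y2 @ Ya" n r] assms by simp
  show "tip_value s t (Yb @ kink n r Virtual @ Y2) Ya = tip_value s t (Yb @ Y2) Ya"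
    using tip_value_detour_first[of Yb "kink n r Virtual" Y2 Ya s Yb "[]" Y2 Ya t] i assms(1) facing_kink(1)[OF assms(2)] assms(2) e
    by (simp add: kink_def)
qed

lemma tip_value_kink_second:
  assumes "inK (Yb @ Y1 @ Ya)" "facing s Yb (Y1 @ Ya)" "n \<notin> crossings (Yb @ Y1 @ Ya)"
  shows "inK (Yb @ Y1 @ kink n r Virtual @ Ya)" "tip_value s t Yb (Y1 @ kink n r Virtual @ Ya) = tip_value s t Yb (Y1 @ Ya)"
proof -
  have e: "erase (kink n r Virtual) Yb = Yb" "erase (kink n r Virtual) Y1 = Y1" "erase (kink n r Virtual) Ya = Ya"
    by (rule erase_disjoint, use assms(3) in \<open>simp add: crossings_kink image_Un\<close>)+
  show i: "inK (Yb @ Y1 @ kink n r Virtual @ Ya)" using virtual_kink(1)[of "Yb @ Y1" Ya n r] assms by simp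
  show "tip_value s t Yb (Y1 @ kink n r Virtual @ Ya) = tip_value s t Yb (Y1 @ Ya)"
    using tip_value_detour_second[of Yb Y1 "kink n r Virtual" Ya s Yb Y1 "[]" Ya t] i assms(1) facing_kink(2)[OF assms(2)] assms(2) e
    by (simp add: kink_def)
qed

lemma arc_value_kink:
  assumes "inK v" "n \<notin> crossings v"
  shows "inK (kink n r Virtual @ v)" "arc_value s t [] (kink n r Virtual @ v) = arc_value s t [] v"
proof -
  have e: "erase (kink n r Virtual) v = v"
    by (rule erase_disjoint, use assms(2) in \<open>simp add: crossings_kink\<close>)
  show i: "inK (kink n r Virtual @ v)" using virtual_kink(1)[of "[]" v n r] assms by simp
  show "arc_value s t [] (kink n r Virtual @ v) = arc_value s t [] v"
    using arc_value_detour[of "[]" "[]" "kink n r Virtual" v "[]" "[]"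
      "[]" v s t] i inK_good[OF assms(1)] e by (simp add: kink_def)
qed

text \<open>
  A tip next to a virtual loop is the local tangle.
\<close>

lemma tip_value_loop:
  assumes i: "inK v" and n: "n \<notin> crossings v"
  shows "tip_value s t [virt n s] ([virt n (opp s)] @ v) = arc_value s t [] v"
proof -
  have k: "inK (kink n s Virtual @ v)"
    "arc_value s t [] (kink n s Virtual @ v) = arc_value s t [] v" using arc_value_kink[OF i n] by blast+
  have a: "inK ([virt n s] @ ([virt n (opp s)] @ v))" using k(1) by (simp add: kink_def)
  have f: "facing s [virt n s] ([virt n (opp s)] @ v)" using facing_loop[of "[]" v s n Virtual] by (simp add: adj_def)
  obtain x y z where xy: "distinct [x, y, z]" "{x, y, z} \<inter> crossings ([virt n s] @ ([virt n (opp s)] @ v)) = {}"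
    by (rule fresh_names)
  have xy': "x \<noteq> y" "{x, y} \<inter> crossings ([virt n s] @ [virt n (opp s)] @ v) = {}" using xy by auto
  have "tip_value s t [virt n s] ([virt n (opp s)] @ v) = arc_value s t [] ([virt n s] @ [virt n (opp s)] @ v)"
    using self_bigon[of s t x y "[virt n s]" "[virt n (opp s)] @ v"] a tip_value_eq[OF a f xy', of t] xy'
      inK_tip(1)[OF a f xy', of t] by (simp add: tip_def)
  then show ?thesis using k(2) by (simp add: kink_def)
qed

text \<open>
  The amount in \<open>antiparallel_test\<close> is evaluated for \<open>z\<close> on the second strand, just before a
  virtual loop.
\<close>

lemma loop_value:
  fixes s q :: strand and k l n :: nat and Y1 Y2 :: "passage list"
  defines "E \<equiv> [virt n s] @ bigon1 s (Classical q) (Classical (opp q)) k l @ ([virt n (opp s)] @ Y2) @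
      bigon2 False s (Classical q) (Classical (opp q)) k l @ Y1"
  assumes i: "inK (Y2 @ Y1)" and f: "facing s Y2 Y1" and k: "distinct [k, l, n]"
    "{k, l, n} \<inter> crossings (Y2 @ Y1) = {}"
  shows "inK E" "par E k = tip_value s t Y2 Y1 - arc_value s t [] (Y2 @ Y1)"
proof -
  have n: "n \<notin> crossings (Y2 @ Y1)" using k(2) by blast
  have iN: "inK ([virt n s] @ ([virt n (opp s)] @ Y2) @ Y1)"
    and tN: "tip_value s t ([virt n s] @ [virt n (opp s)] @ Y2) Y1 = tip_value s t Y2 Y1"
    using tip_value_kink_first[where Yb = "[]"
      and ?Y2.0 = Y2 and Ya = Y1 and s = s and n = n and r = s] i f n by (simp_all add: kink_def)
  have f1: "facing s [virt n s] (([virt n (opp s)] @ Y2) @ Y1)"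
    using facing_loop[of "[]" "Y2 @ Y1" s n Virtual] by (simp add: adj_def)
  have f2: "facing s ([virt n s] @ [virt n (opp s)] @ Y2) Y1"
    using facing_kink(1)[of s "[]" Y2 Y1 n s Virtual] f by (simp add: kink_def)
  have k': "k \<noteq> l" "{k, l} \<inter> crossings ([virt n s] @ ([virt n (opp s)] @ Y2) @ Y1) = {}" using k by auto
  note R = antiparallel_test[OF iN f1 f2 _ k', where q = q, folded E_def]
  show iE: "inK E" using R(1) by simp
  have "tip_value s t [virt n s] (([virt n (opp s)] @ Y2) @ Y1) = arc_value s t [] (Y2 @ Y1)"
    using tip_value_loop[OF i n] by simp
  then have "arc_value s t [] (Y2 @ Y1) - tip_value s t Y2 Y1 = - par E k" using R(2)[of t] R(3) tN by simp
  then show "par E k = tip_value s t Y2 Y1 - arc_value s t [] (Y2 @ Y1)" by (metis minus_diff_eq minus_minus)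
qed

text \<open>
  The strands at gap \<open>length Yb\<close> and at gap \<open>length (Yb @ Y1)\<close> are both on the face of \<open>z\<close>, but
  the latter with the wrong side. The virtual loop \<open>n\<close> on it provides a segment that faces \<open>z\<close>.
\<close>

lemma strand_change_second:
  assumes i: "inK (Yb @ Y1 @ Ya)" and f: "facing s Yb (Y1 @ Ya)" "facing s (Ya @ Yb) Y1"
    and n: "n \<notin> crossings (Yb @ Y1 @ Ya)"
  shows "adj (Yb @ Y1) Ya (flip (sd s)) (flip (sd s))"
    "tip_value s t' Yb (Y1 @ Ya) - tip_value s t' (Yb @ Y1 @ [virt n s]) ([virt n (opp s)] @ Ya) =
      tip_value s t (Ya @ Yb) Y1 - arc_value s t [] (Ya @ Yb @ Y1)"
proof -
  show ad: "adj (Yb @ Y1) Ya (flip (sd s)) (flip (sd s))"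
  proof (unfold adj_def, intro allI impI)
    fix col a b assume fl: "flow col a (Yb @ Y1) b" "flow col b Ya a"
    obtain z where z: "flow col a Yb z" "flow col z Y1 b" using fl(1) by (rule flow_split)
    show "val (flip (sd s)) a = val (flip (sd s)) b"
      using adjD[OF f(1)[unfolded facing_def] z(1) flow_join[OF z(2) fl(2)]]
        adjD[OF f(2)[unfolded facing_def] flow_join[OF fl(2) z(1)] z(2)] by simp
  qed
  obtain k l x where kl: "distinct [k, l, x]"
    "{k, l, x} \<inter> crossings (virt n s # Yb @ Y1 @ Ya) = {}" by (rule fresh_names)
  have kl1: "distinct [k, l, n]" "{k, l, n} \<inter> crossings ((Ya @ Yb) @ Y1) = {}" using kl n by (auto simp: image_Un)
  have iR: "inK ((Ya @ Yb) @ Y1)" using i inK_rotate[of "Yb @ Y1" Ya] by simp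
  note V = loop_value[OF iR f(2) kl1, where q = SWNE]
  have N: "inK (Yb @ Y1 @ kink n s Virtual @ Ya)"
    "tip_value s t' Yb (Y1 @ kink n s Virtual @ Ya) = tip_value s t' Yb (Y1 @ Ya)"
    using tip_value_kink_second[OF i f(1) n] by blast+
  have i1: "inK (Yb @ (Y1 @ [virt n s]) @ ([virt n (opp s)] @ Ya))" using N(1) by (simp add: kink_def)
  have g1: "facing s Yb ((Y1 @ [virt n s]) @ ([virt n (opp s)] @ Ya))"
    using facing_kink(2)[OF f(1), of n s Virtual] by (simp add: kink_def)
  have g2: "facing s (Yb @ Y1 @ [virt n s]) ([virt n (opp s)] @ Ya)"
    using facing_loop[OF ad, of n Virtual] by simp
  have kl2: "l \<noteq> k" "{l, k} \<inter> crossings (Yb @ (Y1 @ [virt n s]) @ ([virt n (opp s)] @ Ya)) = {}"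
    using kl by (auto simp: image_Un)
  note R = antiparallel_test[OF i1 g1 _ _ kl2, where q = SENW]
  let ?E1 = "bigon1 s (Classical SENW) (Classical SWNE) l k @ (Y1 @ [virt n s]) @ bigon2 False s (Classical SENW) (Classical SWNE) l k @ [virt n (opp s)] @ Ya"
  let ?E = "[virt n s] @ bigon1 s (Classical SWNE) (Classical SENW) k l @ ([virt n (opp s)] @ Ya @ Yb) @
      bigon2 False s (Classical SWNE) (Classical SENW) k l @ Y1"
  have "par (Yb @ ?E1) k = par ?E k"
  proof -
    let ?a = "Yb @ bigon1 s (Classical SENW) (Classical SWNE) l k @ Y1"
    let ?b = "[virt n s] @ bigon2 False s (Classical SENW) (Classical SWNE) l k @ [virt n (opp s)] @ Ya"
    have e: "Yb @ ?E1 = ?a @ ?b" "?E = ?b @ ?a" by (simp_all add: bigon1_def bigon2_def)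
    show ?thesis unfolding e using R(1) g2
      by (intro par_rotate[symmetric]) (simp_all add: e(1)[symmetric] cls_append cls_Cons bigon1_def bigon2_def)
  qed
  then show "tip_value s t' Yb (Y1 @ Ya) - tip_value s t' (Yb @ Y1 @ [virt n s]) ([virt n (opp s)] @ Ya) =
      tip_value s t (Ya @ Yb) Y1 - arc_value s t [] (Ya @ Yb @ Y1)"
    using R(2)[of t'] V(2)[of t] g2 N(2) by (simp add: kink_def)
qed

text \<open>
  The same change, when \<open>z\<close> meets the two strands in the other order.
\<close>

lemma strand_change_first:
  assumes i: "inK (Yb @ Y2 @ Ya)" and f: "facing s (Yb @ Y2) Ya" "facing s Y2 (Ya @ Yb)"
    and n: "n \<notin> crossings (Yb @ Y2 @ Ya)"
  shows "adj Yb (Y2 @ Ya) (flip (sd s)) (flip (sd s))"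
    "tip_value s t' (Yb @ Y2) Ya - tip_value s t' (Yb @ [virt n s]) ([virt n (opp s)] @ Y2 @ Ya) =
      tip_value s t Y2 (Ya @ Yb) - arc_value s t [] (Y2 @ Ya @ Yb)"
proof -
  show ad: "adj Yb (Y2 @ Ya) (flip (sd s)) (flip (sd s))"
  proof (unfold adj_def, intro allI impI)
    fix col a b assume fl: "flow col a Yb b" "flow col b (Y2 @ Ya) a"
    obtain z where z: "flow col b Y2 z" "flow col z Ya a" using fl(2) by (rule flow_split)
    show "val (flip (sd s)) a = val (flip (sd s)) b"
      using adjD[OF f(1)[unfolded facing_def] flow_join[OF fl(1) z(1)] z(2)]
        adjD[OF f(2)[unfolded facing_def] z(1) flow_join[OF z(2) fl(1)]] by simp
  qed
  obtain k l x where kl: "distinct [k, l, x]"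
    "{k, l, x} \<inter> crossings (virt n s # Yb @ Y2 @ Ya) = {}" by (rule fresh_names)
  have kl1: "distinct [k, l, n]" "{k, l, n} \<inter> crossings (Y2 @ Ya @ Yb) = {}" using kl n by (auto simp: image_Un)
  have iR: "inK (Y2 @ Ya @ Yb)" using i inK_rotate[of Yb "Y2 @ Ya"] by simp
  note V = loop_value[OF iR f(2) kl1, where q = SWNE]
  have i0: "inK ((Yb @ Y2) @ Ya)" using i by simp
  have N: "inK (Yb @ kink n s Virtual @ Y2 @ Ya)"
    "tip_value s t' (Yb @ kink n s Virtual @ Y2) Ya = tip_value s t' (Yb @ Y2) Ya"
    using tip_value_kink_first[OF i0 f(1) n] by blast+
  have i1: "inK ((Yb @ [virt n s]) @ ([virt n (opp s)] @ Y2) @ Ya)" using N(1) by (simp add: kink_def)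
  have g1: "facing s (Yb @ [virt n s]) (([virt n (opp s)] @ Y2) @ Ya)"
    using facing_loop[OF ad, of n Virtual] by simp
  have g2: "facing s ((Yb @ [virt n s]) @ [virt n (opp s)] @ Y2) Ya"
    using facing_kink(1)[OF f(1), of n s Virtual] by (simp add: kink_def)
  have kl2: "k \<noteq> l" "{k, l} \<inter> crossings ((Yb @ [virt n s]) @ ([virt n (opp s)] @ Y2) @ Ya) = {}"
    using kl by (auto simp: image_Un)
  note R = antiparallel_test[OF i1 g1 g2 _ kl2, where q = SWNE]
  let ?E0 = "[virt n s] @ bigon1 s (Classical SWNE) (Classical SENW) k l @ ([virt n (opp s)] @ Y2) @
      bigon2 False s (Classical SWNE) (Classical SENW) k l @ Ya"
  have "par (?E0 @ Yb) k = par (Yb @ ?E0) k"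
    using R(1) by (intro par_rotate) (simp_all add: cls_append cls_Cons bigon1_def)
  then have "par (Yb @ ?E0) k = tip_value s t Y2 (Ya @ Yb) - arc_value s t [] (Y2 @ Ya @ Yb)" using V(2)[of t] by simp
  then have "- par (Yb @ ?E0) k = - (tip_value s t Y2 (Ya @ Yb) - arc_value s t [] (Y2 @ Ya @ Yb))" by (rule arg_cong)
  then have "tip_value s t' (Yb @ [virt n s]) ([virt n (opp s)] @ Y2 @ Ya) - tip_value s t' (Yb @ Y2) Ya = - (tip_value s t Y2 (Ya @ Yb) - arc_value s t [] (Y2 @ Ya @ Yb))"
    using R(2)[of t'] R(3) N(2) by (simp add: kink_def)
  then show "tip_value s t' (Yb @ Y2) Ya - tip_value s t' (Yb @ [virt n s]) ([virt n (opp s)] @ Y2 @ Ya) =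
      tip_value s t Y2 (Ya @ Yb) - arc_value s t [] (Y2 @ Ya @ Yb)" by (metis minus_diff_eq minus_minus)
qed

end

lemma facing_below:
  assumes "crossing y = crossing x" "strand x = s" "strand y = opp s"
  shows "facing s ([x] @ U) ([y] @ V)"
  using assms unfolding facing_def adj_def
  by (intro allI impI) (cases s; auto simp: before_def)

lemma facing_above:
  assumes "crossing y = crossing x" "strand x = s" "strand y = opp s"
  shows "facing s (U @ [x]) (V @ [y])"
  using assms unfolding facing_def adj_def
  by (intro allI impI) (cases s; auto simp: before_def after_def flow_append)

context parity
begin

text \<open>
  The amount in \<open>strand_change_second\<close> is evaluated once more, for \<open>z\<close> just after the virtual loop
  \<open>n\<close>. There the tip closes up with the roles of the two strands exchanged. As the second strand
  needs a partner on its face, an additional loop \<open>m\<close> is made on it.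
\<close>

lemma arc_value_opp:
  assumes "inK (u @ v)" shows "arc_value (opp s) t u v = arc_value s t u v"
proof -
  have i0: "inK (v @ u)" using assms inK_rotate by blast
  obtain m n l where mn: "distinct [m, n, l]" "{m, n, l} \<inter> crossings (v @ u) = {}" by (rule fresh_names)
  let ?W = "kink m s Virtual @ v @ u"
  have W: "inK ?W" "arc_value s t [] ?W = arc_value s t [] (v @ u)"
    "arc_value (opp s) t [] ?W = arc_value (opp s) t [] (v @ u)"
    using arc_value_kink[OF i0, of m] mn(2) by auto
  have nW: "n \<notin> crossings ?W" using mn by (auto simp: crossings_kink image_Un)
  have f: "facing s [virt m s] ([virt m (opp s)] @ v @ u)"
    using facing_loop[of "[]" "v @ u" s m Virtual] by (simp add: adj_def)
  have i1: "inK ([virt m s] @ ([virt m (opp s)] @ v @ u) @ [])" using W(1) by (simp add: kink_def)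
  have n1: "n \<notin> crossings ([virt m s] @ ([virt m (opp s)] @ v @ u) @ [])" using nW by (simp add: kink_def)
  note C = strand_change_second[OF i1 _ _ n1]
  have ad: "adj ?W [] (flip (sd s)) (flip (sd s))" using C(1) f by (simp add: kink_def)
  have c: "tip_value s t (?W @ [virt n s]) [virt n (opp s)] = arc_value s t [] ?W"
    using C(2)[where s = s and t = t and t' = t] f by (simp add: kink_def)
  have fk: "facing s (?W @ [virt n s]) [virt n (opp s)]" using facing_loop[OF ad, of n Virtual] by simp
  have "inK (kink n s Virtual @ ?W)" "arc_value (opp s) t [] (kink n s Virtual @ ?W) = arc_value (opp s) t [] ?W"
    using arc_value_kink[OF W(1) nW] by blast+
  then have i2: "inK ([virt n s] @ [virt n (opp s)] @ ?W)"
    and d2: "arc_value (opp s) t [] ([virt n s] @ [virt n (opp s)] @ ?W) = arc_value (opp s) t [] ?W"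
    by (simp_all add: kink_def)
  have i3: "inK ([virt n (opp s)] @ ?W @ [virt n s])" using i2 inK_rotate[of "[virt n s]" "[virt n (opp s)] @ ?W"] by simp
  have i4: "inK ((?W @ [virt n s]) @ [virt n (opp s)])" using i3 inK_rotate[of "[virt n (opp s)]" "?W @ [virt n s]"] by simp
  have d3: "arc_value (opp s) t [] ([virt n (opp s)] @ ?W @ [virt n s]) = arc_value (opp s) t [] ?W"
    using arc_value_rotate[of "[virt n s]" "[]" "[virt n (opp s)] @ ?W" "opp s" t] i2 d2
      arc_value_virtual[of "[]" "virt n s" "[virt n (opp s)] @ ?W" "opp s" t] by simp
  obtain k l x where kl: "distinct [k, l, x]" "{k, l, x} \<inter> crossings ((?W @ [virt n s]) @ [virt n (opp s)]) = {}"
    by (rule fresh_names)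
  have kl': "k \<noteq> l" "{k, l} \<inter> crossings ((?W @ [virt n s]) @ [virt n (opp s)]) = {}" using kl by auto
  let ?A = "bigon1 (opp s) (Classical t) (Classical (opp t)) k l"
    and ?B = "bigon2 True (opp s) (Classical t) (Classical (opp t)) k l"
  let ?T = "tip s t k l (?W @ [virt n s]) [virt n (opp s)]"
  have T: "inK ?T" "par ?T k = tip_value s t (?W @ [virt n s]) [virt n (opp s)]"
    using inK_tip(1)[OF i4 fk kl'] tip_value_eq[OF i4 fk kl'] by blast+
  have e: "?T = (?B @ ?W @ [virt n s]) @ (?A @ [virt n (opp s)])" by (simp add: tip_def bigon1_def bigon2_def)
  have "k \<in> cls ?T" by (simp add: tip_def bigon1_def cls_Cons)
  then have "par (?A @ [virt n (opp s)] @ ?B @ ?W @ [virt n s]) k = par ?T k"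
    "inK (?A @ [virt n (opp s)] @ ?B @ ?W @ [virt n s])"
    using par_rotate[of "?B @ ?W @ [virt n s]" "?A @ [virt n (opp s)]" k]
      inK_rotate[of "?B @ ?W @ [virt n s]" "?A @ [virt n (opp s)]"] T(1) unfolding e by simp_all
  moreover from this have "par (?A @ [virt n (opp s)] @ ?B @ ?W @ [virt n s]) k = arc_value (opp s) t [] ([virt n (opp s)] @ ?W @ [virt n s])"
    using i3 kl' by (intro self_bigon) auto
  ultimately have "arc_value (opp s) t [] (v @ u) = arc_value s t [] (v @ u)" using T(2) c d3 W by simp
  then show ?thesis using arc_value_rotate[of u "[]" v "opp s" t] arc_value_rotate[of u "[]" v s t] assms by simp
qed

text \<open>
  A virtual finger of \<open>z\<close> crosses the strand at gap \<open>length X\<close>, in order to face it from the other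
  side. This is a detour of the virtual loop in \<open>strand_change_second\<close>.
\<close>

lemma finger:
  fixes s n1 n2 X Z
  defines "D \<equiv> ([virt n2 s] @ X @ [virt n2 (opp s), virt n1 s]) @ (Z @ [virt n1 (opp s)])"
  assumes i: "inK (X @ Z)" and a: "adj X Z (flip (sd s)) (flip (sd s))" and Z: "Z \<noteq> []"
    and n: "n1 \<noteq> n2" "{n1, n2} \<inter> crossings (X @ Z) = {}"
  shows "inK D" "c \<in> cls (X @ Z) \<Longrightarrow> par D c = par (X @ Z) c"
    "facing s ([virt n2 s] @ X @ [virt n2 (opp s), virt n1 s]) (Z @ [virt n1 (opp s)])"
    "n \<notin> crossings (X @ Z) \<Longrightarrow> tip_value s t (X @ [virt n s]) ([virt n (opp s)] @ Z) =
      tip_value s t ([virt n2 s] @ X @ [virt n2 (opp s), virt n1 s]) (Z @ [virt n1 (opp s)])"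
proof -
  have "good ([virt n1 (opp s), virt n2 s] @ X @ [virt n2 (opp s), virt n1 s] @ Z)"
  proof (cases "X = []")
    case True
    have n': "n1 \<notin> crossings Z" "n2 \<notin> crossings ([virt n1 (opp s)] @ [virt n1 s] @ Z)" using n by auto
    have "good ([virt n1 (opp s)] @ [virt n1 s] @ Z)"
      using good_kink[of "[]" Z n1 "opp s" Virtual] inK_good[OF i] n' True by (simp add: kink_def)
    then have "good ([virt n1 (opp s)] @ kink n2 s Virtual @ [virt n1 s] @ Z)" using n'(2) by (rule good_kink)
    then show ?thesis using True by (simp add: kink_def)
  next
    case False
    have a': "adj X Z (sd (opp s)) (sd (opp s))" using a by (simp add: sd_opp)
    have "good (bigon1 (opp s) Virtual Virtual n1 n2 @ X @ bigon2 False (opp s) Virtual Virtual n1 n2 @ Z)"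
      by (rule good_bigon[OF inK_good[OF i] False Z _ a']) (use n in auto)
    then show ?thesis by (simp add: bigon1_def bigon2_def)
  qed
  then have g: "good D" using good_rotate[of "[virt n1 (opp s)]"
    "[virt n2 s] @ X @ [virt n2 (opp s), virt n1 s] @ Z"] by (simp add: D_def)
  have e: "erase [virt n2 (opp s), virt n1 s] X = X" "erase [virt n2 (opp s), virt n1 s] Z = Z"
    by (rule erase_disjoint, use n(2) in \<open>simp add: image_Un\<close>)+
  note d = detour_par(1)[of X "[]" Z "[virt n2 s] @ X" "[virt n2 (opp s), virt n1 s]" "Z @ [virt n1 (opp s)]"]
    detour_par(2)[of X "[]" Z "[virt n2 s] @ X" "[virt n2 (opp s), virt n1 s]" "Z @ [virt n1 (opp s)]" c]
  show iD: "inK D" "c \<in> cls (X @ Z) \<Longrightarrow> par D c = par (X @ Z) c"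
    using d i g e by (simp_all add: D_def)
  show f: "facing s ([virt n2 s] @ X @ [virt n2 (opp s), virt n1 s]) (Z @ [virt n1 (opp s)])"
    using facing_above[of "virt n1 (opp s)" "virt n1 s" s "[virt n2 s] @ X @ [virt n2 (opp s)]" Z] by simp
  assume n0: "n \<notin> crossings (X @ Z)"
  have k: "inK (X @ kink n s Virtual @ Z)" using virtual_kink(1)[OF i n0] .
  have fk: "facing s (X @ [virt n s]) ([virt n (opp s)] @ Z)" using facing_loop[OF a] .
  have e2: "erase [virt n s] X = X" "erase [virt n s] Z = Z"
    by (rule erase_disjoint, use n0 in \<open>simp add: image_Un\<close>)+
  show "tip_value s t (X @ [virt n s]) ([virt n (opp s)] @ Z) =
      tip_value s t ([virt n2 s] @ X @ [virt n2 (opp s), virt n1 s]) (Z @ [virt n1 (opp s)])"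
    using tip_value_detour_first[of X "[virt n s]" "[]" "[virt n (opp s)] @ Z" s "[virt n2 s] @ X"
      "[virt n2 (opp s), virt n1 s]" "[]"
        "Z @ [virt n1 (opp s)]" t] k fk iD(1) f e e2 by (simp add: kink_def D_def)
qed

lemma finger_parallel:
  fixes s n1 n2 X Z
  defines "D \<equiv> ([virt n2 (opp s)] @ X) @ ([virt n1 (opp s), virt n2 s] @ Z @ [virt n1 s])"
  assumes i: "inK (X @ Z)" and f: "facing s X Z" and n: "n1 \<noteq> n2" "{n1, n2} \<inter> crossings (X @ Z) = {}"
  shows "inK D" "c \<in> cls (X @ Z) \<Longrightarrow> par D c = par (X @ Z) c"
    "arc_value r t ([virt n2 (opp s)] @ X) ([virt n1 (opp s), virt n2 s] @ Z @ [virt n1 s]) = arc_value r t X Z"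
proof -
  have ne: "X \<noteq> []" "Z \<noteq> []" using adj_nonempty[OF inK_good[OF i]] f[unfolded facing_def]
    by (metis flip_flip)+
  have a: "adj X Z (sd (opp s)) (sd s)" using f by (simp add: facing_def sd_opp)
  have "good (bigon1 s Virtual Virtual n1 n2 @ X @ bigon2 True s Virtual Virtual n1 n2 @ Z)"
    by (rule good_bigon[OF inK_good[OF i] ne _ a]) (use n in auto)
  then have g: "good D" using good_rotate[of "[virt n1 s]"
    "[virt n2 (opp s)] @ X @ [virt n1 (opp s), virt n2 s] @ Z"] by (simp add: D_def bigon1_def bigon2_def)
  let ?P = "[virt n1 (opp s), virt n2 s]"
  have e: "erase ?P X = X" "erase ?P Z = Z"
    by (rule erase_disjoint, use n(2) in \<open>simp add: image_Un\<close>)+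
  note d = detour_par(1)[of X "[]" Z "[virt n2 (opp s)] @ X" ?P "Z @ [virt n1 s]"]
    detour_par(2)[of X "[]" Z "[virt n2 (opp s)] @ X" ?P "Z @ [virt n1 s]" c]
  show "inK D" "c \<in> cls (X @ Z) \<Longrightarrow> par D c = par (X @ Z) c" using d i g e by (simp_all add: D_def)
  show "arc_value r t ([virt n2 (opp s)] @ X) (?P @ Z @ [virt n1 s]) = arc_value r t X Z"
    using arc_value_detour[of X "[]" "[]" Z "[virt n2 (opp s)] @ X" "[]" ?P "Z @ [virt n1 s]" r t] i g e by (simp add: D_def)
qed

end

context parity
begin

section \<open>Passing a crossing\<close>

text \<open>
  Here \<open>x\<close> passes \<open>w\<close> on the strand \<open>opp s\<close>, and \<open>z\<close> has to cross the strand \<open>s\<close> below \<open>w\<close>.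
  Changing from the incoming edge of \<open>opp s\<close> to that of \<open>s\<close> subtracts the parity of \<open>w\<close> and adds
  the value of the latter edge; the corner relation adds the parity of \<open>w\<close> again.
\<close>

lemma pass_below_first:
  fixes s m w n1 n2 and U V1 V2 :: "passage list"
  defines "x \<equiv> Passage w s m" and "y \<equiv> Passage w (opp s) m"
  defines "U' \<equiv> [virt n2 s] @ U @ [y]"
    and "V' \<equiv> V1 @ [virt n2 (opp s), virt n1 s] @ [x] @ V2 @ [virt n1 (opp s)]"
  assumes i: "inK (U @ [y] @ V1 @ [x] @ V2)" and f: "facing s U ([y] @ V1 @ [x] @ V2)"
    and n: "n1 \<noteq> n2" "{n1, n2} \<inter> crossings (U @ [y] @ V1 @ [x] @ V2) = {}"
  shows "inK (U' @ V')" "facing s U' V'"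
    "m = Classical q \<Longrightarrow> tip_value s t U' V' = tip_value s t U ([y] @ V1 @ [x] @ V2) + arc_value s q (U @ [y] @ V1) ([x] @ V2)"
    "m = Virtual \<Longrightarrow> tip_value s t U' V' = tip_value s t U ([y] @ V1 @ [x] @ V2)"
proof (unfold U'_def V'_def)
  let ?W = "U @ [y] @ V1 @ [x] @ V2" and ?U = "U" and ?V = "[y] @ V1 @ [x] @ V2" and ?U' = "[virt n2 s] @ U @ [y]"
    and ?V' = "V1 @ [virt n2 (opp s), virt n1 s] @ [x] @ V2 @ [virt n1 (opp s)]"
  let ?X = "U @ [y] @ V1" and ?Z = "[x] @ V2" and ?D = "?U' @ ?V'"
  let ?Uf = "([virt n2 s] @ U) @ [y] @ (V1 @ [virt n2 (opp s), virt n1 s])" and ?Vf = "[x] @ (V2 @ [virt n1 (opp s)])"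
  have xy: "crossing y = crossing x" "strand x = s" "strand y = opp s" by (simp_all add: x_def y_def)
  obtain z k l where z: "z \<notin> crossings ?W" using fresh_names[of "?W"] by (metis disjoint_iff insertI1)
  have i0: "inK (U @ ([y] @ V1) @ ([x] @ V2))" and f0: "facing s U (([y] @ V1) @ ([x] @ V2))" using i f by simp_all
  have z0: "z \<notin> crossings (U @ ([y] @ V1) @ ([x] @ V2))" using z by simp
  have b0: "facing s (([x] @ V2) @ U) ([y] @ V1)"
    using facing_below[OF xy, of "V2 @ U" "V1"] by simp
  note C = strand_change_second[OF i0 f0 b0 z0]
  have iX: "inK (?X @ ?Z)" and nX: "{n1, n2} \<inter> crossings (?X @ ?Z) = {}"
    and zX: "z \<notin> crossings (?X @ ?Z)" using i n(2) z by simp_all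
  have ad: "adj ?X ?Z (flip (sd s)) (flip (sd s))" and Z: "?Z \<noteq> []" using C(1) by simp_all
  note F = finger[OF iX ad Z n(1) nX]
  show iD: "inK ?D" using F(1) by simp
  have fi: "facing s ?Uf ?Vf" using F(3) by simp
  show fo: "facing s ?U' ?V'"
    using corner_facing_first[OF xy, of "[virt n2 s] @ U" "V1 @ [virt n2 (opp s), virt n1 s]"
      "V2 @ [virt n1 (opp s)]"] fi by simp
  show "tip_value s t ?U' ?V' = tip_value s t ?U ?V + arc_value s q ?X ?Z"
    if m: "m = Classical q"
  proof -
    have e: "tip_value s t (?X @ [virt z s]) ([virt z (opp s)] @ ?Z) =
        tip_value s t ?Uf ?Vf" using F(4)[OF zX, of t] by simp
    have c: "tip_value s t ?U' ?V' - tip_value s t ?Uf ?Vf = par ?D w"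
      using corner_first(2)[of "[virt n2 s] @ U" w s q "V1 @ [virt n2 (opp s), virt n1 s]"
        "V2 @ [virt n1 (opp s)]" t] iD fo by (simp add: x_def y_def m)
    have "inK ([x] @ (V2 @ U) @ [y] @ V1)" "par ([x] @ (V2 @ U) @ [y] @ V1) w = par ?W w"
      using inK_rotate[of "U @ [y] @ V1" "[x] @ V2"] par_rotate[of "U @ [y] @ V1" "[x] @ V2" w] i
      by (simp_all add: cls_append cls_Cons x_def y_def m)
    then have b: "tip_value s q (([x] @ V2) @ U) ([y] @ V1) = par ?W w"
      using tip_below(2)[of w s q "V2 @ U" "V1"] by (simp add: x_def y_def m)
    have p: "par ?D w = par ?W w"
      using F(2)[of w] by (simp add: cls_append cls_Cons x_def y_def m)
    have d: "arc_value s q [] (?Z @ ?X) = arc_value s q ?X ?Z"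
      using arc_value_rotate[of "?X" "[]" "?Z" s q] iX by simp
    show ?thesis using C(2)[of t q] c b p d e by (simp add: algebra_simps)
  qed
  show "tip_value s t ?U' ?V' = tip_value s t ?U ?V" if m: "m = Virtual"
  proof -
    have "valid ?W" using inK_good[OF i] good_iff by blast
    from other_crossings[OF this, of x y "U @ V1 @ V2"] have w: "w \<notin> crossings (U @ V1 @ V2)"
      by (simp add: x_def y_def)
    have e: "erase [Passage w s Virtual] U = U" "erase [Passage w s Virtual] V1 = V1" "erase [Passage w s Virtual] V2 = V2"
      "erase [virt n2 (opp s), virt n1 s, Passage w s Virtual] U = U"
        "erase [virt n2 (opp s), virt n1 s, Passage w s Virtual] V1 = V1"
        "erase [virt n2 (opp s), virt n1 s, Passage w s Virtual] V2 = V2"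
      by (rule erase_disjoint, use n(2) w in \<open>simp add: image_Un\<close>)+
    have wn: "w \<noteq> n1" "w \<noteq> n2" using n(2) by (auto simp: x_def)
    show ?thesis
      using tip_value_detour_second[of U "[y] @ V1"
        "[x]" V2 s "[virt n2 s] @ U @ [y]" V1 "[virt n2 (opp s), virt n1 s, x]"
        "V2 @ [virt n1 (opp s)]" t] i f iD fo e m wn by (simp add: x_def y_def)
  qed
qed

lemma pass_below_second:
  fixes s m w n1 n2 and U1 U2 V :: "passage list"
  defines "x \<equiv> Passage w s m" and "y \<equiv> Passage w (opp s) m"
  defines "U' \<equiv> [virt n2 s] @ U1 @ [virt n2 (opp s), virt n1 s] @ [x] @ U2 @ [y]"
    and "V' \<equiv> V @ [virt n1 (opp s)]"
  assumes i: "inK (U1 @ [x] @ U2 @ [y] @ V)" and f: "facing s (U1 @ [x] @ U2) ([y] @ V)"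
    and n: "n1 \<noteq> n2" "{n1, n2} \<inter> crossings (U1 @ [x] @ U2 @ [y] @ V) = {}"
  shows "inK (U' @ V')" "facing s U' V'"
    "m = Classical q \<Longrightarrow> tip_value s t U' V' = tip_value s t (U1 @ [x] @ U2) ([y] @ V) + arc_value s q U1 ([x] @ U2 @ [y] @ V)"
    "m = Virtual \<Longrightarrow> tip_value s t U' V' = tip_value s t (U1 @ [x] @ U2) ([y] @ V)"
proof (unfold U'_def V'_def)
  let ?W = "U1 @ [x] @ U2 @ [y] @ V" and ?U = "U1 @ [x] @ U2" and ?V = "[y] @ V"
    and ?U' = "[virt n2 s] @ U1 @ [virt n2 (opp s), virt n1 s] @ [x] @ U2 @ [y]" and ?V' = "V @ [virt n1 (opp s)]"
  let ?X = "U1" and ?Z = "[x] @ U2 @ [y] @ V" and ?D = "?U' @ ?V'"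
  let ?Uf = "[virt n2 s] @ U1 @ [virt n2 (opp s), virt n1 s]" and ?Vf = "[x] @ U2 @ [y] @ V @ [virt n1 (opp s)]"
  have xy: "crossing y = crossing x" "strand x = s" "strand y = opp s" by (simp_all add: x_def y_def)
  obtain z k l where z: "z \<notin> crossings ?W" using fresh_names[of "?W"] by (metis disjoint_iff insertI1)
  have i0: "inK (U1 @ ([x] @ U2) @ ([y] @ V))" and f0: "facing s (U1 @ ([x] @ U2)) ([y] @ V)" using i f by simp_all
  have z0: "z \<notin> crossings (U1 @ ([x] @ U2) @ ([y] @ V))" using z by simp
  have b0: "facing s ([x] @ U2) (([y] @ V) @ U1)"
    using facing_below[OF xy, of "U2" "V @ U1"] by simp
  note C = strand_change_first[OF i0 f0 b0 z0]
  have iX: "inK (?X @ ?Z)" and nX: "{n1, n2} \<inter> crossings (?X @ ?Z) = {}"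
    and zX: "z \<notin> crossings (?X @ ?Z)" using i n(2) z by simp_all
  have ad: "adj ?X ?Z (flip (sd s)) (flip (sd s))" and Z: "?Z \<noteq> []" using C(1) by simp_all
  note F = finger[OF iX ad Z n(1) nX]
  show iD: "inK ?D" using F(1) by simp
  have fi: "facing s ?Uf ?Vf" using F(3) by simp
  show fo: "facing s ?U' ?V'"
    using corner_facing_second[OF xy, of "[virt n2 s] @ U1 @ [virt n2 (opp s), virt n1 s]" U2 "V @ [virt n1 (opp s)]"] fi by simp
  show "tip_value s t ?U' ?V' = tip_value s t ?U ?V + arc_value s q ?X ?Z"
    if m: "m = Classical q"
  proof -
    have e: "tip_value s t (?X @ [virt z s]) ([virt z (opp s)] @ ?Z) =
        tip_value s t ?Uf ?Vf" using F(4)[OF zX, of t] by simp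
    have c: "tip_value s t ?U' ?V' - tip_value s t ?Uf ?Vf = par ?D w"
      using corner_second(2)[of "[virt n2 s] @ U1 @ [virt n2 (opp s), virt n1 s]" w s q U2 "V @ [virt n1 (opp s)]" t] iD fo by (simp add: x_def y_def m)
    have "inK ([x] @ U2 @ [y] @ (V @ U1))" "par ([x] @ U2 @ [y] @ (V @ U1)) w = par ?W w"
      using inK_rotate[of "U1" "[x] @ U2 @ [y] @ V"] par_rotate[of "U1" "[x] @ U2 @ [y] @ V" w] i
      by (simp_all add: cls_append cls_Cons x_def y_def m)
    then have b: "tip_value s q ([x] @ U2) (([y] @ V) @ U1) = par ?W w"
      using tip_below(2)[of w s q "U2" "V @ U1"] by (simp add: x_def y_def m)
    have p: "par ?D w = par ?W w"
      using F(2)[of w] by (simp add: cls_append cls_Cons x_def y_def m)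
    have d: "arc_value s q [] (?Z @ ?X) = arc_value s q ?X ?Z"
      using arc_value_rotate[of "?X" "[]" "?Z" s q] iX by simp
    show ?thesis using C(2)[of t q] c b p d e by (simp add: algebra_simps)
  qed
  show "tip_value s t ?U' ?V' = tip_value s t ?U ?V" if m: "m = Virtual"
  proof -
    have "valid ?W" using inK_good[OF i] good_iff by blast
    from other_crossings[OF this, of x y "U1 @ U2 @ V"] have w: "w \<notin> crossings (U1 @ U2 @ V)"
      by (simp add: x_def y_def)
    have e: "erase [Passage w s Virtual] U1 = U1" "erase [Passage w s Virtual] U2 = U2" "erase [Passage w s Virtual] V = V"
      "erase [virt n2 (opp s), virt n1 s, Passage w s Virtual] U1 = U1"
        "erase [virt n2 (opp s), virt n1 s, Passage w s Virtual] U2 = U2"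
        "erase [virt n2 (opp s), virt n1 s, Passage w s Virtual] V = V"
      by (rule erase_disjoint, use n(2) w in \<open>simp add: image_Un\<close>)+
    have wn: "w \<noteq> n1" "w \<noteq> n2" using n(2) by (auto simp: x_def)
    show ?thesis
      using tip_value_detour_first[of U1 "[x]" U2 "[y] @ V" s "[virt n2 s] @ U1"
        "[virt n2 (opp s), virt n1 s, x]" "U2 @ [y]"
        "V @ [virt n1 (opp s)]" t] i f iD fo e m wn by (simp add: x_def y_def)
  qed
qed

text \<open>
  Here \<open>x\<close> passes \<open>w\<close> on the strand \<open>s\<close>, and \<open>z\<close> has to cross the strand \<open>opp s\<close> above \<open>w\<close>. The
  corner relation comes first and adds the parity of \<open>w\<close>; changing between the two outgoing edges
  subtracts it together with the value of the outgoing edge of \<open>opp s\<close>.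
\<close>

lemma pass_above_first:
  fixes s m w n1 n2 and U V1 V2 :: "passage list"
  defines "x \<equiv> Passage w s m" and "y \<equiv> Passage w (opp s) m"
  defines "U' \<equiv> [virt n2 (opp s)] @ U @ [x]"
    and "V' \<equiv> V1 @ [y, virt n1 (opp s), virt n2 s] @ V2 @ [virt n1 s]"
  assumes i: "inK (U @ [x] @ V1 @ [y] @ V2)" and f: "facing s U ([x] @ V1 @ [y] @ V2)"
    and n: "n1 \<noteq> n2" "{n1, n2} \<inter> crossings (U @ [x] @ V1 @ [y] @ V2) = {}"
  shows "inK (U' @ V')" "facing s U' V'"
    "m = Classical q \<Longrightarrow> tip_value s t U' V' = tip_value s t U ([x] @ V1 @ [y] @ V2) - arc_value s (opp q) (U @ [x] @ V1 @ [y]) V2"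
    "m = Virtual \<Longrightarrow> tip_value s t U' V' = tip_value s t U ([x] @ V1 @ [y] @ V2)"
proof (unfold U'_def V'_def)
  let ?W = "U @ [x] @ V1 @ [y] @ V2" and ?U = "U" and ?V = "[x] @ V1 @ [y] @ V2"
    and ?U' = "[virt n2 (opp s)] @ U @ [x]" and ?V' = "V1 @ [y, virt n1 (opp s), virt n2 s] @ V2 @ [virt n1 s]"
  let ?X = "U @ [x] @ V1 @ [y]" and ?Z = "V2" and ?XN = "[virt n2 (opp s)] @ U @ [x] @ V1 @ [y]"
    and ?ZN = "[virt n1 (opp s), virt n2 s] @ V2 @ [virt n1 s]"
  let ?U2 = "([virt n1 (opp s), virt n2 s] @ V2 @ [virt n1 s]) @ [virt n2 (opp s)] @ U @ [x]" and ?V2 = "V1 @ [y]"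
    and ?D = "?U' @ ?V'"
  have xy: "crossing y = crossing x" "strand x = s" "strand y = opp s" by (simp_all add: x_def y_def)
  have fX: "facing s ?X ?Z" using corner_facing_second[OF xy, of U V1 V2] f by simp
  have iX: "inK (?X @ ?Z)" and nX: "{n1, n2} \<inter> crossings (?X @ ?Z) = {}" using i n(2) by simp_all
  note F = finger_parallel[OF iX fX n(1) nX]
  show iD: "inK ?D" using F(1) by simp
  show fo: "facing s ?U' ?V'"
    unfolding facing_def adj_def
    by (intro allI impI) (cases s; auto simp: before_def after_def flow_append x_def y_def)
  show "tip_value s t ?U' ?V' = tip_value s t ?U ?V - arc_value s (opp q) ?X ?Z"
    if m: "m = Classical q"
  proof -
    obtain z k l where zkl: "distinct [z, k, l]" "{z, k, l} \<inter> crossings ?D = {}" by (rule fresh_names)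
    have z: "z \<notin> crossings (([virt n2 (opp s)] @ U @ [x]) @ (V1 @ [y]) @ ([virt n1 (opp s), virt n2 s] @ V2 @ [virt n1 s]))" using zkl by auto
    have iY: "inK (([virt n2 (opp s)] @ U @ [x]) @ (V1 @ [y]) @ ([virt n1 (opp s), virt n2 s] @ V2 @ [virt n1 s]))" using iD by simp
    have fY: "facing s ([virt n2 (opp s)] @ U @ [x]) ((V1 @ [y]) @ [virt n1 (opp s), virt n2 s] @ V2 @ [virt n1 s])" using fo by simp
    have f2: "facing s ?U2 ?V2" using facing_above[OF xy, of "([virt n1 (opp s), virt n2 s] @ V2 @ [virt n1 s]) @ [virt n2 (opp s)] @ U"
      "V1"] by simp
    note C = strand_change_second[OF iY fY f2 z]
    have ad: "adj ?XN ?ZN (flip (sd s)) (flip (sd s))" using C(1) by simp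
    have zX: "z \<notin> crossings (?XN @ ?ZN)" and iN: "inK (?XN @ ?ZN)" using z iY by simp_all
    have k: "inK (?XN @ kink z s Virtual @ ?ZN)" using virtual_kink(1)[OF iN zX] .
    have fk: "facing s (?XN @ [virt z s]) ([virt z (opp s)] @ ?ZN)" using facing_loop[OF ad, of z Virtual] by simp
    let ?P = "[virt z (opp s), virt n1 (opp s), virt n2 s]"
    have e: "erase ?P U = U" "erase ?P V1 = V1" "erase ?P V2 = V2"
      by (rule erase_disjoint, use n(2) z in \<open>simp add: image_Un\<close>)+
    have wn: "w \<noteq> n1" "w \<noteq> n2" "w \<noteq> z" using n(2) z by (auto simp: x_def)
    have "tip_value s t (?XN @ [virt z s]) ([] @ ?P @ ?Z @ [virt n1 s]) = tip_value s t ?X ([] @ [] @ ?Z)"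
      by (rule tip_value_detour_second) (use k fk iX fX e wn in \<open>simp_all add: kink_def x_def y_def\<close>)
    then have dt: "tip_value s t (?XN @ [virt z s]) ([virt z (opp s)] @ ?ZN) = tip_value s t ?X ?Z" by simp
    have c: "tip_value s t ?X ?Z - tip_value s t ?U ?V = par ?W w"
      using corner_second(2)[of U w s q V1 V2 t] i fX by (simp add: x_def y_def m)
    have "inK ((([virt n1 (opp s), virt n2 s] @ V2 @ [virt n1 s]) @ [virt n2 (opp s)] @ U @ [x]) @ V1 @ [y])"
      "par ((([virt n1 (opp s), virt n2 s] @ V2 @ [virt n1 s]) @ [virt n2 (opp s)] @ U @ [x]) @ V1 @ [y]) w = par ?D w"
      using inK_rotate[of "[virt n2 (opp s)] @ U @ [x] @ V1 @ [y]"
        "[virt n1 (opp s), virt n2 s] @ V2 @ [virt n1 s]"] par_rotate[of "[virt n2 (opp s)] @ U @ [x] @ V1 @ [y]"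
        "[virt n1 (opp s), virt n2 s] @ V2 @ [virt n1 s]" w] iD
      by (simp_all add: cls_append cls_Cons x_def y_def m)
    then have b: "tip_value s (opp q) ?U2 ?V2 = - par ?D w"
      using tip_above(2)[of "([virt n1 (opp s), virt n2 s] @ V2 @ [virt n1 s]) @ [virt n2 (opp s)] @ U" w s q "V1"] by (simp add: x_def y_def m)
    have p: "par ?D w = par ?W w"
      using F(2)[of w] by (simp add: cls_append cls_Cons x_def y_def m)
    have d: "arc_value s (opp q) [] (?ZN @ ?XN) = arc_value s (opp q) ?X ?Z"
      using arc_value_rotate[of "?XN" "[]" "?ZN" s "opp q"] iN F(3)[of s "opp q"] by simp
    have "tip_value s t ?U' ?V' - tip_value s t (?XN @ [virt z s]) ([virt z (opp s)] @ ?ZN) =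
        tip_value s (opp q) ?U2 ?V2 - arc_value s (opp q) [] (?ZN @ ?XN)" using C(2)[of t "opp q"] by simp
    then show ?thesis using c p dt unfolding b d by (simp add: algebra_simps)
  qed
  show "tip_value s t ?U' ?V' = tip_value s t ?U ?V" if m: "m = Virtual"
  proof -
    have "valid ?W" using inK_good[OF i] good_iff by blast
    from other_crossings[OF this, of x y "U @ V1 @ V2"] have w: "w \<notin> crossings (U @ V1 @ V2)"
      by (simp add: x_def y_def)
    have e: "erase [Passage w (opp s) Virtual] U = U" "erase [Passage w (opp s) Virtual] V1 = V1"
      "erase [Passage w (opp s) Virtual] V2 = V2"
      "erase [Passage w (opp s) Virtual, virt n1 (opp s), virt n2 s] U = U"
        "erase [Passage w (opp s) Virtual, virt n1 (opp s), virt n2 s] V1 = V1"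
        "erase [Passage w (opp s) Virtual, virt n1 (opp s), virt n2 s] V2 = V2"
      by (rule erase_disjoint, use n(2) w in \<open>simp add: image_Un\<close>)+
    have wn: "w \<noteq> n1" "w \<noteq> n2" using n(2) by (auto simp: x_def)
    show ?thesis
      using tip_value_detour_second[of U "[x] @ V1"
        "[y]" V2 s "[virt n2 (opp s)] @ U @ [x]" V1 "[y, virt n1 (opp s), virt n2 s]"
        "V2 @ [virt n1 s]" t] i f iD fo e m wn by (simp add: x_def y_def)
  qed
qed

lemma pass_above_second:
  fixes s m w n1 n2 and U1 U2 V :: "passage list"
  defines "x \<equiv> Passage w s m" and "y \<equiv> Passage w (opp s) m"
  defines "U' \<equiv> [virt n2 (opp s)] @ U1 @ [y, virt n1 (opp s), virt n2 s] @ U2 @ [x]"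
    and "V' \<equiv> V @ [virt n1 s]"
  assumes i: "inK (U1 @ [y] @ U2 @ [x] @ V)" and f: "facing s (U1 @ [y] @ U2) ([x] @ V)"
    and n: "n1 \<noteq> n2" "{n1, n2} \<inter> crossings (U1 @ [y] @ U2 @ [x] @ V) = {}"
  shows "inK (U' @ V')" "facing s U' V'"
    "m = Classical q \<Longrightarrow> tip_value s t U' V' = tip_value s t (U1 @ [y] @ U2) ([x] @ V) - arc_value s (opp q) (U1 @ [y]) (U2 @ [x] @ V)"
    "m = Virtual \<Longrightarrow> tip_value s t U' V' = tip_value s t (U1 @ [y] @ U2) ([x] @ V)"
proof (unfold U'_def V'_def)
  let ?W = "U1 @ [y] @ U2 @ [x] @ V" and ?U = "U1 @ [y] @ U2" and ?V = "[x] @ V"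
    and ?U' = "[virt n2 (opp s)] @ U1 @ [y, virt n1 (opp s), virt n2 s] @ U2 @ [x]" and ?V' = "V @ [virt n1 s]"
  let ?X = "U1 @ [y]" and ?Z = "U2 @ [x] @ V" and ?XN = "[virt n2 (opp s)] @ U1 @ [y]"
    and ?ZN = "[virt n1 (opp s), virt n2 s] @ U2 @ [x] @ V @ [virt n1 s]"
  let ?U2 = "[virt n1 (opp s), virt n2 s] @ U2 @ [x]" and ?V2 = "(V @ [virt n1 s]) @ [virt n2 (opp s)] @ U1 @ [y]"
    and ?D = "?U' @ ?V'"
  have xy: "crossing y = crossing x" "strand x = s" "strand y = opp s" by (simp_all add: x_def y_def)
  have fX: "facing s ?X ?Z" using corner_facing_first[OF xy, of U1 U2 V] f by simp
  have iX: "inK (?X @ ?Z)" and nX: "{n1, n2} \<inter> crossings (?X @ ?Z) = {}" using i n(2) by simp_all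
  note F = finger_parallel[OF iX fX n(1) nX]
  show iD: "inK ?D" using F(1) by simp
  show fo: "facing s ?U' ?V'"
    unfolding facing_def adj_def
    by (intro allI impI) (cases s; auto simp: before_def after_def flow_append x_def y_def)
  show "tip_value s t ?U' ?V' = tip_value s t ?U ?V - arc_value s (opp q) ?X ?Z"
    if m: "m = Classical q"
  proof -
    obtain z k l where zkl: "distinct [z, k, l]" "{z, k, l} \<inter> crossings ?D = {}" by (rule fresh_names)
    have z: "z \<notin> crossings (([virt n2 (opp s)] @ U1 @ [y]) @ ([virt n1 (opp s), virt n2 s] @ U2 @ [x]) @ (V @ [virt n1 s]))" using zkl by auto
    have iY: "inK (([virt n2 (opp s)] @ U1 @ [y]) @ ([virt n1 (opp s), virt n2 s] @ U2 @ [x]) @ (V @ [virt n1 s]))" using iD by simp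
    have fY: "facing s (([virt n2 (opp s)] @ U1 @ [y]) @ [virt n1 (opp s), virt n2 s] @ U2 @ [x]) (V @ [virt n1 s])" using fo by simp
    have f2: "facing s ?U2 ?V2" using facing_above[OF xy, of "[virt n1 (opp s), virt n2 s] @ U2"
      "(V @ [virt n1 s]) @ [virt n2 (opp s)] @ U1"] by simp
    note C = strand_change_first[OF iY fY f2 z]
    have ad: "adj ?XN ?ZN (flip (sd s)) (flip (sd s))" using C(1) by simp
    have zX: "z \<notin> crossings (?XN @ ?ZN)" and iN: "inK (?XN @ ?ZN)" using z iY by simp_all
    have k: "inK (?XN @ kink z s Virtual @ ?ZN)" using virtual_kink(1)[OF iN zX] .
    have fk: "facing s (?XN @ [virt z s]) ([virt z (opp s)] @ ?ZN)" using facing_loop[OF ad, of z Virtual] by simp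
    let ?P = "[virt z (opp s), virt n1 (opp s), virt n2 s]"
    have e: "erase ?P U1 = U1" "erase ?P U2 = U2" "erase ?P V = V"
      by (rule erase_disjoint, use n(2) z in \<open>simp add: image_Un\<close>)+
    have wn: "w \<noteq> n1" "w \<noteq> n2" "w \<noteq> z" using n(2) z by (auto simp: x_def)
    have "tip_value s t (?XN @ [virt z s]) ([] @ ?P @ ?Z @ [virt n1 s]) = tip_value s t ?X ([] @ [] @ ?Z)"
      by (rule tip_value_detour_second) (use k fk iX fX e wn in \<open>simp_all add: kink_def x_def y_def\<close>)
    then have dt: "tip_value s t (?XN @ [virt z s]) ([virt z (opp s)] @ ?ZN) = tip_value s t ?X ?Z" by simp
    have c: "tip_value s t ?X ?Z - tip_value s t ?U ?V = par ?W w"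
      using corner_first(2)[of U1 w s q U2 V t] i fX by (simp add: x_def y_def m)
    have "inK (([virt n1 (opp s), virt n2 s] @ U2 @ [x]) @ ((V @ [virt n1 s]) @ [virt n2 (opp s)] @ U1) @ [y])"
      "par (([virt n1 (opp s), virt n2 s] @ U2 @ [x]) @ ((V @ [virt n1 s]) @ [virt n2 (opp s)] @ U1) @ [y]) w = par ?D w"
      using inK_rotate[of "[virt n2 (opp s)] @ U1 @ [y]"
        "[virt n1 (opp s), virt n2 s] @ U2 @ [x] @ V @ [virt n1 s]"] par_rotate[of "[virt n2 (opp s)] @ U1 @ [y]"
        "[virt n1 (opp s), virt n2 s] @ U2 @ [x] @ V @ [virt n1 s]" w] iD
      by (simp_all add: cls_append cls_Cons x_def y_def m)
    then have b: "tip_value s (opp q) ?U2 ?V2 = - par ?D w"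
      using tip_above(2)[of "[virt n1 (opp s), virt n2 s] @ U2" w s q "(V @ [virt n1 s]) @ [virt n2 (opp s)] @ U1"] by (simp add: x_def y_def m)
    have p: "par ?D w = par ?W w"
      using F(2)[of w] by (simp add: cls_append cls_Cons x_def y_def m)
    have d: "arc_value s (opp q) [] (?ZN @ ?XN) = arc_value s (opp q) ?X ?Z"
      using arc_value_rotate[of "?XN" "[]" "?ZN" s "opp q"] iN F(3)[of s "opp q"] by simp
    have "tip_value s t ?U' ?V' - tip_value s t (?XN @ [virt z s]) ([virt z (opp s)] @ ?ZN) =
        tip_value s (opp q) ?U2 ?V2 - arc_value s (opp q) [] (?ZN @ ?XN)" using C(2)[of t "opp q"] by simp
    then show ?thesis using c p dt unfolding b d by (simp add: algebra_simps)
  qed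
  show "tip_value s t ?U' ?V' = tip_value s t ?U ?V" if m: "m = Virtual"
  proof -
    have "valid ?W" using inK_good[OF i] good_iff by blast
    from other_crossings[OF this, of x y "U1 @ U2 @ V"] have w: "w \<notin> crossings (U1 @ U2 @ V)"
      by (simp add: x_def y_def)
    have e: "erase [Passage w (opp s) Virtual] U1 = U1" "erase [Passage w (opp s) Virtual] U2 = U2"
      "erase [Passage w (opp s) Virtual] V = V"
      "erase [Passage w (opp s) Virtual, virt n1 (opp s), virt n2 s] U1 = U1"
        "erase [Passage w (opp s) Virtual, virt n1 (opp s), virt n2 s] U2 = U2"
        "erase [Passage w (opp s) Virtual, virt n1 (opp s), virt n2 s] V = V"
      by (rule erase_disjoint, use n(2) w in \<open>simp add: image_Un\<close>)+
    have wn: "w \<noteq> n1" "w \<noteq> n2" using n(2) by (auto simp: x_def)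
    show ?thesis
      using tip_value_detour_first[of U1 "[y]" "U2" "[x] @ V" s "[virt n2 (opp s)] @ U1"
        "[y, virt n1 (opp s), virt n2 s]" "U2 @ [x]"
        "V @ [virt n1 s]" t] i f iD fo e m wn by (simp add: x_def y_def)
  qed
qed

end

section \<open>Walking along the knot\<close>

definition partner :: "passage \<Rightarrow> passage" where
  "partner x = Passage (crossing x) (opp (strand x)) (mark x)"

lemma partner_partner [simp]: "partner (partner x) = x"
  by (simp add: partner_def)

lemma partner_sel [simp]: "crossing (partner x) = crossing x" "strand (partner x) = opp (strand x)"
  "mark (partner x) = mark x"
  by (simp_all add: partner_def)

lemma partner_neq [simp]: "partner x \<noteq> x" "x \<noteq> partner x"
  by (metis partner_sel(2) neq_opp)+

lemma partner_eq: "partner x = y \<longleftrightarrow> x = partner y"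
  by (metis partner_partner)

lemma valid_partner: "valid w \<Longrightarrow> x \<in> set w \<Longrightarrow> partner x \<in> set w"
  unfolding valid_def partner_def by blast

lemma valid_distinct: "valid w \<Longrightarrow> distinct w"
  unfolding valid_def distinct_map by blast

lemma valid_key:
  assumes "valid w" "x \<in> set w" "y \<in> set w" "crossing x = crossing y" shows "y = x \<or> y = partner x"
proof -
  have inj: "inj_on (\<lambda>x. (crossing x, strand x)) (set w)" using assms(1) by (simp add: valid_def distinct_map)
  show ?thesis
  proof (cases "strand y = strand x")
    case True
    then show ?thesis using inj_onD[OF inj _ assms(3,2)] assms(4) by simp
  next
    case False
    then have "strand y = opp (strand x)" by (cases "strand x"; cases "strand y") auto
    then show ?thesis using inj_onD[OF inj _ assms(3) valid_partner[OF assms(1,2)]] assms(4) by simp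
  qed
qed

lemma filter_eq_split:
  assumes "filter Q u = a @ q # b" obtains u1 u2 where "u = u1 @ q # u2" "filter Q u1 = a" "filter Q u2 = b"
  using assms
proof (induction a arbitrary: u thesis)
  case Nil
  then obtain us vs where "u = us @ q # vs" "\<forall>x\<in>set us. \<not> Q x"
    "b = filter Q vs" by (auto simp: filter_eq_Cons_iff)
  then show ?case using Nil(1)[of us vs] by simp
next
  case (Cons x a)
  then obtain us vs where u: "u = us @ x # vs" "\<forall>x\<in>set us. \<not> Q x" "Q x" "a @ q # b = filter Q vs"
    by (auto simp: filter_eq_Cons_iff)
  obtain w1 w2 where w: "vs = w1 @ q # w2" "filter Q w1 = a" "filter Q w2 = b" using u(4) by (metis Cons.IH)
  show ?case using Cons(2)[of "us @ x # w1" w2] u w by simp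
qed

text \<open>
  The measure for the walk. When \<open>x\<close> passes a crossing whose other passage is still ahead, a
  finger puts two more crossings on the way; but both passages of that crossing cease to count
  twice.
\<close>

definition weight :: "passage list \<Rightarrow> nat" where
  "weight V = (\<Sum>x\<leftarrow>V. if partner x \<in> set V then 2 else 1)"

lemma weight_mono: "set V \<subseteq> S \<Longrightarrow> weight V \<le> (\<Sum>x\<leftarrow>V. if partner x \<in> S then 2 else 1)"
  unfolding weight_def by (intro sum_list_mono) auto

lemma weight_Cons: "weight R < weight (x # R)"
proof -
  have "weight R \<le> (\<Sum>z\<leftarrow>R. if partner z \<in> set (x # R) then 2 else 1)" by (rule weight_mono) auto
  then show ?thesis unfolding weight_def by simp
qed

lemma weight_finger:
  assumes d: "distinct (x # V1 @ partner x # V2)" and n: "partner a \<notin> set (V1 @ V2)"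
    "partner b \<notin> set (V1 @ V2)"
    "a \<notin> {b, partner b, x, partner x}" "b \<notin> {x, partner x}"
    and P: "mset P = {# partner x, a, b #}"
  shows "weight (V1 @ P @ V2) < weight (x # V1 @ partner x # V2)"
proof -
  let ?R = "V1 @ V2" and ?V = "x # V1 @ partner x # V2" and ?V' = "V1 @ P @ V2"
  have sP: "set P = {partner x, a, b}" using P by (metis insert_commute set_mset_add_mset_insert set_mset_empty set_mset_mset)
  have *: "partner z \<in> set ?V \<longleftrightarrow> partner z \<in> set ?R" if "z \<in> set ?R" for z
  proof -
    have "z \<noteq> x" "z \<noteq> partner x" using that d by auto
    then have "partner z \<noteq> partner x" "partner z \<noteq> x" by (metis partner_partner)+
    then show ?thesis by simp
  qed
  have **: "partner z \<in> set ?V' \<longleftrightarrow> partner z \<in> set ?R" if z: "z \<in> set ?R" for z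
  proof -
    have "z \<noteq> x" "z \<noteq> partner a" "z \<noteq> partner b" using z n(1,2) d by auto
    then have "partner z \<noteq> partner x" "partner z \<noteq> a" "partner z \<noteq> b" by (metis partner_partner)+
    then show ?thesis using sP by simp
  qed
  let ?r = "\<Sum>z\<leftarrow>?R. if partner z \<in> set ?R then 2 else (1::nat)"
  have r: "(\<Sum>z\<leftarrow>?R. if partner z \<in> set ?V then 2 else (1::nat)) = ?r"
    by (rule arg_cong[of _ _ sum_list], rule map_cong[OF refl]) (simp only: *)
  have r': "(\<Sum>z\<leftarrow>?R. if partner z \<in> set ?V' then 2 else (1::nat)) = ?r"
    by (rule arg_cong[of _ _ sum_list], rule map_cong[OF refl]) (simp only: **)
  have "weight ?V = 4 + ?r" unfolding r[symmetric] weight_def by simp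
  moreover have "weight ?V' = 3 + ?r"
  proof -
    have np: "partner a \<notin> set ?V'" "partner b \<notin> set ?V'" "x \<notin> set ?V'"
    proof -
      have a: "partner a \<noteq> a" "partner a \<noteq> b" "partner a \<noteq> partner x" "partner b \<noteq> b"
        "partner b \<noteq> a" "partner b \<noteq> partner x"
        using n(3,4) by (auto simp: partner_eq)
      show "partner a \<notin> set ?V'" "partner b \<notin> set ?V'" using n(1,2) a sP by simp_all
      have "x \<notin> set V1" "x \<notin> set V2" using d by simp_all
      moreover have "x \<noteq> a" "x \<noteq> b" using n(3,4) by auto
      ultimately show "x \<notin> set ?V'" unfolding set_append Un_iff sP by simp
    qed
    define f where "f z = (if partner z \<in> set ?V' then 2 else (1::nat))" for z
    have f1: "f (partner x) = 1" "f a = 1" "f b = 1" unfolding f_def by (simp_all only: partner_partner np if_False)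
    have "(\<Sum>z\<leftarrow>P. f z) = sum_mset (image_mset f (mset P))"
      by (metis mset_map sum_mset_sum_list)
    also have "\<dots> = 3" unfolding P by (simp add: f1)
    finally have "(\<Sum>z\<leftarrow>P. if partner z \<in> set ?V' then 2 else (1::nat)) = 3" unfolding f_def .
    then show ?thesis unfolding r'[symmetric] weight_def by simp
  qed
  ultimately show ?thesis by simp
qed

context parity
begin

definition value_before :: "strand \<Rightarrow> strand \<Rightarrow> passage list \<Rightarrow> passage \<Rightarrow> 'a" where
  "value_before s t W x = arc_value s t (takeWhile (\<lambda>z. z \<noteq> x) W) (dropWhile (\<lambda>z. z \<noteq> x) W)"

definition value_after :: "strand \<Rightarrow> strand \<Rightarrow> passage list \<Rightarrow> passage \<Rightarrow> 'a" where
  "value_after s t W x = arc_value s t (takeWhile (\<lambda>z. z \<noteq> x) W @ [x]) (tl (dropWhile (\<lambda>z. z \<noteq> x) W))"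

lemma before_after:
  assumes "distinct (a @ x # b)"
  shows "value_before s t (a @ x # b) x = arc_value s t a (x # b)"
    "value_after s t (a @ x # b) x = arc_value s t (a @ [x]) b"
proof -
  have "takeWhile (\<lambda>z. z \<noteq> x) (a @ x # b) = a" "dropWhile (\<lambda>z. z \<noteq> x) (a @ x # b) = x # b"
    using assms by (simp_all add: takeWhile_append2 dropWhile_append2 disjoint_iff takeWhile_eq_all_conv[THEN iffD2])
  then show "value_before s t (a @ x # b) x = arc_value s t a (x # b)"
    "value_after s t (a @ x # b) x = arc_value s t (a @ [x]) b"
    by (simp_all add: value_before_def value_after_def)
qed

lemma before_after_detour:
  assumes i: "inK (u @ P @ v)" "good (u' @ P' @ v')" and P: "\<forall>x \<in> set P \<union> set P'. mark x = Virtual"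
    and e: "erase P u = erase P' u'" "erase P v = erase P' v'"
    and x: "x \<in> set (u @ P @ v)" "mark x \<noteq> Virtual"
  shows "value_before s t (u' @ P' @ v') x = value_before s t (u @ P @ v) x"
    "value_after s t (u' @ P' @ v') x = value_after s t (u @ P @ v) x"
proof -
  have v: "valid (u @ P @ v)" "valid (u' @ P' @ v')" using inK_good[OF i(1)] i(2) by (simp_all add: good_iff)
  note d = valid_distinct[OF v(1)] valid_distinct[OF v(2)]
  have xP: "crossing x \<notin> crossings P"
  proof
    assume "crossing x \<in> crossings P"
    then obtain y where y: "y \<in> set P" "crossing x = crossing y" by auto
    then have "y = x \<or> y = partner x" using valid_key[OF v(1) x(1), of y] by auto
    then show False using y(1) P x(2) by (metis UnI1 partner_sel(3))
  qed
  have "x \<in> set u \<or> x \<in> set v" using x xP by auto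
  then have "value_before s t (u' @ P' @ v') x = value_before s t (u @ P @ v) x \<and> value_after s t (u' @ P' @ v') x = value_after s t (u @ P @ v) x"
  proof
    assume "x \<in> set u"
    then obtain u1 u2 where u: "u = u1 @ x # u2" by (metis split_list)
    then have eq: "erase P' u' = erase P u1 @ x # erase P u2" using e(1) xP by simp
    then have "x \<in> set (erase P' u')" by simp
    then have xP': "crossing x \<notin> crossings P'" by (auto simp: erase_def)
    from eq obtain w1 w2 where u': "u' = w1 @ x # w2" "erase P u1 = erase P' w1" "erase P u2 = erase P' w2"
      unfolding erase_def by (metis filter_eq_split)
    show ?thesis
      using before_after[of u1 x "u2 @ P @ v" s t] before_after[of w1 x "w2 @ P' @ v'" s t] d
        arc_value_detour[of u1 "x # u2" P v w1 "x # w2" P' v' s t] arc_value_detour[of "u1 @ [x]" u2 P v "w1 @ [x]" w2 P' v' s t]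
        i P e u' xP xP' unfolding u u'(1) by simp
  next
    assume "x \<in> set v"
    then obtain u1 u2 where u: "v = u1 @ x # u2" by (metis split_list)
    then have eq: "erase P' v' = erase P u1 @ x # erase P u2" using e(2) xP by simp
    then have "x \<in> set (erase P' v')" by simp
    then have xP': "crossing x \<notin> crossings P'" by (auto simp: erase_def)
    from eq obtain w1 w2 where u': "v' = w1 @ x # w2" "erase P u1 = erase P' w1" "erase P u2 = erase P' w2"
      unfolding erase_def by (metis filter_eq_split)
    show ?thesis
      using before_after[of "u @ P @ u1" x u2 s t] before_after[of "u' @ P' @ w1" x w2 s t] d
        arc_value_detour_after[of u P u1 "x # u2" u' P' w1 "x # w2" s t]
        arc_value_detour_after[of u P "u1 @ [x]" u2 u' P' "w1 @ [x]" w2 s t]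
        i P e u' xP xP' unfolding u u'(1) by simp
  qed
  then show "value_before s t (u' @ P' @ v') x = value_before s t (u @ P @ v) x"
    "value_after s t (u' @ P' @ v') x = value_after s t (u @ P @ v) x"
    by blast+
qed

text \<open>
  The change of the tip value when the strand \<open>x\<close> of the tip passes \<open>y\<close>.
\<close>

definition shift :: "strand \<Rightarrow> passage list \<Rightarrow> passage \<Rightarrow> 'a" where
  "shift s W y = (case mark y of Virtual \<Rightarrow> 0
    | Classical q \<Rightarrow> if strand y = opp s then value_before s q W (partner y) else - value_after s (opp q) W (partner y))"

lemma shift_detour:
  assumes i: "inK (u @ P @ v)" "good (u' @ P' @ v')" and P: "\<forall>x \<in> set P \<union> set P'. mark x = Virtual"
    and e: "erase P u = erase P' u'" "erase P v = erase P' v'" and x: "x \<in> set (u @ P @ v)"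
  shows "shift s (u' @ P' @ v') x = shift s (u @ P @ v) x"
proof (cases "mark x")
  case (Classical q)
  have "valid (u @ P @ v)" using inK_good[OF i(1)] by (simp add: good_iff)
  then have "partner x \<in> set (u @ P @ v)" using x by (rule valid_partner)
  then show ?thesis using before_after_detour[OF i P e, of "partner x"] Classical by (simp add: shift_def)
qed (simp add: shift_def)

lemma finger_invariance:
  assumes i: "inK (X @ Z)" "inK ([a] @ X @ P @ Z @ [b])" and v: "\<forall>x\<in>set P. mark x = Virtual"
    and n: "crossings P \<inter> crossings (X @ Z) = {}" "{crossing a, crossing b} \<subseteq> crossings P"
  shows "x \<in> set (X @ Z) \<Longrightarrow> shift s ([a] @ X @ P @ Z @ [b]) x = shift s (X @ Z) x"
    "arc_value s t [] ([a] @ X @ P @ Z @ [b]) = arc_value s t [] (X @ Z)"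
proof -
  have e: "erase P X = X"
    "erase P Z = Z" by (rule erase_disjoint, use n(1) in \<open>simp add: image_Un Int_Un_distrib\<close>)+
  have g: "good (([a] @ X) @ P @ (Z @ [b]))" using inK_good[OF i(2)] by simp
  show "x \<in> set (X @ Z) \<Longrightarrow> shift s ([a] @ X @ P @ Z @ [b]) x = shift s (X @ Z) x"
    using shift_detour[of X "[]" Z "[a] @ X" P "Z @ [b]" x s] i(1) g v e n(2) by simp
  have "mark a = Virtual"
  proof -
    obtain y where y: "y \<in> set P" "crossing y = crossing a" using n(2) by auto
    have "valid ([a] @ X @ P @ Z @ [b])" using inK_good[OF i(2)] by (simp add: good_iff)
    from valid_key[OF this, of a y] y have "y = a \<or> y = partner a" by simp
    then show ?thesis using y(1) v by (metis partner_sel(3))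
  qed
  then have "arc_value s t [] ([a] @ X @ P @ Z @ [b]) = arc_value s t [a] (X @ P @ Z @ [b])"
    using arc_value_virtual[of "[]" a "X @ P @ Z @ [b]"] i(2) by simp
  also have "\<dots> = arc_value s t [] (X @ Z)"
    using arc_value_detour[of "[]" X "[]" Z "[a]" X P "Z @ [b]" s t] i(1) g v e n(2) by simp
  finally show "arc_value s t [] ([a] @ X @ P @ Z @ [b]) = arc_value s t [] (X @ Z)" .
qed

text \<open>
  No classical crossing separates \<open>x\<close> from \<open>z\<close>, so they are on one arc.
\<close>

lemma tip_value_terminal:
  assumes i: "inK (U @ N)" and f: "facing s U N" and N: "\<forall>x\<in>set N. mark x = Virtual"
  shows "tip_value s t U N = arc_value s t [] (U @ N)"
proof -
  obtain k l n where kl: "distinct [k, l, n]" "{k, l, n} \<inter> crossings (U @ N) = {}" by (rule fresh_names)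
  have kl': "k \<noteq> l" "{k, l} \<inter> crossings (U @ N) = {}" "{k, l} \<inter> crossings (N @ U) = {}" using kl by auto
  let ?A = "bigon1 (opp s) (Classical t) (Classical (opp t)) k l"
    and ?B = "bigon2 True (opp s) (Classical t) (Classical (opp t)) k l"
  have T: "inK (tip s t k l U N)" "par (tip s t k l U N) k = tip_value s t U N"
    using inK_tip(1)[OF i f kl'(1,2)] tip_value_eq[OF i f kl'(1,2)] by blast+
  have e: "tip s t k l U N = (?B @ U) @ (?A @ N)" by (simp add: tip_def bigon1_def bigon2_def)
  have "k \<in> cls (tip s t k l U N)" by (simp add: tip_def bigon1_def cls_Cons)
  then have 1: "par (?A @ N @ ?B @ U) k = tip_value s t U N" "inK (?A @ N @ ?B @ U)"
    using par_rotate[of "?B @ U" "?A @ N" k] inK_rotate[of "?B @ U" "?A @ N"] T unfolding e by simp_all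
  have i': "inK (N @ U)" using i inK_rotate by blast
  have "par (?A @ N @ ?B @ U) k = arc_value (opp s) t [] (N @ U)" using 1(2) i' N kl'(1,3) by (rule self_bigon)
  also have "\<dots> = arc_value s t [] (N @ U)" using arc_value_opp[of "[]" "N @ U"] i' by simp
  also have "\<dots> = arc_value s t N U" using arc_value_virtuals[of "[]" N U] i' N by simp
  also have "\<dots> = arc_value s t [] (U @ N)" using arc_value_rotate[of N "[]" U] i' by simp
  finally show ?thesis using 1(1) by simp
qed


text \<open>
  The passage \<open>y\<close> directly ahead of \<open>x\<close> has been passed. The word \<open>N\<close> collects the virtual
  passages at the end of the way, where the fingers of \<open>z\<close> begin.
\<close>

definition progress :: "strand \<Rightarrow> strand \<Rightarrow> passage list \<Rightarrow> passage \<Rightarrow> passage list \<Rightarrow> passage list \<Rightarrow> bool" where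
  "progress s t U y R N \<longleftrightarrow> (\<exists>U' V' N'. inK (U' @ V' @ N') \<and> facing s U' (V' @ N') \<and> (\<forall>x\<in>set N'. mark x = Virtual) \<and>
     weight V' < weight (y # R) \<and> filter (\<lambda>x. mark x \<noteq> Virtual) V' = filter (\<lambda>x. mark x \<noteq> Virtual) R \<and>
     (\<forall>x\<in>set R. shift s (U' @ V' @ N') x = shift s (U @ y # R @ N) x) \<and>
     arc_value s t [] (U' @ V' @ N') = arc_value s t [] (U @ y # R @ N) \<and>
     tip_value s t U' (V' @ N') = tip_value s t U (y # R @ N) + shift s (U @ y # R @ N) y)"

lemma progressI:
  assumes W: "U @ y # R @ N = X @ Z" "inK (X @ Z)" and D: "U' @ V' @ N' = [a] @ X @ P @ Z @ [b]" "inK (U' @ V' @ N')"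
    and f: "facing s U' (V' @ N')" and N: "\<forall>x\<in>set N'. mark x = Virtual" "\<forall>x\<in>set P. mark x = Virtual"
    and n: "crossings P \<inter> crossings (X @ Z) = {}" "{crossing a, crossing b} \<subseteq> crossings P"
    and w: "weight V' < weight (y # R)"
      "filter (\<lambda>x. mark x \<noteq> Virtual) V' = filter (\<lambda>x. mark x \<noteq> Virtual) R"
    and t: "\<And>q. mark y = Classical q \<Longrightarrow> tip_value s t U' (V' @ N') = tip_value s t U (y # R @ N) + shift s (X @ Z) y"
      "mark y = Virtual \<Longrightarrow> tip_value s t U' (V' @ N') = tip_value s t U (y # R @ N)"
  shows "progress s t U y R N"
proof -
  note F = finger_invariance[OF W(2) D(2)[unfolded D(1)] N(2) n]
  have "set R \<subseteq> set (X @ Z)" unfolding W(1)[symmetric] by auto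
  then have 1: "\<forall>x\<in>set R. shift s (U' @ V' @ N') x = shift s (U @ y # R @ N) x" unfolding D(1) W(1) using F(1) by blast
  have 2: "arc_value s t [] (U' @ V' @ N') = arc_value s t [] (U @ y # R @ N)" unfolding D(1) W(1) by (rule F(2))
  have 3: "tip_value s t U' (V' @ N') = tip_value s t U (y # R @ N) + shift s (U @ y # R @ N) y"
    unfolding W(1) using t by (cases "mark y") (simp_all add: shift_def)
  show ?thesis unfolding progress_def
    by (rule exI[of _ U'], rule exI[of _ V'], rule exI[of _ N']) (intro conjI D(2) f N(1) w 1 2 3)
qed

lemma step_below:
  assumes i: "inK (U @ y # R @ N)" and f: "facing s U (y # R @ N)" and N: "\<forall>x\<in>set N. mark x = Virtual"
    and y: "strand y = opp s"
  shows "progress s t U y R N"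
proof -
  let ?W = "U @ y # R @ N" and ?x = "partner y"
  obtain n1 n2 n3 where n0: "distinct [n1, n2, n3]" "{n1, n2, n3} \<inter> crossings ?W = {}" by (rule fresh_names)
  have n: "n1 \<noteq> n2" "{n1, n2} \<inter> crossings ?W = {}" using n0 by auto
  have v: "valid ?W" using inK_good[OF i] by (simp add: good_iff)
  note d = valid_distinct[OF v]
  have yx: "?x = Passage (crossing y) s (mark y)" "y = Passage (crossing y) (opp s) (mark y)"
    using y by (simp_all add: partner_def passage.expand)
  have nw: "n1 \<noteq> crossing y" "n2 \<noteq> crossing y" using n(2) by auto
  have nn: "x \<notin> set ?W" if "crossing x \<in> {n1, n2}" for x using n(2) that by auto
  have "?x \<in> set ?W" using v by (rule valid_partner) simp
  then consider "?x \<in> set U" | "?x \<in> set R" | "?x \<in> set N" by auto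
  then show ?thesis
  proof cases
    case 1
    then obtain U1 U2 where u: "U = U1 @ ?x # U2" by (metis split_list)
    let ?w = "U1 @ [?x] @ U2 @ [y] @ R @ N" and ?U = "U1 @ [?x] @ U2" and ?V = "[y] @ R @ N"
      and ?U' = "[virt n2 s] @ U1 @ [virt n2 (opp s), virt n1 s] @ [?x] @ U2 @ [y]" and ?V' = "R"
      and ?N' = "(N @ [virt n1 (opp s)])"
    let ?X = "U1" and ?Z = "[?x] @ U2 @ [y] @ R @ N"
    have i': "inK ?w" and f': "facing s ?U ?V" and n': "{n1, n2} \<inter> crossings ?w = {}"
      using i f n(2) unfolding u by simp_all
    note S = pass_below_second[where s = s and w = "crossing y" and m = "mark y", folded yx, OF i' f' n(1) n']
    have e: "?W = ?X @ ?Z" unfolding u by simp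
    show ?thesis
    proof (rule progressI[OF e, where U' = "?U'" and V' = "?V'" and N' = "?N'" and P = "[virt n2 (opp s), virt n1 s]"])
      show "inK (?X @ ?Z)" using i' by simp
      show "inK (?U' @ ?V' @ ?N')" using S(1) by simp
      show "facing s ?U' (?V' @ ?N')" using S(2) by simp
      show "crossings [virt n2 (opp s), virt n1 s] \<inter> crossings (?X @ ?Z) = {}"
        unfolding e[symmetric] using n(2) by simp
      show "weight R < weight (y # R)" by (rule weight_Cons)
      show "tip_value s t ?U' (?V' @ ?N') = tip_value s t U (y # R @ N) + shift s (?X @ ?Z) y"
        if m: "mark y = Classical q" for q
      proof -
        have "shift s (?X @ ?Z) y = arc_value s q ?X ?Z"
          using before_after[of "U1" "?x" "U2 @ [y] @ R @ N" s "q"] d y m unfolding e by (simp add: shift_def)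
        then show ?thesis using S(3)[OF m, of t] unfolding u by simp
      qed
      show "tip_value s t ?U' (?V' @ ?N') = tip_value s t U (y # R @ N)" if m: "mark y = Virtual"
        using S(4)[OF m, of t] unfolding u by simp
    qed (use N in \<open>auto simp: u\<close>)
  next
    case 2
    then obtain V1 V2 where r: "R = V1 @ ?x # V2" by (metis split_list)
    let ?w = "U @ [y] @ V1 @ [?x] @ V2 @ N" and ?U = "U" and ?V = "[y] @ V1 @ [?x] @ V2 @ N"
      and ?U' = "[virt n2 s] @ U @ [y]" and ?V' = "V1 @ [virt n2 (opp s), virt n1 s, ?x] @ V2"
      and ?N' = "(N @ [virt n1 (opp s)])"
    let ?X = "U @ [y] @ V1" and ?Z = "[?x] @ V2 @ N"
    have i': "inK ?w" and f': "facing s ?U ?V" and n': "{n1, n2} \<inter> crossings ?w = {}"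
      using i f n(2) unfolding r by simp_all
    note S = pass_below_first[where s = s and w = "crossing y" and m = "mark y", folded yx, OF i' f' n(1) n']
    have e: "?W = ?X @ ?Z" unfolding r by simp
    show ?thesis
    proof (rule progressI[OF e, where U' = "?U'" and V' = "?V'" and N' = "?N'" and P = "[virt n2 (opp s), virt n1 s]"])
      show "inK (?X @ ?Z)" using i' by simp
      show "inK (?U' @ ?V' @ ?N')" using S(1) by simp
      show "facing s ?U' (?V' @ ?N')" using S(2) by simp
      show "crossings [virt n2 (opp s), virt n1 s] \<inter> crossings (?X @ ?Z) = {}"
        unfolding e[symmetric] using n(2) by simp
      show "weight (V1 @ [virt n2 (opp s), virt n1 s, ?x] @ V2) < weight (y # R)" unfolding r
      proof (rule weight_finger[where a = "virt n2 (opp s)" and b = "virt n1 s"])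
        show "distinct (y # V1 @ ?x # V2)" using d unfolding r by (simp add: Int_Un_distrib)
        show "partner (virt n2 (opp s)) \<notin> set (V1 @ V2)" "partner (virt n1 s) \<notin> set (V1 @ V2)"
          using nn[of "partner (virt n2 (opp s))"] nn[of "partner (virt n1 s)"] unfolding r by simp_all
        show "virt n2 (opp s) \<notin> {virt n1 s, partner (virt n1 s), y, ?x}" "virt n1 s \<notin> {y, ?x}"
          using n(1) nw by (auto simp: partner_def)
        show "mset [virt n2 (opp s), virt n1 s, ?x] = {# ?x, virt n2 (opp s), virt n1 s #}" by simp
      qed
      show "tip_value s t ?U' (?V' @ ?N') = tip_value s t U (y # R @ N) + shift s (?X @ ?Z) y"
        if m: "mark y = Classical q" for q
      proof -
        have "shift s (?X @ ?Z) y = arc_value s q ?X ?Z"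
          using before_after[of "U @ [y] @ V1" "?x" "V2 @ N" s "q"] d y m unfolding e by (simp add: shift_def)
        then show ?thesis using S(3)[OF m, of t] unfolding r by simp
      qed
      show "tip_value s t ?U' (?V' @ ?N') = tip_value s t U (y # R @ N)" if m: "mark y = Virtual"
        using S(4)[OF m, of t] unfolding r by simp
    qed (use N in \<open>auto simp: r\<close>)
  next
    case 3
    then obtain V1 V2 where r: "N = V1 @ ?x # V2" by (metis split_list)
    let ?w = "U @ [y] @ (R @ V1) @ [?x] @ V2" and ?U = "U" and ?V = "[y] @ (R @ V1) @ [?x] @ V2"
      and ?U' = "[virt n2 s] @ U @ [y]" and ?V' = "R"
      and ?N' = "(V1 @ [virt n2 (opp s), virt n1 s, ?x] @ V2 @ [virt n1 (opp s)])"
    let ?X = "U @ [y] @ R @ V1" and ?Z = "[?x] @ V2"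
    have i': "inK ?w" and f': "facing s ?U ?V" and n': "{n1, n2} \<inter> crossings ?w = {}"
      using i f n(2) unfolding r by simp_all
    note S = pass_below_first[where s = s and w = "crossing y" and m = "mark y", folded yx, OF i' f' n(1) n']
    have e: "?W = ?X @ ?Z" unfolding r by simp
    show ?thesis
    proof (rule progressI[OF e, where U' = "?U'" and V' = "?V'" and N' = "?N'" and P = "[virt n2 (opp s), virt n1 s]"])
      show "inK (?X @ ?Z)" using i' by simp
      show "inK (?U' @ ?V' @ ?N')" using S(1) by simp
      show "facing s ?U' (?V' @ ?N')" using S(2) by simp
      show "crossings [virt n2 (opp s), virt n1 s] \<inter> crossings (?X @ ?Z) = {}"
        unfolding e[symmetric] using n(2) by simp
      show "weight R < weight (y # R)" by (rule weight_Cons)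
      show "tip_value s t ?U' (?V' @ ?N') = tip_value s t U (y # R @ N) + shift s (?X @ ?Z) y"
        if m: "mark y = Classical q" for q
      proof -
        have "shift s (?X @ ?Z) y = arc_value s q ?X ?Z"
          using before_after[of "U @ [y] @ R @ V1" "?x" "V2" s "q"] d y m unfolding e by (simp add: shift_def)
        then show ?thesis using S(3)[OF m, of t] unfolding r by simp
      qed
      show "tip_value s t ?U' (?V' @ ?N') = tip_value s t U (y # R @ N)" if m: "mark y = Virtual"
        using S(4)[OF m, of t] unfolding r by simp
    qed (use N in \<open>auto simp: r\<close>)
  qed
qed

lemma step_above:
  assumes i: "inK (U @ y # R @ N)" and f: "facing s U (y # R @ N)" and N: "\<forall>x\<in>set N. mark x = Virtual"
    and y: "strand y = s"
  shows "progress s t U y R N"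
proof -
  let ?W = "U @ y # R @ N" and ?x = "partner y"
  obtain n1 n2 n3 where n0: "distinct [n1, n2, n3]" "{n1, n2, n3} \<inter> crossings ?W = {}" by (rule fresh_names)
  have n: "n1 \<noteq> n2" "{n1, n2} \<inter> crossings ?W = {}" using n0 by auto
  have v: "valid ?W" using inK_good[OF i] by (simp add: good_iff)
  note d = valid_distinct[OF v]
  have yx: "y = Passage (crossing y) s (mark y)" "?x = Passage (crossing y) (opp s) (mark y)"
    using y by (simp_all add: partner_def passage.expand)
  have nw: "n1 \<noteq> crossing y" "n2 \<noteq> crossing y" using n(2) by auto
  have nn: "x \<notin> set ?W" if "crossing x \<in> {n1, n2}" for x using n(2) that by auto
  have "?x \<in> set ?W" using v by (rule valid_partner) simp
  then consider "?x \<in> set U" | "?x \<in> set R" | "?x \<in> set N" by auto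
  then show ?thesis
  proof cases
    case 1
    then obtain U1 U2 where u: "U = U1 @ ?x # U2" by (metis split_list)
    let ?w = "U1 @ [?x] @ U2 @ [y] @ R @ N" and ?U = "U1 @ [?x] @ U2" and ?V = "[y] @ R @ N"
      and ?U' = "[virt n2 (opp s)] @ U1 @ [?x, virt n1 (opp s), virt n2 s] @ U2 @ [y]" and ?V' = "R"
      and ?N' = "(N @ [virt n1 s])"
    let ?X = "U1 @ [?x]" and ?Z = "U2 @ [y] @ R @ N"
    have i': "inK ?w" and f': "facing s ?U ?V" and n': "{n1, n2} \<inter> crossings ?w = {}"
      using i f n(2) unfolding u by simp_all
    note S = pass_above_second[where s = s and w = "crossing y" and m = "mark y", folded yx, OF i' f' n(1) n']
    have e: "?W = ?X @ ?Z" unfolding u by simp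
    show ?thesis
    proof (rule progressI[OF e, where U' = "?U'" and V' = "?V'" and N' = "?N'" and P = "[virt n1 (opp s), virt n2 s]"])
      show "inK (?X @ ?Z)" using i' by simp
      show "inK (?U' @ ?V' @ ?N')" using S(1) by simp
      show "facing s ?U' (?V' @ ?N')" using S(2) by simp
      show "crossings [virt n1 (opp s), virt n2 s] \<inter> crossings (?X @ ?Z) = {}"
        unfolding e[symmetric] using n(2) by simp
      show "weight R < weight (y # R)" by (rule weight_Cons)
      show "tip_value s t ?U' (?V' @ ?N') = tip_value s t U (y # R @ N) + shift s (?X @ ?Z) y"
        if m: "mark y = Classical q" for q
      proof -
        have "shift s (?X @ ?Z) y = - arc_value s (opp q) ?X ?Z"
          using before_after[of "U1" "?x" "U2 @ [y] @ R @ N" s "opp q"] d y m unfolding e by (simp add: shift_def)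
        then show ?thesis using S(3)[OF m, of t] unfolding u by simp
      qed
      show "tip_value s t ?U' (?V' @ ?N') = tip_value s t U (y # R @ N)" if m: "mark y = Virtual"
        using S(4)[OF m, of t] unfolding u by simp
    qed (use N in \<open>auto simp: u\<close>)
  next
    case 2
    then obtain V1 V2 where r: "R = V1 @ ?x # V2" by (metis split_list)
    let ?w = "U @ [y] @ V1 @ [?x] @ V2 @ N" and ?U = "U" and ?V = "[y] @ V1 @ [?x] @ V2 @ N"
      and ?U' = "[virt n2 (opp s)] @ U @ [y]" and ?V' = "V1 @ [?x, virt n1 (opp s), virt n2 s] @ V2"
      and ?N' = "(N @ [virt n1 s])"
    let ?X = "U @ [y] @ V1 @ [?x]" and ?Z = "V2 @ N"
    have i': "inK ?w" and f': "facing s ?U ?V" and n': "{n1, n2} \<inter> crossings ?w = {}"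
      using i f n(2) unfolding r by simp_all
    note S = pass_above_first[where s = s and w = "crossing y" and m = "mark y", folded yx, OF i' f' n(1) n']
    have e: "?W = ?X @ ?Z" unfolding r by simp
    show ?thesis
    proof (rule progressI[OF e, where U' = "?U'" and V' = "?V'" and N' = "?N'" and P = "[virt n1 (opp s), virt n2 s]"])
      show "inK (?X @ ?Z)" using i' by simp
      show "inK (?U' @ ?V' @ ?N')" using S(1) by simp
      show "facing s ?U' (?V' @ ?N')" using S(2) by simp
      show "crossings [virt n1 (opp s), virt n2 s] \<inter> crossings (?X @ ?Z) = {}"
        unfolding e[symmetric] using n(2) by simp
      show "weight (V1 @ [?x, virt n1 (opp s), virt n2 s] @ V2) < weight (y # R)" unfolding r
      proof (rule weight_finger[where a = "virt n1 (opp s)" and b = "virt n2 s"])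
        show "distinct (y # V1 @ ?x # V2)" using d unfolding r by (simp add: Int_Un_distrib)
        show "partner (virt n1 (opp s)) \<notin> set (V1 @ V2)" "partner (virt n2 s) \<notin> set (V1 @ V2)"
          using nn[of "partner (virt n1 (opp s))"] nn[of "partner (virt n2 s)"] unfolding r by simp_all
        show "virt n1 (opp s) \<notin> {virt n2 s, partner (virt n2 s), y, ?x}" "virt n2 s \<notin> {y, ?x}"
          using n(1) nw by (auto simp: partner_def)
        show "mset [?x, virt n1 (opp s), virt n2 s] = {# ?x, virt n1 (opp s), virt n2 s #}" by simp
      qed
      show "tip_value s t ?U' (?V' @ ?N') = tip_value s t U (y # R @ N) + shift s (?X @ ?Z) y"
        if m: "mark y = Classical q" for q
      proof -
        have "shift s (?X @ ?Z) y = - arc_value s (opp q) ?X ?Z"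
          using before_after[of "U @ [y] @ V1" "?x" "V2 @ N" s "opp q"] d y m unfolding e by (simp add: shift_def)
        then show ?thesis using S(3)[OF m, of t] unfolding r by simp
      qed
      show "tip_value s t ?U' (?V' @ ?N') = tip_value s t U (y # R @ N)" if m: "mark y = Virtual"
        using S(4)[OF m, of t] unfolding r by simp
    qed (use N in \<open>auto simp: r\<close>)
  next
    case 3
    then obtain V1 V2 where r: "N = V1 @ ?x # V2" by (metis split_list)
    let ?w = "U @ [y] @ (R @ V1) @ [?x] @ V2" and ?U = "U" and ?V = "[y] @ (R @ V1) @ [?x] @ V2"
      and ?U' = "[virt n2 (opp s)] @ U @ [y]" and ?V' = "R"
      and ?N' = "(V1 @ [?x, virt n1 (opp s), virt n2 s] @ V2 @ [virt n1 s])"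
    let ?X = "U @ [y] @ R @ V1 @ [?x]" and ?Z = "V2"
    have i': "inK ?w" and f': "facing s ?U ?V" and n': "{n1, n2} \<inter> crossings ?w = {}"
      using i f n(2) unfolding r by simp_all
    note S = pass_above_first[where s = s and w = "crossing y" and m = "mark y", folded yx, OF i' f' n(1) n']
    have e: "?W = ?X @ ?Z" unfolding r by simp
    show ?thesis
    proof (rule progressI[OF e, where U' = "?U'" and V' = "?V'" and N' = "?N'" and P = "[virt n1 (opp s), virt n2 s]"])
      show "inK (?X @ ?Z)" using i' by simp
      show "inK (?U' @ ?V' @ ?N')" using S(1) by simp
      show "facing s ?U' (?V' @ ?N')" using S(2) by simp
      show "crossings [virt n1 (opp s), virt n2 s] \<inter> crossings (?X @ ?Z) = {}"
        unfolding e[symmetric] using n(2) by simp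
      show "weight R < weight (y # R)" by (rule weight_Cons)
      show "tip_value s t ?U' (?V' @ ?N') = tip_value s t U (y # R @ N) + shift s (?X @ ?Z) y"
        if m: "mark y = Classical q" for q
      proof -
        have "shift s (?X @ ?Z) y = - arc_value s (opp q) ?X ?Z"
          using before_after[of "U @ [y] @ R @ V1" "?x" "V2" s "opp q"] d y m unfolding e by (simp add: shift_def)
        then show ?thesis using S(3)[OF m, of t] unfolding r by simp
      qed
      show "tip_value s t ?U' (?V' @ ?N') = tip_value s t U (y # R @ N)" if m: "mark y = Virtual"
        using S(4)[OF m, of t] unfolding r by simp
    qed (use N in \<open>auto simp: r\<close>)
  qed
qed


lemma progress:
  assumes "inK (U @ y # R @ N)" "facing s U (y # R @ N)" "\<forall>x\<in>set N. mark x = Virtual"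
  shows "progress s t U y R N"
proof (cases "strand y = s")
  case True then show ?thesis using step_above assms by blast
next
  case False
  then have "strand y = opp s" by (cases s; cases "strand y") auto
  then show ?thesis using step_below assms by blast
qed

lemma sum_shift_filter:
  "(\<Sum>y\<leftarrow>filter (\<lambda>x. mark x \<noteq> Virtual) V. shift s W y) = (\<Sum>y\<leftarrow>V. shift s W y)"
  by (rule sum_list_map_filter) (simp add: shift_def)

text \<open>
  The strand \<open>x\<close> moves on until nothing but virtual passages remain between \<open>x\<close> and \<open>z\<close>.
\<close>

theorem walk:
  assumes "inK (U @ V @ N)" "facing s U (V @ N)" "\<forall>x\<in>set N. mark x = Virtual"
  shows "tip_value s t U (V @ N) + (\<Sum>y\<leftarrow>V. shift s (U @ V @ N) y) = arc_value s t [] (U @ V @ N)"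
  using assms
proof (induction "weight V" arbitrary: U V N rule: less_induct)
  case less
  show ?case
  proof (cases V)
    case Nil
    then show ?thesis using tip_value_terminal[of U N s t] less.prems by simp
  next
    case (Cons y R)
    let ?W = "U @ y # R @ N"
    have "progress s t U y R N" using progress less.prems unfolding Cons by simp
    then obtain U' V' N' where P: "inK (U' @ V' @ N')" "facing s U' (V' @ N')" "\<forall>x\<in>set N'. mark x = Virtual"
      "weight V' < weight (y # R)"
        "filter (\<lambda>x. mark x \<noteq> Virtual) V' = filter (\<lambda>x. mark x \<noteq> Virtual) R"
      "\<forall>x\<in>set R. shift s (U' @ V' @ N') x = shift s ?W x" "arc_value s t [] (U' @ V' @ N') = arc_value s t [] ?W"
      "tip_value s t U' (V' @ N') = tip_value s t U (y # R @ N) + shift s ?W y"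
      unfolding progress_def by (elim exE conjE) (rule that)
    have "tip_value s t U' (V' @ N') + (\<Sum>y\<leftarrow>V'. shift s (U' @ V' @ N') y) = arc_value s t [] (U' @ V' @ N')"
      by (rule less.hyps) (use P(1-4) Cons in simp_all)
    moreover have "(\<Sum>y\<leftarrow>V'. shift s (U' @ V' @ N') y) = (\<Sum>y\<leftarrow>R. shift s (U' @ V' @ N') y)"
      using sum_shift_filter[of s "U' @ V' @ N'" V'] sum_shift_filter[of s "U' @ V' @ N'" R] P(5) by simp
    moreover have "(\<Sum>y\<leftarrow>R. shift s (U' @ V' @ N') y) = (\<Sum>y\<leftarrow>R. shift s ?W y)"
      using P(6) by (intro arg_cong[of _ _ sum_list] map_cong refl) simp
    ultimately show ?thesis using P(7,8) unfolding Cons by (simp add: add.assoc)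
  qed
qed

text \<open>
  Starting from a virtual loop next to \<open>z\<close>, the strand \<open>x\<close> walks once around the knot. The tip
  value is the value of the arc of \<open>z\<close> at the beginning and at the end.
\<close>

theorem sum_shifts:
  assumes i: "inK w" shows "(\<Sum>y\<leftarrow>w. shift s w y) = 0"
proof -
  obtain n k l where "distinct [n, k, l]" "{n, k, l} \<inter> crossings w = {}" by (rule fresh_names)
  then have n: "n \<notin> crossings w" by auto
  let ?U = "[virt n s]" and ?V = "[virt n (opp s)] @ w"
  have k: "inK (kink n s Virtual @ w)"
    "arc_value s SWNE [] (kink n s Virtual @ w) = arc_value s SWNE [] w" using arc_value_kink[OF i n] by blast+
  have a: "inK (?U @ ?V @ [])" using k(1) by (simp add: kink_def)
  have f: "facing s ?U (?V @ [])" using facing_loop[of "[]" w s n Virtual] by (simp add: adj_def)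
  have "tip_value s SWNE ?U (?V @ []) + (\<Sum>y\<leftarrow>?V. shift s (?U @ ?V @ []) y) = arc_value s SWNE [] (?U @ ?V @ [])"
    using walk[OF a f] by simp
  then have "(\<Sum>y\<leftarrow>?V. shift s (?U @ ?V @ []) y) = 0"
    using tip_value_loop[OF i n, of s SWNE] k(2) by (simp add: kink_def)
  moreover have "shift s (?U @ ?V @ []) (virt n (opp s)) = 0" by (simp add: shift_def)
  moreover have "shift s (?U @ ?V @ []) y = shift s w y" if "y \<in> set w" for y
  proof -
    have "erase (kink n s Virtual) w = w" by (rule erase_disjoint, use n in \<open>simp add: crossings_kink\<close>)
    then show ?thesis using shift_detour[of "[]" "[]" w "[]" "kink n s Virtual" w y s] i k(1) inK_good[OF k(1)] that
      by (simp add: kink_def)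
  qed
  then have "(\<Sum>y\<leftarrow>w. shift s (?U @ ?V @ []) y) = (\<Sum>y\<leftarrow>w. shift s w y)"
    by (intro arg_cong[of _ _ sum_list] map_cong refl) simp
  ultimately show ?thesis by simp
qed

lemma tip_value_swap:
  assumes i: "inK (U @ V)" and f: "facing s U V"
  shows "facing (opp s) V U" "tip_value (opp s) t V U = tip_value s t U V"
proof -
  show f': "facing (opp s) V U" unfolding facing_def adj_def
    using adjD[OF f[unfolded facing_def]] by (simp add: sd_opp)
  have i': "inK (V @ U)" using i inK_rotate by blast
  obtain k l n where kl: "distinct [k, l, n]" "{k, l, n} \<inter> crossings (U @ V) = {}" by (rule fresh_names)
  have kl': "k \<noteq> l" "{k, l} \<inter> crossings (U @ V) = {}" "{k, l} \<inter> crossings (V @ U) = {}" using kl by auto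
  let ?A = "bigon1 (opp s) (Classical t) (Classical (opp t)) k l"
    and ?B = "bigon2 True (opp s) (Classical t) (Classical (opp t)) k l"
  have e: "tip s t k l U V = (?B @ U) @ (?A @ V)" "tip (opp s) t k l V U = (?A @ V) @ (?B @ U)"
    by (simp_all add: tip_def bigon1_def bigon2_def)
  have "k \<in> cls (tip s t k l U V)" by (simp add: tip_def bigon1_def cls_Cons)
  then have "par (tip (opp s) t k l V U) k = par (tip s t k l U V) k"
    using par_rotate[of "?B @ U" "?A @ V" k] inK_tip(1)[OF i f kl'(1,2), of t] unfolding e by simp
  then show "tip_value (opp s) t V U = tip_value s t U V" using tip_value_eq[OF i f kl'(1,2), of t] tip_value_eq[OF i' f' kl'(1,3), of t] by simp
qed

text \<open>
  By \<open>strand_change_second\<close>, exchanging the marks changes the tip value and the value of the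
  strand \<open>z\<close> by the same amount. Since \<open>z\<close> and \<open>x\<close> can exchange their roles, the same holds for
  \<open>x\<close>.
\<close>

lemma mark_difference:
  assumes i: "inK (U @ V)" and f: "facing s U V"
  shows "arc_value s t U V - arc_value s t' U V = arc_value s t [] (U @ V) - arc_value s t' [] (U @ V)"
proof -
  have *: "tip_value s t U V - tip_value s t' U V = arc_value s t [] (U @ V) - arc_value s t' [] (U @ V)"
    if i: "inK (U @ V)" and f: "facing s U V" for s U V
  proof -
    obtain n k l where "distinct [n, k, l]" "{n, k, l} \<inter> crossings (U @ V) = {}" by (rule fresh_names)
    then have n: "n \<notin> crossings (U @ V @ [])" by auto
    have i': "inK (U @ V @ [])" and f': "facing s U (V @ [])" "facing s ([] @ U) V" using i f by simp_all
    note C = strand_change_second(2)[OF i' f' n, of t]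
    have "tip_value s t U V - arc_value s t [] (U @ V) = tip_value s t' U V - arc_value s t' [] (U @ V)"
      using C[of t] C[of t'] by simp
    then show ?thesis by (simp add: algebra_simps)
  qed
  have i': "inK (V @ U)" using i inK_rotate by blast
  have "tip_value (opp s) t V U - tip_value (opp s) t' V U = arc_value (opp s) t [] (V @ U) - arc_value (opp s) t' [] (V @ U)"
    by (rule *[OF i' tip_value_swap(1)[OF i f]])
  moreover have "arc_value (opp s) q [] (V @ U) = arc_value s q U V" for q
    using arc_value_opp[of "[]" "V @ U" s q] arc_value_rotate[of U "[]" V s q] i i' by simp
  ultimately show ?thesis using *[OF i f] tip_value_swap(2)[OF i f] by simp
qed

text \<open>
  A first Reidemeister move adds two terms to the sum in \<open>sum_shifts\<close>: the values of the new loop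
  for the two marks, with opposite signs. So the marks do not matter on the loop, and by
  \<open>mark_difference\<close> they do not matter on the strand next to it, which is arbitrary.
\<close>

lemma arc_value_mark:
  assumes i: "inK (u @ v)" shows "arc_value s (opp t) u v = arc_value s t u v"
proof -
  let ?v = "v @ u"
  have iv: "inK ?v" using i inK_rotate by blast
  obtain c k l where "distinct [c, k, l]" "{c, k, l} \<inter> crossings ?v = {}" by (rule fresh_names)
  then have c: "c \<notin> crossings ([] @ ?v)" by auto
  let ?y = "Passage c (opp s) (Classical t)" and ?x = "Passage c s (Classical t)"
  let ?W = "kink c (opp s) (Classical t) @ ?v"
  have kW: "?W = [?y] @ ?x # ?v" "?W = [] @ ?y # ?x # ?v" by (simp_all add: kink_def)
  have gW: "good ?W" using good_kink[of "[]" ?v c] inK_good[OF iv] c by simp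
  then have iW: "inK ?W" using R1_par(1)[of "[]" ?v c "opp s" t] inK_good[OF iv] iv by simp
  have v: "valid ?W" "valid ?v" using gW inK_good[OF iv] by (simp_all add: good_iff)
  note d = valid_distinct[OF v(1)] valid_distinct[OF v(2)]
  \<comment> \<open>The loop is far from all the other crossings.\<close>
  have old: "shift s ?W y = shift s ?v y" if y: "y \<in> set ?v" for y
  proof (cases "mark y")
    case (Classical q)
    obtain a b where ab: "?v = a @ partner y # b" using valid_partner[OF v(2) y] by (metis split_list)
    have e: "?W = ([?y, ?x] @ a) @ partner y # b" unfolding ab by (simp add: kink_def)
    note b1 = before_after[OF d(1)[unfolded e]] and b2 = before_after[OF d(2)[unfolded ab]]
    have "arc_value s r ([?y, ?x] @ a) (partner y # b) = arc_value s r a (partner y # b)"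
      "arc_value s r (([?y, ?x] @ a) @ [partner y]) b = arc_value s r (a @ [partner y]) b" for r
      using arc_value_R1_after[of "[]" a "partner y # b" c "opp s" t s r] arc_value_R1_after[of "[]"
        "a @ [partner y]" b c "opp s" t s r] iv gW
      unfolding ab by (simp_all add: kink_def)
    then have "value_before s r ?W (partner y) = value_before s r ?v (partner y)"
      "value_after s r ?W (partner y) = value_after s r ?v (partner y)" for r
      unfolding b1[folded e] b2[folded ab] by simp_all
    then show ?thesis using Classical by (simp add: shift_def)
  qed (simp add: shift_def)
  have "(\<Sum>y\<leftarrow>?v. shift s ?W y) = (\<Sum>y\<leftarrow>?v. shift s ?v y)"
    using old by (intro arg_cong[of _ _ sum_list] map_cong refl) simp
  then have 0: "shift s ?W ?y + shift s ?W ?x = 0"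
    using sum_shifts[OF iW, of s] sum_shifts[OF iv, of s] by (simp add: kink_def)
  have "shift s ?W ?y = arc_value s t [?y] (?x # ?v)"
    using before_after(1)[of "[?y]" ?x ?v s t] d(1) unfolding kW(1) by (simp add: shift_def partner_def)
  moreover have "shift s ?W ?x = - arc_value s (opp t) [?y] (?x # ?v)"
    using before_after(2)[of "[]" ?y "?x # ?v" s "opp t"] d(1) unfolding kW(2) by (simp add: shift_def partner_def)
  ultimately have l: "arc_value s t [?y] (?x # ?v) = arc_value s (opp t) [?y] (?x # ?v)" using 0 by simp
  have f: "facing (opp s) [?y] (?x # ?v)"
    using facing_loop[of "[]" ?v "opp s" c "Classical t"] by (simp add: adj_def)
  have i1: "inK ([?y] @ ?x # ?v)" using iW unfolding kW(1) .
  have "arc_value (opp s) t [] ([?y] @ ?x # ?v) = arc_value (opp s) (opp t) [] ([?y] @ ?x # ?v)"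
    using mark_difference[OF i1 f, of t "opp t"] arc_value_opp[OF i1] l by simp
  then have "arc_value (opp s) t [] ?v = arc_value (opp s) (opp t) [] ?v"
    using arc_value_R1[of "[]" "[]" ?v c "opp s" t "opp s"] iv gW unfolding kW(1)[symmetric] by simp
  then have "arc_value s t [] ?v = arc_value s (opp t) [] ?v" using arc_value_opp[of "[]" ?v s] iv by simp
  then show ?thesis using arc_value_rotate[of u "[]" v s t] arc_value_rotate[of u "[]" v s "opp t"] i by simp
qed

definition edge_value :: "passage list \<Rightarrow> passage list \<Rightarrow> 'a" where
  "edge_value u v = arc_value SWNE SWNE u v"

lemma arc_value_edge_value:
  assumes "inK (u @ v)" shows "arc_value s t u v = edge_value u v"
  using arc_value_opp[OF assms, of SWNE] arc_value_mark[OF assms, of SWNE SWNE]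
        arc_value_mark[OF assms, of SENW SWNE] unfolding edge_value_def
  by (cases s; cases t) auto

end

context parity
begin

section \<open>Relations at a crossing\<close>

lemma before_after_rotate:
  assumes i: "inK (A @ B)" and x: "x \<in> set (A @ B)"
  shows "value_before s t (B @ A) x = value_before s t (A @ B) x" "value_after s t (B @ A) x = value_after s t (A @ B) x"
proof -
  have i': "inK (B @ A)" using i inK_rotate by blast
  have d: "distinct (A @ B)" "distinct (B @ A)"
    using inK_good[OF i] inK_good[OF i'] valid_distinct by (auto simp: good_iff simp del: distinct_append)
  have *: "value_before s t (B @ A) x = value_before s t (A @ B) x \<and> value_after s t (B @ A) x = value_after s t (A @ B) x"
    if i: "inK (A @ B)" and d: "distinct (A @ B)" "distinct (B @ A)" and "x \<in> set A" for A B
  proof -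
    obtain a b where A: "A = a @ x # b" using \<open>x \<in> set A\<close> by (metis split_list)
    have "value_before s t (B @ A) x = arc_value s t (B @ a) (x # b)"
      "value_after s t (B @ A) x = arc_value s t (B @ a @ [x]) b"
      using before_after[of "B @ a" x b s t] d(2) unfolding A by simp_all
    moreover have "value_before s t (A @ B) x = arc_value s t a (x # b @ B)"
      "value_after s t (A @ B) x = arc_value s t (a @ [x]) (b @ B)"
      using before_after[of a x "b @ B" s t] d(1) unfolding A by simp_all
    moreover have "inK (B @ A)" using i inK_rotate by blast
    ultimately show ?thesis using arc_value_rotate[of B a "x # b" s t] arc_value_rotate[of B "a @ [x]" b s t] unfolding A by simp
  qed
  show "value_before s t (B @ A) x = value_before s t (A @ B) x" "value_after s t (B @ A) x = value_after s t (A @ B) x"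
    using *[OF i d] *[OF i' d(2,1)] x by auto
qed

lemma shift_rotate:
  assumes i: "inK (A @ B)" and x: "x \<in> set (A @ B)"
  shows "shift s (B @ A) x = shift s (A @ B) x"
proof -
  have "valid (A @ B)" using inK_good[OF i] by (simp add: good_iff)
  then have "partner x \<in> set (A @ B)" using x by (rule valid_partner)
  from before_after_rotate[OF i this] show ?thesis by (simp add: shift_def split: mark.split)
qed

text \<open>
  The walk starts with \<open>z\<close> and \<open>x\<close> on the two outgoing edges of \<open>v\<close>, where \<open>tip_above\<close> gives the
  tip value. The value of the arc of \<open>z\<close>, at which the walk ends, is the shift at the passage of
  \<open>v\<close> on the strand \<open>s\<close>, up to sign.
\<close>

theorem crossing_value:
  fixes v s m
  defines "x \<equiv> Passage v s (Classical m)" and "y \<equiv> Passage v (opp s) (Classical m)"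
  assumes i: "inK (U @ [x] @ V @ [y])"
  shows "par (U @ [x] @ V @ [y]) v = (\<Sum>z\<leftarrow>[x] @ V @ [y]. shift s (U @ [x] @ V @ [y]) z)"
proof -
  let ?W = "U @ [x] @ V @ [y]"
  have i': "inK ((U @ [x]) @ V @ [y])" and i2: "inK ((U @ [x]) @ (V @ [y]) @ [])" using i by simp_all
  note T = tip_above[of U v s m V, folded x_def y_def, OF i']
  have f2: "facing s (U @ [x]) ((V @ [y]) @ [])" using T(1) by simp
  have "tip_value s (opp m) (U @ [x]) (V @ [y]) + (\<Sum>z\<leftarrow>V @ [y]. shift s ?W z) = arc_value s (opp m) [] ?W"
    using walk[OF i2 f2, of "opp m"] by simp
  moreover have "shift s ?W x = - arc_value s (opp m) [] ?W"
  proof -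
    have "distinct ?W" using inK_good[OF i] valid_distinct by (simp add: good_iff del: distinct_append)
    then have "value_after s (opp m) ?W y = arc_value s (opp m) ?W []"
      using before_after(2)[of "U @ [x] @ V" y "[]" s "opp m"] by (simp del: distinct_append)
    then show ?thesis using arc_value_rotate[of ?W "[]" "[]" s "opp m"] i by (simp add: shift_def x_def y_def partner_def)
  qed
  ultimately show ?thesis using T(2) by (simp add: algebra_simps)
qed

text \<open>
  For \<open>s = SENW\<close> the four values belong to SW, SE, NW and NE in this order. A virtual loop \<open>n\<close> is
  made on SW. The corner relation in the western corner of \<open>v\<close> compares the tips formed by the
  loop with SW and with NW. The first of them is the value of SW. The second one is the start of a
  walk from the loop to NW, which misses exactly the passages in the interior \<open>V\<close> of the left
  half. Their shifts are known from \<open>crossing_value\<close>.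
\<close>

theorem conservation:
  fixes v s m
  defines "x \<equiv> Passage v s (Classical m)" and "y \<equiv> Passage v (opp s) (Classical m)"
  assumes i: "inK (U @ [x] @ V @ [y])"
  shows "edge_value (U @ [x] @ V) [y] + edge_value U ([x] @ V @ [y]) =
    edge_value (U @ [x]) (V @ [y]) + edge_value [] (U @ [x] @ V @ [y])"
proof -
  let ?W = "U @ [x] @ V @ [y]" and ?M = "[y] @ U @ [x] @ V"
  have d: "distinct ?W" using inK_good[OF i] valid_distinct by (simp add: good_iff del: distinct_append)
  have iM: "inK ?M" using i inK_rotate[of "U @ [x] @ V" "[y]"] by simp
  have iV: "inK (V @ [y] @ U @ [x])" using i inK_rotate[of "U @ [x]" "V @ [y]"] by simp
  obtain n k l where "distinct [n, k, l]" "{n, k, l} \<inter> crossings ?W = {}" by (rule fresh_names)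
  then have n: "n \<notin> crossings ?W" "n \<notin> crossings ?M" "n \<notin> crossings (?M @ [])"
    "n \<notin> crossings (V @ [y] @ U @ [x])" by auto
  let ?n = "virt n s" and ?n' = "virt n (opp s)" and ?k = "kink n s Virtual"
  have v: "v \<in> cls (?M @ [])" "v \<in> cls ?W" by (simp_all add: cls_append cls_Cons x_def)
  have iM0: "inK (?M @ [])" using iM by simp
  have k: "inK (?M @ ?k @ [])" "par (?M @ ?k @ []) v = par (?M @ []) v"
    using virtual_kink[OF iM0 n(3)] v(1) by blast+
  have iL: "inK ((?M @ [?n]) @ [?n'])" using k(1) by (simp add: kink_def)
  have fL: "facing s (?M @ [?n]) [?n']" using facing_loop[of ?M "[]" s n Virtual] by (simp add: adj_def)
  have erM: "erase ?k ?M = ?M" by (rule erase_disjoint, use n(2) in \<open>simp add: crossings_kink image_Un\<close>)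
  have dM: "arc_value s SWNE [] (?M @ ?k) = arc_value s SWNE [] ?M"
    using arc_value_detour[of "[]" ?M ?k "[]" "[]" ?M "[]" "[]" s SWNE] k(1) iM inK_good[OF iM] erM by (simp add: kink_def)
  have t1: "tip_value s SWNE (?M @ [?n]) [?n'] = arc_value s SWNE [] ?M"
    using tip_value_terminal[OF iL fL, of SWNE] dM by (simp add: kink_def)
  note S1 = tip_value_swap(1)[OF iL fL] tip_value_swap(2)[OF iL fL, where t = SWNE]
  let ?W3 = "[?n'] @ [y] @ U @ [x] @ V @ [?n]"
  \<comment> \<open>Now the loop is the strand \<open>z\<close>.\<close>
  have i3: "inK ?W3" using iL inK_rotate[of "?M @ [?n]" "[?n']"] by simp
  have f3: "facing (opp s) ([?n'] @ [y] @ U @ [x]) (V @ [?n])"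
    using corner_facing_second[of x y "opp s" "[?n']" U "V @ [?n]"] S1(1) by (simp add: x_def y_def)
  have c: "tip_value (opp s) SWNE ([?n'] @ [y] @ U @ [x]) (V @ [?n]) - tip_value (opp s) SWNE [?n'] (?M @ [?n]) = par ?W3 v"
    using corner_second(2)[of "[?n']" v "opp s" m U "V @ [?n]" SWNE] i3 f3 by (simp add: x_def y_def)
  have p: "par ?W3 v = par ?W v"
  proof -
    have "par ?W3 v = par ((?M @ [?n]) @ [?n']) v"
      using par_rotate[OF iL, of v] by (simp add: cls_append cls_Cons x_def)
    also have "\<dots> = par (?M @ []) v" using k(2) by (simp add: kink_def)
    also have "\<dots> = par ?W v" using par_rotate[of "U @ [x] @ V" "[y]" v] i v by simp
    finally show ?thesis .
  qed
  have i4: "inK (([?n'] @ [y] @ U @ [x]) @ (V @ [?n]))" using i3 by simp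
  note S2 = tip_value_swap(1)[OF i4 f3] tip_value_swap(2)[OF i4 f3, where t = SWNE]
  let ?W4 = "V @ ?k @ [y] @ U @ [x]" and ?V = "V @ [y] @ U @ [x]"
  \<comment> \<open>Back to NW as the strand \<open>z\<close>, with the loop as the walking strand \<open>x\<close>.\<close>
  have i5: "inK ((V @ [?n]) @ ([?n'] @ [y] @ U @ [x]) @ [])" using i4 inK_rotate[of "[?n'] @ [y] @ U @ [x]"
    "V @ [?n]"] by simp
  have f5: "facing s (V @ [?n]) (([?n'] @ [y] @ U @ [x]) @ [])" using S2(1) by simp
  have w: "tip_value s SWNE (V @ [?n]) ([?n'] @ [y] @ U @ [x]) + (\<Sum>z\<leftarrow>[?n'] @ [y] @ U @ [x]. shift s ?W4 z) = arc_value s SWNE [] ?W4"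
    using walk[OF i5 f5, of SWNE] by (simp add: kink_def)
  have i4': "inK ?W4" using i5 by (simp add: kink_def)
  have er: "erase ?k V = V" "erase ?k ([y] @ U @ [x]) = [y] @ U @ [x]"
    by (rule erase_disjoint, use n(1) in \<open>simp add: crossings_kink image_Un\<close>)+
  have d4: "arc_value s SWNE [] ?W4 = arc_value s SWNE [] ?V"
    using arc_value_detour[of "[]" V ?k "[y] @ U @ [x]" "[]" V "[]"
      "[y] @ U @ [x]" s SWNE] i4' inK_good[OF iV] er by (simp add: kink_def)
  have sh: "shift s ?W4 z = shift s ?W z" if z: "z \<in> set ?W" for z
  proof -
    have z': "z \<in> set (V @ [y] @ U @ [x])" using z by auto
    have "shift s ?W4 z = shift s ?V z"
      by (rule shift_detour[of V "[]" "[y] @ U @ [x]" V ?k "[y] @ U @ [x]" z s, simplified append_Nil erase_Nil])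
        (use iV inK_good[OF i4'] er z' in \<open>simp_all add: kink_def\<close>)
    also have "\<dots> = shift s ?W z" using shift_rotate[of "U @ [x]" "V @ [y]" z s] i z by simp
    finally show ?thesis .
  qed
  have "shift s ?W4 ?n' = 0" by (simp add: shift_def)
  then have "(\<Sum>z\<leftarrow>[?n'] @ [y] @ U @ [x]. shift s ?W4 z) = (\<Sum>z\<leftarrow>[y] @ U @ [x]. shift s ?W4 z)" by simp
  also have "\<dots> = (\<Sum>z\<leftarrow>[y] @ U @ [x]. shift s ?W z)"
    by (intro arg_cong[of _ _ sum_list] map_cong refl sh) auto
  finally have sm: "(\<Sum>z\<leftarrow>[?n'] @ [y] @ U @ [x]. shift s ?W4 z) = (\<Sum>z\<leftarrow>[y] @ U @ [x]. shift s ?W z)" .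
  let ?g = "shift s ?W"
  have main: "par ?W v + arc_value s SWNE [] ?M + (?g y + sum_list (map ?g U) + ?g x) = arc_value s SWNE [] ?V"
    using w c p t1 S1(2) S2(2) sm d4 by (simp add: algebra_simps)
  have all: "sum_list (map ?g U) + ?g x + sum_list (map ?g V) + ?g y = 0"
    using sum_shifts[OF i, of s] by (simp add: add.assoc)
  have pv: "par ?W v = ?g x + sum_list (map ?g V) + ?g y"
    using crossing_value[of U v s m V, folded x_def y_def, OF i] by (simp add: add.assoc)
  \<comment> \<open>The sum over \<open>U\<close> is eliminated by \<open>sum_shifts\<close>, the one over \<open>V\<close> by \<open>crossing_value\<close>.\<close>
  have grp: "S + gy + gx = e" if "p + S + (gy + u + gx) = e" "u + gx + r + gy = 0" "p = gx + r + gy"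
    for S gy gx e p u r :: 'a
  proof -
    have "p + u = 0" using that(2,3) by (simp add: ac_simps)
    moreover have "p + S + (gy + u + gx) = (p + u) + (S + gy + gx)" by (simp add: ac_simps)
    ultimately show ?thesis using that(1) by simp
  qed
  have main2: "arc_value s SWNE [] ?M + ?g y + ?g x = arc_value s SWNE [] ?V" by (rule grp[OF main all pv])
  \<comment> \<open>The partner \<open>y\<close> of \<open>x\<close> is the last passage of the word, so that the gap after it is the base point.\<close>
  have gx: "?g x = - edge_value [] ?W"
  proof -
    have "value_after s (opp m) ?W y = arc_value s (opp m) ?W []"
      using before_after(2)[of "U @ [x] @ V" y "[]" s "opp m"] d by (simp del: distinct_append)
    then show ?thesis using arc_value_rotate[of ?W "[]" "[]" s "opp m"] i arc_value_edge_value[of "[]" ?W s "opp m"]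
      by (simp add: shift_def x_def y_def partner_def)
  qed
  have gy: "?g y = edge_value U ([x] @ V @ [y])"
  proof -
    have "value_before s m ?W x = arc_value s m U ([x] @ V @ [y])" using before_after(1)[of U x "V @ [y]" s m] d by (simp del: distinct_append)
    then show ?thesis using arc_value_edge_value[of U "[x] @ V @ [y]" s m] i
      by (simp add: shift_def x_def y_def partner_def)
  qed
  have "arc_value s SWNE [] ?M = edge_value (U @ [x] @ V) [y]"
    using arc_value_rotate[of "U @ [x] @ V" "[]" "[y]" s SWNE] arc_value_edge_value[of "U @ [x] @ V" "[y]" s SWNE] i by simp
  moreover have "arc_value s SWNE [] ?V = edge_value (U @ [x]) (V @ [y])"
    using arc_value_rotate[of "U @ [x]" "[]" "V @ [y]" s SWNE] arc_value_edge_value[of "U @ [x]" "V @ [y]" s SWNE] i by simp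
  ultimately show ?thesis using main2 unfolding gx gy by (simp add: algebra_simps)
qed

end

section \<open>The value of an edge under the moves\<close>

text \<open>
  Sending every side of a face to the next one is a permutation without proper invariant subsets,
  and three sides admit only two such permutations.
\<close>

lemma face_is_triangle:
  assumes v: "valid w" "w \<noteq> []" and x: "x1 \<in> sides w" "x2 \<in> sides w" "x3 \<in> sides w"
    and d: "x1 \<noteq> x2" "x2 \<noteq> x3" "x1 \<noteq> x3" and r: "{x1, x2, x3} = region w {} z"
  shows "fore w x1 = hind w x2 \<and> fore w x2 = hind w x3 \<and> fore w x3 = hind w x1 \<or>
    fore w x1 = hind w x3 \<and> fore w x3 = hind w x2 \<and> fore w x2 = hind w x1"
proof -
  let ?S = "{x1, x2, x3}"
  have reg: "region w {} y = ?S" if "y \<in> ?S" for y using region_same[of y w z] that r by simp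
  have succ: "\<exists>q\<in>?S. hind w q = fore w y" if y: "y \<in> ?S" for y
  proof -
    have ys: "y \<in> sides w" using y x by auto
    obtain c e where ce: "fore w y = (c, e)" by force
    then have c: "c \<in> crossings w" using fore_iff[OF v(1) ys v(2)] by blast
    define q where "q = (case e of West \<Rightarrow> (nw w c, Left) | South \<Rightarrow> (sw w c, Right) | East \<Rightarrow> (se w c, Right) | North \<Rightarrow> (ne w c, Left))"
    have qs: "q \<in> sides w" using corner_sides[OF v(1) c] by (cases e) (simp_all add: q_def)
    have h: "hind w q = (c, e)" using hind_iff[OF v(1) qs v(2)] c by (simp add: q_def)
    then have "(y, q) \<in> corners w \<union> (corners w)\<inverse>" using corners_iff[OF v] ys qs ce by simp
    then have "q \<in> region w {} y" unfolding region_eq by blast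
    then show ?thesis using reg[OF y] h ce by metis
  qed
  have closed: False if T: "T \<subseteq> ?S" "T \<noteq> ?S" "T \<noteq> {}"
    and f: "\<And>y. y \<in> T \<Longrightarrow> (\<exists>q\<in>T. hind w q = fore w y) \<and> (\<exists>q\<in>T. fore w q = hind w y)" for T
  proof -
    obtain y where y: "y \<in> T" using T(3) by blast
    have Ts: "T \<subseteq> sides w" using T(1) x by auto
    have "q \<in> T" if "q \<in> region w {} y" for q
    proof -
      have "(y, q) \<in> connected_sides w" using that by (simp add: region_eq)
      then show ?thesis
      proof (induction rule: rtrancl_induct)
        case (step p q)
        have q: "q \<in> sides w"
          "fore w p = hind w q \<or> hind w p = fore w q" using corners_iff[OF v, of p q] step(2) by auto
        obtain a b where ab: "a \<in> T" "hind w a = fore w p" "b \<in> T" "fore w b = hind w p" using f[OF step.IH] by blast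
        have "fore w p = hind w q \<Longrightarrow> q = a" using hind_inj[OF v q(1), of a] ab(1,2) Ts by auto
        moreover have "hind w p = fore w q \<Longrightarrow> q = b" using fore_inj[OF v q(1), of b] ab(3,4) Ts by auto
        ultimately show ?case using q(2) ab by blast
      qed (use y in simp)
    qed
    moreover have "region w {} y = ?S" using reg y T(1) by blast
    ultimately show False using T by blast
  qed
  have nofix: "fore w y \<noteq> hind w y" if "y \<in> ?S" for y
    using closed[of "{y}"] that d by auto
  have two: "\<not> (fore w y = hind w q \<and> fore w q = hind w y)" if "y \<in> ?S" "q \<in> ?S" for y q
  proof
    assume yq: "fore w y = hind w q \<and> fore w q = hind w y"
    have ne: "{y, q} \<noteq> ?S"
    proof
      assume e: "{y, q} = ?S"
      have "card {y, q} \<le> 2" by (simp add: card_insert_if)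
      moreover have "card ?S = 3" using d by simp
      ultimately show False unfolding e by simp
    qed
    show False by (rule closed[OF _ ne]) (use that yq in auto)
  qed
  have inj: "fore w x1 \<noteq> fore w x2" "fore w x2 \<noteq> fore w x3" "fore w x1 \<noteq> fore w x3"
    using fore_inj[OF v] x d by blast+
  have s1: "fore w x1 = hind w x2 \<or> fore w x1 = hind w x3" using succ[of x1] nofix[of x1] by auto
  have s2: "fore w x2 = hind w x1 \<or> fore w x2 = hind w x3" using succ[of x2] nofix[of x2] by auto
  have s3: "fore w x3 = hind w x1 \<or> fore w x3 = hind w x2" using succ[of x3] nofix[of x3] by auto
  have t12: "\<not> (fore w x1 = hind w x2 \<and> fore w x2 = hind w x1)"
    and t23: "\<not> (fore w x2 = hind w x3 \<and> fore w x3 = hind w x2)"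
    and t13: "\<not> (fore w x1 = hind w x3 \<and> fore w x3 = hind w x1)" using two by blast+
  show ?thesis using s1 s2 s3 t12 t23 t13 by argo
qed

lemma triangle_of_face:
  fixes u0 u1 u2 u3 :: "passage list" and a b c d x y :: passage
  defines "w \<equiv> u0 @ [a, b] @ u1 @ [c, d] @ u2 @ [x, y] @ u3"
  assumes v: "valid w" and D: "\<Delta> \<in> faces w" "card \<Delta> = 3"
    "fst ` \<Delta> = {length u0 + 1, length u0 + length u1 + 3, length u0 + length u1 + length u2 + 5}"
  obtains \<sigma>1 \<sigma>2 \<sigma>3 where "triangle a b \<sigma>1 c d \<sigma>2 x y \<sigma>3"
proof -
  let ?e1 = "length u0 + 1" and ?e2 = "length u0 + length u1 + 3" and ?e3 = "length u0 + length u1 + length u2 + 5"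
  have ne: "w \<noteq> []" by (simp add: w_def)
  obtain \<sigma>1 \<sigma>2 \<sigma>3 where m: "(?e1, \<sigma>1) \<in> \<Delta>"
    "(?e2, \<sigma>2) \<in> \<Delta>" "(?e3, \<sigma>3) \<in> \<Delta>"
  proof -
    have "?e1 \<in> fst ` \<Delta>" "?e2 \<in> fst ` \<Delta>" "?e3 \<in> fst ` \<Delta>" unfolding D(3) by simp_all
    then show ?thesis using that by auto
  qed
  have fin: "finite \<Delta>" using D(2) card.infinite by fastforce
  have "card {(?e1, \<sigma>1), (?e2, \<sigma>2), (?e3, \<sigma>3)} = 3" by simp
  then have S: "{(?e1, \<sigma>1), (?e2, \<sigma>2), (?e3, \<sigma>3)} = \<Delta>"
    using m D(2) by (intro card_subset_eq[OF fin]) auto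
  obtain z where z: "\<Delta> = region w {} z" using D(1) by (auto simp: faces_def)
  have s: "(?e1, \<sigma>1) \<in> sides w" "(?e2, \<sigma>2) \<in> sides w" "(?e3, \<sigma>3) \<in> sides w"
    using sides_iff[OF ne] by (auto simp: w_def)
  have f1: "fore w (?e1, \<sigma>1) = fore2 a b \<sigma>1" "hind w (?e1, \<sigma>1) = hind2 a b \<sigma>1"
    using fore_inner[of w u0 a b "u1 @ [c, d] @ u2 @ [x, y] @ u3"] by (simp_all add: w_def)
  have f2: "fore w (?e2, \<sigma>2) = fore2 c d \<sigma>2" "hind w (?e2, \<sigma>2) = hind2 c d \<sigma>2"
    using fore_inner[of w "u0 @ [a, b] @ u1" c d "u2 @ [x, y] @ u3"] by (simp_all add: w_def eval_nat_numeral)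
  have f3: "fore w (?e3, \<sigma>3) = fore2 x y \<sigma>3" "hind w (?e3, \<sigma>3) = hind2 x y \<sigma>3"
    using fore_inner[of w "u0 @ [a, b] @ u1 @ [c, d] @ u2" x y u3] by (simp_all add: w_def eval_nat_numeral add.assoc)
  have "triangle a b \<sigma>1 c d \<sigma>2 x y \<sigma>3"
    using face_is_triangle[OF v ne s _ _ _ trans[OF S z]] unfolding triangle_def f1 f2 f3 by auto
  then show ?thesis by (rule that)
qed

context parity
begin

text \<open>
  The value of the edge \<open>i\<close>, which ends at the passage \<open>i\<close>.
\<close>

definition ev :: "passage list \<Rightarrow> nat \<Rightarrow> 'a" where
  "ev w i = edge_value [] (rotate i w)"

lemma inK_rotate_power: "inK w \<Longrightarrow> inK (rotate i w)"
  unfolding rotate_drop_take using inK_rotate[of "take (i mod length w) w" "drop (i mod length w) w"] by simp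

lemma ev_edge [simp]: "ev w (edge w i) = ev w i"
  unfolding ev_def edge_def by (simp add: rotate_conv_mod[symmetric])

lemma edge_value_rotate: "inK (a @ b) \<Longrightarrow> edge_value [] (b @ a) = edge_value a b"
  unfolding edge_value_def using arc_value_rotate[of a "[]" b SWNE SWNE] by simp

lemma ev_at: "inK (a @ b) \<Longrightarrow> i = length a \<Longrightarrow> ev (a @ b) i = edge_value a b"
  unfolding ev_def by (simp add: rotate_append edge_value_rotate)

lemma ev_eqI:
  assumes "inK (a @ b)" "inK (a' @ b')" "w = a @ b" "w' = a' @ b'" "i = length a" "i' = length a'"
    "edge_value a b = edge_value a' b'"
  shows "ev w i = ev w' i'"
  using assms ev_at by simp

lemma ev_isotopy:
  assumes "isotopy \<sigma> D D' E" "D \<in> K" "(e, e') \<in> E"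
  shows "ev (curve D) e = ev (curve D') e'"
proof -
  let ?w = "curve D"
  obtain k i where k: "curve D' = rotate k (map (rename \<sigma>) ?w)" and e: "e = edge ?w (i + k)" "e' = i"
    and inj: "inj_on \<sigma> (crossings ?w)"
    using assms(1,3) unfolding isotopy_def rename_def[abs_def] by auto
  have i: "inK (rotate (i + k) ?w)" using K_inK[OF assms(2)] by (rule inK_rotate_power)
  have "ev (curve D') e' = edge_value (map (rename \<sigma>) []) (map (rename \<sigma>) (rotate (i + k) ?w))"
    unfolding ev_def k e by (simp add: rotate_rotate rotate_map)
  also have "\<dots> = edge_value [] (rotate (i + k) ?w)"
    unfolding edge_value_def by (rule arc_value_rename) (use i inj in simp_all)
  finally show ?thesis unfolding e by (simp add: ev_def[of ?w "i + k"])
qed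

lemma ev_detour:
  assumes "detour D D' E" "D \<in> K" "(e, e') \<in> E"
  shows "ev (curve D) e = ev (curve D') e'"
proof -
  let ?w = "curve D" and ?w' = "curve D'"
  obtain u P v u' P' v' where w: "?w = u @ P @ v" "?w' = u' @ P' @ v'"
    and V: "\<forall>x \<in> set P \<union> set P'. mark x = Virtual"
    and er: "erase P u = erase P' u'" "erase P v = erase P' v'"
    and E: "E = {(edge ?w i, edge ?w' i') | i i'.
               i \<le> length u \<and> i' \<le> length u' \<and>
               length (erase P (take i u)) = length (erase P' (take i' u'))} \<union>
            {(edge ?w (length (u @ P) + i), edge ?w' (length (u' @ P') + i')) | i i'.
               i \<le> length v \<and> i' \<le> length v' \<and>
               length (erase P (take i v)) = length (erase P' (take i' v'))}"
    using assms(1) unfolding detour_def by (elim conjE exE) (rule that)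
  have i: "inK ?w" using K_inK[OF assms(2)] .
  have i': "inK ?w'" using K_inK[OF K_move[OF assms(2) move.detour[OF assms(1)]]] .
  have cut: "erase P (take i r) = erase P' (take i' r') \<and> erase P (drop i r) = erase P' (drop i' r')"
    if "erase P r = erase P' r'" "length (erase P (take i r)) = length (erase P' (take i' r'))" for i i' r r'
  proof -
    have "erase P (take i r) @ erase P (drop i r) = erase P' (take i' r') @ erase P' (drop i' r')"
      using that(1) by (metis append_take_drop_id erase_append)
    then show ?thesis using append_eq_append_conv[of "erase P (take i r)" "erase P' (take i' r')"] that(2) by blast
  qed
  consider i i' where "e = edge ?w i" "e' = edge ?w' i'" "i \<le> length u" "i' \<le> length u'"
      "length (erase P (take i u)) = length (erase P' (take i' u'))"
    | i i' where "e = edge ?w (length (u @ P) + i)" "e' = edge ?w' (length (u' @ P') + i')" "i \<le> length v"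
      "i' \<le> length v'"
      "length (erase P (take i v)) = length (erase P' (take i' v'))"
    using assms(3) unfolding E by blast
  then show ?thesis
  proof cases
    case (1 j j')
    note c = cut[OF er(1) 1(5)]
    have "edge_value (take j u) (drop j u @ P @ v) = edge_value (take j' u') (drop j' u' @ P' @ v')"
      unfolding edge_value_def
      by (rule arc_value_detour) (use i inK_good[OF i'] V er c in \<open>simp_all add: w append_assoc[symmetric] del: append_assoc\<close>)
    then have "ev ?w j = ev ?w' j'"
      by (intro ev_eqI[of "take j u" "drop j u @ P @ v" "take j' u'" "drop j' u' @ P' @ v'"])
        (use i i' 1(3,4) in \<open>simp_all add: w append_assoc[symmetric] del: append_assoc\<close>)
    then show ?thesis unfolding 1(1,2) by simp
  next
    case (2 j j')
    note c = cut[OF er(2) 2(5)]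
    have "edge_value (u @ P @ take j v) (drop j v) = edge_value (u' @ P' @ take j' v') (drop j' v')"
      unfolding edge_value_def
      by (rule arc_value_detour_after) (use i inK_good[OF i'] V er c in \<open>simp_all add: w\<close>)
    then have "ev ?w (length (u @ P) + j) = ev ?w' (length (u' @ P') + j')"
      by (intro ev_eqI[of "u @ P @ take j v" "drop j v" "u' @ P' @ take j' v'" "drop j' v'"])
        (use i i' 2(3,4) in \<open>simp_all add: w\<close>)
    then show ?thesis unfolding 2(1,2) by simp
  qed
qed

lemma local_moveE:
  assumes "local_move us As Bs D D' E" "(e, e') \<in> E"
  obtains j i where "j < length us" "i \<le> length (us ! j)" "curve D = weave us As" "curve D' = weave us Bs"
    "e = edge (curve D) (length (weave (take j us) (take j As)) + i)"
    "e' = edge (curve D') (length (weave (take j us) (take j Bs)) + i)"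
  using assms unfolding local_move_def by blast

lemma ev_R1:
  assumes "R1 c D D' E" "D \<in> K" "(e, e') \<in> E"
  shows "ev (curve D) e = ev (curve D') e'"
proof -
  obtain u v s t where lm: "local_move [u, v] [[]] [kink c s (Classical t)] D D' E"
    using assms(1) unfolding R1_def kink_def by blast
  from local_moveE[OF lm assms(3)] obtain j i where
    j: "j < length [u, v]" "i \<le> length ([u, v] ! j)" and w: "curve D = u @ v"
      "curve D' = u @ kink c s (Classical t) @ v" and
    e: "e = edge (curve D) (length (weave (take j [u, v]) (take j [[]])) + i)"
      "e' = edge (curve D') (length (weave (take j [u, v]) (take j [kink c s (Classical t)])) + i)" by auto
  have i: "inK (u @ v)" using K_inK[OF assms(2)] w by simp
  have i': "inK (u @ kink c s (Classical t) @ v)" using K_inK[OF K_move[OF assms(2) move.R1[OF assms(1)]]] w by simp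
  have "j = 0 \<or> j = 1" using j(1) by auto
  then show ?thesis
  proof
    assume j0: "j = 0"
    have "edge_value (take i u) (drop i u @ kink c s (Classical t) @ v) = edge_value (take i u) (drop i u @ v)"
      unfolding edge_value_def by (rule arc_value_R1) (use i inK_good[OF i'] in \<open>simp_all add: append_assoc[symmetric] del: append_assoc\<close>)
    then have "ev (curve D) i = ev (curve D') i"
      by (intro ev_eqI[of "take i u" "drop i u @ v" "take i u" "drop i u @ kink c s (Classical t) @ v"])
        (use i i' j j0 in \<open>simp_all add: w append_assoc[symmetric] del: append_assoc\<close>)
    then show ?thesis using e j0 by simp
  next
    assume j1: "j = 1"
    have "edge_value (u @ kink c s (Classical t) @ take i v) (drop i v) = edge_value (u @ take i v) (drop i v)"
      unfolding edge_value_def by (rule arc_value_R1_after) (use i inK_good[OF i'] in simp_all)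
    then have "ev (curve D) (length u + i) = ev (curve D') (length (u @ kink c s (Classical t)) + i)"
      by (intro ev_eqI[of "u @ take i v" "drop i v" "u @ kink c s (Classical t) @ take i v" "drop i v"])
        (use i i' j j1 in \<open>simp_all add: w\<close>)
    then show ?thesis using e j1 by simp
  qed
qed

lemma ev_R2:
  assumes "R2 pl k l ee ff D D' E" "D \<in> K" "(e, e') \<in> E"
  shows "ev (curve D) e = ev (curve D') e'"
proof -
  obtain u v x s t where lm: "local_move [u, v, x] [[], []]
      [bigon1 s (Classical t) (Classical (opp t)) k l, bigon2 pl s (Classical t) (Classical (opp t)) k l] D D' E"
    using assms(1) unfolding R2_def Let_def bigon1_def bigon2_def by (cases pl) auto
  define A B where "A = bigon1 s (Classical t) (Classical (opp t)) k l"
    "B = bigon2 pl s (Classical t) (Classical (opp t)) k l"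
  from local_moveE[OF lm[folded A_B_def] assms(3)] obtain j i where
    j: "j < length [u, v, x]" "i \<le> length ([u, v, x] ! j)" and w: "curve D = u @ v @ x"
      "curve D' = u @ A @ v @ B @ x" and
    e: "e = edge (curve D) (length (weave (take j [u, v, x]) (take j [[], []])) + i)"
      "e' = edge (curve D') (length (weave (take j [u, v, x]) (take j [A, B])) + i)" by auto
  have i: "inK (u @ v @ x)" using K_inK[OF assms(2)] w by simp
  have i': "inK (u @ A @ v @ B @ x)" using K_inK[OF K_move[OF assms(2) move.R2[OF assms(1)]]] w by simp
  have "j = 0 \<or> j = 1 \<or> j = 2" using j(1) by auto
  then show ?thesis
  proof (elim disjE)
    assume j0: "j = 0"
    have "edge_value (take i u) (drop i u @ A @ v @ B @ x) = edge_value (take i u) (drop i u @ v @ x)"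
      unfolding edge_value_def A_B_def
      by (rule arc_value_R2(1)) (use i inK_good[OF i'] in \<open>simp_all add: A_B_def append_assoc[symmetric] del: append_assoc\<close>)
    then have "ev (curve D) i = ev (curve D') i"
      by (intro ev_eqI[of "take i u" "drop i u @ v @ x" "take i u" "drop i u @ A @ v @ B @ x"])
        (use i i' j j0 in \<open>simp_all add: w append_assoc[symmetric] del: append_assoc\<close>)
    then show ?thesis using e j0 by simp
  next
    assume j1: "j = 1"
    have vv: "take i v @ drop i v @ z = v @ z" for z by (simp add: append_assoc[symmetric] del: append_assoc)
    have "edge_value (u @ A @ take i v) (drop i v @ B @ x) = edge_value (u @ take i v) (drop i v @ x)"
      unfolding edge_value_def A_B_def
      by (rule arc_value_R2(2)) (use i inK_good[OF i'] in \<open>simp_all add: A_B_def vv\<close>)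
    then have "ev (curve D) (length u + i) = ev (curve D') (length (u @ A) + i)"
      by (intro ev_eqI[of "u @ take i v" "drop i v @ x" "u @ A @ take i v" "drop i v @ B @ x"])
        (use i i' j j1 in \<open>simp_all add: w vv\<close>)
    then show ?thesis using e j1 by simp
  next
    assume j2: "j = 2"
    have "edge_value (u @ A @ v @ B @ take i x) (drop i x) = edge_value (u @ v @ take i x) (drop i x)"
      unfolding edge_value_def A_B_def
      by (rule arc_value_R2(3)) (use i inK_good[OF i'] in \<open>simp_all add: A_B_def\<close>)
    then have "ev (curve D) (length (u @ v) + i) = ev (curve D') (length (u @ A @ v @ B) + i)"
      by (intro ev_eqI[of "u @ v @ take i x" "drop i x" "u @ A @ v @ B @ take i x" "drop i x"])
        (use i i' j j2 in \<open>simp_all add: w\<close>)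
    then show ?thesis using e j2 by (simp add: numeral_2_eq_2)
  qed
qed

lemma ev_R3:
  assumes "R3 \<Delta> V D D' E" "D \<in> K" "(e, e') \<in> E"
  shows "ev (curve D) e = ev (curve D') e'"
proof -
  obtain u0 u1 u2 u3 a b c d x y where lm: "local_move [u0, u1, u2, u3] [[a, b], [c, d], [x, y]] [[b, a], [d, c], [y, x]] D D' E"
    and m: "\<forall>z \<in> {a, b, c, d, x, y}. mark z \<noteq> Virtual"
      "\<exists>(z, z') \<in> {(a, b), (c, d), (x, y)}. over z \<and> over z'"
      "\<exists>(z, z') \<in> {(a, b), (c, d), (x, y)}. under z \<and> under z'"
    and \<Delta>: "\<Delta> \<in> faces (curve D)" "card \<Delta> = 3"
      "fst ` \<Delta> = {length u0 + 1, length u0 + length u1 + 3, length u0 + length u1 + length u2 + 5}"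
    using assms(1) unfolding R3_def by (elim exE conjE) (rule that)
  define A B where "A = [[a, b], [c, d], [x, y]]" "B = [[b, a], [d, c], [y, x]]"
  from local_moveE[OF lm assms(3)] obtain j i where
    j: "j < length [u0, u1, u2, u3]" "i \<le> length ([u0, u1, u2, u3] ! j)" and
    w: "curve D = weave [u0, u1, u2, u3] [[a, b], [c, d], [x, y]]"
      "curve D' = weave [u0, u1, u2, u3] [[b, a], [d, c], [y, x]]" and
    e: "e = edge (curve D) (length (weave (take j [u0, u1, u2, u3]) (take j A)) + i)"
      "e' = edge (curve D') (length (weave (take j [u0, u1, u2, u3]) (take j B)) + i)" unfolding A_B_def by metis
  let ?W = "\<lambda>u0 u1 u2 u3. u0 @ [a, b] @ u1 @ [c, d] @ u2 @ [x, y] @ u3"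
  let ?W' = "\<lambda>u0 u1 u2 u3. u0 @ [b, a] @ u1 @ [d, c] @ u2 @ [y, x] @ u3"
  have w: "curve D = ?W u0 u1 u2 u3" "curve D' = ?W' u0 u1 u2 u3" using w by simp_all
  have i: "inK (?W u0 u1 u2 u3)" using K_inK[OF assms(2)] w by simp
  have i': "inK (?W' u0 u1 u2 u3)" using K_inK[OF K_move[OF assms(2) move.R3[OF assms(1)]]] w by simp
  have v: "valid (?W u0 u1 u2 u3)" using inK_good[OF i] by (simp add: good_iff)
  obtain \<sigma>1 \<sigma>2 \<sigma>3 where tr: "triangle a b \<sigma>1 c d \<sigma>2 x y \<sigma>3"
    using triangle_of_face[OF v] \<Delta> unfolding w by metis
  have R: "par (?W p0 p1 p2 p3) n = par (?W' p0 p1 p2 p3) n"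
    if "inK (?W p0 p1 p2 p3)" "good (?W' p0 p1 p2 p3)" "n \<in> cls (?W p0 p1 p2 p3)" for p0 p1 p2 p3 n
    using R3_par(2)[OF inK_good[OF that(1)] that(2) tr m that(1,3)] by simp
  have tk: "take i u @ drop i u @ z = u @ z" for u z :: "passage list" by (simp add: append_assoc[symmetric] del: append_assoc)
  have eq: "ev (curve D) (length p) = ev (curve D') (length p')"
    if pq: "p @ q = ?W u0 u1 u2 u3" "p' @ q' = ?W' u0 u1 u2 u3"
      and T: "\<And>k l n. inK (p @ tangle SWNE SWNE k l n @ q) \<Longrightarrow> good (p' @ tangle SWNE SWNE k l n @ q') \<Longrightarrow>
        k \<in> cls (p @ tangle SWNE SWNE k l n @ q) \<Longrightarrow>
        par (p @ tangle SWNE SWNE k l n @ q) k = par (p' @ tangle SWNE SWNE k l n @ q') k" for p q p' q'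
  proof -
    have "edge_value p q = edge_value p' q'" unfolding edge_value_def
      by (rule arc_value_transfer) (use i i' T in \<open>simp_all add: pq\<close>)
    then show ?thesis by (intro ev_eqI[of p q p' q']) (use i i' in \<open>simp_all add: w pq\<close>)
  qed
  have "j = 0 \<or> j = 1 \<or> j = 2 \<or> j = 3" using j(1) by auto
  then show ?thesis
  proof (elim disjE)
    assume j0: "j = 0"
    have "ev (curve D) (length (take i u0)) = ev (curve D') (length (take i u0))"
      by (rule eq[of _ "drop i u0 @ [a, b] @ u1 @ [c, d] @ u2 @ [x, y] @ u3" _ "drop i u0 @ [b, a] @ u1 @ [d, c] @ u2 @ [y, x] @ u3"])
        (use R[of "take i u0 @ tangle SWNE SWNE _ _ _ @ drop i u0" u1 u2 u3] in \<open>simp_all add: tk\<close>)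
    then show ?thesis using e j j0 by simp
  next
    assume j1: "j = 1"
    have "ev (curve D) (length (u0 @ [a, b] @ take i u1)) = ev (curve D') (length (u0 @ [b, a] @ take i u1))"
      by (rule eq[of _ "drop i u1 @ [c, d] @ u2 @ [x, y] @ u3" _ "drop i u1 @ [d, c] @ u2 @ [y, x] @ u3"])
        (use R[of u0 "take i u1 @ tangle SWNE SWNE _ _ _ @ drop i u1" u2 u3] in \<open>simp_all add: tk\<close>)
    then show ?thesis using e j j1 by (simp add: A_B_def)
  next
    assume j2: "j = 2"
    have "ev (curve D) (length (u0 @ [a, b] @ u1 @ [c, d] @ take i u2)) = ev (curve D') (length (u0 @ [b, a] @ u1 @ [d, c] @ take i u2))"
      by (rule eq[of _ "drop i u2 @ [x, y] @ u3" _ "drop i u2 @ [y, x] @ u3"])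
        (use R[of u0 u1 "take i u2 @ tangle SWNE SWNE _ _ _ @ drop i u2" u3] in \<open>simp_all add: tk\<close>)
    then show ?thesis using e j j2 by (simp add: A_B_def numeral_2_eq_2 add.assoc)
  next
    assume j3: "j = 3"
    have "ev (curve D) (length (u0 @ [a, b] @ u1 @ [c, d] @ u2 @ [x, y] @ take i u3)) =
        ev (curve D') (length (u0 @ [b, a] @ u1 @ [d, c] @ u2 @ [y, x] @ take i u3))"
      by (rule eq[of _ "drop i u3" _ "drop i u3"])
        (use R[of u0 u1 u2 "take i u3 @ tangle SWNE SWNE _ _ _ @ drop i u3"] in \<open>simp_all add: tk\<close>)
    then show ?thesis using e j j3 by (simp add: A_B_def numeral_3_eq_3 add.assoc)
  qed
qed

theorem edge_value_invariant: "move D D' F E \<Longrightarrow> D \<in> K \<Longrightarrow> (e, e') \<in> E \<Longrightarrow> ev (curve D) e = ev (curve D') e'"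
proof (induction arbitrary: e e' rule: move.induct)
  case isotopy then show ?case by (rule ev_isotopy)
next
  case detour then show ?case by (rule ev_detour)
next
  case R1 then show ?case by (rule ev_R1)
next
  case R2 then show ?case by (rule ev_R2)
next
  case R3 then show ?case by (rule ev_R3)
next
  case (inverse D D' F E)
  have "D \<in> K" using K_move_iff[OF inverse.hyps] inverse.prems(1) by blast
  then show ?case using inverse.IH[of e' e] inverse.prems(2) by simp
qed

end

section \<open>The parity cycle\<close>

lemma mem_arc_of [simp]: "e \<in> arc_of D e"
  by (simp add: arc_of_def Let_def)

lemma arc_of_eq: "e' \<in> arc_of D e \<Longrightarrow> arc_of D e' = arc_of D e"
  unfolding arc_of_def Let_def Image_singleton
  by (auto intro: rtrancl_trans symD[OF sym_rtrancl[OF sym_Un_converse]])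

lemma arcs_arc_of: "a \<in> arcs D \<Longrightarrow> e \<in> a \<Longrightarrow> a = arc_of D e"
  unfolding arcs_def using arc_of_eq by auto

lemma arc_of_Diagram: "arc_of (Diagram w x) = arc_of (Diagram w y)"
  by (simp add: arc_of_def fun_eq_iff)

lemma closed_relation:
  assumes "(a, b) \<in> (r \<union> r\<inverse>)\<^sup>*"
    "\<And>x y. (x, y) \<in> r \<Longrightarrow> x \<in> S \<longleftrightarrow> y \<in> S"
  shows "a \<in> S \<longleftrightarrow> b \<in> S"
  using assms(1) by (induction rule: rtrancl_induct) (use assms(2) in auto)

lemma arc_closed:
  assumes "f \<in> arc_of D e"
    and "\<And>i. i < length (curve D) \<Longrightarrow> mark (curve D ! i) = Virtual \<Longrightarrow> i \<in> S \<longleftrightarrow> edge (curve D) (Suc i) \<in> S"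
  shows "e \<in> S \<longleftrightarrow> f \<in> S"
  using assms(1) unfolding arc_of_def Let_def Image_singleton_iff
  by (rule closed_relation) (use assms(2) in auto)

text \<open>
  Two classical passages, one on either way from one gap to the other, would cut the knot into two
  pieces, and no arc meets both of them.
\<close>

lemma same_arc_virtual:
  assumes ij: "i \<le> j" "j \<le> length (curve D)" and a: "edge (curve D) j \<in> arc_of D (edge (curve D) i)"
  shows "(\<forall>k. i \<le> k \<and> k < j \<longrightarrow> mark (curve D ! k) = Virtual) \<or>
    (\<forall>k<length (curve D). k < i \<or> j \<le> k \<longrightarrow> mark (curve D ! k) = Virtual)"
proof (rule ccontr)
  let ?w = "curve D"
  assume "\<not> ?thesis"
  then obtain c d where c: "i \<le> c" "c < j" "mark (?w ! c) \<noteq> Virtual" and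
    d: "d < length ?w" "d < i \<or> j \<le> d" "mark (?w ! d) \<noteq> Virtual" by auto
  have ne: "?w \<noteq> []" using d by auto
  show False
  proof (cases "j \<le> d")
    case True
    have "edge ?w i \<in> {c<..d} \<longleftrightarrow> edge ?w j \<in> {c<..d}"
    proof (rule arc_closed[OF a])
      fix m assume m: "m < length ?w" "mark (?w ! m) = Virtual"
      then have "m \<noteq> c" "m \<noteq> d" using c d by auto
      then show "m \<in> {c<..d} \<longleftrightarrow> edge ?w (Suc m) \<in> {c<..d}"
        using m d(1) by (cases "Suc m = length ?w") (auto simp: edge_def)
    qed
    moreover have "edge ?w i = i" "edge ?w j = j" using True d c ij ne by (simp_all add: edge_def)
    ultimately show False using c True by simp
  next
    case False
    then have di: "d < i" using d by simp
    have "edge ?w i \<in> {d<..c} \<longleftrightarrow> edge ?w j \<in> {d<..c}"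
    proof (rule arc_closed[OF a])
      fix m assume m: "m < length ?w" "mark (?w ! m) = Virtual"
      then have "m \<noteq> c" "m \<noteq> d" using c d by auto
      then show "m \<in> {d<..c} \<longleftrightarrow> edge ?w (Suc m) \<in> {d<..c}"
        using m c ij by (cases "Suc m = length ?w") (auto simp: edge_def)
    qed
    moreover have "edge ?w i = i" using c ij ne by (simp add: edge_def)
    moreover have "edge ?w j = j \<or> edge ?w j = 0" using ij ne by (cases "j = length ?w") (auto simp: edge_def)
    ultimately show False using c di by auto
  qed
qed

context parity
begin

lemma ev_Suc:
  assumes "inK w" "i < length w" "mark (w ! i) = Virtual" shows "ev w (Suc i) = ev w i"
proof -
  have w: "w = take i w @ w ! i # drop (Suc i) w" "w = (take i w @ [w ! i]) @ drop (Suc i) w"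
    using assms(2) by (simp_all add: id_take_nth_drop)
  have "edge_value (take i w) (w ! i # drop (Suc i) w) = edge_value (take i w @ [w ! i]) (drop (Suc i) w)"
    unfolding edge_value_def by (rule arc_value_virtual) (use assms w(1) in simp_all)
  then show ?thesis
    by (intro ev_eqI[OF _ _ w(2) w(1)]) (use assms w in simp_all)
qed

lemma ev_arc:
  assumes "inK (curve D)" "f \<in> arc_of D e" shows "ev (curve D) f = ev (curve D) e"
  using arc_closed[OF assms(2), of "{i. ev (curve D) i = ev (curve D) e}"] ev_Suc[OF assms(1)] by simp

lemma detour_step_value:
  assumes "detour_step (D, a) (D', a')" "D \<in> K" "\<forall>e\<in>a. ev (curve D) e = c"
  shows "D' \<in> K \<and> a' \<in> arcs D' \<and> (\<forall>e\<in>a'. ev (curve D') e = c)"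
proof -
  obtain E F where m: "move D D' F E" and co: "correspondent E D D' a a'"
    using assms(1) move.isotopy move.detour unfolding detour_step_def by blast
  have K': "D' \<in> K" using K_move[OF assms(2) m] .
  obtain e e' where e: "(e, e') \<in> E" "e \<in> a" "e' \<in> a'"
    "a' \<in> arcs D'" using co unfolding correspondent_def by auto
  have "ev (curve D') e' = c" using edge_value_invariant[OF m assms(2) e(1)] assms(3) e(2) by simp
  then show ?thesis using K' e(4) arcs_arc_of[OF e(4,3)] ev_arc[OF K_inK[OF K'], of _ e'] by blast
qed

text \<open>
  The two strands are joined by virtual passages along \<open>v\<close> or along \<open>x @ u\<close>. In the second case
  they exchange their roles in \<open>self_bigon\<close>.
\<close>

lemma R2_value:
  assumes R: "R2 True k l e f D D' E" and D: "D \<in> K" and f: "f \<in> arc_of D e"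
  shows "p D' k = ev (curve D) e"
proof -
  obtain u v x s t where lm: "local_move [u, v, x] [[], []]
      [bigon1 s (Classical t) (Classical (opp t)) k l, bigon2 True s (Classical t) (Classical (opp t)) k l] D D' E"
    and ef: "e = edge (curve D) (length u)" "f = edge (curve D) (length (u @ v))"
    using R unfolding R2_def Let_def bigon1_def bigon2_def by auto
  let ?A = "bigon1 s (Classical t) (Classical (opp t)) k l" and ?B = "bigon2 True s (Classical t) (Classical (opp t)) k l"
  have w: "curve D = u @ v @ x" "curve D' = u @ ?A @ v @ ?B @ x" using lm by (simp_all add: local_move_def)
  have K': "D' \<in> K" using K_move[OF D move.R2[OF R]] .
  have i: "inK (u @ v @ x)" and i': "inK (u @ ?A @ v @ ?B @ x)" using K_inK[OF D] K_inK[OF K'] w by simp_all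
  have k: "k \<in> cls (u @ ?A @ v @ ?B @ x)" by (simp add: bigon1_def cls_append cls_Cons)
  have pk: "p D' k = par (u @ ?A @ v @ ?B @ x) k"
    using par_outer[of "u @ ?A @ v @ ?B @ x" "outer D'" k] K' k unfolding w(2)[symmetric] by simp
  have v': "valid (u @ ?A @ v @ ?B @ x)" using inK_good[OF i'] by (simp add: good_iff)
  have kl: "k \<noteq> l" "k \<notin> crossings (u @ v @ x)" "l \<notin> crossings (u @ v @ x)"
    using other_crossings[OF v', of "Passage k s (Classical t)" "Passage k (opp s) (Classical t)"
        "Passage l (opp s) (Classical (opp t)) # Passage l s (Classical (opp t)) # u @ v @ x"]
      other_crossings[OF v', of "Passage l (opp s) (Classical (opp t))" "Passage l s (Classical (opp t))"
        "Passage k s (Classical t) # Passage k (opp s) (Classical t) # u @ v @ x"]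
    by (simp_all add: bigon1_def bigon2_def)
  have "(\<forall>y\<in>set v. mark y = Virtual) \<or> (\<forall>y\<in>set (x @ u). mark y = Virtual)"
  proof -
    have "edge (curve D) (length (u @ v)) \<in> arc_of D (edge (curve D) (length u))" using f ef by simp
    from same_arc_virtual[OF _ _ this]
    have "(\<forall>k. length u \<le> k \<and> k < length (u @ v) \<longrightarrow> mark ((u @ v @ x) ! k) = Virtual) \<or>
      (\<forall>k<length (u @ v @ x). k < length u \<or> length (u @ v) \<le> k \<longrightarrow> mark ((u @ v @ x) ! k) = Virtual)"
      unfolding w by simp
    then show ?thesis
    proof (elim disjE)
      assume *: "\<forall>k. length u \<le> k \<and> k < length (u @ v) \<longrightarrow> mark ((u @ v @ x) ! k) = Virtual"
      have "mark (v ! i) = Virtual" if "i < length v" for i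
        using *[rule_format, of "length u + i"] that by (simp add: nth_append)
      then show ?thesis by (metis in_set_conv_nth)
    next
      assume *: "\<forall>k<length (u @ v @ x). k < length u \<or> length (u @ v) \<le> k \<longrightarrow> mark ((u @ v @ x) ! k) = Virtual"
      have "mark (u ! i) = Virtual" if "i < length u" for i
        using *[rule_format, of i] that by (simp add: nth_append)
      moreover have "mark (x ! i) = Virtual" if "i < length x" for i
        using *[rule_format, of "length (u @ v) + i"] that by (simp add: nth_append)
      ultimately show ?thesis by (metis Un_iff in_set_conv_nth set_append)
    qed
  qed
  then show ?thesis
  proof
    assume V: "\<forall>y\<in>set v. mark y = Virtual"
    have "par (u @ ?A @ v @ ?B @ x) k = par (?A @ v @ ?B @ (x @ u)) k" "inK (?A @ v @ ?B @ (x @ u))"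
      using par_rotate[OF i' k] i' inK_rotate[of u "?A @ v @ ?B @ x"] by simp_all
    moreover have r: "inK (v @ (x @ u))" using i inK_rotate[of u "v @ x"] by simp
    moreover have "{k, l} \<inter> crossings (v @ (x @ u)) = {}" using kl by auto
    ultimately have "par (u @ ?A @ v @ ?B @ x) k = arc_value s t [] (v @ (x @ u))"
      using self_bigon[of s t k l v "x @ u"] V kl(1) by simp
    also have "\<dots> = edge_value u (v @ x)"
      using arc_value_edge_value[of "[]" "v @ x @ u" s t] r edge_value_rotate[OF i] by simp
    also have "\<dots> = ev (curve D) e" using ev_at[OF i refl] ef w by simp
    finally show ?thesis using pk by simp
  next
    assume V: "\<forall>y\<in>set (x @ u). mark y = Virtual"
    have e2: "bigon1 (opp s) (Classical t) (Classical (opp t)) k l = ?B"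
      "bigon2 True (opp s) (Classical t) (Classical (opp t)) k l = ?A"
      by (simp_all add: bigon1_def bigon2_def)
    have i2: "inK ((u @ ?A @ v) @ (?B @ x))" and k2: "k \<in> cls ((u @ ?A @ v) @ (?B @ x))" using i' k by simp_all
    have "par (u @ ?A @ v @ ?B @ x) k = par (?B @ (x @ u) @ ?A @ v) k" "inK (?B @ (x @ u) @ ?A @ v)"
      using par_rotate[OF i2 k2] i2 inK_rotate[of "u @ ?A @ v" "?B @ x"] by simp_all
    moreover have r: "inK ((x @ u) @ v)" using i inK_rotate[of "u @ v" "x"] by simp
    moreover have "{k, l} \<inter> crossings ((x @ u) @ v) = {}" using kl by auto
    ultimately have "par (u @ ?A @ v @ ?B @ x) k = arc_value (opp s) t [] ((x @ u) @ v)"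
      using self_bigon[of "opp s" t k l "x @ u" v] V kl(1) unfolding e2 by simp
    also have "\<dots> = edge_value (u @ v) x"
      using arc_value_edge_value[of "[]" "x @ u @ v" "opp s" t] r edge_value_rotate[of "u @ v" x] i by simp
    also have "\<dots> = ev (curve D) f" using ev_at[of "u @ v" x] i ef w by simp
    also have "\<dots> = ev (curve D) e" using ev_arc[OF K_inK[OF D] f] .
    finally show ?thesis using pk by simp
  qed
qed

lemma delta_value_unique:
  assumes "delta_value p D a x" "D \<in> K" "a \<in> arcs D" "e \<in> a"
  shows "x = ev (curve D) e"
proof -
  obtain D1 a1 D2 k l e1 f1 E where st: "detour_step\<^sup>*\<^sup>* (D, a) (D1, a1)" and
    R: "R2 True k l e1 f1 D1 D2 E" "e1 \<in> a1" "f1 \<in> a1" "x = p D2 k"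
    using assms(1) unfolding delta_value_def by blast
  let ?I = "\<lambda>(D', a'). D' \<in> K \<and> a' \<in> arcs D' \<and> (\<forall>e'\<in>a'. ev (curve D') e' = ev (curve D) e)"
  have "?I (D1, a1)" using st
  proof (induction rule: rtranclp_induct)
    case base
    have "ev (curve D) e' = ev (curve D) e" if "e' \<in> a" for e'
      using ev_arc[OF K_inK[OF assms(2)], of e' e] arcs_arc_of[OF assms(3,4)] that by simp
    then show ?case unfolding prod.case using assms(2,3) by blast
  next
    case (step q r)
    obtain D' a' D'' a'' where q: "q = (D', a')" "r = (D'', a'')" by (cases q; cases r)
    have "D' \<in> K" "\<forall>e'\<in>a'. ev (curve D') e' = ev (curve D) e" using step.IH unfolding q prod.case by blast+
    from detour_step_value[OF step.hyps(2)[unfolded q] this] show ?case unfolding q prod.case .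
  qed
  then have D1: "D1 \<in> K" "a1 \<in> arcs D1" "\<forall>e'\<in>a1. ev (curve D1) e' = ev (curve D) e" by auto
  have "f1 \<in> arc_of D1 e1" using arcs_arc_of[OF D1(2) R(2)] R(3) by simp
  from R2_value[OF R(1) D1(1) this] show ?thesis using R(2,4) D1(3) by simp
qed

text \<open>
  The point at infinity is moved to its standard place, and then a detour makes a virtual loop,
  which runs beside its own arc.
\<close>

lemma delta_value_exists:
  assumes D: "D \<in> K" "a \<in> arcs D" shows "\<exists>x. delta_value p D a x"
proof -
  let ?w = "curve D" and ?D = "\<lambda>x. Diagram (curve D) x"
  obtain e where e: "e \<in> edges ?w" "a = arc_of D e" using D(2) by (auto simp: arcs_def)
  have iw: "inK ?w" using K_inK[OF D(1)] .
  have g: "good ?w" using inK_good[OF iw] .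
  have arc: "a = arc_of (?D x) e" "a \<in> arcs (?D x)" for x
    using D(2) e(2) arc_of_Diagram[of ?w x "outer D"] by (simp_all add: arcs_def)
  have "fst (outer D) \<in> edges ?w" using K_diagram[OF D(1)] diagram_iff by (metis diagram.collapse)
  then have "(outer D, (0, Left)) \<in> (side_step ?w)\<^sup>*" using all_side_steps g good_iff by simp
  then have "detour_step\<^sup>*\<^sup>* (D, a) (?D (0, Left), a)"
  proof (induction rule: rtrancl_induct)
    case (step y z)
    then obtain d where d: "fst y \<in> edges ?w" "fst z \<in> edges ?w" "d \<in> edges ?w" "z \<in> region ?w {d} y"
      by (auto simp: side_step_def)
    obtain E where E: "detour (?D y) (?D z) E"
      "\<And>i. i \<in> edges ?w \<Longrightarrow> (i, i) \<in> E" using outer_detour[OF g d] by blast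
    have "correspondent E (?D y) (?D z) a a"
      unfolding correspondent_def using arc E(2)[OF e(1)] e(2) by (auto intro!: bexI[of _ "(e, e)"])
    then have "detour_step (?D y, a) (?D z, a)" using E(1) unfolding detour_step_def by auto
    then show ?case using step.IH by simp
  qed simp
  let ?u = "take e ?w" and ?v = "drop e ?w"
  have lu: "length ?u = e" using e(1) by (cases ?w) (auto simp: edges_def)
  obtain k l n where kl: "distinct [k, l, n]" "{k, l, n} \<inter> crossings (?u @ ?v) = {}" by (rule fresh_names)
  let ?n = "virt n SWNE" and ?n' = "virt n SENW"
  let ?w1 = "?u @ kink n SWNE Virtual @ ?v"
  have n: "n \<notin> crossings (?u @ ?v)" using kl(2) by blast
  have g1: "good ?w1" by (rule good_kink) (use g n in simp_all)
  have er: "erase (kink n SWNE Virtual) ?u = ?u" "erase (kink n SWNE Virtual) ?v = ?v"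
    by (rule erase_disjoint, use n in \<open>simp add: crossings_kink image_Un del: append_take_drop_id\<close>)+
  obtain E where E: "detour (Diagram (?u @ [] @ ?v) (0, Left)) (Diagram ?w1 (0, Left)) E"
    "\<And>i i'. i \<le> length ?u \<Longrightarrow> i' \<le> length ?u \<Longrightarrow>
       length (erase [] (take i ?u)) = length (erase (kink n SWNE Virtual) (take i' ?u)) \<Longrightarrow>
       (edge (?u @ [] @ ?v) i, edge ?w1 i') \<in> E"
    by (rule detour_words[of ?u "[]" ?v ?u "kink n SWNE Virtual" ?v]) (use g g1 er in \<open>auto simp: kink_def\<close>)
  have ee: "(e, edge ?w1 e) \<in> E"
    using E(2)[of e e] lu er(1) edge_less[OF e(1)] by simp
  let ?D1 = "Diagram ?w1 (0, Left)"
  let ?a1 = "arc_of ?D1 (edge ?w1 e)"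
  have "?a1 \<in> arcs ?D1" unfolding arcs_def using edge_in_edges by simp
  then have "correspondent E (?D (0, Left)) ?D1 a ?a1"
    unfolding correspondent_def using arc(2) ee e(2) by (auto intro!: bexI[of _ "(e, edge ?w1 e)"])
  then have "detour_step (?D (0, Left), a) (?D1, ?a1)" using E(1) unfolding detour_step_def by auto
  with \<open>detour_step\<^sup>*\<^sup>* (D, a) (?D (0, Left), a)\<close> have st: "detour_step\<^sup>*\<^sup>* (D, a) (?D1, ?a1)" by simp
  let ?A = "bigon1 SWNE (Classical SWNE) (Classical (opp SWNE)) k l"
    and ?B = "bigon2 True SWNE (Classical SWNE) (Classical (opp SWNE)) k l"
  have g2: "good (?u @ ?A @ [?n] @ ?B @ [?n'] @ ?v)"
    using good_tangle[of ?u ?v k l n SWNE SWNE] g kl by (simp add: tangle_eq)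
  have w1: "?w1 = ?u @ [?n] @ [?n'] @ ?v" by (simp add: kink_def)
  obtain E2 where R: "R2 True k l (edge ?w1 (length ?u)) (edge ?w1 (length (?u @ [?n]))) ?D1
      (Diagram (?u @ ?A @ [?n] @ ?B @ [?n'] @ ?v) (0, Left)) E2"
    unfolding w1 by (rule R2_words[of ?u "[?n]" "[?n'] @ ?v" SWNE SWNE k l True]) (use g1 g2 w1 in simp_all)
  have "edge ?w1 (Suc e) \<in> ?a1"
  proof -
    have "e < length ?w1" "?w1 ! e = ?n" using lu by (simp_all add: kink_def nth_append)
    then have "edge ?w1 e = e" "mark (?w1 ! e) = Virtual" by (auto simp: edge_def)
    then show ?thesis using \<open>e < length ?w1\<close> unfolding arc_of_def Let_def diagram.sel Image_singleton_iff
      by (intro r_into_rtrancl UnI1) auto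
  qed
  then show ?thesis unfolding delta_value_def using st R lu by (metis length_append_singleton mem_arc_of)
qed

theorem parity_cycle_ev:
  assumes "D \<in> K" "a \<in> arcs D" "e \<in> a"
  shows "parity_cycle p D a = ev (curve D) e"
  unfolding parity_cycle_def using delta_value_exists[OF assms(1,2)] delta_value_unique[OF _ assms] assms(2)
  by (auto intro!: the_equality)


lemma coeff_parity_cycle:
  assumes "D \<in> K" "e \<in> edges (curve D)"
  shows "coeff_at D (parity_cycle p D) e = ev (curve D) e"
  unfolding coeff_at_def using assms by (intro parity_cycle_ev) (simp_all add: arcs_def)

lemma ev_rotate: "ev (rotate k w) i = ev w (k + i)"
  by (simp add: ev_def rotate_rotate add.commute)

text \<open>
  The knot is read from the edge NE of \<open>v\<close> on, so that \<open>V\<close> is the interior of the left half.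
\<close>

lemma crossing_word:
  assumes i: "inK w" and v: "v \<in> cls w"
  obtains k m U V where "rotate k w = U @ [Passage v SENW (Classical m)] @ V @ [Passage v (opp SENW) (Classical m)]"
    "sw w v = edge w (Suc (k + length U + length V))" "se w v = edge w (k + length U)"
    "nw w v = edge w (Suc (k + length U))" "ne w v = edge w k" "w \<noteq> []"
proof -
  have va: "valid w" using inK_good[OF i] by (simp add: good_iff)
  have vc: "v \<in> crossings w" using v cls_sub by auto
  let ?j = "position w v SWNE" and ?k = "Suc (position w v SWNE)"
  note pos = position_props[OF va vc]
  have ne: "w \<noteq> []" using vc by auto
  let ?y = "w ! ?j"
  have y: "crossing ?y = v" "strand ?y = SWNE" using pos by simp_all
  have "mark ?y \<noteq> Virtual"
  proof -
    obtain z where z: "z \<in> set w" "mark z \<noteq> Virtual" "crossing z = v" using v by (auto simp: cls_eq)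
    then have "z = ?y \<or> z = partner ?y" using valid_key[OF va, of ?y z] pos(1) y by simp
    then show ?thesis using z(2) by auto
  qed
  then obtain m where m: "mark ?y = Classical m" by (cases "mark ?y") auto
  have yy: "?y = Passage v SWNE (Classical m)" using y m by (simp add: passage.expand)
  have px: "partner ?y = Passage v SENW (Classical m)" using yy by (simp add: partner_def)
  let ?W = "rotate ?k w"
  have W: "?W = drop ?k w @ take ?j w @ [?y]"
  proof (cases "?k = length w")
    case True
    then have "?W = w" by simp
    moreover have "w = take ?j w @ [?y]" using True pos(1)[of SWNE] by (metis lessI order_refl take_Suc_conv_app_nth take_all)
    ultimately show ?thesis using True by simp
  next
    case False
    then have "?k < length w" using pos(1)[of SWNE] by simp
    then show ?thesis using take_Suc_conv_app_nth[OF pos(1)[of SWNE]] by (simp add: rotate_drop_take)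
  qed
  have "partner ?y \<in> set w" using valid_partner[OF va] pos(1) by simp
  then have "partner ?y \<in> set ?W" by simp
  then have "partner ?y \<in> set (drop ?k w @ take ?j w)" unfolding W by auto
  then obtain U V where UV: "drop ?k w @ take ?j w = U @ partner ?y # V" by (metis split_list)
  have "?W = (drop ?k w @ take ?j w) @ [?y]" using W by simp
  then have R: "?W = U @ [Passage v SENW (Classical m)] @ V @ [Passage v (opp SENW) (Classical m)]"
    unfolding UV unfolding px unfolding yy by simp
  have len: "length w = length U + length V + 2" using arg_cong[OF R, of length] by simp
  have nth: "w ! edge w (?k + q) = ?W ! q" if "q < length w" for q
    using nth_rotate[OF that, of ?k] ne by (simp add: edge_def)
  have posn: "position w (crossing (?W ! q)) (strand (?W ! q)) = edge w (?k + q)" if "q < length w" for q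
    using position_nth[OF va, of "edge w (?k + q)"] nth[OF that] ne by (simp add: edge_def)
  have px': "position w v SENW = edge w (?k + length U)" using posn[of "length U"] len R by (simp add: nth_append)
  have py': "position w v SWNE = edge w (Suc (?k + length U + length V))"
    using posn[of "Suc (length U + length V)"] len R by (simp add: nth_append add.assoc)
  have ee: "edge w (edge w q) = edge w q" "edge w (Suc (edge w q)) = edge w (Suc q)" for q
    by (simp_all add: edge_def mod_Suc_eq)
  have "sw w v = edge w (Suc (?k + length U + length V))"
    unfolding sw_def using trans[OF arg_cong[OF py', of "edge w"] ee(1)] .
  moreover have "se w v = edge w (?k + length U)" "nw w v = edge w (Suc (?k + length U))"
    unfolding se_def nw_def px' ee by (rule refl)+
  moreover have "ne w v = edge w ?k" by (simp add: ne_def)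
  ultimately show ?thesis using that[OF R] ne by blast
qed

lemma parity_cycle_chain: "parity_cycle p D \<in> chains D"
  by (simp add: chains_def parity_cycle_def)

theorem parity_cycle_cycle:
  assumes D: "D \<in> K" shows "parity_cycle p D \<in> cycles D"
proof -
  let ?w = "curve D"
  have "boundary D (parity_cycle p D) v = 0" if "v \<in> classical D" for v
  proof -
    have v: "v \<in> cls ?w" using that by (simp add: classical_def)
    have i: "inK ?w" using K_inK[OF D] .
    obtain k m U V where R: "rotate k ?w = U @ [Passage v SENW (Classical m)] @ V @ [Passage v (opp SENW) (Classical m)]" (is "_ = ?W")
      and e: "sw ?w v = edge ?w (Suc (k + length U + length V))" "se ?w v = edge ?w (k + length U)"
        "nw ?w v = edge ?w (Suc (k + length U))" "ne ?w v = edge ?w k"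
      by (rule crossing_word[OF i v]) (rule that)
    have iW: "inK ?W" using inK_rotate_power[OF i, of k] R by simp
    let ?x = "Passage v SENW (Classical m)" and ?y = "Passage v (opp SENW) (Classical m)"
    have "ev ?w (sw ?w v) = edge_value (U @ [?x] @ V) [?y]"
      using ev_rotate[of k ?w "Suc (length U + length V)"] ev_at[of "U @ [?x] @ V"
        "[?y]"] iW unfolding R e by (simp add: add.assoc)
    moreover have "ev ?w (se ?w v) = edge_value U ([?x] @ V @ [?y])"
      using ev_rotate[of k ?w "length U"] ev_at[of U "[?x] @ V @ [?y]"] iW unfolding R e by simp
    moreover have "ev ?w (nw ?w v) = edge_value (U @ [?x]) (V @ [?y])"
      using ev_rotate[of k ?w "Suc (length U)"] ev_at[of "U @ [?x]" "V @ [?y]"] iW unfolding R e by simp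
    moreover have "ev ?w (ne ?w v) = edge_value [] (U @ [?x] @ V @ [?y])"
      using ev_rotate[of k ?w 0] ev_at[of "[]" ?W] iW unfolding R e by simp
    ultimately have "ev ?w (sw ?w v) + ev ?w (se ?w v) = ev ?w (nw ?w v) + ev ?w (ne ?w v)"
      using conservation[OF iW] by simp
    then show ?thesis
      unfolding boundary_def Let_def
      by (simp add: coeff_parity_cycle[OF D] sw_def se_def nw_def ne_def edge_in_edges)
  qed
  then show ?thesis using parity_cycle_chain by (simp add: cycles_def)
qed

theorem parity_cycle_invariant: "invariant_family K (parity_cycle p)"
  unfolding invariant_family_def
proof (intro conjI ballI allI impI)
  fix D D' F E a a'
  assume D: "D \<in> K" "D' \<in> K" and m: "move D D' F E \<and> correspondent E D D' a a'"
  then obtain e e' where "(e, e') \<in> E" "e \<in> a" "e' \<in> a'" "a \<in> arcs D" "a' \<in> arcs D'"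
    unfolding correspondent_def by auto
  then show "parity_cycle p D a = parity_cycle p D' a'"
    using parity_cycle_ev[OF D(1), of a e] parity_cycle_ev[OF D(2), of a' e'] edge_value_invariant[of D D' F E e e'] D(1) m by simp
qed (rule parity_cycle_chain)

text \<open>
  With \<open>s = SENW\<close> the shifts are the local terms of the intersection number.
\<close>

lemma shift_ev:
  assumes i: "inK w" and y: "y \<in> set w" "mark y \<noteq> Virtual"
  shows "shift SENW w y = (if strand y = SWNE then ev w (se w (crossing y)) else - ev w (ne w (crossing y)))"
proof -
  have va: "valid w" using inK_good[OF i] by (simp add: good_iff)
  obtain a b where ab: "w = a @ partner y # b" using valid_partner[OF va y(1)] by (metis split_list)
  have d: "distinct (a @ partner y # b)" using valid_distinct[OF va] ab by simp
  have "position w (crossing (w ! length a)) (strand (w ! length a)) = length a"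
    by (rule position_nth[OF va]) (simp add: ab)
  then have p: "position w (crossing y) (opp (strand y)) = length a" by (simp add: ab)
  obtain q where q: "mark y = Classical q" using y(2) by (cases "mark y") auto
  have i2: "inK (a @ partner y # b)" "inK ((a @ [partner y]) @ b)" using i ab by simp_all
  show ?thesis
  proof (cases "strand y")
    case SWNE
    have "shift SENW w y = arc_value SENW q a (partner y # b)"
      using before_after(1)[OF d] q SWNE by (simp add: shift_def ab)
    also have "\<dots> = ev w (length a)" using arc_value_edge_value[OF i2(1)] ev_at[OF i2(1)] ab by simp
    finally show ?thesis using SWNE p by (simp add: se_def)
  next
    case SENW
    have "shift SENW w y = - arc_value SENW (opp q) (a @ [partner y]) b"
      using before_after(2)[OF d] q SENW by (simp add: shift_def ab)
    also have "\<dots> = - ev w (Suc (length a))" using arc_value_edge_value[OF i2(2)] ev_at[OF i2(2)] ab by simp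
    finally show ?thesis using SENW p by (simp add: ne_def)
  qed
qed

lemma sum_over_crossings:
  assumes i: "inK w"
  shows "(\<Sum>y\<leftarrow>w. if Q (crossing y) (strand y) then shift SENW w y else 0) =
    (\<Sum>v\<in>cls w. (if Q v SWNE then ev w (se w v) else 0) - (if Q v SENW then ev w (ne w v) else 0))"
proof -
  have va: "valid w" using inK_good[OF i] by (simp add: good_iff)
  let ?C = "{y \<in> set w. mark y \<noteq> Virtual}" and ?h = "\<lambda>y. (crossing y, strand y)"
  define g where "g z = (if Q (fst z) (snd z) then (if snd z = SWNE then ev w (se w (fst z)) else - ev w (ne w (fst z))) else 0)" for z
  have bij: "bij_betw ?h ?C (cls w \<times> UNIV)"
  proof (rule bij_betw_imageI)
    show "inj_on ?h ?C" using va by (auto simp: valid_def distinct_map inj_on_def)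
    show "?h ` ?C = cls w \<times> UNIV"
    proof
      show "cls w \<times> UNIV \<subseteq> ?h ` ?C"
      proof
        fix z assume "z \<in> cls w \<times> (UNIV :: strand set)"
        then obtain y where y: "y \<in> ?C" "crossing y = fst z" by (auto simp: cls_eq)
        have "partner y \<in> ?C" using y(1) valid_partner[OF va] by simp
        moreover have "snd z = strand y \<or> snd z = opp (strand y)" using neq_opp by blast
        ultimately show "z \<in> ?h ` ?C" using y by (metis (no_types, lifting) image_eqI partner_sel(1,2) prod.collapse)
      qed
    qed (auto simp: cls_eq)
  qed
  have "(\<Sum>y\<leftarrow>w. if Q (crossing y) (strand y) then shift SENW w y else 0) =
      (\<Sum>y\<in>set w. if Q (crossing y) (strand y) then shift SENW w y else 0)"
    using valid_distinct[OF va] by (rule sum_list_distinct_conv_sum_set)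
  also have "\<dots> = (\<Sum>y\<in>?C. if Q (crossing y) (strand y) then shift SENW w y else 0)"
    by (rule sum.mono_neutral_right) (auto simp: shift_def)
  also have "\<dots> = (\<Sum>y\<in>?C. g (?h y))"
    by (rule sum.cong[OF refl]) (use shift_ev[OF i] in \<open>simp add: g_def\<close>)
  also have "\<dots> = (\<Sum>z\<in>cls w \<times> UNIV. g z)" by (rule sum.reindex_bij_betw[OF bij])
  also have "\<dots> = (\<Sum>v\<in>cls w. \<Sum>s\<in>UNIV. g (v, s))" by (simp only: sum.cartesian_product case_prod_unfold prod.collapse)
  also have "\<dots> = (\<Sum>v\<in>cls w. (if Q v SWNE then ev w (se w v) else 0) - (if Q v SENW then ev w (ne w v) else 0))"
  proof -
    have U: "(UNIV :: strand set) = {SWNE, SENW}" by (auto intro: strand.exhaust)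
    show ?thesis unfolding U by (intro sum.cong refl) (simp add: g_def)
  qed
  finally show ?thesis .
qed

lemma classical_cls: "classical D = cls (curve D)"
  by (simp add: classical_def)

theorem parity_cycle_normalized:
  assumes D: "D \<in> K" shows "intersection D (whole_cycle D) (parity_cycle p D) = 0"
proof -
  let ?w = "curve D"
  have i: "inK ?w" using K_inK[OF D] .
  have one: "coeff_at D (whole_cycle D) (edge ?w q) = 1" for q
    by (simp add: coeff_at_def whole_cycle_def arcs_def edge_in_edges)
  have "intersection D (whole_cycle D) (parity_cycle p D) = (\<Sum>v\<in>cls ?w. ev ?w (se ?w v) - ev ?w (ne ?w v))"
    unfolding intersection_def Let_def classical_cls[of D]
    by (rule sum.cong[OF refl]) (simp add: coeff_parity_cycle[OF D] one sw_def se_def nw_def ne_def edge_in_edges)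
  also have "\<dots> = (\<Sum>y\<leftarrow>?w. shift SENW ?w y)"
    using sum_over_crossings[OF i, of "\<lambda>_ _. True"] by simp
  also have "\<dots> = 0" using sum_shifts[OF i] .
  finally show ?thesis .
qed

text \<open>
  A passage contributes iff \<open>x\<close> meets it on the walk from NW to SW, where both passages of \<open>v\<close>
  count: the passage on \<open>SENW\<close> accounts for the value of NE, at which the walk in \<open>crossing_value\<close>
  ends.
\<close>

theorem intersection_formula:
  assumes D: "D \<in> K" and "v \<in> classical D"
  shows "p D v = intersection D (left_half D v) (parity_cycle p D)"
proof -
  let ?w = "curve D"
  have v: "v \<in> cls ?w" using assms(2) unfolding classical_cls[of D] .
  have i: "inK ?w" using K_inK[OF D] .
  have va: "valid ?w" using inK_good[OF i] by (simp add: good_iff)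
  obtain k m U V where R: "rotate k ?w = U @ [Passage v SENW (Classical m)] @ V @ [Passage v (opp SENW) (Classical m)]" (is "_ = ?W")
    and e: "sw ?w v = edge ?w (Suc (k + length U + length V))" "nw ?w v = edge ?w (Suc (k + length U))"
      and ne: "?w \<noteq> []"
    by (rule crossing_word[OF i v]) (rule that)
  let ?x = "Passage v SENW (Classical m)" and ?y = "Passage v (opp SENW) (Classical m)"
  let ?n = "length ?w" and ?c = "Suc (k + length U)" and ?S = "set ([?x] @ V @ [?y])"
  have iW: "inK ?W" using inK_rotate_power[OF i, of k] R by simp
  have d: "distinct ?w" "distinct ?W" using valid_distinct[OF va] R by (metis distinct_rotate)+
  have len: "?n = length U + length V + 2" using arg_cong[OF R, of length] by simp
  have edge_mod: "edge ?w q = q mod ?n" for q using ne by (simp add: edge_def)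
  have nth: "?w ! edge ?w (k + q) = ?W ! q" if "q < ?n" for q
    using nth_rotate[OF that, of k] by (simp only: R edge_mod)
  have at: "j = edge ?w (k + q) \<longleftrightarrow> ?w ! j = ?W ! q" if "j < ?n" "q < ?n" for j q
    using nth[OF that(2)] nth_eq_iff_index_eq[OF d(1) that(1), of "edge ?w (k + q)"] ne unfolding edge_mod by auto
  have wx: "?W ! length U = ?x" and wy: "?W ! (Suc (length U + length V)) = ?y"
    by (simp_all add: nth_append)
  define P where "P = path ?w (nw ?w v) (sw ?w v)"
  have P: "P = {edge ?w (?c + q) | q. q \<le> length V}"
  proof -
    have same: "edge ?w (edge ?w ?c + q) = edge ?w (?c + q)" for q unfolding edge_mod by (simp add: mod_add_left_eq)
    have "edge ?w (?c + q) \<noteq> edge ?w (?c + length V)" if "q < length V" for q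
    proof
      assume "edge ?w (?c + q) = edge ?w (?c + length V)"
      then have "?n dvd (?c + length V) - (?c + q)" unfolding edge_mod by (metis add_le_cancel_left mod_eq_dvd_iff_nat nat_less_le that)
      then have "?n dvd length V - q" by simp
      then show False using that len by (auto dest: dvd_imp_le)
    qed
    then have "(\<forall>j<q. edge ?w (?c + j) \<noteq> edge ?w (?c + length V)) \<longleftrightarrow> q \<le> length V" for q
      by (metis leI less_le_trans not_less)
    then show ?thesis unfolding P_def path_def e same by simp
  qed
  \<comment> \<open>The path begins and ends at a classical passage of \<open>v\<close>, so it is a union of arcs.\<close>
  have closed: "i \<in> P \<longleftrightarrow> edge ?w (Suc i) \<in> P" if i: "i < ?n" "mark (?w ! i) = Virtual" for i
  proof
    assume "i \<in> P"
    then obtain q where q: "i = edge ?w (?c + q)" "q \<le> length V" unfolding P by blast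
    have "?w ! i = ?W ! (Suc (length U) + q)" using nth[of "Suc (length U) + q"] q len by (simp add: add.assoc)
    then have "q \<noteq> length V" using i(2) wy by auto
    moreover have "edge ?w (Suc i) = edge ?w (?c + Suc q)" unfolding q(1) edge_mod by (simp add: mod_Suc_eq)
    ultimately show "edge ?w (Suc i) \<in> P" using q(2) unfolding P by (metis (mono_tags, lifting) Suc_leI le_neq_implies_less mem_Collect_eq)
  next
    assume "edge ?w (Suc i) \<in> P"
    then obtain q where q: "edge ?w (Suc i) = edge ?w (?c + q)" "q \<le> length V" unfolding P by blast
    have "edge ?w (k + length U + q) < ?n" using ne by (simp add: edge_mod)
    moreover have "edge ?w (Suc (edge ?w (k + length U + q))) = edge ?w (Suc i)"
      unfolding q(1) unfolding edge_mod by (simp add: mod_Suc_eq)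
    ultimately have iq: "i = edge ?w (k + length U + q)" using pred_edge_Suc i(1) by metis
    then have wi: "?w ! i = ?W ! (length U + q)" using nth[of "length U + q"] q(2) len by (simp add: add.assoc)
    have "q \<noteq> 0"
    proof
      assume "q = 0"
      then have "?w ! i = ?x" using wi wx by (simp only: add_0_right)
      then show False using i(2) by simp
    qed
    then obtain q' where "q = Suc q'" by (cases q) auto
    then show "i \<in> P" using iq q(2) unfolding P by auto
  qed
  have coeff: "coeff_at D (left_half D v) f = (if f \<in> P then 1 else 0)" for f
  proof -
    have "arc_of D f \<in> arc_of D ` P \<longleftrightarrow> f \<in> P"
    proof
      assume "arc_of D f \<in> arc_of D ` P"
      then obtain g where g: "g \<in> P" "arc_of D f = arc_of D g" by auto
      then have "g \<in> arc_of D f" by simp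
      from arc_closed[OF this, of P] closed g(1) show "f \<in> P" by simp
    qed simp
    then show ?thesis by (simp add: coeff_at_def left_half_def P_def)
  qed
  define Q where "Q u s \<longleftrightarrow> ?w ! position ?w u s \<in> ?S" for u s
  have inP: "(sw ?w u \<in> P \<longleftrightarrow> Q u SWNE) \<and> (nw ?w u \<in> P \<longleftrightarrow> Q u SENW)" if u: "u \<in> cls ?w" for u
  proof -
    have uc: "u \<in> crossings ?w" using u cls_sub by auto
    note pos = position_props[OF va uc]
    let ?j = "position ?w u SWNE" and ?l = "position ?w u SENW"
    have S1: "z \<in> set (V @ [?y]) \<longleftrightarrow> (\<exists>q\<le>length V. z = ?W ! (Suc (length U) + q))" for z
    proof -
      have "?W ! (Suc (length U) + q) = (V @ [?y]) ! q" for q by (simp add: nth_append)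
      then show ?thesis unfolding in_set_conv_nth length_append_singleton less_Suc_eq_le by metis
    qed
    have S2: "z \<in> set ([?x] @ V) \<longleftrightarrow> (\<exists>q\<le>length V. z = ?W ! (length U + q))" for z
    proof -
      have "?W ! (length U + q) = ([?x] @ V) ! q" if "q \<le> length V" for q
        using that by (simp add: nth_append nth_Cons split: nat.split)
      moreover have "length ([?x] @ V) = Suc (length V)" by simp
      ultimately show ?thesis unfolding in_set_conv_nth by (metis less_Suc_eq_le)
    qed
    have "sw ?w u \<in> P \<longleftrightarrow> (\<exists>q\<le>length V. ?j = edge ?w (k + (Suc (length U) + q)))"
      using sw_se_position(1)[OF va uc] unfolding P by (auto simp: add.assoc)
    also have "\<dots> \<longleftrightarrow> (\<exists>q\<le>length V. ?w ! ?j = ?W ! (Suc (length U) + q))"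
      by (rule ex_cong1, rule conj_cong[OF refl], rule at) (use pos(1) len in auto)
    also have "\<dots> \<longleftrightarrow> ?w ! ?j \<in> set (V @ [?y])" unfolding S1 by (rule refl)
    also have "\<dots> \<longleftrightarrow> Q u SWNE"
    proof -
      have "?w ! ?j \<noteq> ?x" using pos(3)[of SWNE] by (metis passage.sel(2) strand.distinct(1))
      then show ?thesis by (simp add: Q_def)
    qed
    finally have 1: "sw ?w u \<in> P \<longleftrightarrow> Q u SWNE" .
    have suc: "edge ?w (Suc ?l) = edge ?w (?c + q) \<longleftrightarrow> ?l = edge ?w (k + (length U + q))" for q
    proof -
      have "edge ?w (?c + q) = edge ?w (Suc (edge ?w (k + (length U + q))))" unfolding edge_mod by (simp add: mod_Suc_eq add.assoc)
      moreover have "edge ?w (k + (length U + q)) < ?n" using ne by (simp add: edge_mod)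
      ultimately show ?thesis using pred_edge_Suc pos(1)[of SENW] by metis
    qed
    have "nw ?w u \<in> P \<longleftrightarrow> (\<exists>q\<le>length V. ?l = edge ?w (k + (length U + q)))"
      unfolding nw_def P mem_Collect_eq suc by blast
    also have "\<dots> \<longleftrightarrow> (\<exists>q\<le>length V. ?w ! ?l = ?W ! (length U + q))"
      by (rule ex_cong1, rule conj_cong[OF refl], rule at) (use pos(1) len in auto)
    also have "\<dots> \<longleftrightarrow> ?w ! ?l \<in> set ([?x] @ V)" unfolding S2 by (rule refl)
    also have "\<dots> \<longleftrightarrow> Q u SENW"
    proof -
      have "?w ! ?l \<noteq> ?y" using pos(3)[of SENW] by (metis opp.simps(2) passage.sel(2) strand.distinct(1))
      then show ?thesis by (simp add: Q_def)
    qed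
    finally show ?thesis using 1 by simp
  qed
  have "intersection D (left_half D v) (parity_cycle p D) =
      (\<Sum>u\<in>cls ?w. (if Q u SWNE then ev ?w (se ?w u) else 0) - (if Q u SENW then ev ?w (ne ?w u) else 0))"
    unfolding intersection_def Let_def classical_cls[of D]
  proof (rule sum.cong[OF refl])
    fix u assume "u \<in> cls ?w"
    from inP[OF this] show "zmult (coeff_at D (left_half D v) (sw ?w u)) (coeff_at D (parity_cycle p D) (se ?w u)) -
        zmult (coeff_at D (left_half D v) (nw ?w u)) (coeff_at D (parity_cycle p D) (ne ?w u)) =
        (if Q u SWNE then ev ?w (se ?w u) else 0) - (if Q u SENW then ev ?w (ne ?w u) else 0)"
      unfolding coeff by (simp add: coeff_parity_cycle[OF D] se_def ne_def edge_in_edges)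
  qed
  also have "\<dots> = (\<Sum>y\<leftarrow>?w. if Q (crossing y) (strand y) then shift SENW ?w y else 0)"
    by (rule sum_over_crossings[OF i, symmetric])
  also have "\<dots> = (\<Sum>y\<leftarrow>?w. if y \<in> ?S then shift SENW ?w y else 0)"
  proof (rule arg_cong[of _ _ sum_list], rule map_cong[OF refl])
    fix y assume "y \<in> set ?w"
    then obtain j where "j < ?n" "?w ! j = y" by (metis in_set_conv_nth)
    then have "?w ! position ?w (crossing y) (strand y) = y" using position_nth[OF va, of j] by simp
    then show "(if Q (crossing y) (strand y) then shift SENW ?w y else 0) = (if y \<in> ?S then shift SENW ?w y else 0)"
      by (simp add: Q_def)
  qed
  also have "\<dots> = (\<Sum>y\<in>set ?w. if y \<in> ?S then shift SENW ?w y else 0)"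
    by (rule sum_list_distinct_conv_sum_set[OF d(1)])
  also have "\<dots> = (\<Sum>y\<in>?S. shift SENW ?w y)"
  proof -
    have "set ?w = set ?W" using R by (metis set_rotate)
    then have "set ?w \<inter> ?S = ?S" by auto
    then show ?thesis using sum.inter_restrict[of "set ?w" "shift SENW ?w" ?S] by simp
  qed
  also have "\<dots> = (\<Sum>y\<in>?S. shift SENW ?W y)"
  proof (rule sum.cong[OF refl])
    fix y assume "y \<in> ?S"
    then have y: "y \<in> set ?w" using R by (metis UnCI set_append set_rotate)
    let ?a = "take (k mod ?n) ?w" and ?b = "drop (k mod ?n) ?w"
    have "shift SENW (?b @ ?a) y = shift SENW (?a @ ?b) y"
      by (rule shift_rotate) (use i y in simp_all)
    then show "shift SENW ?w y = shift SENW ?W y" unfolding R[symmetric] rotate_drop_take by simp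
  qed
  also have "\<dots> = (\<Sum>y\<leftarrow>[?x] @ V @ [?y]. shift SENW ?W y)"
    by (rule sum_list_distinct_conv_sum_set[symmetric]) (use d(2) in simp)
  also have "\<dots> = par ?W v" using crossing_value[OF iW] by simp
  also have "\<dots> = par ?w v"
  proof -
    let ?a = "take (k mod ?n) ?w" and ?b = "drop (k mod ?n) ?w"
    have "par (?b @ ?a) v = par (?a @ ?b) v" by (rule par_rotate) (use i v in simp_all)
    then show ?thesis unfolding R[symmetric] rotate_drop_take by simp
  qed
  also have "\<dots> = p D v" using par_outer[of ?w "outer D" v] D v by simp
  finally show ?thesis by simp
qed

end

theorem theorem1:
  fixes K :: "diagram set" and p :: "diagram \<Rightarrow> nat \<Rightarrow> 'a::ab_group_add"
  assumes "virtual_knot K" and "oriented_parity K p"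
  shows "(\<forall>D\<in>K. parity_cycle p D \<in> cycles D) \<and>
         invariant_family K (parity_cycle p) \<and>
         (\<forall>D\<in>K. intersection D (whole_cycle D) (parity_cycle p D) = 0) \<and>
         (\<forall>D\<in>K. \<forall>v\<in>classical D. p D v = intersection D (left_half D v) (parity_cycle p D))"
proof -
  interpret parity K p by standard (rule assms)+
  show ?thesis
    using parity_cycle_cycle parity_cycle_invariant parity_cycle_normalized intersection_formula by blast
qed

end
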